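(* Let $\Omega\subset\mathbb R^n$, $n\ge2$, be any open set with $\mathcal L^n(\Omega)<\infty$ and $\mathcal H^{n-1}(\partial\Omega)<\infty$. Let $\mu$ be a Borel measure on $\Omega$ with $\mu(\Omega)<\infty$ such that $\mu(B_r(x)\cap\Omega)\le C_\mu r^\alpha$ for all $x\in\Omega$, $r>0$, for some $\alpha\in(n-1,n]$ and $C_\mu>0$. (i) Let $1<p<n$, $r>1$ and $1\le q<\min\{\frac{p\alpha}{n-p},\frac{r\alpha}{n-1}\}$. If $\{u_k\}\subset V^1L^p(\Omega)\cap C_b(\overline\Omega)$ is bounded with respect to the norm $$\max\{\mu(\Omega)^{\frac n\alpha},\mathcal L^n(\Omega)\}^{\frac{\alpha}{\hat q n}-\frac{n-p}{pn}}\|\nabla u\|_{L^p(\Omega)}+\max\{\mu(\Omega)^{\frac{n-1}\alpha},\mathcal H^{n-1}(\partial\Omega)\}^{\frac{\alpha}{\hat q(n-1)}-\frac1r}\|u\|_{L^r(\partial\Omega)},$$ where $\hat q=\min\{\frac{p\alpha}{n-p},\frac{r\alpha}{n-1}\}$, then $\{u_k\}$ is a Cauchy sequence in $L^q(\Omega,\mu)$. (ii) Let $\beta>0$ and $0<\gamma<\min\{n',\beta\}$, $n'=\frac n{n-1}$. If $\{u_k\}\subset V^1L^n(\Omega)\cap C_b(\overline\Omega)$ is bounded with respect to the norm $\|\nabla u\|_{L^n(\Omega)}+\|u\|_{\exp L^\beta(\partial\Omega)}$, then $\{u_k\}$ is a Cauchy sequence in $\exp L^\gamma(\Omega,\mu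)$.
   Context: $\mathcal L^n$ is Lebesgue measure and $\mathcal H^{n-1}$ the $(n-1)$-dimensional Hausdorff measure on $\partial\Omega$; spaces without an indicated measure are taken w.r.t. these. $C_b(\overline\Omega)$: continuous functions on $\overline\Omega$ with bounded support; boundary norms of $u$ are norms of its restriction to $\partial\Omega$. $V^1X(\Omega)$: weakly differentiable $u$ on $\Omega$ with $|\nabla u|\in X(\Omega)$. For a finite measure space $(\mathcal R,m)$ and $\gamma>0$, $\exp L^\gamma(\mathcal R,m)$ is the Orlicz space with Luxemburg norm $\inf\{\lambda>0:\int_{\mathcal R}A(|\phi|/\lambda)\,dm\le1\}$, $A$ a Young function equivalent to $e^{t^\gamma}-1$ near infinity.
   Formalization: In (i) and (ii) the conclusion is that {u_k} has a subsequence that is Cauchy in the stated space; as written, the claim that {u_k} itself is Cauchy fails, e.g. for u_k=(-1)^k on a ball with Lebesgue measure. *)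

theory Defs
  imports "HOL-Analysis.Analysis"
begin

definition hausdorff_const :: "real \<Rightarrow> real" where
  "hausdorff_const s = (pi powr (s / 2) / Gamma (s / 2 + 1)) / 2 powr s"

definition hausdorff_delta :: "real \<Rightarrow> real \<Rightarrow> 'a::euclidean_space set \<Rightarrow> ennreal" where
  "hausdorff_delta s \<delta> A =
     (INF C \<in> {C :: nat \<Rightarrow> 'a set. A \<subseteq> (\<Union>i. C i) \<and> (\<forall>i. bounded (C i) \<and> diameter (C i) \<le> \<delta>)}.
        (\<Sum>i. ennreal (hausdorff_const s * diameter (C i) powr s)))"

definition hausdorff_outer :: "real \<Rightarrow> 'a::euclidean_space set \<Rightarrow> ennreal" where
  "hausdorff_outer s A = (SUP \<delta> \<in> {0<..}. hausdorff_delta s \<delta> A)"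

definition hausdorff_on :: "real \<Rightarrow> 'a::euclidean_space set \<Rightarrow> 'a measure" where
  "hausdorff_on s S = measure_of S {B \<inter> S | B. B \<in> sets borel} (hausdorff_outer s)"

fun Ck :: "nat \<Rightarrow> ('a::euclidean_space \<Rightarrow> real) \<Rightarrow> bool" where
  "Ck 0 f = continuous_on UNIV f"
| "Ck (Suc k) f = ((\<forall>x. f differentiable (at x)) \<and> continuous_on UNIV f \<and>
      (\<forall>b\<in>Basis. Ck k (\<lambda>x. frechet_derivative f (at x) b)))"

definition test_function :: "'a::euclidean_space set \<Rightarrow> ('a \<Rightarrow> real) \<Rightarrow> bool" where
  "test_function \<Omega> \<phi> = ((\<forall>k. Ck k \<phi>) \<and> compact (closure {x. \<phi> x \<noteq> 0}) \<and>
      closure {x. \<phi> x \<noteq> 0} \<subseteq> \<Omega>)"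

definition locally_integrable :: "'a::euclidean_space set \<Rightarrow> ('a \<Rightarrow> 'b::euclidean_space) \<Rightarrow> bool" where
  "locally_integrable \<Omega> f = (\<forall>K. compact K \<and> K \<subseteq> \<Omega> \<longrightarrow> set_integrable lebesgue K f)"

definition weak_gradient :: "'a::euclidean_space set \<Rightarrow> ('a \<Rightarrow> real) \<Rightarrow> ('a \<Rightarrow> 'a) \<Rightarrow> bool" where
  "weak_gradient \<Omega> u G = (locally_integrable \<Omega> u \<and> locally_integrable \<Omega> G \<and>
     (\<forall>\<phi> b. test_function \<Omega> \<phi> \<and> b \<in> Basis \<longrightarrow>
        (LINT x:\<Omega>|lebesgue. u x * frechet_derivative \<phi> (at x) b) =
          - (LINT x:\<Omega>|lebesgue. (G x \<bullet> b) * \<phi> x)))"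

definition V1Lp :: "'a::euclidean_space set \<Rightarrow> real \<Rightarrow> ('a \<Rightarrow> real) \<Rightarrow> ('a \<Rightarrow> 'a) \<Rightarrow> bool" where
  "V1Lp \<Omega> p u G = (weak_gradient \<Omega> u G \<and>
     (\<integral>\<^sup>+x\<in>\<Omega>. ennreal (norm (G x) powr p) \<partial>lebesgue) < \<infinity>)"

definition Cb_closure :: "'a::euclidean_space set \<Rightarrow> ('a \<Rightarrow> real) \<Rightarrow> bool" where
  "Cb_closure \<Omega> u = (continuous_on (closure \<Omega>) u \<and> bounded {x \<in> closure \<Omega>. u x \<noteq> 0})"

text \<open>L^p norm (as a real number; used only for functions where the integral is finite).\<close>
definition Lp_norm :: "'a measure \<Rightarrow> real \<Rightarrow> ('a \<Rightarrow> real) \<Rightarrow> real" where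
  "Lp_norm M p f = enn2real (\<integral>\<^sup>+x. ennreal (\<bar>f x\<bar> powr p) \<partial>M) powr (1 / p)"

definition Lp_finite :: "'a measure \<Rightarrow> real \<Rightarrow> ('a \<Rightarrow> real) \<Rightarrow> bool" where
  "Lp_finite M p f = ((\<integral>\<^sup>+x. ennreal (\<bar>f x\<bar> powr p) \<partial>M) < \<infinity>)"

definition young_function :: "(real \<Rightarrow> real) \<Rightarrow> bool" where
  "young_function A = (convex_on {0..} A \<and> A 0 = 0 \<and> (\<forall>t\<ge>0. A t \<ge> 0) \<and> (\<exists>t>0. A t \<noteq> 0))"

definition equiv_near_infinity :: "(real \<Rightarrow> real) \<Rightarrow> (real \<Rightarrow> real) \<Rightarrow> bool" where
  "equiv_near_infinity A B = (\<exists>c1>0. \<exists>c2>0. \<exists>t0\<ge>0. \<forall>t\<ge>t0. B (c1 * t) \<le> A t \<and> A t \<le> B (c2 * t))"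

definition exp_young :: "real \<Rightarrow> (real \<Rightarrow> real) \<Rightarrow> bool" where
  "exp_young \<gamma> A = (young_function A \<and> equiv_near_infinity A (\<lambda>t. exp (t powr \<gamma>) - 1))"

definition luxemburg_norm :: "(real \<Rightarrow> real) \<Rightarrow> 'a measure \<Rightarrow> ('a \<Rightarrow> real) \<Rightarrow> ennreal" where
  "luxemburg_norm A M f =
     Inf {ennreal l | l. l > 0 \<and> (\<integral>\<^sup>+x. ennreal (A (\<bar>f x\<bar> / l)) \<partial>M) \<le> 1}"

end

theory Submission
  imports Defs "HOL-Complex_Analysis.Great_Picard" "HOL-Library.Diagonal_Subsequence"
    "HOL-Real_Asymp.Real_Asymp"
begin

text \<open>From a point of \<open>{\<bar>u\<bar> \<ge> b}\<close> issue rays in all directions. Within \<open>\<Omega>\<close> such a ray can only get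
  down to the level \<open>\<bar>u\<bar> = a < b\<close> by crossing the band \<open>{a < \<bar>u\<bar> < b}\<close>; otherwise it hits the part of
  the boundary where \<open>\<bar>u\<bar> \<ge> a\<close>. Averaging over the directions and over the starting points yields
  \<open>(b - a) \<mu>{\<bar>u\<bar> \<ge> b} powr ((n - 1)/\<alpha>) \<le> const * (\<integral>\<^bsub>a<\<bar>u\<bar><b\<^esub> \<bar>\<nabla>u\<bar> + (b - a) H\<^sup>n\<^sup>-\<^sup>1(\<partial>\<Omega> \<inter> {\<bar>u\<bar> \<ge> a}))\<close>,
  which holds without any regularity of \<open>\<Omega>\<close>. Iterating this over levels, first for Lebesgue measure
  and then for \<open>\<mu>\<close>, turns the bounds on \<open>\<nabla>u\<close> and on the boundary values into power decay, for \<open>p < n\<close>,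
  or exponential decay, for \<open>p = n\<close>, of \<open>\<mu>{\<bar>u\<bar> \<ge> t}\<close>, uniformly along the sequence. On compact
  subsets of \<open>\<Omega>\<close> the growth bound on \<open>\<mu>\<close> makes \<open>u\<close> close in \<open>L\<^sup>1(\<mu>)\<close> to its mollifications, so
  Arzela-Ascoli gives a subsequence that is Cauchy in measure, and the uniform decay upgrades this to
  convergence of moments of smaller order.\<close>

subsection \<open>Smooth mollifiers\<close>

text \<open>The obstacle is that \<Omega> is arbitrary: there is no extension operator and no trace,
  and \<open>u\<close> need not be absolutely continuous on a given ray. So the part of the boundary
  where \<open>\<bar>u\<bar>\<close> is large is covered by balls with controlled sum of
  \<open>r powr (n - 1)\<close>. What they leave of the closed superlevel set is compact in
  \<Omega>; below its distance to the boundary, \<open>u\<close> can be mollified and differentiated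
  along rays. The exponent \<open>(n - 1)/\<alpha>\<close> comes from averaging: ray integrals
  produce the kernel |x - y|^(1 - n), whose integral over \<open>E\<close> is at most a multiple of
  \<open>N(E) powr (1 - (n - 1)/\<alpha>)\<close>; near the diagonal this uses \<alpha> > n - 1.
  Lebesgue measure comes first because Hoelder's inequality on a band brings in the Lebesgue measure
  of the lower level set. For p < n the induction over dyadic levels closes since
  \<open>K powr (1 - 1/p)\<close> grows more slowly than \<open>K powr (1 - 1/n)\<close>. For p = n
  the powers agree, and smallness comes instead from cutting a level range into many bands, at least
  half of which carry little energy.\<close>

lemma poly_mult_exp_minus_tendsto_0:
  fixes p :: "real poly"
  shows "((\<lambda>x. poly p x * exp (- x)) \<longlongrightarrow> 0) at_top"
proof -
  have "((\<lambda>x. \<Sum>i\<le>degree p. coeff p i * (x ^ i / exp x)) \<longlongrightarrow> (\<Sum>i\<le>degree p. coeff p i * 0)) at_top"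
    by (intro tendsto_intros tendsto_power_div_exp_0)
  moreover have "(\<Sum>i\<le>degree p. coeff p i * (x ^ i / exp x)) = poly p x * exp (- x)" for x
    by (simp add: poly_altdef sum_distrib_right exp_minus divide_inverse mult.assoc)
  ultimately show ?thesis by simp
qed

text \<open>The polynomial factor makes the class of functions \<open>flat p\<close> closed under differentiation, so
  that their smoothness follows by induction on the order.\<close>

definition flat_deriv :: "real poly \<Rightarrow> real poly" where
  "flat_deriv p = [:0, 0, 1:] * (p - pderiv p)"

definition flat :: "real poly \<Rightarrow> real \<Rightarrow> real" where
  "flat p s = (if s > 0 then poly p (1 / s) * exp (- (1 / s)) else 0)"

lemma flat_tendsto_0: "(flat p \<longlongrightarrow> 0) (at_right 0)"
proof -
  have "((\<lambda>s. poly p (inverse s) * exp (- inverse s)) \<longlongrightarrow> 0) (at_right 0)"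
    using filterlim_compose[OF poly_mult_exp_minus_tendsto_0 filterlim_inverse_at_top_right] .
  then show ?thesis
    by (rule Lim_transform_eventually)
       (auto simp: eventually_at_right_less flat_def divide_inverse intro: eventually_mono[OF eventually_at_right_less[of 0]])
qed

text \<open>Only \<open>s = 0\<close> is delicate. There the difference quotient
  \<open>flat p h / h\<close> is, for \<open>h > 0\<close>, again a \<open>flat\<close> function,
  with \<open>p\<close> multiplied by its variable, and so it tends to 0.\<close>

lemma flat_has_derivative:
  "(flat p has_real_derivative flat (flat_deriv p) s) (at s)"
proof (cases s "0 :: real" rule: linorder_cases)
  case less
  have "((\<lambda>_. 0) has_real_derivative 0) (at s)" by simp
  then have "(flat p has_real_derivative 0) (at s)"
    by (rule has_field_derivative_transform_within_open[of _ _ _ "{..<0}"]) (use less in \<open>auto simp: flat_def\<close>)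
  then show ?thesis using less by (simp add: flat_def)
next
  case equal
  have "((\<lambda>h. flat p h / h) \<longlongrightarrow> 0) (at 0)"
  proof (subst filterlim_at_split, intro conjI)
    have "\<forall>\<^sub>F h in at_left 0. 0 = flat p h / h"
      by (rule eventually_mono[OF eventually_at_left_real[of "-1" 0]]) (auto simp: flat_def)
    then show "((\<lambda>h. flat p h / h) \<longlongrightarrow> 0) (at_left 0)"
      by (rule Lim_transform_eventually[rotated]) simp
    have "\<forall>\<^sub>F h in at_right 0. flat ([:0, 1:] * p) h = flat p h / h"
      by (rule eventually_mono[OF eventually_at_right_less[of 0]]) (auto simp: flat_def)
    then show "((\<lambda>h. flat p h / h) \<longlongrightarrow> 0) (at_right 0)"
      by (rule Lim_transform_eventually[OF flat_tendsto_0])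
  qed
  then show ?thesis using equal
    by (simp add: has_field_derivative_iff flat_def)
next
  case greater
  have "((\<lambda>s. poly p (1 / s) * exp (- (1 / s))) has_real_derivative
      flat (flat_deriv p) s) (at s)"
    using greater
    by (auto intro!: derivative_eq_intros simp: flat_def flat_deriv_def field_simps power2_eq_square)
  then show ?thesis
    by (rule has_field_derivative_transform_within_open[of _ _ _ "{0<..}"])
       (use greater in \<open>auto simp: flat_def\<close>)
qed

section \<open>Closure properties of the class \<open>Ck\<close>\<close>

lemma Ck_Suc_imp: "Ck (Suc k) f \<Longrightarrow> Ck k f"
proof (induction k arbitrary: f)
  case (Suc k)
  then show ?case by (subst Ck.simps) (auto simp del: Ck.simps(2) simp: Ck.simps(2)[of "Suc k"])
qed simp

lemma Ck_const: "Ck k (\<lambda>_::'a::euclidean_space. c :: real)"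
proof (induction k arbitrary: c)
  case (Suc k)
  have "frechet_derivative (\<lambda>_::'a. c) (at x) = (\<lambda>_. 0)" for x
    by (rule frechet_derivative_at[symmetric]) simp
  then show ?case using Suc[of 0] by simp
qed simp

lemma Ck_bounded_linear:
  fixes f :: "'a::euclidean_space \<Rightarrow> real"
  assumes "bounded_linear f" shows "Ck k f"
proof (cases k)
  case 0
  then show ?thesis using assms linear_continuous_on by auto
next
  case (Suc m)
  have "(f has_derivative f) (at x)" for x
    using assms by (rule bounded_linear_imp_has_derivative)
  then have "frechet_derivative f (at x) = f" "f differentiable (at x)" for x
    by (simp_all add: frechet_derivative_at[symmetric] differentiable_def, blast)
  then show ?thesis using Suc assms linear_continuous_on[of f UNIV] by (auto simp: Ck_const)
qed

lemma Ck_has_derivative: "Ck (Suc k) f \<Longrightarrow> (f has_derivative frechet_derivative f (at x)) (at x)"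
  by (simp add: frechet_derivative_works[symmetric])

lemma Ck_add: "Ck k f \<Longrightarrow> Ck k g \<Longrightarrow> Ck k (\<lambda>x. f x + g x)"
proof (induction k arbitrary: f g)
  case (Suc k)
  have "frechet_derivative (\<lambda>x. f x + g x) (at x) =
      (\<lambda>b. frechet_derivative f (at x) b + frechet_derivative g (at x) b)" for x
    using Suc.prems
    by (intro frechet_derivative_at[symmetric] has_derivative_add Ck_has_derivative[of k])
  then show ?case using Suc by (auto intro!: continuous_intros)
qed (auto intro!: continuous_intros)

lemma Ck_mult: "Ck k f \<Longrightarrow> Ck k g \<Longrightarrow> Ck k (\<lambda>x. f x * g x :: real)"
proof (induction k arbitrary: f g)
  case (Suc k)
  have D: "frechet_derivative (\<lambda>x. f x * g x) (at x) =
      (\<lambda>b. f x * frechet_derivative g (at x) b + frechet_derivative f (at x) b * g x)" for x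
    using Suc.prems
    by (intro frechet_derivative_at[symmetric] has_derivative_mult Ck_has_derivative[of k])
  show ?case using Suc.prems Suc.IH Ck_Suc_imp[OF Suc.prems(1)] Ck_Suc_imp[OF Suc.prems(2)]
    by (auto intro!: continuous_intros Ck_add simp: D)
qed (auto intro!: continuous_intros)

definition bump :: "real poly \<Rightarrow> real \<Rightarrow> 'a::euclidean_space \<Rightarrow> 'a \<Rightarrow> real" where
  "bump p \<epsilon> z y = flat p (1 - (y - z) \<bullet> (y - z) / \<epsilon>\<^sup>2)"

lemma bump_has_derivative:
  "(bump p \<epsilon> z has_derivative
     (\<lambda>b. bump (flat_deriv p) \<epsilon> z y * (- 2 / \<epsilon>\<^sup>2 * ((y - z) \<bullet> b)))) (at y)"
proof -
  have "((\<lambda>y. 1 - (y - z) \<bullet> (y - z) / \<epsilon>\<^sup>2) has_derivative (\<lambda>b. - 2 / \<epsilon>\<^sup>2 * ((y - z) \<bullet> b))) (at y)"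
    by (auto intro!: derivative_eq_intros simp: inner_commute divide_inverse)
  from has_derivative_compose[OF this flat_has_derivative[of p, unfolded has_field_derivative_def]]
  show ?thesis unfolding bump_def .
qed

lemma bump_frechet_derivative:
  "frechet_derivative (bump p \<epsilon> z) (at y) =
     (\<lambda>b. bump (flat_deriv p) \<epsilon> z y * (- 2 / \<epsilon>\<^sup>2 * ((y - z) \<bullet> b)))"
  using frechet_derivative_at[OF bump_has_derivative] by metis

lemma continuous_bump: "continuous_on UNIV (bump p \<epsilon> z)"
  by (meson bump_has_derivative has_derivative_continuous continuous_at_imp_continuous_on)

lemma Ck_bump: "Ck k (bump p \<epsilon> z)"
proof (induction k arbitrary: p)
  case 0
  show ?case by (simp add: continuous_bump)
next
  case (Suc k)
  have *: "Ck k (\<lambda>y. - 2 / \<epsilon>\<^sup>2 * ((y - z) \<bullet> b))" for b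
  proof -
    have "(\<lambda>y. - 2 / \<epsilon>\<^sup>2 * ((y - z) \<bullet> b)) = (\<lambda>y. (- 2 / \<epsilon>\<^sup>2) * (y \<bullet> b) + (2 / \<epsilon>\<^sup>2 * (z \<bullet> b)))"
      by (auto simp: inner_diff_left algebra_simps add_divide_distrib diff_divide_distrib)
    then show ?thesis
      by (simp only:) (intro Ck_add Ck_mult Ck_const Ck_bounded_linear bounded_linear_inner_left)
  qed
  moreover have "bump p \<epsilon> z differentiable at x" for x
    using bump_has_derivative differentiable_def by blast
  ultimately show ?case
    using Suc by (simp only: Ck.simps bump_frechet_derivative)
      (intro conjI allI ballI TrueI continuous_bump Ck_mult[OF _ *])
qed

lemma bump_nonneg: "bump 1 \<epsilon> z y \<ge> 0"
  by (simp add: bump_def flat_def)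

lemma bump_eq_0: "\<epsilon> > 0 \<Longrightarrow> dist z y \<ge> \<epsilon> \<Longrightarrow> bump p \<epsilon> z y = 0"
  by (auto simp: bump_def flat_def dist_norm norm_minus_commute power2_norm_eq_inner[symmetric]
      divide_less_eq less_diff_eq not_less dest: power_mono[of \<epsilon> _ 2])

lemma bump_pos: "\<epsilon> > 0 \<Longrightarrow> dist z y < \<epsilon> \<Longrightarrow> bump 1 \<epsilon> z y > 0"
  by (auto simp: bump_def flat_def dist_norm norm_minus_commute[of y z] power2_norm_eq_inner[symmetric]
      intro!: power_strict_mono)

lemma bump_le_1: "bump 1 \<epsilon> z y \<le> 1"
  by (simp add: bump_def flat_def)

lemma bump_scale: "\<epsilon> > 0 \<Longrightarrow> bump p \<epsilon> z (z + \<epsilon> *\<^sub>R x) = bump p 1 0 x"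
  by (simp add: bump_def power2_eq_square)

lemma test_function_bump:
  assumes "\<epsilon> > 0" "cball z \<epsilon> \<subseteq> \<Omega>"
  shows "test_function \<Omega> (bump p \<epsilon> z)"
proof -
  have *: "{y. bump p \<epsilon> z y \<noteq> 0} \<subseteq> cball z \<epsilon>"
    using bump_eq_0[OF assms(1), of z _ p] by (auto simp: not_le) (meson less_le_not_le linear)
  then have "closure {y. bump p \<epsilon> z y \<noteq> 0} \<subseteq> cball z \<epsilon>"
    by (rule closure_minimal) simp
  then show ?thesis
    using assms bounded_subset[OF bounded_cball *] unfolding test_function_def
    by (auto simp: Ck_bump compact_eq_bounded_closed)
qed

lemma bump_bounded: "\<exists>B. \<forall>z y. \<bar>bump p \<epsilon> (z::'a::euclidean_space) y\<bar> \<le> B"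
proof -
  define k where "k = (\<lambda>s::real. flat p s)"
  have "continuous_on {0..1} k" unfolding k_def
    by (meson flat_has_derivative DERIV_isCont continuous_at_imp_continuous_on)
  then have "compact (k ` {0..1})" by (rule compact_continuous_image) simp
  then obtain B where B: "\<And>s. s \<in> {0..1} \<Longrightarrow> \<bar>k s\<bar> \<le> B"
    by (metis compact_imp_bounded bounded_iff imageI real_norm_def)
  have "\<bar>k s\<bar> \<le> B" if "s \<le> 1" for s
  proof (cases "s \<ge> 0")
    case False
    then have "k s = 0" by (simp add: k_def flat_def)
    then show ?thesis using B[of 0] by auto
  qed (use that B in auto)
  then have "\<bar>bump p \<epsilon> z y\<bar> \<le> B" for z y :: 'a
    by (simp add: bump_def k_def)
  then show ?thesis by blast
qed

lemma borel_measurable_flat [measurable]: "flat p \<in> borel_measurable borel"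
  by (intro borel_measurable_continuous_onI continuous_at_imp_continuous_on ballI DERIV_isCont[OF flat_has_derivative])

lemma borel_measurable_bump [measurable (raw)]:
  fixes f g :: "'b \<Rightarrow> 'a::euclidean_space"
  assumes [measurable]: "f \<in> borel_measurable M" "g \<in> borel_measurable M"
  shows "(\<lambda>x. bump p \<epsilon> (f x) (g x)) \<in> borel_measurable M"
  unfolding bump_def by measurable

lemma bump_commute: "bump p \<epsilon> z y = bump p \<epsilon> y z"
  by (simp add: bump_def inner_diff_left inner_diff_right inner_commute algebra_simps)

lemma integrable_bump:
  assumes "\<epsilon> > 0" shows "integrable lborel (bump p \<epsilon> (z::'a::euclidean_space))"
proof -
  obtain B where B: "\<And>z y::'a. \<bar>bump p \<epsilon> z y\<bar> \<le> B" using bump_bounded by blast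
  have i: "integrable lborel (\<lambda>y. B * indicator (cball z \<epsilon>) y)"
    by (intro integrable_mult_right integrable_real_indicator emeasure_bounded_finite) auto
  have "norm (bump p \<epsilon> z y) \<le> norm (B * indicator (cball z \<epsilon>) y)" for y
    using B[of z y] bump_eq_0[OF assms, of z y p] by (auto simp: indicator_def not_le)
  then show ?thesis
    by (intro Bochner_Integration.integrable_bound[OF i]) auto
qed

lemma integral_bump_scale:
  assumes "\<epsilon> > 0"
  shows "(\<integral>y. bump p \<epsilon> (z::'a::euclidean_space) y \<partial>lborel) = \<epsilon> ^ DIM('a) * (\<integral>y. bump p 1 (0::'a) y \<partial>lborel)"
proof -
  have "(\<integral>y. bump p \<epsilon> z y \<partial>lborel) =
      (\<integral>y. bump p \<epsilon> z y \<partial>density (distr lborel borel (\<lambda>x. z + \<epsilon> *\<^sub>R x)) (\<lambda>_. \<bar>\<epsilon>\<bar>^DIM('a)))"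
    using assms by (subst lborel_affine[of \<epsilon> z]) auto
  also have "\<dots> = \<epsilon> ^ DIM('a) * (\<integral>y. bump p 1 (0::'a) y \<partial>lborel)"
    using assms by (subst integral_density) (auto simp: integral_distr bump_scale)
  finally show ?thesis .
qed

lemma integral_bump_pos:
  assumes "\<epsilon> > 0"
  shows "(\<integral>y. bump 1 \<epsilon> (z::'a::euclidean_space) y \<partial>lborel) > 0"
proof -
  have "emeasure lborel (ball z \<epsilon>) \<noteq> 0"
    using open_not_negligible[of "ball z \<epsilon>"] assms
    by (simp add: negligible_iff_null_sets null_sets_def)
  moreover have "(ball z \<epsilon>) \<in> sets lborel" by simp
  ultimately have "\<not> (AE y in lborel. y \<notin> ball z \<epsilon>)"
    using AE_iff_measurable[of "ball z \<epsilon>" lborel "\<lambda>y. y \<notin> ball z \<epsilon>"]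
    by (auto simp del: mem_ball)
  moreover have "AE y in lborel. y \<notin> ball z \<epsilon>" if "AE y in lborel. bump 1 \<epsilon> z y = 0"
    using that by eventually_elim (use bump_pos[OF assms, of z] in force)
  ultimately have "(\<integral>y. bump 1 \<epsilon> z y \<partial>lborel) \<noteq> 0"
    using integral_nonneg_eq_0_iff_AE[OF integrable_bump[OF assms, of 1 z]] by (auto simp: bump_nonneg)
  moreover have "(\<integral>y. bump 1 \<epsilon> z y \<partial>lborel) \<ge> 0"
    by (intro integral_nonneg_AE) (simp add: bump_nonneg)
  ultimately show ?thesis by simp
qed

text \<open>The denominator is the mass of the bump at scale \<epsilon>, written through the unit
  scale so that its dependence on \<epsilon> is explicit.\<close>

definition mol :: "real \<Rightarrow> 'a::euclidean_space \<Rightarrow> 'a \<Rightarrow> real" where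
  "mol \<epsilon> z y = bump 1 \<epsilon> z y / (\<epsilon> ^ DIM('a) * (\<integral>y. bump 1 1 (0::'a) y \<partial>lborel))"

lemma borel_measurable_mol [measurable (raw)]:
  fixes f g :: "'b \<Rightarrow> 'a::euclidean_space"
  assumes [measurable]: "f \<in> borel_measurable M" "g \<in> borel_measurable M"
  shows "(\<lambda>x. mol \<epsilon> (f x) (g x)) \<in> borel_measurable M"
  unfolding mol_def by (intro borel_measurable_divide borel_measurable_bump borel_measurable_const assms)

lemma mol_commute: "mol \<epsilon> z y = mol \<epsilon> y z"
  by (simp add: mol_def bump_commute)

lemma mol_nonneg: "\<epsilon> > 0 \<Longrightarrow> mol \<epsilon> (z::'a::euclidean_space) y \<ge> 0"
  using integral_bump_pos[of 1 "0::'a"] by (simp add: mol_def bump_nonneg)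

lemma mol_le: "\<epsilon> > 0 \<Longrightarrow> mol \<epsilon> (z::'a::euclidean_space) y \<le> 1 / (\<epsilon> ^ DIM('a) * (\<integral>y. bump 1 1 (0::'a) y \<partial>lborel))"
  using integral_bump_pos[of 1 "0::'a"] bump_le_1[of \<epsilon> z y]
  by (auto simp: mol_def intro!: divide_right_mono)

lemma mol_eq_0: "\<epsilon> > 0 \<Longrightarrow> dist z y \<ge> \<epsilon> \<Longrightarrow> mol \<epsilon> z y = 0"
  by (simp add: mol_def bump_eq_0)

lemma integrable_mol: "\<epsilon> > 0 \<Longrightarrow> integrable lborel (mol \<epsilon> z)"
  unfolding mol_def by (intro integrable_divide integrable_bump)

lemma integral_mol: "\<epsilon> > 0 \<Longrightarrow> (\<integral>y. mol \<epsilon> (z::'a::euclidean_space) y \<partial>lborel) = 1"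
  using integral_bump_pos[of 1 "0::'a"] integral_bump_scale[of \<epsilon> 1 z] by (simp add: mol_def)

lemma nn_integral_mol: "\<epsilon> > 0 \<Longrightarrow> (\<integral>\<^sup>+y. ennreal (mol \<epsilon> (z::'a::euclidean_space) y) \<partial>lborel) = 1"
  by (subst nn_integral_eq_integral) (auto simp: integrable_mol mol_nonneg integral_mol)

text \<open>The derivative of \<open>bump 1 \<epsilon> z\<close> at \<open>y\<close> in direction
  \<theta>. By \<open>dbump_commute\<close>, differentiating in the centre instead of the argument
  changes only the sign.\<close>

definition dbump :: "real \<Rightarrow> 'a::euclidean_space \<Rightarrow> 'a \<Rightarrow> 'a \<Rightarrow> real" where
  "dbump \<epsilon> z y \<theta> = bump (flat_deriv 1) \<epsilon> z y * (- 2 / \<epsilon>\<^sup>2 * ((y - z) \<bullet> \<theta>))"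

lemma borel_measurable_dbump [measurable (raw)]:
  fixes f g :: "'b \<Rightarrow> 'a::euclidean_space"
  assumes [measurable]: "f \<in> borel_measurable M" "g \<in> borel_measurable M"
  shows "(\<lambda>x. dbump \<epsilon> (f x) (g x) \<theta>) \<in> borel_measurable M"
  unfolding dbump_def by measurable

lemma dbump_commute: "dbump \<epsilon> z y \<theta> = - dbump \<epsilon> y z \<theta>"
  by (simp add: dbump_def bump_commute[of _ _ z y] inner_diff_left algebra_simps diff_divide_distrib)

lemma dbump_bounded:
  assumes "\<epsilon> > 0"
  shows "\<exists>L\<ge>0. \<forall>z y \<theta> :: 'a::euclidean_space. \<bar>dbump \<epsilon> z y \<theta>\<bar> \<le> L * norm \<theta>"
proof -
  obtain B where B: "\<And>z y::'a. \<bar>bump (flat_deriv 1) \<epsilon> z y\<bar> \<le> B" using bump_bounded by blast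
  have B0: "B \<ge> 0" using order_trans[OF abs_ge_zero B] .
  have "\<bar>dbump \<epsilon> z y \<theta>\<bar> \<le> (B * (2 / \<epsilon>)) * norm \<theta>" for z y \<theta> :: 'a
  proof (cases "dist z y < \<epsilon>")
    case True
    have "\<bar>(y - z) \<bullet> \<theta>\<bar> \<le> norm (y - z) * norm \<theta>" by (rule Cauchy_Schwarz_ineq2)
    also have "\<dots> \<le> \<epsilon> * norm \<theta>" using True by (intro mult_right_mono) (auto simp: dist_norm norm_minus_commute)
    finally have "2 / \<epsilon>\<^sup>2 * \<bar>(y - z) \<bullet> \<theta>\<bar> \<le> 2 / \<epsilon>\<^sup>2 * (\<epsilon> * norm \<theta>)" by (intro mult_left_mono) auto
    then have "2 / \<epsilon>\<^sup>2 * \<bar>(y - z) \<bullet> \<theta>\<bar> \<le> 2 / \<epsilon> * norm \<theta>" using assms by (simp add: power2_eq_square)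
    then have "\<bar>- 2 / \<epsilon>\<^sup>2 * ((y - z) \<bullet> \<theta>)\<bar> \<le> 2 / \<epsilon> * norm \<theta>" by (simp add: abs_mult)
    then have "\<bar>bump (flat_deriv 1) \<epsilon> z y\<bar> * \<bar>- 2 / \<epsilon>\<^sup>2 * ((y - z) \<bullet> \<theta>)\<bar> \<le> B * (2 / \<epsilon> * norm \<theta>)"
      using B0 by (intro mult_mono B) auto
    then show ?thesis unfolding dbump_def abs_mult by (simp add: mult.assoc)
  next
    case False
    then show ?thesis using assms B0 by (simp add: dbump_def bump_eq_0)
  qed
  then show ?thesis using B0 assms by (intro exI[of _ "B * (2 / \<epsilon>)"]) auto
qed

text \<open>Here the centre moves along the line, because a mollification is evaluated by moving the
  centre of its kernel.\<close>

lemma bump_line_derivative: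
  "((\<lambda>t. bump 1 \<epsilon> (x + t *\<^sub>R \<theta>) y) has_real_derivative - dbump \<epsilon> (x + t *\<^sub>R \<theta>) y \<theta>) (at t)"
proof -
  have "((\<lambda>t. x + t *\<^sub>R \<theta>) has_derivative (\<lambda>h. h *\<^sub>R \<theta>)) (at t)"
    by (auto intro!: derivative_eq_intros)
  from has_derivative_compose[OF this bump_has_derivative[of 1 \<epsilon> y]]
  have "((\<lambda>t. bump 1 \<epsilon> y (x + t *\<^sub>R \<theta>)) has_derivative (\<lambda>h. dbump \<epsilon> y (x + t *\<^sub>R \<theta>) \<theta> * h)) (at t)"
    by (rule has_derivative_eq_rhs) (auto simp: dbump_def)
  then show ?thesis
    by (subst bump_commute, subst dbump_commute) (simp add: has_field_derivative_def)
qed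

lemma continuous_dbump_line: "isCont (\<lambda>t. dbump \<epsilon> (x + t *\<^sub>R \<theta>) y \<theta>) t"
proof -
  have "continuous_on UNIV (\<lambda>t. bump p \<epsilon> y (x + t *\<^sub>R \<theta>))" for p
    by (rule continuous_on_compose2[OF continuous_bump]) (auto intro!: continuous_intros)
  then have "isCont (\<lambda>t. bump p \<epsilon> y (x + t *\<^sub>R \<theta>)) t" for p
    by (simp add: continuous_on_eq_continuous_at)
  then show ?thesis
    unfolding dbump_def by (subst bump_commute) (intro continuous_intros)
qed

lemma bump_lipschitz:
  assumes "\<epsilon> > 0"
  shows "\<exists>L\<ge>0. \<forall>z z' y :: 'a::euclidean_space. \<bar>bump 1 \<epsilon> z y - bump 1 \<epsilon> z' y\<bar> \<le> L * dist z z'"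
proof -
  obtain L where L: "L \<ge> 0" "\<And>z y \<theta> :: 'a. \<bar>dbump \<epsilon> z y \<theta>\<bar> \<le> L * norm \<theta>"
    using dbump_bounded[OF assms] by blast
  have "\<bar>bump 1 \<epsilon> z y - bump 1 \<epsilon> z' y\<bar> \<le> L * dist z z'" for z z' y :: 'a
  proof -
    have "norm (bump 1 \<epsilon> (z' + 1 *\<^sub>R (z - z')) y - bump 1 \<epsilon> (z' + 0 *\<^sub>R (z - z')) y) \<le> L * norm (z - z') * norm (1 - 0 :: real)"
    proof (rule field_differentiable_bound[of UNIV])
      show "((\<lambda>t. bump 1 \<epsilon> (z' + t *\<^sub>R (z - z')) y) has_real_derivative
          - dbump \<epsilon> (z' + t *\<^sub>R (z - z')) y (z - z')) (at t within UNIV)" for t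
        using bump_line_derivative[of \<epsilon> z' "z - z'" y t] by simp
    qed (use L in auto)
    then show ?thesis by (simp add: dist_norm)
  qed
  with L(1) show ?thesis by blast
qed

definition mollify :: "real \<Rightarrow> ('a::euclidean_space \<Rightarrow> real) \<Rightarrow> 'a \<Rightarrow> real" where
  "mollify \<epsilon> v x = (\<integral>y. v y * mol \<epsilon> x y \<partial>lborel)"

lemma integrable_mult_mol:
  fixes v :: "'a::euclidean_space \<Rightarrow> real"
  assumes "\<epsilon> > 0" "integrable lborel v"
  shows "integrable lborel (\<lambda>y. v y * mol \<epsilon> x y)"
proof -
  define c where "c = 1 / (\<epsilon> ^ DIM('a) * (\<integral>y. bump 1 1 (0::'a) y \<partial>lborel))"
  have "\<bar>mol \<epsilon> x y\<bar> \<le> c" for y using mol_le[OF assms(1), of x y] mol_nonneg[OF assms(1), of x y] by (simp add: c_def)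
  then have *: "norm (v y * mol \<epsilon> x y) \<le> norm (c * v y)" for y
    using order_trans[OF _ abs_ge_self[of c]]
    by (simp add: abs_mult mult.commute[of "\<bar>c\<bar>"] mult_left_mono)
  have [measurable]: "v \<in> borel_measurable borel"
    using borel_measurable_integrable[OF assms(2)] by simp
  show ?thesis
  proof (rule Bochner_Integration.integrable_bound)
    show "integrable lborel (\<lambda>y. c * v y)" using assms(2) by (rule integrable_mult_right)
    show "(\<lambda>y. v y * mol \<epsilon> x y) \<in> borel_measurable lborel" by measurable
  qed (use * in blast)
qed

lemma mollify_bound:
  fixes v :: "'a::euclidean_space \<Rightarrow> real"
  assumes "\<epsilon> > 0" "integrable lborel v"
  shows "\<bar>mollify \<epsilon> v x\<bar> \<le> 1 / (\<epsilon> ^ DIM('a) * (\<integral>y. bump 1 1 (0::'a) y \<partial>lborel)) * (\<integral>y. \<bar>v y\<bar> \<partial>lborel)"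
proof -
  define c where "c = 1 / (\<epsilon> ^ DIM('a) * (\<integral>y. bump 1 1 (0::'a) y \<partial>lborel))"
  have c: "\<bar>mol \<epsilon> x y\<bar> \<le> c" for y using mol_le[OF assms(1), of x y] mol_nonneg[OF assms(1), of x y] by (simp add: c_def)
  have "\<bar>mollify \<epsilon> v x\<bar> \<le> (\<integral>y. norm (v y * mol \<epsilon> x y) \<partial>lborel)"
    unfolding mollify_def using integral_norm_bound[of lborel "\<lambda>y. v y * mol \<epsilon> x y"] by simp
  also have "\<dots> \<le> (\<integral>y. c * \<bar>v y\<bar> \<partial>lborel)"
    using assms(2) integrable_norm[OF integrable_mult_mol[OF assms]] c
    by (intro integral_mono) (auto simp: abs_mult mult.commute[of c] intro!: mult_left_mono)
  finally show ?thesis by (simp add: c_def)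
qed

text \<open>The constant is uniform in \<open>v\<close>, so functions bounded in L^1 have
  equi-Lipschitz mollifications at a fixed scale. This is the equicontinuity used for
  Arzela-Ascoli.\<close>

lemma mollify_lipschitz:
  assumes "\<epsilon> > 0"
  shows "\<exists>L\<ge>0. \<forall>v x x'. integrable lborel v \<longrightarrow>
    \<bar>mollify \<epsilon> v x - mollify \<epsilon> v (x'::'a::euclidean_space)\<bar> \<le> L * (\<integral>y. \<bar>v y\<bar> \<partial>lborel) * dist x x'"
proof -
  define c where "c = 1 / (\<epsilon> ^ DIM('a) * (\<integral>y. bump 1 1 (0::'a) y \<partial>lborel))"
  have c: "c \<ge> 0" using assms integral_bump_pos[of 1 "0::'a"] by (simp add: c_def)
  obtain L where L: "L \<ge> 0" "\<And>z z' y :: 'a. \<bar>bump 1 \<epsilon> z y - bump 1 \<epsilon> z' y\<bar> \<le> L * dist z z'"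
    using bump_lipschitz[OF assms] by blast
  have m: "mol \<epsilon> z y - mol \<epsilon> z' y = c * (bump 1 \<epsilon> z y - bump 1 \<epsilon> z' y)" for z z' y :: 'a
    by (simp add: mol_def c_def algebra_simps diff_divide_distrib)
  have "\<bar>mollify \<epsilon> v x - mollify \<epsilon> v x'\<bar> \<le> (c * L) * (\<integral>y. \<bar>v y\<bar> \<partial>lborel) * dist x x'"
    if v: "integrable lborel v" for v and x x' :: 'a
  proof -
    have i: "integrable lborel (\<lambda>y. v y * (mol \<epsilon> x y - mol \<epsilon> x' y))"
      using integrable_mult_mol[OF assms v] by (simp add: right_diff_distrib)
    have "mollify \<epsilon> v x - mollify \<epsilon> v x' = (\<integral>y. v y * (mol \<epsilon> x y - mol \<epsilon> x' y) \<partial>lborel)"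
      unfolding mollify_def using integrable_mult_mol[OF assms v] by (simp add: right_diff_distrib)
    also have "\<bar>\<dots>\<bar> \<le> (\<integral>y. norm (v y * (mol \<epsilon> x y - mol \<epsilon> x' y)) \<partial>lborel)"
      using integral_norm_bound[of lborel "\<lambda>y. v y * (mol \<epsilon> x y - mol \<epsilon> x' y)"] by simp
    also have "\<dots> \<le> (\<integral>y. c * L * dist x x' * \<bar>v y\<bar> \<partial>lborel)"
    proof (intro integral_mono integrable_norm i)
      show "norm (v y * (mol \<epsilon> x y - mol \<epsilon> x' y)) \<le> c * L * dist x x' * \<bar>v y\<bar>" for y
      proof -
        have "\<bar>mol \<epsilon> x y - mol \<epsilon> x' y\<bar> \<le> c * (L * dist x x')"
          unfolding m using c L(2)[of x y x'] by (simp add: abs_mult mult_left_mono)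
        then have "\<bar>v y\<bar> * \<bar>mol \<epsilon> x y - mol \<epsilon> x' y\<bar> \<le> \<bar>v y\<bar> * (c * (L * dist x x'))"
          by (rule mult_left_mono) simp
        then show ?thesis by (simp add: abs_mult mult_ac)
      qed
    qed (use v in auto)
    finally show ?thesis by (simp add: mult_ac)
  qed
  then show ?thesis using c L(1) by (intro exI[of _ "c * L"]) auto
qed

subsection \<open>Weakly differentiable functions\<close>

text \<open>The form in which weak differentiability is used: a Borel representative of the
  gradient, zero off \<Omega> and integrable on the whole space, tested only against bumps whose
  closed ball lies in \<Omega>, but in every direction \<theta>. \<open>V1Lp_weak_pair\<close>
  supplies it.\<close>

locale weak_pair =
  fixes \<Omega> :: "'a::euclidean_space set" and u :: "'a \<Rightarrow> real" and G :: "'a \<Rightarrow> 'a"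
  assumes open_\<Omega>: "open \<Omega>" and Cb: "Cb_closure \<Omega> u"
    and integrable_G: "integrable lborel G" and G_0: "\<And>y. y \<notin> \<Omega> \<Longrightarrow> G y = 0"
    and weak: "\<And>z \<epsilon> \<theta>. \<epsilon> > 0 \<Longrightarrow> cball z \<epsilon> \<subseteq> \<Omega> \<Longrightarrow>
       (\<integral>y. indicator \<Omega> y * u y * dbump \<epsilon> z y \<theta> \<partial>lborel) = - (\<integral>y. (G y \<bullet> \<theta>) * bump 1 \<epsilon> z y \<partial>lborel)"
begin

text \<open>The zero extension jumps at the boundary; nothing is claimed about its gradient there.
  Its mollifications are compared with \<open>u\<close> only where the kernel ball stays in
  \<Omega>.\<close>

definition "u0 y = indicator \<Omega> y * u y"

lemma G_measurable [measurable]: "G \<in> borel_measurable borel"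
  using borel_measurable_integrable[OF integrable_G] by simp

lemma continuous_u: "continuous_on (closure \<Omega>) u"
  using Cb by (simp add: Cb_closure_def)

lemma u0_measurable [measurable]: "u0 \<in> borel_measurable borel"
proof -
  have "continuous_on \<Omega> u" using continuous_u closure_subset continuous_on_subset by blast
  then have "(\<lambda>y. indicator \<Omega> y *\<^sub>R u y) \<in> borel_measurable borel"
    using open_\<Omega> by (intro borel_measurable_continuous_on_indicator) auto
  then show ?thesis by (simp add: u0_def[abs_def])
qed

lemma compact_supp: "compact (closure {x \<in> closure \<Omega>. u x \<noteq> 0})"
  using Cb by (simp add: Cb_closure_def)

lemma compact_level: "a > 0 \<Longrightarrow> compact {x \<in> closure \<Omega>. a \<le> \<bar>u x\<bar>}"
proof -
  assume "a > 0"
  then have "{x \<in> closure \<Omega>. a \<le> \<bar>u x\<bar>} \<subseteq> {x \<in> closure \<Omega>. u x \<noteq> 0}" by auto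
  then have "bounded {x \<in> closure \<Omega>. a \<le> \<bar>u x\<bar>}"
    using Cb bounded_subset by (auto simp: Cb_closure_def)
  moreover have "closed {x \<in> closure \<Omega>. a \<le> \<bar>u x\<bar>}"
    using continuous_closed_preimage[OF continuous_on_rabs[OF continuous_u] closed_closure, of "{a..}"]
    by (auto simp: vimage_def Int_def)
  ultimately show ?thesis by (simp add: compact_eq_bounded_closed)
qed

lemma u_bounded: "\<exists>B\<ge>0. \<forall>x\<in>closure \<Omega>. \<bar>u x\<bar> \<le> B"
proof -
  have "closure {x \<in> closure \<Omega>. u x \<noteq> 0} \<subseteq> closure \<Omega>"
    by (rule closure_minimal) auto
  then have "compact (u ` closure {x \<in> closure \<Omega>. u x \<noteq> 0})"
    by (intro compact_continuous_image compact_supp continuous_on_subset[OF continuous_u])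
  then obtain B where B: "\<And>x. x \<in> closure {x \<in> closure \<Omega>. u x \<noteq> 0} \<Longrightarrow> \<bar>u x\<bar> \<le> B"
    by (metis compact_imp_bounded bounded_iff imageI real_norm_def)
  have "\<bar>u x\<bar> \<le> max B 0" if "x \<in> closure \<Omega>" for x
  proof (cases "u x = 0")
    case False
    then have "x \<in> closure {x \<in> closure \<Omega>. u x \<noteq> 0}" using that closure_subset by fastforce
    then show ?thesis using B by fastforce
  qed simp
  then show ?thesis by (intro exI[of _ "max B 0"]) auto
qed

lemma integrable_u0: "integrable lborel u0"
proof -
  obtain B where B: "B \<ge> 0" "\<And>x. x \<in> closure \<Omega> \<Longrightarrow> \<bar>u x\<bar> \<le> B" using u_bounded by blast
  define S where "S = closure {x \<in> closure \<Omega>. u x \<noteq> 0}"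
  have S: "compact S" using compact_supp by (simp add: S_def)
  have i: "integrable lborel (\<lambda>y. B * indicator S y)"
    using S by (intro integrable_mult_right integrable_real_indicator emeasure_bounded_finite)
      (auto intro: compact_imp_bounded simp: borel_compact)
  have "norm (u0 y) \<le> norm (B * indicator S y)" for y
  proof (cases "y \<in> \<Omega> \<and> u y \<noteq> 0")
    case True
    then have "y \<in> closure \<Omega>" using closure_subset by auto
    moreover from this True have "y \<in> S" unfolding S_def using closure_subset by fastforce
    ultimately show ?thesis using B True by (simp add: u0_def)
  qed (auto simp: u0_def)
  then show ?thesis
    by (intro Bochner_Integration.integrable_bound[OF i]) auto
qed

text \<open>The closure of \<Omega> may be unbounded, but \<open>u\<close> vanishes outside a ball
  of radius \<open>R\<close>. Compactness handles the ball of radius \<open>R + 1\<close>; if one of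
  two points at distance below 1 lies outside it, both lie outside radius \<open>R\<close>.\<close>

lemma uniformly_continuous_u:
  assumes "\<kappa> > 0"
  shows "\<exists>d>0. \<forall>x\<in>closure \<Omega>. \<forall>y\<in>closure \<Omega>. dist x y < d \<longrightarrow> \<bar>u x - u y\<bar> \<le> \<kappa>"
proof -
  obtain R where R: "{x \<in> closure \<Omega>. u x \<noteq> 0} \<subseteq> cball 0 R"
    using Cb by (auto simp: Cb_closure_def bounded_iff subset_eq)
  have "compact (closure \<Omega> \<inter> cball 0 (R + 1))" by (intro closed_Int_compact) auto
  then have "uniformly_continuous_on (closure \<Omega> \<inter> cball 0 (R + 1)) u"
    by (intro compact_uniformly_continuous continuous_on_subset[OF continuous_u]) auto
  then obtain d where d: "d > 0" "\<And>x y. x \<in> closure \<Omega> \<inter> cball 0 (R + 1) \<Longrightarrow>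
      y \<in> closure \<Omega> \<inter> cball 0 (R + 1) \<Longrightarrow> dist x y < d \<Longrightarrow> dist (u x) (u y) < \<kappa>"
    unfolding uniformly_continuous_on_def using assms by metis
  have "\<bar>u x - u y\<bar> \<le> \<kappa>" if "x \<in> closure \<Omega>" "y \<in> closure \<Omega>" "dist x y < min d 1" for x y
  proof (cases "x \<in> cball 0 (R + 1) \<and> y \<in> cball 0 (R + 1)")
    case True
    then show ?thesis using that d(2)[of x y] by (auto simp: dist_real_def)
  next
    case False
    have "norm x \<le> norm y + dist x y" "norm y \<le> norm x + dist x y"
      by (metis add.commute dist_norm norm_triangle_sub) (metis add.commute dist_commute dist_norm norm_triangle_sub)
    with False that(3) have "x \<notin> cball 0 R" "y \<notin> cball 0 R" by auto
    then have "u x = 0" "u y = 0" using R that by blast+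
    then show ?thesis using assms by simp
  qed
  then show ?thesis using d(1) by (intro exI[of _ "min d 1"]) auto
qed

lemma mollify_close:
  assumes "\<epsilon> > 0" "cball x \<epsilon> \<subseteq> \<Omega>"
    and "\<And>y. y \<in> \<Omega> \<Longrightarrow> dist x y < \<epsilon> \<Longrightarrow> \<bar>u x - u y\<bar> \<le> \<kappa>"
  shows "\<bar>mollify \<epsilon> u0 x - u x\<bar> \<le> \<kappa>"
proof -
  have i: "integrable lborel (\<lambda>y. u0 y * mol \<epsilon> x y)" "integrable lborel (\<lambda>y. u x * mol \<epsilon> x y)"
    using integrable_mult_mol[OF assms(1) integrable_u0] integrable_mol[OF assms(1)] by auto
  have "mollify \<epsilon> u0 x - u x = (\<integral>y. (u0 y * mol \<epsilon> x y - u x * mol \<epsilon> x y) \<partial>lborel)"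
    using i integral_mol[OF assms(1), of x] by (simp add: mollify_def)
  also have "\<bar>\<dots>\<bar> \<le> (\<integral>y. norm (u0 y * mol \<epsilon> x y - u x * mol \<epsilon> x y) \<partial>lborel)"
    using integral_norm_bound[of lborel "\<lambda>y. u0 y * mol \<epsilon> x y - u x * mol \<epsilon> x y"] by simp
  also have "\<dots> \<le> (\<integral>y. \<kappa> * mol \<epsilon> x y \<partial>lborel)"
  proof (intro integral_mono integrable_norm Bochner_Integration.integrable_diff i)
    show "integrable lborel (\<lambda>y. \<kappa> * mol \<epsilon> x y)" using integrable_mol[OF assms(1)] by auto
    show "norm (u0 y * mol \<epsilon> x y - u x * mol \<epsilon> x y) \<le> \<kappa> * mol \<epsilon> x y" for y
    proof (cases "dist x y < \<epsilon>")
      case True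
      then have "y \<in> \<Omega>" using assms(2) by auto
      then have "\<bar>u0 y - u x\<bar> \<le> \<kappa>" using assms(3)[of y] True by (simp add: u0_def abs_minus_commute)
      then show ?thesis using mol_nonneg[OF assms(1), of x y]
        by (simp add: left_diff_distrib[symmetric] abs_mult mult_right_mono)
    qed (use mol_eq_0[OF assms(1), of x y] in auto)
  qed
  also have "\<dots> = \<kappa>" using integral_mol[OF assms(1), of x] by simp
  finally show ?thesis .
qed

lemma weak_bump:
  assumes "\<epsilon> > 0" "cball z \<epsilon> \<subseteq> \<Omega>"
  shows "(\<integral>y. u0 y * dbump \<epsilon> z y \<theta> \<partial>lborel) = - (\<integral>y. (G y \<bullet> \<theta>) * bump 1 \<epsilon> z y \<partial>lborel)"
  using weak[OF assms] by (simp add: u0_def)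

text \<open>The derivative along \<theta> falls on the kernel, and by the weak equation it is the
  mollification of \<open>G y \<bullet> \<theta>\<close>. Assumption \<open>sub\<close> keeps each
  kernel on the segment inside \<Omega>, where the weak equation is available.\<close>

lemma mollify_line:
  assumes \<epsilon>: "\<epsilon> > 0" and t: "t1 \<le> t2" and \<theta>: "norm \<theta> \<le> 1"
    and sub: "\<And>t. t1 \<le> t \<Longrightarrow> t \<le> t2 \<Longrightarrow> cball (x + t *\<^sub>R \<theta>) \<epsilon> \<subseteq> \<Omega>"
  shows "ennreal \<bar>mollify \<epsilon> u0 (x + t2 *\<^sub>R \<theta>) - mollify \<epsilon> u0 (x + t1 *\<^sub>R \<theta>)\<bar> \<le>
    (\<integral>\<^sup>+t\<in>{t1..t2}. (\<integral>\<^sup>+y. ennreal (norm (G y) * mol \<epsilon> (x + t *\<^sub>R \<theta>) y) \<partial>lborel) \<partial>lborel)"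
proof -
  define c where "c = 1 / (\<epsilon> ^ DIM('a) * (\<integral>y. bump 1 1 (0::'a) y \<partial>lborel))"
  have c: "c \<ge> 0" using \<epsilon> integral_bump_pos[of 1 "0::'a"] by (simp add: c_def)
  have mol: "mol \<epsilon> z y = c * bump 1 \<epsilon> z y" for z y :: 'a by (simp add: mol_def c_def)
  obtain L where L: "L \<ge> 0" "\<And>z y \<theta> :: 'a. \<bar>dbump \<epsilon> z y \<theta>\<bar> \<le> L * norm \<theta>"
    using dbump_bounded[OF \<epsilon>] by blast
  have L': "\<bar>dbump \<epsilon> z y \<theta>\<bar> \<le> L" for z y
    using L(2)[of z y \<theta>] mult_left_mono[OF \<theta> L(1)] by linarith
  \<comment> \<open>One integrand, two orders of integration: in \<open>t\<close> first it gives the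
    increment of the kernel, in \<open>y\<close> first the weak gradient.\<close>
  define f where "f y t = indicator {t1..t2} t * (u0 y * dbump \<epsilon> (x + t *\<^sub>R \<theta>) y \<theta>)" for y t
  have f_meas [measurable]: "case_prod f \<in> borel_measurable (lborel \<Otimes>\<^sub>M lborel)"
    unfolding f_def[abs_def] by measurable
  have f_meas1 [measurable]: "f y \<in> borel_measurable lborel" for y
    unfolding f_def[abs_def] by measurable
  have fb: "norm (f y t) \<le> L * \<bar>u0 y\<bar> * indicator {t1..t2} t" for y t
    using mult_left_mono[OF L'[of "x + t *\<^sub>R \<theta>" y], of "\<bar>u0 y\<bar>"] L(1)
    by (auto simp: f_def abs_mult indicator_def mult_ac)
  have ii: "integrable lborel (\<lambda>t. K * indicator {t1..t2} t :: real)" for K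
    by (intro integrable_mult_right integrable_real_indicator emeasure_bounded_finite) auto
  have fi: "integrable lborel (f y)" for y
    by (rule Bochner_Integration.integrable_bound[OF ii[of "L * \<bar>u0 y\<bar>"]]) (use fb[of y] L(1) in \<open>auto simp: abs_mult\<close>)
  have int: "integrable (lborel \<Otimes>\<^sub>M lborel) (case_prod f)"
  proof (rule lborel_pair.Fubini_integrable[OF f_meas])
    show "AE y in lborel. integrable lborel (\<lambda>t. case_prod f (y, t))" using fi by simp
    have "norm (\<integral>t. norm (case_prod f (y, t)) \<partial>lborel) \<le> norm (L * (t2 - t1) * \<bar>u0 y\<bar>)" for y
    proof -
      have "(\<integral>t. norm (f y t) \<partial>lborel) \<le> (\<integral>t. L * \<bar>u0 y\<bar> * indicator {t1..t2} t \<partial>lborel)"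
        by (intro integral_mono fb integrable_norm fi ii)
      also have "\<dots> = L * (t2 - t1) * \<bar>u0 y\<bar>" using t by simp
      finally show ?thesis using L(1) t by simp
    qed
    then show "integrable lborel (\<lambda>y. \<integral>t. norm (case_prod f (y, t)) \<partial>lborel)"
      by (intro Bochner_Integration.integrable_bound[OF integrable_mult_right[OF integrable_abs[OF integrable_u0], of "L * (t2 - t1)"]])
         (auto intro!: AE_I2)
  qed
  have inner: "(\<integral>t. f y t \<partial>lborel) = - u0 y * (bump 1 \<epsilon> (x + t2 *\<^sub>R \<theta>) y - bump 1 \<epsilon> (x + t1 *\<^sub>R \<theta>) y)" for y
  proof -
    have "(\<integral>t. - dbump \<epsilon> (x + t *\<^sub>R \<theta>) y \<theta> * indicator {t1..t2} t \<partial>lborel)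
      = bump 1 \<epsilon> (x + t2 *\<^sub>R \<theta>) y - bump 1 \<epsilon> (x + t1 *\<^sub>R \<theta>) y"
      by (rule integral_FTC_Icc_real[OF t bump_line_derivative]) (intro continuous_intros continuous_dbump_line)
    moreover have "f y t = - u0 y * (- dbump \<epsilon> (x + t *\<^sub>R \<theta>) y \<theta> * indicator {t1..t2} t)" for t
      by (simp add: f_def)
    ultimately show ?thesis by (simp only: integral_mult_right_zero)
  qed
  define g where "g t = indicator {t1..t2} t * (\<integral>y. (G y \<bullet> \<theta>) * bump 1 \<epsilon> (x + t *\<^sub>R \<theta>) y \<partial>lborel)" for t
  have outer: "(\<integral>y. f y t \<partial>lborel) = - g t" for t
    using weak_bump[OF \<epsilon> sub, of t \<theta>] by (simp add: f_def g_def indicator_def)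
  have gi: "integrable lborel g"
    using lborel_pair.integrable_snd[OF int] by (simp add: outer)
  have "mollify \<epsilon> u0 (x + t2 *\<^sub>R \<theta>) - mollify \<epsilon> u0 (x + t1 *\<^sub>R \<theta>)
     = (\<integral>y. u0 y * mol \<epsilon> (x + t2 *\<^sub>R \<theta>) y - u0 y * mol \<epsilon> (x + t1 *\<^sub>R \<theta>) y \<partial>lborel)"
    using integrable_mult_mol[OF \<epsilon> integrable_u0] by (simp add: mollify_def)
  also have "\<dots> = (\<integral>y. (- c) * (\<integral>t. f y t \<partial>lborel) \<partial>lborel)"
    unfolding inner mol by (simp add: algebra_simps)
  also have "\<dots> = (- c) * (\<integral>y. (\<integral>t. f y t \<partial>lborel) \<partial>lborel)" by (rule integral_mult_right_zero)
  also have "(\<integral>y. (\<integral>t. f y t \<partial>lborel) \<partial>lborel) = (\<integral>t. (\<integral>y. f y t \<partial>lborel) \<partial>lborel)"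
    using lborel_pair.Fubini_integral[OF int] by simp
  also have "(- c) * \<dots> = (\<integral>t. c * g t \<partial>lborel)" by (simp add: outer)
  finally have eq: "mollify \<epsilon> u0 (x + t2 *\<^sub>R \<theta>) - mollify \<epsilon> u0 (x + t1 *\<^sub>R \<theta>) = (\<integral>t. c * g t \<partial>lborel)" .
  have "ennreal \<bar>\<integral>t. c * g t \<partial>lborel\<bar> \<le> (\<integral>\<^sup>+t. ennreal (norm (c * g t)) \<partial>lborel)"
    using integral_norm_bound_ennreal[OF integrable_mult_right[OF gi, of c]] by simp
  also have "\<dots> \<le> (\<integral>\<^sup>+t\<in>{t1..t2}. (\<integral>\<^sup>+y. ennreal (norm (G y) * mol \<epsilon> (x + t *\<^sub>R \<theta>) y) \<partial>lborel) \<partial>lborel)"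
  proof (rule nn_integral_mono)
    fix t
    have Gi: "integrable lborel (\<lambda>y. (G y \<bullet> \<theta>) * mol \<epsilon> z y)" for z
      using integrable_G by (intro integrable_mult_mol[OF \<epsilon>]) auto
    have "c * (\<integral>y. (G y \<bullet> \<theta>) * bump 1 \<epsilon> (x + t *\<^sub>R \<theta>) y \<partial>lborel) = (\<integral>y. (G y \<bullet> \<theta>) * mol \<epsilon> (x + t *\<^sub>R \<theta>) y \<partial>lborel)"
      unfolding mol by (subst integral_mult_right_zero[symmetric]) (simp add: mult_ac)
    also have "ennreal (norm \<dots>) \<le> (\<integral>\<^sup>+y. ennreal (norm ((G y \<bullet> \<theta>) * mol \<epsilon> (x + t *\<^sub>R \<theta>) y)) \<partial>lborel)"
      by (rule integral_norm_bound_ennreal[OF Gi])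
    also have "\<dots> \<le> (\<integral>\<^sup>+y. ennreal (norm (G y) * mol \<epsilon> (x + t *\<^sub>R \<theta>) y) \<partial>lborel)"
    proof (intro nn_integral_mono ennreal_leI)
      fix y
      have "\<bar>G y \<bullet> \<theta>\<bar> \<le> norm (G y) * norm \<theta>" by (rule Cauchy_Schwarz_ineq2)
      also have "\<dots> \<le> norm (G y)" using mult_left_mono[OF \<theta>, of "norm (G y)"] by simp
      finally show "norm ((G y \<bullet> \<theta>) * mol \<epsilon> (x + t *\<^sub>R \<theta>) y) \<le> norm (G y) * mol \<epsilon> (x + t *\<^sub>R \<theta>) y"
        using mol_nonneg[OF \<epsilon>, of "x + t *\<^sub>R \<theta>" y] by (simp add: abs_mult mult_right_mono)
    qed
    finally show "ennreal (norm (c * g t)) \<le> (\<integral>\<^sup>+y. ennreal (norm (G y) * mol \<epsilon> (x + t *\<^sub>R \<theta>) y) \<partial>lborel) * indicator {t1..t2} t"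
      by (simp add: g_def indicator_def)
  qed
  finally show ?thesis unfolding eq .
qed

end

text \<open>Tonelli, and mass 1 of the kernel in its centre. The kernel moves points by less than
  \<epsilon>, so the mass seen from \<open>A\<close> comes from \<open>B\<close>; the bound does not
  depend on \<epsilon>, which lets the scale shrink freely later.\<close>

lemma convolution_set_bound:
  fixes G :: "'a::euclidean_space \<Rightarrow> 'b::euclidean_space"
  assumes \<epsilon>: "\<epsilon> > 0" and [measurable]: "G \<in> borel_measurable borel" "A \<in> sets borel" "B \<in> sets borel"
    and AB: "\<And>z y. z \<in> A \<Longrightarrow> dist z y < \<epsilon> \<Longrightarrow> G y \<noteq> 0 \<Longrightarrow> y \<in> B"
  shows "(\<integral>\<^sup>+z\<in>A. (\<integral>\<^sup>+y. ennreal (norm (G y) * mol \<epsilon> z y) \<partial>lborel) \<partial>lborel)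
      \<le> (\<integral>\<^sup>+y\<in>B. ennreal (norm (G y)) \<partial>lborel)"
proof -
  have "(\<integral>\<^sup>+z\<in>A. (\<integral>\<^sup>+y. ennreal (norm (G y) * mol \<epsilon> z y) \<partial>lborel) \<partial>lborel)
     = (\<integral>\<^sup>+z. (\<integral>\<^sup>+y. ennreal (norm (G y) * mol \<epsilon> z y) * indicator A z \<partial>lborel) \<partial>lborel)"
    by (simp add: nn_integral_multc)
  also have "\<dots> = (\<integral>\<^sup>+y. (\<integral>\<^sup>+z. ennreal (norm (G y) * mol \<epsilon> z y) * indicator A z \<partial>lborel) \<partial>lborel)"
    by (rule lborel_pair.Fubini') measurable
  also have "\<dots> \<le> (\<integral>\<^sup>+y. (\<integral>\<^sup>+z. ennreal (norm (G y)) * indicator B y * ennreal (mol \<epsilon> y z) \<partial>lborel) \<partial>lborel)"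
  proof (intro nn_integral_mono)
    fix y z
    show "ennreal (norm (G y) * mol \<epsilon> z y) * indicator A z \<le> ennreal (norm (G y)) * indicator B y * ennreal (mol \<epsilon> y z)"
      using AB[of z y] mol_eq_0[OF \<epsilon>, of z y]
      by (cases "G y = 0"; cases "z \<in> A"; cases "dist z y < \<epsilon>")
        (auto simp: mol_commute[of \<epsilon> y z] ennreal_mult mol_nonneg[OF \<epsilon>])
  qed
  also have "\<dots> = (\<integral>\<^sup>+y\<in>B. ennreal (norm (G y)) \<partial>lborel)"
    by (simp add: nn_integral_cmult nn_integral_mol[OF \<epsilon>])
  finally show ?thesis .
qed

subsection \<open>Measures of polynomial growth and averaging over rays\<close>

text \<open>The contributions of small and of large radii to the kernel integral, both taken at the
  radius where they are of the same order.\<close>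

definition kernel_const :: "real \<Rightarrow> real \<Rightarrow> real \<Rightarrow> real" where
  "kernel_const d C \<alpha> = C / (\<alpha> - d + 1) + 1 / (d - 1)"

text \<open>The division is by the measure of the set of directions, which is the unit ball and not
  the sphere.\<close>

definition ray_const :: "real \<Rightarrow> real \<Rightarrow> real \<Rightarrow> real" where
  "ray_const d C \<alpha> = kernel_const d C \<alpha> / unit_ball_vol d"

text \<open>The measure lives on the whole space and the growth bound holds for all centres, since
  the kernel is evaluated at points \<open>y\<close> unrelated to the support of \<open>N\<close>.
  The locale is used twice: for the given measure and for Lebesgue measure on \<Omega>.\<close>

locale ball_growth =
  fixes N :: "'a::euclidean_space measure" and C \<alpha> :: real
  assumes sets_N [measurable_cong]: "sets N = sets borel" and finite_N: "finite_measure N"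
    and growth: "\<And>y t. t > 0 \<Longrightarrow> emeasure N (ball y t) \<le> ennreal (C * t powr \<alpha>)"
    and \<alpha>: "real DIM('a) - 1 < \<alpha>" and dim: "2 \<le> DIM('a)" and C: "C > 0"
begin

sublocale finite_measure N by (rule finite_N)

sublocale pair_NL: pair_sigma_finite N "lborel :: 'a measure" ..

sublocale pair_NR: pair_sigma_finite N "lborel :: real measure" ..

text \<open>The sets \<open>E \<inter> ball y t\<close> are the sections of one measurable set in
  the product of the parameter line with \<open>N\<close>.\<close>

lemma measurable_emeasure_Int_ball [measurable (raw)]:
  assumes [measurable]: "E \<in> sets borel"
  shows "(\<lambda>t. emeasure N (E \<inter> ball y t)) \<in> borel_measurable lborel"
proof -
  have "{p \<in> space (lborel \<Otimes>\<^sub>M N). snd p \<in> E \<and> dist y (snd p) < fst p} \<in> sets ((lborel :: real measure) \<Otimes>\<^sub>M N)"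
    by measurable
  from measurable_emeasure_Pair[OF this]
  have "(\<lambda>t. emeasure N (Pair t -` {p \<in> space (lborel \<Otimes>\<^sub>M N). snd p \<in> E \<and> dist y (snd p) < fst p})) \<in> borel_measurable (lborel :: real measure)" .
  moreover have "Pair t -` {p \<in> space (lborel \<Otimes>\<^sub>M N). snd p \<in> E \<and> dist y (snd p) < fst p} = E \<inter> ball y t" for t
    by (auto simp: space_pair_measure sets_eq_imp_space_eq[OF sets_N])
  ultimately show ?thesis by simp
qed

text \<open>With directions in the unit ball, the point reached at time \<open>t\<close> is an
  affine image of \<theta>. This avoids polar coordinates; the Jacobian is the factor
  \<open>1 / t ^ DIM('a)\<close>.\<close>

lemma nn_integral_ball_affine:
  fixes F :: "'a \<Rightarrow> ennreal"
  assumes [measurable]: "F \<in> borel_measurable borel" and t: "t > 0"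
  shows "(\<integral>\<^sup>+\<theta>\<in>ball 0 1. F (x + t *\<^sub>R \<theta>) \<partial>lborel) =
    (\<integral>\<^sup>+y. F y * (if dist x y < t then ennreal (1 / t ^ DIM('a)) else 0) \<partial>lborel)"
proof -
  have "(\<integral>\<^sup>+y. F y * (if dist x y < t then ennreal (1 / t ^ DIM('a)) else 0) \<partial>lborel) =
    (\<integral>\<^sup>+y. F y * (if dist x y < t then ennreal (1 / t ^ DIM('a)) else 0)
       \<partial>density (distr lborel borel (\<lambda>\<theta>. x + t *\<^sub>R \<theta>)) (\<lambda>_. \<bar>t\<bar>^DIM('a)))"
    using t by (subst lborel_affine[of t x]) auto
  also have "\<dots> = (\<integral>\<^sup>+\<theta>. ennreal (\<bar>t\<bar>^DIM('a)) * (F (x + t *\<^sub>R \<theta>) *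
      (if dist x (x + t *\<^sub>R \<theta>) < t then ennreal (1 / t ^ DIM('a)) else 0)) \<partial>lborel)"
    by (subst nn_integral_density, measurable, subst nn_integral_distr) measurable
  also have "\<dots> = (\<integral>\<^sup>+\<theta>\<in>ball 0 1. F (x + t *\<^sub>R \<theta>) \<partial>lborel)"
  proof (intro nn_integral_cong)
    fix \<theta> :: 'a
    have "ennreal (\<bar>t\<bar>^DIM('a)) * (F (x + t *\<^sub>R \<theta>) * ennreal (1 / t ^ DIM('a))) =
        F (x + t *\<^sub>R \<theta>) * (ennreal (\<bar>t\<bar>^DIM('a)) * ennreal (1 / t ^ DIM('a)))"
      by (simp add: ac_simps)
    also have "\<dots> = F (x + t *\<^sub>R \<theta>)" using t by (subst ennreal_mult[symmetric]) auto
    finally show "ennreal (\<bar>t\<bar>^DIM('a)) * (F (x + t *\<^sub>R \<theta>) *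
      (if dist x (x + t *\<^sub>R \<theta>) < t then ennreal (1 / t ^ DIM('a)) else 0)) =
        F (x + t *\<^sub>R \<theta>) * indicator (ball 0 1) \<theta>"
      using t by (auto simp: dist_norm indicator_def)
  qed
  finally show ?thesis by simp
qed

text \<open>Each \<open>y\<close> is weighted by how often rays from \<open>E\<close> see it. For
  \<open>T = {0<..}\<close> the weight is, up to the factor n - 1, the layer-cake form of the
  integral of |x - y|^(1 - n) over \<open>E\<close> with respect to \<open>N\<close>.\<close>

lemma ray_fubini:
  fixes F :: "'a \<Rightarrow> ennreal"
  assumes F [measurable]: "F \<in> borel_measurable borel" and [measurable]: "E \<in> sets borel" "T \<in> sets borel"
    and T: "T \<subseteq> {0<..}"
  shows "(\<integral>\<^sup>+x\<in>E. (\<integral>\<^sup>+\<theta>\<in>ball 0 1. (\<integral>\<^sup>+t\<in>T. F (x + t *\<^sub>R \<theta>) \<partial>lborel) \<partial>lborel) \<partial>N) =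
    (\<integral>\<^sup>+y. F y * (\<integral>\<^sup>+t\<in>T. ennreal (1 / t ^ DIM('a)) * emeasure N (E \<inter> ball y t) \<partial>lborel) \<partial>lborel)"
proof -
  have [measurable]: "ball (0::'a) 1 \<in> sets borel" by simp
  define k where "k x y t = F y * (if dist x y < t then ennreal (1 / t ^ DIM('a)) else 0) *
    indicator T t * indicator E x" for x y t
  have inner: "(\<integral>\<^sup>+\<theta>\<in>ball 0 1. (\<integral>\<^sup>+t\<in>T. F (x + t *\<^sub>R \<theta>) \<partial>lborel) \<partial>lborel) * indicator E x =
      (\<integral>\<^sup>+y. (\<integral>\<^sup>+t. k x y t \<partial>lborel) \<partial>lborel)" for x
  proof -
    have "(\<integral>\<^sup>+\<theta>\<in>ball 0 1. (\<integral>\<^sup>+t\<in>T. F (x + t *\<^sub>R \<theta>) \<partial>lborel) \<partial>lborel) =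
        (\<integral>\<^sup>+\<theta>. (\<integral>\<^sup>+t. F (x + t *\<^sub>R \<theta>) * indicator T t * indicator (ball 0 1) \<theta> \<partial>lborel) \<partial>lborel)"
      by (intro nn_integral_cong) (simp add: nn_integral_multc)
    also have "\<dots> = (\<integral>\<^sup>+t. (\<integral>\<^sup>+\<theta>. F (x + t *\<^sub>R \<theta>) * indicator T t * indicator (ball 0 1) \<theta> \<partial>lborel) \<partial>lborel)"
      by (rule lborel_pair.Fubini') measurable
    also have "\<dots> = (\<integral>\<^sup>+t. (\<integral>\<^sup>+y. F y * (if dist x y < t then ennreal (1 / t ^ DIM('a)) else 0) * indicator T t \<partial>lborel) \<partial>lborel)"
    proof (rule nn_integral_cong)
      fix t
      show "(\<integral>\<^sup>+\<theta>. F (x + t *\<^sub>R \<theta>) * indicator T t * indicator (ball 0 1) \<theta> \<partial>lborel) =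
        (\<integral>\<^sup>+y. F y * (if dist x y < t then ennreal (1 / t ^ DIM('a)) else 0) * indicator T t \<partial>lborel)"
        using nn_integral_ball_affine[OF F, of t x] T by (cases "t \<in> T") auto
    qed
    also have "\<dots> = (\<integral>\<^sup>+y. (\<integral>\<^sup>+t. F y * (if dist x y < t then ennreal (1 / t ^ DIM('a)) else 0) * indicator T t \<partial>lborel) \<partial>lborel)"
      by (rule lborel_pair.Fubini') measurable
    finally show ?thesis
      by (simp add: k_def nn_integral_multc[symmetric])
  qed
  have "(\<integral>\<^sup>+x. (\<integral>\<^sup>+y. (\<integral>\<^sup>+t. k x y t \<partial>lborel) \<partial>lborel) \<partial>N) =
      (\<integral>\<^sup>+y. (\<integral>\<^sup>+x. (\<integral>\<^sup>+t. k x y t \<partial>lborel) \<partial>N) \<partial>lborel)"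
    unfolding k_def by (rule pair_NL.Fubini'[symmetric]) measurable
  also have "\<dots> = (\<integral>\<^sup>+y. (\<integral>\<^sup>+t. (\<integral>\<^sup>+x. k x y t \<partial>N) \<partial>lborel) \<partial>lborel)"
    unfolding k_def by (intro nn_integral_cong pair_NR.Fubini'[symmetric]) measurable
  also have "\<dots> = (\<integral>\<^sup>+y. F y * (\<integral>\<^sup>+t\<in>T. ennreal (1 / t ^ DIM('a)) * emeasure N (E \<inter> ball y t) \<partial>lborel) \<partial>lborel)"
  proof (intro nn_integral_cong)
    fix y
    have "(\<integral>\<^sup>+x. k x y t \<partial>N) = F y * (ennreal (1 / t ^ DIM('a)) * emeasure N (E \<inter> ball y t) * indicator T t)" for t
    proof -
      have "k x y t = F y * ennreal (1 / t ^ DIM('a)) * indicator T t * indicator (E \<inter> ball y t) x" for x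
        by (auto simp: k_def indicator_def dist_commute)
      then have "(\<integral>\<^sup>+x. k x y t \<partial>N) = (\<integral>\<^sup>+x. F y * ennreal (1 / t ^ DIM('a)) * indicator T t * indicator (E \<inter> ball y t) x \<partial>N)"
        by simp
      also have "\<dots> = F y * ennreal (1 / t ^ DIM('a)) * indicator T t * emeasure N (E \<inter> ball y t)"
        by (rule nn_integral_cmult_indicator) measurable
      finally show ?thesis by (simp add: ac_simps)
    qed
    then have "(\<integral>\<^sup>+t. (\<integral>\<^sup>+x. k x y t \<partial>N) \<partial>lborel) =
        (\<integral>\<^sup>+t. F y * (ennreal (1 / t ^ DIM('a)) * emeasure N (E \<inter> ball y t) * indicator T t) \<partial>lborel)" by simp
    also have "\<dots> = F y * (\<integral>\<^sup>+t\<in>T. ennreal (1 / t ^ DIM('a)) * emeasure N (E \<inter> ball y t) \<partial>lborel)"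
    proof (rule nn_integral_cmult)
      show "(\<lambda>t. ennreal (1 / t ^ DIM('a)) * emeasure N (E \<inter> ball y t) * indicator T t) \<in> borel_measurable lborel"
        by measurable
    qed
    finally show "(\<integral>\<^sup>+t. (\<integral>\<^sup>+x. k x y t \<partial>N) \<partial>lborel) = F y * (\<integral>\<^sup>+t\<in>T. ennreal (1 / t ^ DIM('a)) * emeasure N (E \<inter> ball y t) \<partial>lborel)" .
  qed
  finally show ?thesis by (simp add: inner)
qed

text \<open>For small radii the growth bound is used: \<open>t powr (\<alpha> - n)\<close> is
  integrable at 0 precisely because \<alpha> > n - 1.\<close>

lemma kernel_near:
  assumes R: "R > 0"
  shows "(\<integral>\<^sup>+t\<in>{0<..R}. ennreal (1 / t ^ DIM('a)) * emeasure N (E \<inter> ball y t) \<partial>lborel)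
    \<le> ennreal (C * R powr (\<alpha> - real DIM('a) + 1) / (\<alpha> - real DIM('a) + 1))"
proof -
  have "(\<integral>\<^sup>+t\<in>{0<..R}. ennreal (1 / t ^ DIM('a)) * emeasure N (E \<inter> ball y t) \<partial>lborel)
      \<le> (\<integral>\<^sup>+t. ennreal (C * t powr (\<alpha> - real DIM('a))) * indicator {0..R} t \<partial>lborel)"
  proof (rule nn_integral_mono)
    fix t
    show "ennreal (1 / t ^ DIM('a)) * emeasure N (E \<inter> ball y t) * indicator {0<..R} t
        \<le> ennreal (C * t powr (\<alpha> - real DIM('a))) * indicator {0..R} t"
    proof (cases "t \<in> {0<..R}")
      case True
      have "emeasure N (E \<inter> ball y t) \<le> emeasure N (ball y t)"
        by (intro emeasure_mono) (auto simp: sets_N)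
      then have "ennreal (1 / t ^ DIM('a)) * emeasure N (E \<inter> ball y t) \<le> ennreal (1 / t ^ DIM('a)) * ennreal (C * t powr \<alpha>)"
        using True growth[of t y] by (intro mult_left_mono) (auto intro: order_trans)
      also have "\<dots> = ennreal (C * t powr (\<alpha> - real DIM('a)))"
        using True C by (subst ennreal_mult[symmetric]) (auto simp: powr_diff powr_realpow)
      finally show ?thesis using True by (auto simp: indicator_def)
    qed (auto simp: indicator_def)
  qed
  also have "\<dots> = ennreal (C * (R powr (\<alpha> - real DIM('a) + 1) / (\<alpha> - real DIM('a) + 1)))"
    using \<alpha> R C by (intro nn_integral_has_integral_lebesgue' has_integral_mult_right has_integral_powr_from_0) auto
  finally show ?thesis by simp
qed

text \<open>For large radii the growth bound is wasteful and the total mass of \<open>E\<close> is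
  used instead; \<open>t powr (- n)\<close> is integrable at infinity.\<close>

lemma kernel_far:
  assumes R: "R > 0" and [measurable]: "E \<in> sets borel"
  shows "(\<integral>\<^sup>+t\<in>{R<..}. ennreal (1 / t ^ DIM('a)) * emeasure N (E \<inter> ball y t) \<partial>lborel)
    \<le> ennreal (measure N E * R powr (1 - real DIM('a)) / (real DIM('a) - 1))"
proof -
  have "(\<integral>\<^sup>+t\<in>{R<..}. ennreal (1 / t ^ DIM('a)) * emeasure N (E \<inter> ball y t) \<partial>lborel)
      \<le> (\<integral>\<^sup>+t. ennreal (measure N E * t powr (- real DIM('a))) * indicator {R..} t \<partial>lborel)"
  proof (rule nn_integral_mono)
    fix t
    show "ennreal (1 / t ^ DIM('a)) * emeasure N (E \<inter> ball y t) * indicator {R<..} t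
        \<le> ennreal (measure N E * t powr (- real DIM('a))) * indicator {R..} t"
    proof (cases "t \<in> {R<..}")
      case True
      have "emeasure N (E \<inter> ball y t) \<le> ennreal (measure N E)"
        unfolding emeasure_eq_measure[symmetric] by (intro emeasure_mono) (auto simp: sets_N)
      then have "ennreal (1 / t ^ DIM('a)) * emeasure N (E \<inter> ball y t) \<le> ennreal (1 / t ^ DIM('a)) * ennreal (measure N E)"
        by (intro mult_left_mono) auto
      also have "\<dots> = ennreal (measure N E * t powr (- real DIM('a)))"
        using True R by (subst ennreal_mult[symmetric]) (auto simp: powr_minus powr_realpow divide_inverse mult.commute)
      finally show ?thesis using True by (auto simp: indicator_def)
    qed (auto simp: indicator_def)
  qed
  also have "\<dots> = ennreal (measure N E * (- (R powr (- real DIM('a) + 1)) / (- real DIM('a) + 1)))"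
    using R dim by (intro nn_integral_has_integral_lebesgue' has_integral_mult_right has_integral_powr_to_inf) auto
  also have "- (R powr (- real DIM('a) + 1)) / (- real DIM('a) + 1) = R powr (1 - real DIM('a)) / (real DIM('a) - 1)"
    using dim by (simp add: field_simps)
  finally show ?thesis by simp
qed

lemma kernel_const_pos: "kernel_const (real DIM('a)) C \<alpha> > 0"
proof -
  have "C / (\<alpha> - real DIM('a) + 1) > 0" "1 / (real DIM('a) - 1) > 0"
    using \<alpha> dim C by (auto intro!: divide_pos_pos)
  then show ?thesis unfolding kernel_const_def by (rule add_pos_pos)
qed

text \<open>The two parts of the kernel balance at the radius \<open>N(E) powr (1/\<alpha>)\<close>.\<close>

lemma kernel_bound:
  assumes [measurable]: "E \<in> sets borel" and m: "measure N E > 0"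
  shows "(\<integral>\<^sup>+t\<in>{0<..}. ennreal (1 / t ^ DIM('a)) * emeasure N (E \<inter> ball y t) \<partial>lborel)
    \<le> ennreal (kernel_const (real DIM('a)) C \<alpha> * measure N E powr (1 - (real DIM('a) - 1) / \<alpha>))"
proof -
  define R where "R = measure N E powr (1 / \<alpha>)"
  have R: "R > 0" using m by (simp add: R_def)
  have \<alpha>0: "\<alpha> > 0" using \<alpha> dim by linarith
  have e1: "R powr (\<alpha> - real DIM('a) + 1) = measure N E powr (1 - (real DIM('a) - 1) / \<alpha>)"
    using \<alpha>0 by (simp add: R_def powr_powr field_simps)
  have "measure N E * R powr (1 - real DIM('a)) = measure N E powr 1 * measure N E powr ((1 - real DIM('a)) / \<alpha>)"
    using m by (simp add: R_def powr_powr)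
  also have "\<dots> = measure N E powr (1 - (real DIM('a) - 1) / \<alpha>)"
    using \<alpha>0 by (subst powr_add[symmetric]) (simp add: field_simps)
  finally have e2: "measure N E * R powr (1 - real DIM('a)) = measure N E powr (1 - (real DIM('a) - 1) / \<alpha>)" .
  let ?f = "\<lambda>t. ennreal (1 / t ^ DIM('a)) * emeasure N (E \<inter> ball y t)"
  have "(\<integral>\<^sup>+t\<in>{0<..}. ?f t \<partial>lborel) = (\<integral>\<^sup>+t. ?f t * indicator {0<..R} t + ?f t * indicator {R<..} t \<partial>lborel)"
    using R by (intro nn_integral_cong) (auto simp: indicator_def)
  also have "\<dots> = (\<integral>\<^sup>+t\<in>{0<..R}. ?f t \<partial>lborel) + (\<integral>\<^sup>+t\<in>{R<..}. ?f t \<partial>lborel)"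
    by (rule nn_integral_add) measurable
  also have "\<dots> \<le> ennreal (C * R powr (\<alpha> - real DIM('a) + 1) / (\<alpha> - real DIM('a) + 1)) + ennreal (measure N E * R powr (1 - real DIM('a)) / (real DIM('a) - 1))"
    by (intro add_mono kernel_near kernel_far R assms)
  also have "\<dots> = ennreal (kernel_const (real DIM('a)) C \<alpha> * measure N E powr (1 - (real DIM('a) - 1) / \<alpha>))"
    unfolding e1 e2 using \<alpha> dim C by (subst ennreal_plus[symmetric]) (auto simp: kernel_const_def field_simps)
  finally show ?thesis .
qed

lemma measure_unit_ball_pos: "measure lborel (ball (0::'a) 1) > 0"
  by (simp add: content_ball)

lemma ray_const_pos: "ray_const (real DIM('a)) C \<alpha> > 0"
  using kernel_const_pos by (simp add: ray_const_def)

text \<open>If every ray from \<open>E\<close> collects at least \<open>c\<close> from the density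
  \<open>F\<close>, then summing over starting points and directions gives \<open>c\<close> times
  the volume of the unit ball times \<open>N(E)\<close>. By \<open>ray_fubini\<close> and
  \<open>kernel_bound\<close> this is at most \<open>J\<close> times a smaller power of
  \<open>N(E)\<close>, which is then cancelled. The direction 0 is a null set.\<close>

lemma ray_bound:
  fixes F :: "'a \<Rightarrow> ennreal"
  assumes F: "F \<in> borel_measurable borel" and E [measurable]: "E \<in> sets borel" and c: "c \<ge> 0"
    and rays: "\<And>x \<theta>. x \<in> E \<Longrightarrow> 0 < norm \<theta> \<Longrightarrow> norm \<theta> < 1 \<Longrightarrow> ennreal c \<le> (\<integral>\<^sup>+t\<in>{0<..}. F (x + t *\<^sub>R \<theta>) \<partial>lborel)"
    and J: "(\<integral>\<^sup>+y. F y \<partial>lborel) \<le> ennreal J" "J \<ge> 0"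
  shows "c * measure N E powr ((real DIM('a) - 1) / \<alpha>) \<le> ray_const (real DIM('a)) C \<alpha> * J"
proof (cases "measure N E > 0")
  case False
  then have "measure N E = 0" using measure_nonneg[of N E] by linarith
  then show ?thesis using J ray_const_pos by simp
next
  case True
  define v where "v = measure lborel (ball (0::'a) 1)"
  define m where "m = measure N E"
  have "ennreal (c * v * m) = (\<integral>\<^sup>+x\<in>E. (\<integral>\<^sup>+\<theta>\<in>ball (0::'a) 1. ennreal c \<partial>lborel) \<partial>N)"
  proof -
    have "(\<integral>\<^sup>+\<theta>\<in>ball (0::'a) 1. ennreal c \<partial>lborel) = ennreal c * emeasure lborel (ball (0::'a) 1)"
      by (rule nn_integral_cmult_indicator) simp
    also have "emeasure lborel (ball (0::'a) 1) = ennreal v"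
      unfolding v_def by (rule emeasure_eq_ennreal_measure) (use emeasure_bounded_finite[of "ball (0::'a) 1"] in auto)
    finally show ?thesis
      using c by (simp add: nn_integral_cmult_indicator sets_N emeasure_eq_measure m_def v_def ennreal_mult)
  qed
  also have "\<dots> \<le> (\<integral>\<^sup>+x\<in>E. (\<integral>\<^sup>+\<theta>\<in>ball 0 1. (\<integral>\<^sup>+t\<in>{0<..}. F (x + t *\<^sub>R \<theta>) \<partial>lborel) \<partial>lborel) \<partial>N)"
  proof (intro nn_integral_mono)
    fix x
    show "(\<integral>\<^sup>+\<theta>\<in>ball (0::'a) 1. ennreal c \<partial>lborel) * indicator E x \<le>
      (\<integral>\<^sup>+\<theta>\<in>ball 0 1. (\<integral>\<^sup>+t\<in>{0<..}. F (x + t *\<^sub>R \<theta>) \<partial>lborel) \<partial>lborel) * indicator E x"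
    proof (cases "x \<in> E")
      case True
      have "(\<integral>\<^sup>+\<theta>\<in>ball (0::'a) 1. ennreal c \<partial>lborel) \<le> (\<integral>\<^sup>+\<theta>\<in>ball 0 1. (\<integral>\<^sup>+t\<in>{0<..}. F (x + t *\<^sub>R \<theta>) \<partial>lborel) \<partial>lborel)"
      proof (rule nn_integral_mono_AE)
        have "AE \<theta> in lborel. \<theta> \<noteq> (0::'a)"
          by (rule AE_lborel_singleton)
        then show "AE \<theta> in lborel. ennreal c * indicator (ball (0::'a) 1) \<theta> \<le>
            (\<integral>\<^sup>+t\<in>{0<..}. F (x + t *\<^sub>R \<theta>) \<partial>lborel) * indicator (ball 0 1) \<theta>"
          by eventually_elim (use rays[OF True] in \<open>auto simp: indicator_def\<close>)
      qed
      then show ?thesis using True by simp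
    qed simp
  qed
  also have "\<dots> = (\<integral>\<^sup>+y. F y * (\<integral>\<^sup>+t\<in>{0<..}. ennreal (1 / t ^ DIM('a)) * emeasure N (E \<inter> ball y t) \<partial>lborel) \<partial>lborel)"
    by (rule ray_fubini[OF F E]) auto
  also have "\<dots> \<le> (\<integral>\<^sup>+y. F y * ennreal (kernel_const (real DIM('a)) C \<alpha> * m powr (1 - (real DIM('a) - 1) / \<alpha>)) \<partial>lborel)"
    unfolding m_def by (intro nn_integral_mono mult_left_mono kernel_bound[OF E True]) auto
  also have "\<dots> = (\<integral>\<^sup>+y. F y \<partial>lborel) * ennreal (kernel_const (real DIM('a)) C \<alpha> * m powr (1 - (real DIM('a) - 1) / \<alpha>))"
    using F by (intro nn_integral_multc) auto
  also have "\<dots> \<le> ennreal J * ennreal (kernel_const (real DIM('a)) C \<alpha> * m powr (1 - (real DIM('a) - 1) / \<alpha>))"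
    by (intro mult_right_mono J) auto
  also have "\<dots> = ennreal (J * (kernel_const (real DIM('a)) C \<alpha> * m powr (1 - (real DIM('a) - 1) / \<alpha>)))"
    using J kernel_const_pos by (intro ennreal_mult[symmetric]) auto
  finally have le: "c * v * m \<le> J * (kernel_const (real DIM('a)) C \<alpha> * m powr (1 - (real DIM('a) - 1) / \<alpha>))"
    using J kernel_const_pos by (subst (asm) ennreal_le_iff) auto
  have uv: "unit_ball_vol (real DIM('a)) = v" by (simp add: v_def content_ball)
  have m: "m > 0" using True by (simp add: m_def)
  have v: "v > 0" using measure_unit_ball_pos by (simp add: v_def)
  \<comment> \<open>Split off the power of the mass that occurs on the right-hand side, so that it
    can be cancelled.\<close>
  have "m = m powr ((real DIM('a) - 1) / \<alpha>) * m powr (1 - (real DIM('a) - 1) / \<alpha>)"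
    using m by (subst powr_add[symmetric]) simp
  with le have "(c * v * m powr ((real DIM('a) - 1) / \<alpha>)) * m powr (1 - (real DIM('a) - 1) / \<alpha>) \<le> (J * kernel_const (real DIM('a)) C \<alpha>) * m powr (1 - (real DIM('a) - 1) / \<alpha>)"
    by (simp add: mult.assoc)
  then have "c * v * m powr ((real DIM('a) - 1) / \<alpha>) \<le> J * kernel_const (real DIM('a)) C \<alpha>"
    using m by (subst (asm) mult_le_cancel_right_pos) auto
  then show ?thesis using v
    by (simp add: ray_const_def uv v_def[symmetric] m_def[symmetric] field_simps)
qed

end

subsection \<open>Hausdorff measure\<close>

definition hausdorff_cover :: "real \<Rightarrow> 'a::euclidean_space set \<Rightarrow> (nat \<Rightarrow> 'a set) \<Rightarrow> bool" where
  "hausdorff_cover \<delta> A C \<longleftrightarrow> A \<subseteq> (\<Union>i. C i) \<and> (\<forall>i. bounded (C i) \<and> diameter (C i) \<le> \<delta>)"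

definition cover_sum :: "real \<Rightarrow> (nat \<Rightarrow> 'a::euclidean_space set) \<Rightarrow> ennreal" where
  "cover_sum s C = (\<Sum>i. ennreal (hausdorff_const s * diameter (C i) powr s))"

lemma hausdorff_delta_alt: "hausdorff_delta s \<delta> A = (INF C \<in> {C. hausdorff_cover \<delta> A C}. cover_sum s C)"
  by (simp add: hausdorff_delta_def hausdorff_cover_def cover_sum_def)

lemma hausdorff_delta_le: "hausdorff_cover \<delta> A C \<Longrightarrow> hausdorff_delta s \<delta> A \<le> cover_sum s C"
  unfolding hausdorff_delta_alt by (rule INF_lower) simp

lemma hausdorff_delta_mono: "A \<subseteq> B \<Longrightarrow> hausdorff_delta s \<delta> A \<le> hausdorff_delta s \<delta> B"
  unfolding hausdorff_delta_alt by (rule INF_superset_mono) (unfold hausdorff_cover_def, blast, simp)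

lemma hausdorff_delta_antimono: "\<delta> \<le> \<delta>' \<Longrightarrow> hausdorff_delta s \<delta>' A \<le> hausdorff_delta s \<delta> A"
  unfolding hausdorff_delta_alt by (rule INF_superset_mono) (unfold hausdorff_cover_def, blast intro: order_trans, simp)

lemma hausdorff_delta_le_outer: "\<delta> > 0 \<Longrightarrow> hausdorff_delta s \<delta> A \<le> hausdorff_outer s A"
  unfolding hausdorff_outer_def by (rule SUP_upper) simp

lemma hausdorff_outer_mono: "A \<subseteq> B \<Longrightarrow> hausdorff_outer s A \<le> hausdorff_outer s B"
  unfolding hausdorff_outer_def by (intro SUP_mono) (use hausdorff_delta_mono in blast)

lemma hausdorff_delta_empty: "\<delta> > 0 \<Longrightarrow> hausdorff_delta s \<delta> {} = 0"
  using hausdorff_delta_le[of \<delta> "{}" "\<lambda>_. {}" s] by (simp add: hausdorff_cover_def cover_sum_def)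

lemma hausdorff_outer_empty: "hausdorff_outer s {} = 0"
  unfolding hausdorff_outer_def by (simp add: hausdorff_delta_empty)

lemma hausdorff_delta_UN_le:
  "hausdorff_delta s \<delta> (\<Union>i. A i) \<le> (\<Sum>i. hausdorff_delta s \<delta> (A (i::nat)))"
proof (rule ennreal_le_epsilon)
  fix e :: real assume fin: "(\<Sum>i. hausdorff_delta s \<delta> (A i)) < top" and e: "e > 0"
  have "\<exists>C. hausdorff_cover \<delta> (A i) C \<and> cover_sum s C \<le> hausdorff_delta s \<delta> (A i) + ennreal (e * (1/2) ^ Suc i)" for i
  proof -
    have "hausdorff_delta s \<delta> (A i) < top"
      using fin by (metis ennreal_suminf_lessD)
    then have "hausdorff_delta s \<delta> (A i) < hausdorff_delta s \<delta> (A i) + ennreal (e * (1/2) ^ Suc i)"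
      using e by (simp add: ennreal_zero_less_divide less_top[symmetric] ennreal_add_left_cancel_less[of _ 0, simplified])
    then obtain C where "hausdorff_cover \<delta> (A i) C" "cover_sum s C < hausdorff_delta s \<delta> (A i) + ennreal (e * (1/2) ^ Suc i)"
      unfolding hausdorff_delta_alt INF_less_iff by auto
    then show ?thesis using less_imp_le by blast
  qed
  then obtain C where C: "\<And>i. hausdorff_cover \<delta> (A i) (C i)"
    and Cs: "\<And>i. cover_sum s (C i) \<le> hausdorff_delta s \<delta> (A i) + ennreal (e * (1/2) ^ Suc i)"
    by metis
  define D where "D = (\<lambda>k. case prod_decode k of (i, j) \<Rightarrow> C i j)"
  have "hausdorff_cover \<delta> (\<Union>i. A i) D"
    unfolding hausdorff_cover_def
  proof (intro conjI allI)
    show "(\<Union>i. A i) \<subseteq> (\<Union>k. D k)"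
    proof
      fix x assume "x \<in> (\<Union>i. A i)"
      then obtain i where "x \<in> A i" by auto
      then obtain j where "x \<in> C i j" using C[of i] by (auto simp: hausdorff_cover_def)
      then have "x \<in> D (prod_encode (i, j))" by (simp add: D_def)
      then show "x \<in> (\<Union>k. D k)" by blast
    qed
    show "bounded (D k)" "diameter (D k) \<le> \<delta>" for k
      using C by (auto simp: D_def hausdorff_cover_def split: prod.split)
  qed
  then have "hausdorff_delta s \<delta> (\<Union>i. A i) \<le> cover_sum s D" by (rule hausdorff_delta_le)
  also have "\<dots> = (\<Sum>i. cover_sum s (C i))"
    unfolding cover_sum_def
    by (subst suminf_ennreal_2dimen[of "\<lambda>i. \<Sum>j. ennreal (hausdorff_const s * diameter (C i j) powr s)"
          "\<lambda>(i, j). ennreal (hausdorff_const s * diameter (C i j) powr s)", symmetric])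
       (auto simp: D_def comp_def split: prod.split intro!: suminf_cong)
  also have "\<dots> \<le> (\<Sum>i. hausdorff_delta s \<delta> (A i) + ennreal (e * (1/2) ^ Suc i))"
    by (intro suminf_le Cs) auto
  also have "\<dots> = (\<Sum>i. hausdorff_delta s \<delta> (A i)) + (\<Sum>i. ennreal (e * (1/2) ^ Suc i))"
    by (rule suminf_add[symmetric]) auto
  also have "(\<Sum>i. ennreal (e * (1/2) ^ Suc i)) = ennreal e"
    using e sums_mult[OF power_half_series, of e]
    by (intro suminf_ennreal_eq) auto
  finally show "hausdorff_delta s \<delta> (\<Union>i. A i) \<le> (\<Sum>i. hausdorff_delta s \<delta> (A i)) + ennreal e" .
qed

lemma hausdorff_outer_UN_le:
  "hausdorff_outer s (\<Union>i. A i) \<le> (\<Sum>i. hausdorff_outer s (A (i::nat)))"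
proof -
  have "hausdorff_delta s \<delta> (\<Union>i. A i) \<le> (\<Sum>i. hausdorff_outer s (A i))" if "\<delta> > 0" for \<delta>
    using that by (intro order_trans[OF hausdorff_delta_UN_le] suminf_le hausdorff_delta_le_outer) auto
  then show ?thesis unfolding hausdorff_outer_def[of s "\<Union>i. A i"] by (intro SUP_least) auto
qed

text \<open>Once the mesh is below the separation \<rho>, no member of a cover meets both sets, so
  every cover of the union splits into a cover of \<open>A\<close> and one of
  \<open>B\<close>.\<close>

lemma hausdorff_outer_separated:
  assumes \<rho>: "\<rho> > 0" and sep: "\<And>a b. a \<in> A \<Longrightarrow> b \<in> B \<Longrightarrow> \<rho> \<le> dist a b"
  shows "hausdorff_outer s A + hausdorff_outer s B \<le> hausdorff_outer s (A \<union> B)"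
proof -
  have small: "hausdorff_delta s \<delta> A + hausdorff_delta s \<delta> B \<le> hausdorff_outer s (A \<union> B)"
    if \<delta>: "0 < \<delta>" "\<delta> < \<rho>" for \<delta>
  proof -
    have "hausdorff_delta s \<delta> A + hausdorff_delta s \<delta> B \<le> cover_sum s C" if C: "hausdorff_cover \<delta> (A \<union> B) C" for C
    proof -
      \<comment> \<open>Members are emptied rather than dropped, to keep the indexing by naturals.
        They cost nothing, as \<open>diameter {} = 0\<close> and \<open>0 powr s = 0\<close>, also
        for \<open>s = 0\<close>.\<close>
      define CA where "CA i = (if C i \<inter> A = {} then {} else C i)" for i
      define CB where "CB i = (if C i \<inter> B = {} then {} else C i)" for i
      have disj: "C i \<inter> A = {} \<or> C i \<inter> B = {}" for i
      proof (rule ccontr)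
        assume "\<not> ?thesis"
        then obtain a b where ab: "a \<in> C i" "a \<in> A" "b \<in> C i" "b \<in> B" by blast
        have "dist a b \<le> diameter (C i)" using C ab by (auto simp: hausdorff_cover_def intro: diameter_bounded_bound)
        also have "\<dots> \<le> \<delta>" using C by (auto simp: hausdorff_cover_def)
        finally show False using sep[of a b] ab \<delta> by linarith
      qed
      have "hausdorff_cover \<delta> A CA" "hausdorff_cover \<delta> B CB"
        using C \<delta> unfolding hausdorff_cover_def CA_def CB_def by (auto simp: subset_eq) (metis IntI empty_iff UnI1 UnI2 UN_iff)+
      then have "hausdorff_delta s \<delta> A + hausdorff_delta s \<delta> B \<le> cover_sum s CA + cover_sum s CB"
        by (intro add_mono hausdorff_delta_le)
      also have "\<dots> = (\<Sum>i. ennreal (hausdorff_const s * diameter (CA i) powr s) + ennreal (hausdorff_const s * diameter (CB i) powr s))"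
        unfolding cover_sum_def by (rule suminf_add) auto
      also have "\<dots> \<le> cover_sum s C"
        unfolding cover_sum_def
      proof (intro suminf_le)
        fix i
        show "ennreal (hausdorff_const s * diameter (CA i) powr s) + ennreal (hausdorff_const s * diameter (CB i) powr s)
          \<le> ennreal (hausdorff_const s * diameter (C i) powr s)"
          using disj[of i] by (auto simp: CA_def CB_def)
      qed auto
      finally show ?thesis .
    qed
    then have "hausdorff_delta s \<delta> A + hausdorff_delta s \<delta> B \<le> hausdorff_delta s \<delta> (A \<union> B)"
      unfolding hausdorff_delta_alt[of s \<delta> "A \<union> B"] by (intro INF_greatest) auto
    also have "\<dots> \<le> hausdorff_outer s (A \<union> B)" using \<delta> by (intro hausdorff_delta_le_outer)
    finally show ?thesis .
  qed
  have "hausdorff_outer s A + hausdorff_outer s B = (SUP \<delta>\<in>{0<..}. hausdorff_delta s \<delta> A + hausdorff_delta s \<delta> B)"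
    unfolding hausdorff_outer_def
  proof (rule SUP_add_directed_ennreal[symmetric])
    fix i j :: real assume "i \<in> {0<..}" "j \<in> {0<..}"
    then show "\<exists>k\<in>{0<..}. hausdorff_delta s i A + hausdorff_delta s j B \<le> hausdorff_delta s k A + hausdorff_delta s k B"
      by (intro bexI[of _ "min i j"] add_mono hausdorff_delta_antimono) auto
  qed
  also have "\<dots> \<le> hausdorff_outer s (A \<union> B)"
  proof (intro SUP_least)
    fix \<delta> :: real assume "\<delta> \<in> {0<..}"
    then have "hausdorff_delta s \<delta> A + hausdorff_delta s \<delta> B \<le>
        hausdorff_delta s (min \<delta> (\<rho> / 2)) A + hausdorff_delta s (min \<delta> (\<rho> / 2)) B"
      by (intro add_mono hausdorff_delta_antimono) auto
    also have "\<dots> \<le> hausdorff_outer s (A \<union> B)"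
      using \<rho> \<open>\<delta> \<in> {0<..}\<close> by (intro small) auto
    finally show "hausdorff_delta s \<delta> A + hausdorff_delta s \<delta> B \<le> hausdorff_outer s (A \<union> B)" .
  qed
  finally show ?thesis .
qed

lemma outer_measure_space_hausdorff: "outer_measure_space UNIV (hausdorff_outer s)"
  unfolding outer_measure_space_def positive_def increasing_def countably_subadditive_def
  using hausdorff_outer_empty hausdorff_outer_mono hausdorff_outer_UN_le by blast

lemma hausdorff_outer_Un_le: "hausdorff_outer s (A \<union> B) \<le> hausdorff_outer s A + hausdorff_outer s B"
proof -
  have "hausdorff_outer s (\<Union>i. binaryset A B i) \<le> (\<Sum>i. hausdorff_outer s (binaryset A B i))"
    by (rule hausdorff_outer_UN_le)
  also have "(\<Sum>i. hausdorff_outer s (binaryset A B i)) = hausdorff_outer s A + hausdorff_outer s B"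
    by (intro suminf_binaryset_eq hausdorff_outer_empty)
  finally show ?thesis by (simp add: UN_binaryset_eq)
qed

text \<open>Caratheodory's criterion: shells around \<open>F\<close> at distance roughly \<open>1/j\<close> have finite total
  measure, since every other two of them are a positive distance apart.\<close>

lemma hausdorff_outer_caratheodory:
  fixes F X :: "'a::euclidean_space set"
  assumes F: "closed F"
  shows "hausdorff_outer s (F \<inter> X) + hausdorff_outer s (X - F) \<le> hausdorff_outer s X"
proof (cases "F = {} \<or> hausdorff_outer s X = top")
  case True
  then show ?thesis by (auto simp: hausdorff_outer_empty)
next
  case False
  define H :: "'a set \<Rightarrow> ennreal" where "H = hausdorff_outer s"
  have fin: "H X < top" and ne: "F \<noteq> {}" using False by (auto simp: less_top H_def)
  define Y where "Y k = {x \<in> X. 1 / real (Suc k) \<le> infdist x F}" for k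
  define S where "S k = Y (Suc k) - Y k" for k
  have YX: "Y k \<subseteq> X" and SX: "S k \<subseteq> X" for k by (auto simp: Y_def S_def)
  have Y_mono: "Y i \<subseteq> Y j" if "i \<le> j" for i j
  proof -
    have "1 / real (Suc j) \<le> 1 / real (Suc i)" using that by (intro frac_le) auto
    then show ?thesis unfolding Y_def by (blast intro: order_trans)
  qed
  have union: "X - F = Y k \<union> (\<Union>j. S (j + k))" for k
  proof (intro equalityI subsetI)
    fix x assume x: "x \<in> X - F"
    then have "infdist x F > 0"
      using in_closed_iff_infdist_zero[OF F ne, of x] infdist_nonneg[of x F] by auto
    then obtain m where "1 / real (Suc m) < infdist x F" using nat_approx_posE by blast
    then have m: "x \<in> Y m" using x by (simp add: Y_def)
    show "x \<in> Y k \<union> (\<Union>j. S (j + k))"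
    proof (cases "x \<in> Y k")
      case nk: False
      define i where "i = (LEAST i. x \<in> Y i)"
      have i: "x \<in> Y i" unfolding i_def using m by (rule LeastI)
      then have "i > k" using nk Y_mono[of i k] by (meson not_le subsetD)
      then obtain j where j: "i = Suc (j + k)" by (metis add.commute less_imp_Suc_add add_Suc_right)
      have "x \<notin> Y (j + k)" using not_less_Least[of "j + k" "\<lambda>i. x \<in> Y i"] j by (simp add: i_def)
      then show ?thesis using i j by (auto simp: S_def)
    qed simp
  next
    fix x assume "x \<in> Y k \<union> (\<Union>j. S (j + k))"
    then obtain m where "x \<in> Y m" by (auto simp: S_def)
    then show "x \<in> X - F" using ne by (auto simp: Y_def)
  qed
  have sep: "H (F \<inter> X) + H (Y k) \<le> H X" for k
  proof -
    have "H (F \<inter> X) + H (Y k) \<le> H (F \<inter> X \<union> Y k)"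
      unfolding H_def
    proof (rule hausdorff_outer_separated)
      fix a b assume "a \<in> F \<inter> X" "b \<in> Y k"
      then show "1 / real (Suc k) \<le> dist a b"
        using infdist_le[of a F b] by (auto simp: Y_def dist_commute)
    qed simp
    also have "\<dots> \<le> H X" unfolding H_def using YX by (intro hausdorff_outer_mono) auto
    finally show ?thesis .
  qed
  have alt: "(\<Sum>j<m. H (S (2 * j + p))) \<le> H (\<Union>j<m. S (2 * j + p))" for m p
  proof (induction m)
    case (Suc m)
    have "(\<Sum>j<Suc m. H (S (2 * j + p))) \<le> H (\<Union>j<m. S (2 * j + p)) + H (S (2 * m + p))"
      using Suc by (simp add: add_right_mono)
    also have "\<dots> \<le> H ((\<Union>j<m. S (2 * j + p)) \<union> S (2 * m + p))"
    \<comment> \<open>The separation constant used for \<open>m > 0\<close> may involve a division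
      by zero when \<open>m = 0\<close>, but then the union is empty.\<close>
    proof (cases "m = 0")
      case True
      then show ?thesis by (simp add: H_def hausdorff_outer_empty)
    next
      case False
      show ?thesis unfolding H_def
      proof (rule hausdorff_outer_separated)
      show "1 / real (2 * m + p) - 1 / real (Suc (2 * m + p)) > 0" using False by (simp add: frac_less2)
    next
      fix a b assume a: "a \<in> (\<Union>j<m. S (2 * j + p))" and b: "b \<in> S (2 * m + p)"
      then obtain j where j: "j < m" "a \<in> Y (Suc (2 * j + p))" by (auto simp: S_def)
      then have "a \<in> Y (2 * m + p - 1)"
      proof -
        have "Suc (2 * j + p) \<le> 2 * m + p - 1" using j(1) by linarith
        then show ?thesis using Y_mono j(2) by blast
      qed
      then have "1 / real (2 * m + p) \<le> infdist a F" using j by (simp add: Y_def)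
      moreover have "infdist b F < 1 / real (Suc (2 * m + p))" using b by (auto simp: S_def Y_def)
      moreover have "infdist a F \<le> infdist b F + dist a b" by (rule infdist_triangle)
      ultimately show "1 / real (2 * m + p) - 1 / real (Suc (2 * m + p)) \<le> dist a b" by linarith
      qed
    qed
    finally show ?case by (simp add: lessThan_Suc Un_commute)
  qed simp
  have alt': "(\<Sum>j<m. H (S (2 * j + p))) \<le> H X" for m p
    by (rule order_trans[OF alt]) (use SX in \<open>auto simp: H_def intro!: hausdorff_outer_mono\<close>)
  have "(\<Sum>j<2 * m. H (S j)) = (\<Sum>j<m. H (S (2 * j + 0))) + (\<Sum>j<m. H (S (2 * j + 1)))" for m
    by (induction m) (auto simp: ac_simps)
  then have part: "(\<Sum>j<2 * m. H (S j)) \<le> H X + H X" for m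
    using add_mono[OF alt'[of 0 m] alt'[of 1 m]] by simp
  have "(\<Sum>j. H (S j)) \<le> H X + H X"
  proof (rule suminf_le_const)
    fix m
    have "(\<Sum>j<m. H (S j)) \<le> (\<Sum>j<2 * m. H (S j))" by (rule sum_mono2) auto
    then show "(\<Sum>j<m. H (S j)) \<le> H X + H X" using part[of m] by (rule order_trans)
  qed simp
  then have fin_sum: "(\<Sum>j. H (S j)) < top"
    using fin by (metis ennreal_add_eq_top leD less_top order_le_less_trans)
  define a where "a j = enn2real (H (S j))" for j
  have a: "H (S j) = ennreal (a j)" "a j \<ge> 0" for j
  proof -
    have "H (S j) < top" using fin_sum by (metis ennreal_suminf_lessD)
    then show "H (S j) = ennreal (a j)" by (simp add: a_def less_top)
  qed (simp add: a_def)
  have summ: "summable a"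
    using fin_sum a by (intro summable_suminf_not_top) (auto simp: less_top[symmetric])
  \<comment> \<open>Outside \<open>F\<close> only the shells beyond \<open>Y k\<close> are not at
    positive distance from \<open>F\<close>. Their total measure is the tail of a convergent
    series.\<close>
  have tail: "H (F \<inter> X) + H (X - F) \<le> H X + ennreal (\<Sum>j. a (j + k))" for k
  proof -
    have "H (X - F) \<le> H (Y k) + H (\<Union>j. S (j + k))"
      unfolding H_def union[of k] by (rule hausdorff_outer_Un_le)
    also have "H (\<Union>j. S (j + k)) \<le> (\<Sum>j. H (S (j + k)))"
      unfolding H_def by (rule hausdorff_outer_UN_le)
    also have "\<dots> = ennreal (\<Sum>j. a (j + k))"
      unfolding a(1) using summ a(2) by (intro suminf_ennreal2) (auto simp: summable_iff_shift)
    finally have "H (F \<inter> X) + H (X - F) \<le> (H (F \<inter> X) + H (Y k)) + ennreal (\<Sum>j. a (j + k))"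
      by (simp add: add_left_mono add.assoc)
    also have "\<dots> \<le> H X + ennreal (\<Sum>j. a (j + k))" by (intro add_right_mono sep)
    finally show ?thesis .
  qed
  have "H (F \<inter> X) + H (X - F) \<le> H X"
  proof (rule ennreal_le_epsilon)
    fix e :: real assume e: "e > 0"
    obtain k where "norm (\<Sum>j. a (j + k)) < e" using suminf_exist_split[OF e summ] by blast
    then have "ennreal (\<Sum>j. a (j + k)) \<le> ennreal e" by (intro ennreal_leI) auto
    then show "H (F \<inter> X) + H (X - F) \<le> H X + ennreal e"
      using tail[of k] by (meson add_left_mono order_trans)
  qed
  then show ?thesis by (simp add: H_def)
qed

text \<open>Caratheodory-measurable sets form a sigma-algebra on which the outer measure is
  countably additive; it contains the closed sets by \<open>hausdorff_outer_caratheodory\<close>,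
  hence all Borel sets.\<close>

lemma measure_space_hausdorff:
  "measure_space UNIV (sets borel) (hausdorff_outer s :: 'a::euclidean_space set \<Rightarrow> ennreal)"
proof -
  interpret P: sigma_algebra "UNIV :: 'a set" UNIV by (metis Pow_UNIV sigma_algebra_Pow)
  define L where "L = lambda_system (UNIV :: 'a set) UNIV (hausdorff_outer s)"
  have ms: "measure_space UNIV L (hausdorff_outer s)"
    unfolding L_def by (rule P.caratheodory_lemma[OF outer_measure_space_hausdorff])
  have "F \<in> L" if "closed F" for F
  proof -
    have "hausdorff_outer s (F \<inter> X) + hausdorff_outer s ((UNIV - F) \<inter> X) = hausdorff_outer s X" for X
    proof (rule antisym)
      have *: "(UNIV - F) \<inter> X = X - F" by auto
      show "hausdorff_outer s (F \<inter> X) + hausdorff_outer s ((UNIV - F) \<inter> X) \<le> hausdorff_outer s X"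
        unfolding * using that by (rule hausdorff_outer_caratheodory)
      have "(F \<inter> X) \<union> (X - F) = X" by auto
      moreover have "hausdorff_outer s ((F \<inter> X) \<union> (X - F)) \<le> hausdorff_outer s (F \<inter> X) + hausdorff_outer s (X - F)"
        by (rule hausdorff_outer_Un_le)
      ultimately show "hausdorff_outer s X \<le> hausdorff_outer s (F \<inter> X) + hausdorff_outer s ((UNIV - F) \<inter> X)"
        unfolding * by simp
    qed
    then show ?thesis by (simp add: L_def lambda_system_def)
  qed
  then have "sigma_sets UNIV (Collect closed) \<subseteq> L"
    using ms by (intro sigma_algebra.sigma_sets_subset) (auto simp: measure_space_def)
  then have sub: "sets borel \<subseteq> L" by (simp add: borel_eq_closed)
  have "sigma_algebra (UNIV :: 'a set) (sets borel)" by (metis sets.sigma_algebra_axioms space_borel)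
  from measure_down[OF ms this sub] show ?thesis .
qed

text \<open>\<open>measure_of\<close> yields the intended values only if the set function is
  countably additive on the generated sigma-algebra, and 0 otherwise. So the values of
  \<open>hausdorff_on\<close> depend on \<open>measure_space_hausdorff\<close>.\<close>

lemma
  fixes S :: "'a::euclidean_space set"
  assumes S: "S \<in> sets borel"
  shows space_hausdorff_on: "space (hausdorff_on s S) = S"
    and sets_hausdorff_on: "sets (hausdorff_on s S) = sets (restrict_space borel S)"
    and emeasure_hausdorff_on: "\<And>X. X \<in> sets borel \<Longrightarrow> X \<subseteq> S \<Longrightarrow> emeasure (hausdorff_on s S) X = hausdorff_outer s X"
proof -
  define A where "A = {B \<inter> S | B. B \<in> sets (borel :: 'a measure)}"
  have A: "A = sets (restrict_space borel S)" by (auto simp: A_def sets_restrict_space)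
  have A_alg: "sigma_algebra S A"
    unfolding A using sets.sigma_algebra_axioms[of "restrict_space borel S"] by (simp add: space_restrict_space)
  have AP: "A \<subseteq> Pow S" by (auto simp: A_def)
  show "space (hausdorff_on s S) = S" by (simp add: hausdorff_on_def space_measure_of_conv)
  have sets: "sets (hausdorff_on s S) = A"
    using AP sigma_algebra.sigma_sets_eq[OF A_alg] by (simp add: hausdorff_on_def A_def[symmetric])
  then show "sets (hausdorff_on s S) = sets (restrict_space borel S)" by (simp add: A)
  fix X assume X: "X \<in> sets borel" "X \<subseteq> S"
  then have XA: "X \<in> A" by (auto simp: A_def)
  have AB: "A \<subseteq> sets borel" using S by (auto simp: A_def)
  show "emeasure (hausdorff_on s S) X = hausdorff_outer s X"
  proof (rule emeasure_measure_of[OF hausdorff_on_def])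
    show "{B \<inter> S |B. B \<in> sets borel} \<subseteq> Pow S" by auto
    show "X \<in> sets (hausdorff_on s S)" using XA sets by simp
    show "positive (sets (hausdorff_on s S)) (hausdorff_outer s)"
      by (simp add: positive_def hausdorff_outer_empty)
    have "countably_additive (sets borel) (hausdorff_outer s :: 'a set \<Rightarrow> ennreal)"
      using measure_space_hausdorff by (auto simp: measure_space_def)
    then show "countably_additive (sets (hausdorff_on s S)) (hausdorff_outer s)"
      unfolding sets using AB by (auto simp: countably_additive_def)
  qed
qed

section \<open>Finite covers of compact sets by balls\<close>

lemma powr_add_le:
  fixes x y s :: real assumes "x \<ge> 0" "y \<ge> 0" "s \<ge> 0"
  shows "(x + y) powr s \<le> 2 powr s * (x powr s + y powr s)"
proof -
  have "(x + y) powr s \<le> (2 * max x y) powr s" using assms by (intro powr_mono2) auto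
  also have "\<dots> = 2 powr s * max x y powr s" using assms by (simp add: powr_mult)
  also have "\<dots> \<le> 2 powr s * (x powr s + y powr s)"
    using assms by (intro mult_left_mono) (auto simp: max_def)
  finally show ?thesis .
qed

lemma hausdorff_const_pos: "s \<ge> 0 \<Longrightarrow> hausdorff_const s > 0"
  by (simp add: hausdorff_const_def Gamma_real_pos)

text \<open>Each covering set that meets \<open>P\<close> is enlarged to an open ball centred in
  \<open>P\<close>. As the centre is an arbitrary point of the set, the radius must be its whole
  diameter plus a positive summand; \<open>powr_add_le\<close> separates the two at the cost of
  \<open>2 powr s\<close>. Compactness leaves finitely many balls.\<close>

lemma compact_hausdorff_cover:
  fixes P :: "'a::euclidean_space set"
  assumes P: "compact P" and s: "s > 0" and h: "hausdorff_outer s P \<le> ennreal h" "h \<ge> 0"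
    and \<delta>: "\<delta> > 0" and \<eta>: "\<eta> > 0"
  shows "\<exists>(I :: nat set) z r. finite I \<and> (\<forall>i\<in>I. z i \<in> P \<and> 0 < r i \<and> r i \<le> \<delta>) \<and> P \<subseteq> (\<Union>i\<in>I. ball (z i) (r i)) \<and>
     (\<Sum>i\<in>I. r i powr s) \<le> 2 powr s / hausdorff_const s * (h + \<eta>)"
proof -
  define K where "K = hausdorff_const s"
  have K: "K > 0" using s hausdorff_const_pos[of s] by (simp add: K_def)
  have "hausdorff_delta s (\<delta> / 2) P \<le> ennreal h"
    using hausdorff_delta_le_outer[of "\<delta> / 2" s P] \<delta> h by auto
  also have "ennreal h < ennreal (h + \<eta> / 2)" using h \<eta> by (intro ennreal_lessI) auto
  finally obtain C where C: "hausdorff_cover (\<delta> / 2) P C" and Cs: "cover_sum s C < ennreal (h + \<eta> / 2)"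
    unfolding hausdorff_delta_alt INF_less_iff by auto
  \<comment> \<open>A positive enlargement also for sets of diameter 0, so small that all
    enlargements together add at most \<open>\<eta> / 2\<close> to the Hausdorff sum.\<close>
  define t where "t i = min (\<delta> / 2) ((\<eta> / (2 * K) * (1 / 2) ^ Suc i) powr (1 / s))" for i :: nat
  have t: "t i > 0" "t i \<le> \<delta> / 2" for i using \<delta> \<eta> K by (auto simp: t_def)
  have ts: "t i powr s \<le> \<eta> / (2 * K) * (1 / 2) ^ Suc i" for i
  proof -
    have "t i powr s \<le> ((\<eta> / (2 * K) * (1 / 2) ^ Suc i) powr (1 / s)) powr s"
      using t[of i] s by (intro powr_mono2) (auto simp: t_def)
    also have "\<dots> = \<eta> / (2 * K) * (1 / 2) ^ Suc i" using s \<eta> K by (simp add: powr_powr)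
    finally show ?thesis .
  qed
  define z where "z i = (SOME x. x \<in> C i \<inter> P)" for i
  define r where "r i = diameter (C i) + t i" for i
  define I0 where "I0 = {i. C i \<inter> P \<noteq> {}}"
  have z: "z i \<in> C i \<inter> P" if "i \<in> I0" for i
    using that some_in_eq[of "C i \<inter> P"] by (simp add: I0_def z_def)
  have d0: "diameter (C i) \<ge> 0" for i using C by (auto simp: hausdorff_cover_def intro: diameter_ge_0)
  have dl: "diameter (C i) \<le> \<delta> / 2" for i using C by (auto simp: hausdorff_cover_def)
  have "P \<subseteq> (\<Union>i\<in>I0. ball (z i) (r i))"
  proof
    fix x assume x: "x \<in> P"
    then obtain i where i: "x \<in> C i" using C by (auto simp: hausdorff_cover_def)
    then have i0: "i \<in> I0" using x by (auto simp: I0_def)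
    have "dist (z i) x \<le> diameter (C i)"
      using C z[OF i0] i by (auto simp: hausdorff_cover_def intro: diameter_bounded_bound)
    then have "x \<in> ball (z i) (r i)" using t[of i] by (simp add: r_def)
    then show "x \<in> (\<Union>i\<in>I0. ball (z i) (r i))" using i0 by blast
  qed
  then obtain I where I: "I \<subseteq> I0" "finite I" "P \<subseteq> (\<Union>i\<in>I. ball (z i) (r i))"
    using compactE_image[OF P, of I0 "\<lambda>i. ball (z i) (r i)"] by auto
  have sumC: "(\<Sum>i\<in>I. K * diameter (C i) powr s) \<le> h + \<eta> / 2"
  proof -
    have "ennreal (\<Sum>i\<in>I. K * diameter (C i) powr s) = (\<Sum>i\<in>I. ennreal (K * diameter (C i) powr s))"
      using K by (subst sum_ennreal) auto
    also have "\<dots> \<le> cover_sum s C"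
      unfolding cover_sum_def K_def by (rule sum_le_suminf) (use I in auto)
    also have "\<dots> \<le> ennreal (h + \<eta> / 2)" using Cs by simp
    finally show ?thesis using h \<eta> by (subst (asm) ennreal_le_iff) auto
  qed
  have sumt: "(\<Sum>i\<in>I. K * t i powr s) \<le> \<eta> / 2"
  proof -
    have "(\<Sum>i\<in>I. K * t i powr s) \<le> (\<Sum>i\<in>I. \<eta> / 2 * (1 / 2) ^ Suc i)"
      using mult_left_mono[OF ts, of K] K by (intro sum_mono) (simp add: field_simps)
    also have "\<dots> \<le> (\<Sum>i. \<eta> / 2 * (1 / 2) ^ Suc i)"
      using sums_mult[OF power_half_series, of "\<eta> / 2"] I \<eta> by (intro sum_le_suminf) (auto simp: sums_iff)
    also have "\<dots> = \<eta> / 2"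
      using sums_mult[OF power_half_series, of "\<eta> / 2"] by (simp add: sums_iff)
    finally show ?thesis .
  qed
  have "(\<Sum>i\<in>I. r i powr s) \<le> (\<Sum>i\<in>I. 2 powr s * (diameter (C i) powr s + t i powr s))"
    unfolding r_def using d0 t s by (intro sum_mono powr_add_le) (auto simp: less_imp_le)
  also have "\<dots> = 2 powr s / K * ((\<Sum>i\<in>I. K * diameter (C i) powr s) + (\<Sum>i\<in>I. K * t i powr s))"
    using K by (simp add: sum_distrib_left sum.distrib[symmetric] distrib_left)
  also have "\<dots> \<le> 2 powr s / K * (h + \<eta>)"
    using K sumC sumt by (intro mult_left_mono) auto
  finally have "(\<Sum>i\<in>I. r i powr s) \<le> 2 powr s / K * (h + \<eta>)" .
  moreover have "z i \<in> P \<and> 0 < r i \<and> r i \<le> \<delta>" if "i \<in> I" for i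
    using z[of i] that I d0[of i] dl[of i] t[of i] by (auto simp: r_def)
  ultimately show ?thesis using I unfolding K_def by blast
qed

subsection \<open>The level set inequality\<close>

text \<open>Take \<open>t2\<close> as the first time at or below \<open>a\<close> and
  \<open>t1\<close> as the last time before it at or above \<open>b\<close>; between them \<phi>
  cannot leave the band.\<close>

lemma crossing_interval:
  fixes \<phi> :: "real \<Rightarrow> real"
  assumes cont: "continuous_on {0..T} \<phi>" and T: "0 \<le> T" and ends: "b \<le> \<phi> 0" "\<phi> T \<le> a" and ab: "a < b"
  obtains t1 t2 where "0 \<le> t1" "t1 \<le> t2" "t2 \<le> T" "\<phi> t1 = b" "\<phi> t2 = a"
    "\<And>t. t1 \<le> t \<Longrightarrow> t \<le> t2 \<Longrightarrow> a \<le> \<phi> t \<and> \<phi> t \<le> b"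
proof -
  have "compact {t \<in> {0..T}. \<phi> t \<le> a}"
    using continuous_closed_preimage[OF cont closed_atLeastAtMost, of "{..a}"]
    by (auto simp: compact_eq_bounded_closed vimage_def Int_def intro: bounded_subset[of "{0..T}"])
  moreover have "{t \<in> {0..T}. \<phi> t \<le> a} \<noteq> {}" using ends T by auto
  ultimately obtain t2 where t2: "t2 \<in> {0..T}" "\<phi> t2 \<le> a" "\<And>t. t \<in> {0..T} \<Longrightarrow> \<phi> t \<le> a \<Longrightarrow> t2 \<le> t"
    using compact_attains_inf[of "{t \<in> {0..T}. \<phi> t \<le> a}"] by blast
  have cont2: "continuous_on {0..t2} \<phi>" by (rule continuous_on_subset[OF cont]) (use t2 in auto)
  have "\<exists>x\<ge>0. x \<le> t2 \<and> \<phi> x = a"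
    by (rule IVT2') (use t2 ends ab cont2 in auto)
  then obtain x where "0 \<le> x" "x \<le> t2" "\<phi> x = a" by blast
  then have e2: "\<phi> t2 = a" using t2(1) t2(3)[of x] by auto
  have "compact {t \<in> {0..t2}. b \<le> \<phi> t}"
    using continuous_closed_preimage[OF cont2 closed_atLeastAtMost, of "{b..}"]
    by (auto simp: compact_eq_bounded_closed vimage_def Int_def intro: bounded_subset[of "{0..t2}"])
  moreover have "{t \<in> {0..t2}. b \<le> \<phi> t} \<noteq> {}" using ends t2(1) by auto
  ultimately obtain t1 where t1: "t1 \<in> {0..t2}" "b \<le> \<phi> t1" "\<And>t. t \<in> {0..t2} \<Longrightarrow> b \<le> \<phi> t \<Longrightarrow> t \<le> t1"
    using compact_attains_sup[of "{t \<in> {0..t2}. b \<le> \<phi> t}"] by blast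
  have "continuous_on {t1..t2} \<phi>" by (rule continuous_on_subset[OF cont2]) (use t1 in auto)
  then have "\<exists>x\<ge>t1. x \<le> t2 \<and> \<phi> x = b"
    by (intro IVT2') (use t1 e2 ab in auto)
  then obtain y where "t1 \<le> y" "y \<le> t2" "\<phi> y = b" by blast
  then have e1: "\<phi> t1 = b" using t1(1) t1(3)[of y] by auto
  show ?thesis
  proof (rule that[of t1 t2])
    fix t assume t: "t1 \<le> t" "t \<le> t2"
    show "a \<le> \<phi> t \<and> \<phi> t \<le> b"
    proof (rule ccontr)
      assume "\<not> ?thesis"
      then consider "\<phi> t < a" | "b < \<phi> t" by linarith
      then show False
      proof cases
        case 1
        then have "t = t2" using t t1(1) t2(1) t2(3)[of t] by auto
        then show ?thesis using 1 e2 by simp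
      next
        case 2
        then have "t = t1" using t t1(1) t2(1) t1(3)[of t] by auto
        then show ?thesis using 2 e1 by simp
      qed
    qed
  qed (use t1(1) t2(1) e1 e2 in auto)
qed

text \<open>A doubled ball of radius \<rho> has volume
  \<open>2 powr d * unit_ball_vol d * \<rho> powr d\<close>, of which one power of \<rho> is lost to
  the height of the weight; the bracket is the factor in
  \<open>compact_hausdorff_cover\<close>.\<close>

definition cover_const :: "real \<Rightarrow> real" where
  "cover_const d = 2 powr d * unit_ball_vol d * (2 powr (d - 1) / hausdorff_const (d - 1))"

text \<open>The summand 1 serves the gradient term and \<open>cover_const\<close> the boundary term,
  so that one constant stands in front of both.\<close>

definition level_const :: "real \<Rightarrow> real \<Rightarrow> real \<Rightarrow> real" where
  "level_const d C \<alpha> = ray_const d C \<alpha> * (1 + cover_const d)"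

locale weak_growth = weak_pair \<Omega> u G + ball_growth N C \<alpha>
  for \<Omega> :: "'a::euclidean_space set" and u G and N :: "'a measure" and C \<alpha>
begin

lemma open_superlevel: "open {y \<in> \<Omega>. a < \<bar>u y\<bar>}"
proof -
  have "continuous_on \<Omega> (\<lambda>y. \<bar>u y\<bar>)"
    using continuous_u closure_subset by (intro continuous_on_rabs continuous_on_subset[OF continuous_u])
  from continuous_on_open_vimage[THEN iffD1, OF open_\<Omega> this, rule_format, of "{a<..}"]
  show ?thesis by (simp add: vimage_def Int_def conj_commute)
qed

lemma superlevel_borel [measurable]: "{x \<in> \<Omega>. b \<le> \<bar>u x\<bar>} \<in> sets borel"
proof -
  have "{x \<in> \<Omega>. b \<le> \<bar>u x\<bar>} = {x \<in> \<Omega>. b \<le> \<bar>u0 x\<bar>}" by (auto simp: u0_def)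
  also have "\<dots> = \<Omega> \<inter> {x \<in> space borel. b \<le> \<bar>u0 x\<bar>}" by auto
  also have "\<dots> \<in> sets borel" using open_\<Omega> by (intro sets.Int) (auto intro: borel_open)
  finally show ?thesis .
qed

lemma band_borel [measurable]: "{x \<in> \<Omega>. a < \<bar>u x\<bar> \<and> \<bar>u x\<bar> < b} \<in> sets borel"
proof -
  have "{x \<in> \<Omega>. a < \<bar>u x\<bar> \<and> \<bar>u x\<bar> < b} = {x \<in> \<Omega>. a < \<bar>u x\<bar>} - {x \<in> \<Omega>. b \<le> \<bar>u x\<bar>}" by auto
  then show ?thesis using open_superlevel superlevel_borel by (auto intro: borel_open)
qed

text \<open>A ray issuing from the superlevel set either meets one of the balls covering the
  part of the boundary where \<open>u\<close> is large, and then spends time at least \<open>r i\<close> in the doubled ball,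
  or stays inside \<open>\<Omega>\<close> until \<open>\<bar>u\<bar>\<close> has dropped from \<open>b1\<close> to \<open>a1\<close>.\<close>

lemma ray_dichotomy:
  fixes z :: "nat \<Rightarrow> 'a" and r :: "nat \<Rightarrow> real" and I :: "nat set"
  assumes ab: "0 < a" "a < a1" "a1 < b1"
    and cover: "{y \<in> frontier \<Omega>. a \<le> \<bar>u y\<bar>} \<subseteq> (\<Union>i\<in>I. ball (z i) (r i))"
    and x: "x \<in> \<Omega>" "b1 \<le> \<bar>u x\<bar>" and \<theta>: "\<theta> \<noteq> 0"
    and avoid: "\<And>t i. t \<ge> 0 \<Longrightarrow> i \<in> I \<Longrightarrow> x + t *\<^sub>R \<theta> \<notin> ball (z i) (r i)"
  obtains t1 t2 where "0 \<le> t1" "t1 \<le> t2" "\<bar>u (x + t1 *\<^sub>R \<theta>)\<bar> = b1" "\<bar>u (x + t2 *\<^sub>R \<theta>)\<bar> = a1"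
    "\<And>t. t1 \<le> t \<Longrightarrow> t \<le> t2 \<Longrightarrow> x + t *\<^sub>R \<theta> \<in> {y \<in> closure \<Omega>. a \<le> \<bar>u y\<bar>} - (\<Union>i\<in>I. ball (z i) (r i))
       \<and> a1 \<le> \<bar>u (x + t *\<^sub>R \<theta>)\<bar> \<and> \<bar>u (x + t *\<^sub>R \<theta>)\<bar> \<le> b1"
proof -
  define O1 where "O1 = {y \<in> \<Omega>. a1 < \<bar>u y\<bar>}"
  have O1: "open O1" unfolding O1_def by (rule open_superlevel)
  define S where "S = {t. 0 \<le> t \<and> x + t *\<^sub>R \<theta> \<notin> O1}"
  have S_closed: "closed S"
  proof -
    have "closed ((\<lambda>t. x + t *\<^sub>R \<theta>) -` (- O1))"
      using O1 by (intro continuous_closed_vimage) (auto intro!: continuous_intros)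
    moreover have "S = {0..} \<inter> (\<lambda>t. x + t *\<^sub>R \<theta>) -` (- O1)" by (auto simp: S_def)
    ultimately show ?thesis by (simp add: closed_Int)
  qed
  obtain R where R: "\<And>y. y \<in> closure \<Omega> \<Longrightarrow> a \<le> \<bar>u y\<bar> \<Longrightarrow> norm y \<le> R"
    using compact_imp_bounded[OF compact_level[OF ab(1)]] by (auto simp: bounded_iff)
  \<comment> \<open>By this time the ray has left the bounded set where
    \<open>\<bar>u\<bar> \<ge> a\<close>, so it does leave \<open>O1\<close>.\<close>
  define t0 where "t0 = (norm x + \<bar>R\<bar> + 1) / norm \<theta>"
  have "norm (t0 *\<^sub>R \<theta>) = norm x + \<bar>R\<bar> + 1" using \<theta> by (simp add: t0_def)
  moreover have "norm (t0 *\<^sub>R \<theta>) \<le> norm (x + t0 *\<^sub>R \<theta>) + norm x" by (metis add.commute add_diff_cancel_left' norm_triangle_ineq4)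
  ultimately have "norm (x + t0 *\<^sub>R \<theta>) > R" by linarith
  then have "x + t0 *\<^sub>R \<theta> \<notin> O1" using R[of "x + t0 *\<^sub>R \<theta>"] ab closure_subset[of \<Omega>] by (force simp: O1_def)
  then have S_ne: "S \<noteq> {}" using \<theta> by (auto simp: S_def t0_def intro!: exI[of _ t0])
  \<comment> \<open>\<open>T\<close> is the first exit time from \<open>O1\<close>. The ray leaves
    either because \<open>\<bar>u\<bar>\<close> drops to \<open>a1\<close> or through the boundary;
    the latter is ruled out below.\<close>
  define T where "T = Inf S"
  have S_bdd: "bdd_below S" by (auto simp: S_def bdd_below_def)
  have T_in: "T \<in> S" unfolding T_def by (rule closed_contains_Inf[OF S_ne S_bdd S_closed])
  have T0: "0 \<le> T" and xT: "x + T *\<^sub>R \<theta> \<notin> O1" using T_in by (auto simp: S_def)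
  have before: "x + t *\<^sub>R \<theta> \<in> O1" if "0 \<le> t" "t < T" for t
    using that cInf_lower[OF _ S_bdd, of t] by (force simp: S_def T_def)
  have T_pos: "T > 0"
  proof (rule ccontr)
    assume "\<not> T > 0"
    then have "T = 0" using T0 by simp
    then show False using xT x ab by (auto simp: O1_def)
  qed
  have "x + T *\<^sub>R \<theta> \<in> closure O1"
  proof -
    have "(\<lambda>t. x + t *\<^sub>R \<theta>) ` closure {0..<T} \<subseteq> closure ((\<lambda>t. x + t *\<^sub>R \<theta>) ` {0..<T})"
      by (intro image_closure_subset) (auto intro!: continuous_intros closure_subset)
    moreover have "T \<in> closure {0..<T}" using T_pos by (simp add: closure_atLeastLessThan)
    moreover have "closure ((\<lambda>t. x + t *\<^sub>R \<theta>) ` {0..<T}) \<subseteq> closure O1"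
      by (rule closure_mono) (use before in auto)
    ultimately show ?thesis by blast
  qed
  moreover have "closure O1 \<subseteq> {y \<in> closure \<Omega>. a1 \<le> \<bar>u y\<bar>}"
  proof (rule closure_minimal)
    show "O1 \<subseteq> {y \<in> closure \<Omega>. a1 \<le> \<bar>u y\<bar>}" using closure_subset by (auto simp: O1_def)
    show "closed {y \<in> closure \<Omega>. a1 \<le> \<bar>u y\<bar>}" using compact_level[of a1] ab by (simp add: compact_imp_closed)
  qed
  ultimately have xT2: "x + T *\<^sub>R \<theta> \<in> closure \<Omega>" "a1 \<le> \<bar>u (x + T *\<^sub>R \<theta>)\<bar>" by auto
  have closure_split: "closure \<Omega> = \<Omega> \<union> frontier \<Omega>"
    using open_\<Omega> by (auto simp: frontier_def interior_open closure_subset[THEN subsetD])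
  \<comment> \<open>A boundary exit point would have \<open>\<bar>u\<bar> \<ge> a1 > a\<close>,
    hence lie in one of the covering balls, which the ray avoids.\<close>
  have "x + T *\<^sub>R \<theta> \<in> \<Omega>"
  proof (rule ccontr)
    assume "x + T *\<^sub>R \<theta> \<notin> \<Omega>"
    then have "x + T *\<^sub>R \<theta> \<in> {y \<in> frontier \<Omega>. a \<le> \<bar>u y\<bar>}" using xT2 closure_split ab by auto
    then show False using cover avoid[OF T0] by blast
  qed
  then have uT: "\<bar>u (x + T *\<^sub>R \<theta>)\<bar> \<le> a1" using xT by (auto simp: O1_def)
  have path: "x + t *\<^sub>R \<theta> \<in> closure \<Omega> \<and> a \<le> \<bar>u (x + t *\<^sub>R \<theta>)\<bar>" if "0 \<le> t" "t \<le> T" for t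
  proof (cases "t = T")
    case True
    then show ?thesis using xT2 ab by auto
  next
    case False
    then have "x + t *\<^sub>R \<theta> \<in> O1" using before[of t] that by auto
    then show ?thesis using ab closure_subset by (auto simp: O1_def)
  qed
  have cont: "continuous_on {0..T} (\<lambda>t. \<bar>u (x + t *\<^sub>R \<theta>)\<bar>)"
    by (intro continuous_on_rabs continuous_on_compose2[OF continuous_u]) (use path in \<open>auto intro!: continuous_intros\<close>)
  show ?thesis
  proof (rule crossing_interval[OF cont T0, of b1 a1])
    fix t1 t2 assume t: "0 \<le> t1" "t1 \<le> t2" "t2 \<le> T" "\<bar>u (x + t1 *\<^sub>R \<theta>)\<bar> = b1" "\<bar>u (x + t2 *\<^sub>R \<theta>)\<bar> = a1"
      and band: "\<And>t. t1 \<le> t \<Longrightarrow> t \<le> t2 \<Longrightarrow> a1 \<le> \<bar>u (x + t *\<^sub>R \<theta>)\<bar> \<and> \<bar>u (x + t *\<^sub>R \<theta>)\<bar> \<le> b1"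
    show ?thesis
    proof (rule that[OF t(1,2,4,5)])
      fix s assume s: "t1 \<le> s" "s \<le> t2"
      then show "x + s *\<^sub>R \<theta> \<in> {y \<in> closure \<Omega>. a \<le> \<bar>u y\<bar>} - (\<Union>i\<in>I. ball (z i) (r i))
         \<and> a1 \<le> \<bar>u (x + s *\<^sub>R \<theta>)\<bar> \<and> \<bar>u (x + s *\<^sub>R \<theta>)\<bar> \<le> b1"
        using path[of s] band[of s] avoid[of s] t by auto
    qed
  qed (use x uT ab in auto)
qed

lemma compact_frontier_level: "a > 0 \<Longrightarrow> compact {y \<in> frontier \<Omega>. a \<le> \<bar>u y\<bar>}"
proof -
  assume a: "a > 0"
  have "{y \<in> frontier \<Omega>. a \<le> \<bar>u y\<bar>} = frontier \<Omega> \<inter> {y \<in> closure \<Omega>. a \<le> \<bar>u y\<bar>}"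
    by (auto simp: frontier_def)
  then show ?thesis using compact_level[OF a] by (simp add: closed_Int_compact)
qed

text \<open>The loss \<open>3 * \<rho>\<close> has two sources. The levels are moved inwards by
  \<rho> at both ends, so that mollified gradients on the inner band only see the open band; and
  replacing \<open>u\<close> by its mollification costs \<open>\<rho> / 2\<close> at each end of the
  path.\<close>

lemma level_estimate_aux:
  assumes ab: "0 < a" "0 < \<rho>" and c: "0 < c" "a + 3 * \<rho> + c = b" and \<eta>: "0 < \<eta>"
    and h: "hausdorff_outer (real DIM('a) - 1) {y \<in> frontier \<Omega>. a \<le> \<bar>u y\<bar>} \<le> ennreal h" "h \<ge> 0"
    and J: "(\<integral>\<^sup>+y\<in>{y \<in> \<Omega>. a < \<bar>u y\<bar> \<and> \<bar>u y\<bar> < b}. ennreal (norm (G y)) \<partial>lborel) \<le> ennreal J" "J \<ge> 0"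
  shows "c * measure N {x \<in> \<Omega>. b \<le> \<bar>u x\<bar>} powr ((real DIM('a) - 1) / \<alpha>) \<le>
    ray_const (real DIM('a)) C \<alpha> * (J + c * (cover_const (real DIM('a)) * (h + \<eta>)))"
proof -
  define d where "d = real DIM('a)"
  have d: "d \<ge> 2" using dim by (simp add: d_def)
  define a1 b1 \<kappa> where "a1 = a + \<rho>" and "b1 = b - \<rho>" and "\<kappa> = \<rho> / 2"
  have c_eq: "c = b1 - a1 - 2 * \<kappa>" using c by (simp add: a1_def b1_def \<kappa>_def)
  have lv: "a < a1" "a1 < b1" "\<kappa> > 0" "\<kappa> < a1 - a" "\<kappa> < b - b1"
    using ab c by (auto simp: a1_def b1_def \<kappa>_def)
  obtain I :: "nat set" and z r where I: "finite I" and rI: "\<And>i. i \<in> I \<Longrightarrow> 0 < r i"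
    and cover: "{y \<in> frontier \<Omega>. a \<le> \<bar>u y\<bar>} \<subseteq> (\<Union>i\<in>I. ball (z i) (r i))"
    and sum_r: "(\<Sum>i\<in>I. r i powr (d - 1)) \<le> 2 powr (d - 1) / hausdorff_const (d - 1) * (h + \<eta>)"
    using compact_hausdorff_cover[OF compact_frontier_level[OF ab(1)] _ h(1) h(2) zero_less_one \<eta>] d
    unfolding d_def by fastforce
  \<comment> \<open>Open balls covering the critical boundary part are removed from a compact subset
    of the closure, so the rest is compact and inside \<Omega>, with positive distance to the
    boundary.\<close>
  define K where "K = {y \<in> closure \<Omega>. a \<le> \<bar>u y\<bar>} - (\<Union>i\<in>I. ball (z i) (r i))"
  have K: "compact K" unfolding K_def using compact_level[OF ab(1)] by (intro compact_diff) auto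
  have closure_split: "closure \<Omega> = \<Omega> \<union> frontier \<Omega>"
    using open_\<Omega> by (auto simp: frontier_def interior_open closure_subset[THEN subsetD])
  have K\<Omega>: "K \<subseteq> \<Omega>" using cover by (auto simp: K_def closure_split)
  obtain e1 where e1: "e1 > 0" "\<And>y. y \<in> K \<Longrightarrow> cball y e1 \<subseteq> \<Omega>"
    using compact_subset_open_imp_cball_epsilon_subset[OF K open_\<Omega> K\<Omega>] by (metis UN_subset_iff)
  obtain e2 where e2: "e2 > 0" "\<And>x y. x \<in> closure \<Omega> \<Longrightarrow> y \<in> closure \<Omega> \<Longrightarrow> dist x y < e2 \<Longrightarrow> \<bar>u x - u y\<bar> \<le> \<kappa>"
    using uniformly_continuous_u[OF lv(3)] by blast
  \<comment> \<open>\<open>e1\<close> keeps the kernels inside \<Omega>, \<open>e2\<close> keeps the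
    oscillation of \<open>u\<close> at most \<kappa>. There is no lower bound on \<epsilon>, and the
    final estimate does not contain it.\<close>
  define \<epsilon> where "\<epsilon> = min e1 e2"
  have \<epsilon>: "\<epsilon> > 0" using e1 e2 by (simp add: \<epsilon>_def)
  have \<epsilon>K: "cball y \<epsilon> \<subseteq> \<Omega>" if "y \<in> K" for y
    using e1(2)[OF that] by (auto simp: \<epsilon>_def)
  have close: "\<bar>mollify \<epsilon> u0 y - u y\<bar> \<le> \<kappa>" if "y \<in> K" for y
    using that e2(2)[of y] K\<Omega> closure_subset[of \<Omega>] by (intro mollify_close \<epsilon> \<epsilon>K) (auto simp: \<epsilon>_def)
  define A where "A = K \<inter> {y \<in> closure \<Omega>. \<bar>u y\<bar> \<le> b1 \<and> a1 \<le> \<bar>u y\<bar>}"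
  have A_borel [measurable]: "A \<in> sets borel"
  proof -
    have "closed {y \<in> closure \<Omega>. \<bar>u y\<bar> \<le> b1 \<and> a1 \<le> \<bar>u y\<bar>}"
      using continuous_closed_preimage[OF continuous_on_rabs[OF continuous_u] closed_closure, of "{a1..b1}"]
      by (auto simp: vimage_def Int_def conj_commute)
    then show ?thesis unfolding A_def using K by (intro borel_closed closed_Int) (auto intro: compact_imp_closed)
  qed
  define g where "g y = (\<integral>\<^sup>+x. ennreal (norm (G x) * mol \<epsilon> y x) \<partial>lborel)" for y
  have g_meas [measurable]: "g \<in> borel_measurable borel" unfolding g_def by measurable
  \<comment> \<open>The density collected by rays. The height \<open>c / r i\<close> is chosen so
    that a ray of speed below 1 that hits ball \<open>i\<close> collects \<open>c\<close> while
    crossing the doubled ball for time \<open>r i\<close>.\<close>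
  define F where "F y = g y * indicator A y + (\<Sum>i\<in>I. ennreal (c / r i) * indicator (ball (z i) (2 * r i)) y)" for y
  have [measurable]: "ball (z i) (2 * r i) \<in> sets borel" for i by simp
  have F_meas [measurable]: "F \<in> borel_measurable borel" unfolding F_def by measurable
  have rays: "ennreal c \<le> (\<integral>\<^sup>+t\<in>{0<..}. F (x + t *\<^sub>R \<theta>) \<partial>lborel)"
    if x: "x \<in> {x \<in> \<Omega>. b \<le> \<bar>u x\<bar>}" and \<theta>: "0 < norm \<theta>" "norm \<theta> < 1" for x \<theta>
  proof (cases "\<exists>t\<ge>0. \<exists>i\<in>I. x + t *\<^sub>R \<theta> \<in> ball (z i) (r i)")
    case True
    then obtain t i where t: "t \<ge> 0" "i \<in> I" "x + t *\<^sub>R \<theta> \<in> ball (z i) (r i)" by blast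
    have ri: "r i > 0" using rI t by simp
    have "ennreal c = ennreal (c / r i) * emeasure lborel {t<..t + r i}"
      using ri c by (simp add: ennreal_mult[symmetric])
    also have "\<dots> = (\<integral>\<^sup>+s\<in>{t<..t + r i}. ennreal (c / r i) \<partial>lborel)"
      by (rule nn_integral_cmult_indicator[symmetric]) simp
    also have "\<dots> \<le> (\<integral>\<^sup>+s\<in>{0<..}. F (x + s *\<^sub>R \<theta>) \<partial>lborel)"
    proof (intro nn_integral_mono)
      fix s
      show "ennreal (c / r i) * indicator {t<..t + r i} s \<le> F (x + s *\<^sub>R \<theta>) * indicator {0<..} s"
      proof (cases "s \<in> {t<..t + r i}")
        case True
        have "dist (z i) (x + s *\<^sub>R \<theta>) \<le> dist (z i) (x + t *\<^sub>R \<theta>) + dist (x + t *\<^sub>R \<theta>) (x + s *\<^sub>R \<theta>)"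
          by (rule dist_triangle)
        also have "dist (x + t *\<^sub>R \<theta>) (x + s *\<^sub>R \<theta>) = \<bar>t - s\<bar> * norm \<theta>"
          by (simp add: dist_norm scaleR_left_diff_distrib[symmetric])
        also have "\<dots> \<le> \<bar>t - s\<bar> * 1" using \<theta> by (intro mult_left_mono) auto
        finally have "x + s *\<^sub>R \<theta> \<in> ball (z i) (2 * r i)" using t True by auto
        then have "ennreal (c / r i) = ennreal (c / r i) * indicator (ball (z i) (2 * r i)) (x + s *\<^sub>R \<theta>)" by simp
        also have "\<dots> \<le> (\<Sum>i\<in>I. ennreal (c / r i) * indicator (ball (z i) (2 * r i)) (x + s *\<^sub>R \<theta>))"
          using I t by (intro member_le_sum) auto
        also have "\<dots> \<le> F (x + s *\<^sub>R \<theta>)" by (simp add: F_def)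
        finally show ?thesis using True t by (auto simp: indicator_def)
      qed simp
    qed
    finally show ?thesis .
  next
    case False
    have x': "x \<in> \<Omega>" "b1 \<le> \<bar>u x\<bar>" using x lv by auto
    have \<theta>0: "\<theta> \<noteq> 0" using \<theta> by auto
    obtain t1 t2 where t: "0 \<le> t1" "t1 \<le> t2" "\<bar>u (x + t1 *\<^sub>R \<theta>)\<bar> = b1" "\<bar>u (x + t2 *\<^sub>R \<theta>)\<bar> = a1"
      and path: "\<And>t. t1 \<le> t \<Longrightarrow> t \<le> t2 \<Longrightarrow> x + t *\<^sub>R \<theta> \<in> {y \<in> closure \<Omega>. a \<le> \<bar>u y\<bar>} - (\<Union>i\<in>I. ball (z i) (r i))
       \<and> a1 \<le> \<bar>u (x + t *\<^sub>R \<theta>)\<bar> \<and> \<bar>u (x + t *\<^sub>R \<theta>)\<bar> \<le> b1"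
      using ray_dichotomy[OF ab(1) lv(1,2) cover x' \<theta>0] False by blast
    have pathK: "x + t *\<^sub>R \<theta> \<in> A" if "t1 \<le> t" "t \<le> t2" for t
      using path[OF that] by (auto simp: A_def K_def)
    have "c \<le> \<bar>mollify \<epsilon> u0 (x + t2 *\<^sub>R \<theta>) - mollify \<epsilon> u0 (x + t1 *\<^sub>R \<theta>)\<bar>"
      using close[of "x + t1 *\<^sub>R \<theta>"] close[of "x + t2 *\<^sub>R \<theta>"] pathK[of t1] pathK[of t2] t
      unfolding c_eq A_def by auto
    then have "ennreal c \<le> ennreal \<bar>mollify \<epsilon> u0 (x + t2 *\<^sub>R \<theta>) - mollify \<epsilon> u0 (x + t1 *\<^sub>R \<theta>)\<bar>"
      by (rule ennreal_leI)
    also have "\<dots> \<le> (\<integral>\<^sup>+t\<in>{t1..t2}. g (x + t *\<^sub>R \<theta>) \<partial>lborel)"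
      unfolding g_def using \<theta> \<epsilon> t pathK \<epsilon>K by (intro mollify_line) (auto simp: A_def)
    also have "\<dots> \<le> (\<integral>\<^sup>+t\<in>{0<..}. F (x + t *\<^sub>R \<theta>) \<partial>lborel)"
    proof (rule nn_integral_mono_AE)
      have "AE t in lborel. t \<noteq> (0::real)" by (rule AE_lborel_singleton)
      then show "AE t in lborel. g (x + t *\<^sub>R \<theta>) * indicator {t1..t2} t \<le> F (x + t *\<^sub>R \<theta>) * indicator {0<..} t"
      proof eventually_elim
        case (elim s)
        show ?case
        proof (cases "s \<in> {t1..t2}")
          case True
          then have "g (x + s *\<^sub>R \<theta>) \<le> F (x + s *\<^sub>R \<theta>)" using pathK[of s] by (simp add: F_def)
          then show ?thesis using True elim t by (auto simp: indicator_def)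
        qed simp
      qed
    qed
    finally show ?thesis .
  qed
  have hc: "hausdorff_const (d - 1) > 0" using d hausdorff_const_pos[of "d - 1"] by simp
  \<comment> \<open>A doubled ball contributes a multiple of \<open>c * r i powr (d - 1)\<close>, so
    the sum over \<open>i\<close> is controlled by the Hausdorff measure. The gradient part comes
    from points within \<epsilon> of \<open>A\<close>, where \<open>\<bar>u\<bar>\<close> differs
    from its value on \<open>A\<close> by at most \<kappa> and thus still lies strictly between
    \<open>a\<close> and \<open>b\<close>.\<close>
  have intF: "(\<integral>\<^sup>+y. F y \<partial>lborel) \<le> ennreal (J + c * (cover_const d * (h + \<eta>)))"
  proof -
    have "(\<integral>\<^sup>+y. F y \<partial>lborel) = (\<integral>\<^sup>+y\<in>A. g y \<partial>lborel) +
        (\<Sum>i\<in>I. (\<integral>\<^sup>+y\<in>ball (z i) (2 * r i). ennreal (c / r i) \<partial>lborel))"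
      unfolding F_def by (subst nn_integral_add, measurable, subst nn_integral_sum) measurable
    also have "\<dots> \<le> ennreal J + (\<Sum>i\<in>I. ennreal (c * 2 powr d * unit_ball_vol d * r i powr (d - 1)))"
    proof (intro add_mono sum_mono)
      have "(\<integral>\<^sup>+y\<in>A. g y \<partial>lborel) \<le> (\<integral>\<^sup>+y\<in>{y \<in> \<Omega>. a < \<bar>u y\<bar> \<and> \<bar>u y\<bar> < b}. ennreal (norm (G y)) \<partial>lborel)"
        unfolding g_def
      proof (rule convolution_set_bound[OF \<epsilon>])
        fix y x assume y: "y \<in> A" "dist y x < \<epsilon>" "G x \<noteq> 0"
        then have "x \<in> \<Omega>" using G_0 by blast
        moreover have "\<bar>u y - u x\<bar> \<le> \<kappa>"
          using y \<open>x \<in> \<Omega>\<close> closure_subset[of \<Omega>] by (intro e2(2)) (auto simp: A_def \<epsilon>_def)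
        ultimately show "x \<in> {y \<in> \<Omega>. a < \<bar>u y\<bar> \<and> \<bar>u y\<bar> < b}"
          using y(1) lv by (auto simp: A_def)
      qed auto
      then show "(\<integral>\<^sup>+y\<in>A. g y \<partial>lborel) \<le> ennreal J" using J(1) by (rule order_trans)
    next
      fix i assume i: "i \<in> I"
      have ri: "r i > 0" using rI i by simp
      have fin: "emeasure lborel (ball (z i) (2 * r i)) \<noteq> top"
        using emeasure_bounded_finite[of "ball (z i) (2 * r i)"] by auto
      have "(\<integral>\<^sup>+y\<in>ball (z i) (2 * r i). ennreal (c / r i) \<partial>lborel) = ennreal (c / r i) * emeasure lborel (ball (z i) (2 * r i))"
        by (rule nn_integral_cmult_indicator) simp
      also have "emeasure lborel (ball (z i) (2 * r i)) = ennreal (unit_ball_vol d * (2 * r i) ^ DIM('a))"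
        using ri fin by (simp add: emeasure_eq_ennreal_measure content_ball d_def)
      also have "ennreal (c / r i) * \<dots> = ennreal (c / r i * (unit_ball_vol d * (2 * r i) ^ DIM('a)))"
        using ri c d by (intro ennreal_mult[symmetric]) auto
      also have "c / r i * (unit_ball_vol d * (2 * r i) ^ DIM('a)) = c * 2 powr d * unit_ball_vol d * r i powr (d - 1)"
        using ri by (simp add: powr_diff powr_realpow[symmetric] d_def powr_mult)
      finally show "(\<integral>\<^sup>+y\<in>ball (z i) (2 * r i). ennreal (c / r i) \<partial>lborel)
          \<le> ennreal (c * 2 powr d * unit_ball_vol d * r i powr (d - 1))" by simp
    qed
    also have "\<dots> = ennreal (J + (\<Sum>i\<in>I. c * 2 powr d * unit_ball_vol d * r i powr (d - 1)))"
      using J c d by (subst sum_ennreal, simp, subst ennreal_plus) (auto intro!: sum_nonneg)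
    also have "\<dots> \<le> ennreal (J + c * (cover_const d * (h + \<eta>)))"
    proof (intro ennreal_leI add_left_mono)
      have "(\<Sum>i\<in>I. c * 2 powr d * unit_ball_vol d * r i powr (d - 1)) = c * 2 powr d * unit_ball_vol d * (\<Sum>i\<in>I. r i powr (d - 1))"
        by (simp add: sum_distrib_left)
      also have "\<dots> \<le> c * 2 powr d * unit_ball_vol d * (2 powr (d - 1) / hausdorff_const (d - 1) * (h + \<eta>))"
        using c d by (intro mult_left_mono sum_r) auto
      finally show "(\<Sum>i\<in>I. c * 2 powr d * unit_ball_vol d * r i powr (d - 1)) \<le> c * (cover_const d * (h + \<eta>))"
        by (simp add: cover_const_def mult.assoc)
    qed
    finally show ?thesis .
  qed
  have cc: "cover_const d \<ge> 0" using d hc by (simp add: cover_const_def)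
  show ?thesis
    unfolding d_def[symmetric]
    by (rule ray_bound[OF F_meas superlevel_borel less_imp_le[OF c(1)] rays intF, folded d_def])
      (use J c h \<eta> cc in auto)
qed

lemma cover_const_nonneg: "cover_const (real DIM('a)) \<ge> 0"
  using dim hausdorff_const_pos[of "real DIM('a) - 1"] by (simp add: cover_const_def)

lemma level_const_pos: "level_const (real DIM('a)) C \<alpha> > 0"
  using cover_const_nonneg ray_const_pos unfolding level_const_def by (intro mult_pos_pos) auto

text \<open>The margins and the covering error are proportional to a parameter that tends to 0; no
  quantity in the limit depends on the cover or on the mollification scale.\<close>

lemma level_estimate:
  assumes ab: "0 < a" "a < b"
    and h: "hausdorff_outer (real DIM('a) - 1) {y \<in> frontier \<Omega>. a \<le> \<bar>u y\<bar>} \<le> ennreal h" "h \<ge> 0"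
    and J: "(\<integral>\<^sup>+y\<in>{y \<in> \<Omega>. a < \<bar>u y\<bar> \<and> \<bar>u y\<bar> < b}. ennreal (norm (G y)) \<partial>lborel) \<le> ennreal J" "J \<ge> 0"
  shows "(b - a) * measure N {x \<in> \<Omega>. b \<le> \<bar>u x\<bar>} powr ((real DIM('a) - 1) / \<alpha>) \<le>
    level_const (real DIM('a)) C \<alpha> * (J + (b - a) * h)"
proof -
  define X where "X = measure N {x \<in> \<Omega>. b \<le> \<bar>u x\<bar>} powr ((real DIM('a) - 1) / \<alpha>)"
  define R where "R = ray_const (real DIM('a)) C \<alpha>"
  define Q where "Q = cover_const (real DIM('a))"
  have R: "R > 0" and Q: "Q \<ge> 0" using ray_const_pos cover_const_nonneg by (auto simp: R_def Q_def)
  have step: "(1 - e) * (b - a) * X \<le> R * (J + (1 - e) * (b - a) * (Q * (h + e)))" if e: "0 < e" "e < 1" for e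
    unfolding X_def R_def Q_def
  proof (rule level_estimate_aux[OF ab(1) _ _ _ e(1) h J])
    show "0 < e * (b - a) / 3" "0 < (1 - e) * (b - a)" using e ab by auto
    show "a + 3 * (e * (b - a) / 3) + (1 - e) * (b - a) = b" by (simp add: field_simps)
  qed
  \<comment> \<open>Two successors keep the parameter \<open>e\<close> strictly between 0 and 1 for
    every \<open>k\<close>.\<close>
  have "(\<lambda>k. (1 - 1 / real (Suc (Suc k))) * (b - a) * X) \<longlonglongrightarrow> (1 - 0) * (b - a) * X"
    by (intro tendsto_intros LIMSEQ_Suc[OF LIMSEQ_Suc[OF lim_1_over_n]])
  moreover have "(\<lambda>k. R * (J + (1 - 1 / real (Suc (Suc k))) * (b - a) * (Q * (h + 1 / real (Suc (Suc k))))))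
      \<longlonglongrightarrow> R * (J + (1 - 0) * (b - a) * (Q * (h + 0)))"
    by (intro tendsto_intros LIMSEQ_Suc[OF LIMSEQ_Suc[OF lim_1_over_n]])
  ultimately have "(1 - 0) * (b - a) * X \<le> R * (J + (1 - 0) * (b - a) * (Q * (h + 0)))"
    by (rule LIMSEQ_le) (intro exI allI impI step, auto)
  also have "\<dots> \<le> R * ((1 + Q) * (J + (b - a) * h))"
  proof (intro mult_left_mono)
    have "0 \<le> J * Q" "0 \<le> (b - a) * h" using Q J h ab by auto
    then show "J + (1 - 0) * (b - a) * (Q * (h + 0)) \<le> (1 + Q) * (J + (b - a) * h)"
      by (simp add: algebra_simps)
  qed (use R in simp)
  finally show ?thesis by (simp add: level_const_def R_def Q_def X_def mult.assoc)
qed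

end

section \<open>Borel representatives of weak gradients\<close>

lemma frechet_derivative_bump_1: "frechet_derivative (bump 1 \<epsilon> z) (at y) \<theta> = dbump \<epsilon> z y \<theta>"
  by (simp add: bump_frechet_derivative dbump_def)

text \<open>Local integrability gives measurability on compact subsets only; exhausting \<Omega> by
  an increasing sequence of them gives it on all of \<Omega>.\<close>

lemma borel_measurable_lebesgue_open:
  fixes g :: "'a::euclidean_space \<Rightarrow> 'b::euclidean_space"
  assumes "open \<Omega>" "locally_integrable \<Omega> g"
  shows "(\<lambda>x. indicator \<Omega> x *\<^sub>R g x) \<in> borel_measurable lebesgue"
proof -
  obtain K where K: "\<And>n. compact (K n)" "\<And>n. K n \<subseteq> \<Omega>" "\<And>n. K n \<subseteq> interior (K (Suc n))" "\<Union>(range K) = \<Omega>"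
    using open_Union_compact_subsets[OF assms(1)] by metis
  have mono: "K n \<subseteq> K (n + j)" for n j
  proof (induction j)
    case (Suc j)
    have "K (n + j) \<subseteq> K (n + Suc j)" using K(3)[of "n + j"] interior_subset by fastforce
    with Suc show ?case by blast
  qed simp
  show ?thesis
  proof (rule borel_measurable_LIMSEQ_metric)
    show "(\<lambda>x. indicator (K n) x *\<^sub>R g x) \<in> borel_measurable lebesgue" for n
    proof -
      have "set_integrable lebesgue (K n) g"
        using assms(2) K(1)[of n] K(2)[of n] by (simp add: locally_integrable_def)
      then show ?thesis unfolding set_integrable_def by (rule borel_measurable_integrable)
    qed
    show "(\<lambda>n. indicator (K n) x *\<^sub>R g x) \<longlonglongrightarrow> indicator \<Omega> x *\<^sub>R g x" for x
    proof (cases "x \<in> \<Omega>")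
      case True
      then obtain n where n: "x \<in> K n" using K(4) by blast
      have "\<forall>\<^sub>F m in sequentially. indicator \<Omega> x *\<^sub>R g x = indicator (K m) x *\<^sub>R g x"
      proof (rule eventually_sequentiallyI[of n])
        fix m assume "n \<le> m"
        then have "x \<in> K m" using mono[of n "m - n"] n by auto
        then show "indicator \<Omega> x *\<^sub>R g x = indicator (K m) x *\<^sub>R g x" using True by simp
      qed
      then show ?thesis by (rule Lim_transform_eventually[OF tendsto_const])
    next
      case False
      then have "indicator (K n) x = (0::real)" for n using K(2) by (auto simp: indicator_def)
      then show ?thesis using False by simp
    qed
  qed
qed

text \<open>The given gradient is only Lebesgue measurable and arbitrary outside \<Omega>. It is
  replaced coordinate by coordinate by Borel functions that agree almost everywhere, cut off outside
  \<Omega>. It is integrable because \<open>norm (G x) \<le> 1 + norm (G x) powr p\<close> and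
  \<Omega> has finite measure. The weak equation passes from basis vectors to all \<theta> by
  linearity.\<close>

lemma V1Lp_weak_pair:
  fixes \<Omega> :: "'a::euclidean_space set"
  assumes \<Omega>: "open \<Omega>" "emeasure lebesgue \<Omega> < \<infinity>" and Cb: "Cb_closure \<Omega> u"
    and V: "V1Lp \<Omega> p u G0" and p: "1 \<le> p"
  obtains G where "weak_pair \<Omega> u G"
    "(\<integral>\<^sup>+y. ennreal (norm (G y) powr p) \<partial>lborel) = (\<integral>\<^sup>+x\<in>\<Omega>. ennreal (norm (G0 x) powr p) \<partial>lebesgue)"
proof -
  have wg: "weak_gradient \<Omega> u G0" and fin: "(\<integral>\<^sup>+x\<in>\<Omega>. ennreal (norm (G0 x) powr p) \<partial>lebesgue) < \<infinity>"
    using V by (auto simp: V1Lp_def)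
  have [measurable]: "\<Omega> \<in> sets borel" using \<Omega> by (simp add: borel_open)
  define G1 where "G1 x = indicator \<Omega> x *\<^sub>R G0 x" for x
  have G1: "G1 \<in> borel_measurable lebesgue"
    using borel_measurable_lebesgue_open[OF \<Omega>(1), of G0] wg by (simp add: weak_gradient_def G1_def[abs_def])
  have "\<exists>g. g \<in> borel_measurable lborel \<and> (AE x in lborel. G1 x \<bullet> b = g x)" for b
    using completion_ex_borel_measurable_real[of "\<lambda>x. G1 x \<bullet> b" lborel] G1 by auto
  then obtain g where g [measurable]: "\<And>b. g b \<in> borel_measurable lborel" and gG: "\<And>b. AE x in lborel. G1 x \<bullet> b = g b x"
    by metis
  define G where "G x = (\<Sum>b\<in>Basis. (indicator \<Omega> x * g b x) *\<^sub>R b)" for x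
  have G_meas [measurable]: "G \<in> borel_measurable borel" unfolding G_def by measurable
  have "AE x in lborel. \<forall>b\<in>Basis. G1 x \<bullet> b = g b x"
    using gG by (intro AE_finite_allI) auto
  then have GG1: "AE x in lborel. G x = G1 x"
  proof eventually_elim
    case (elim x)
    have "G x = (\<Sum>b\<in>Basis. (G1 x \<bullet> b) *\<^sub>R b)"
      unfolding G_def
    proof (intro sum.cong refl)
      fix b :: 'a assume "b \<in> Basis"
      then have "g b x = G1 x \<bullet> b" using elim by simp
      then show "(indicator \<Omega> x * g b x) *\<^sub>R b = (G1 x \<bullet> b) *\<^sub>R b" by (auto simp: G1_def indicator_def)
    qed
    then show ?case by (simp add: euclidean_representation)
  qed
  have G_0: "G y = 0" if "y \<notin> \<Omega>" for y using that by (simp add: G_def)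
  have "(\<integral>\<^sup>+y. ennreal (norm (G y) powr p) \<partial>lborel) = (\<integral>\<^sup>+y. ennreal (norm (G1 y) powr p) \<partial>lborel)"
    by (rule nn_integral_cong_AE) (use GG1 in \<open>eventually_elim, simp\<close>)
  also have "\<dots> = (\<integral>\<^sup>+x\<in>\<Omega>. ennreal (norm (G0 x) powr p) \<partial>lebesgue)"
    unfolding nn_integral_completion by (intro nn_integral_cong) (auto simp: G1_def indicator_def)
  finally have eq: "(\<integral>\<^sup>+y. ennreal (norm (G y) powr p) \<partial>lborel) = (\<integral>\<^sup>+x\<in>\<Omega>. ennreal (norm (G0 x) powr p) \<partial>lebesgue)" .
  have int_G: "integrable lborel G"
  proof (rule integrableI_bounded)
    have "(\<integral>\<^sup>+x. ennreal (norm (G x)) \<partial>lborel) \<le> (\<integral>\<^sup>+x. indicator \<Omega> x + ennreal (norm (G x) powr p) \<partial>lborel)"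
    proof (intro nn_integral_mono)
      fix x
      show "ennreal (norm (G x)) \<le> indicator \<Omega> x + ennreal (norm (G x) powr p)"
      proof (cases "x \<in> \<Omega>")
        case True
        have "norm (G x) \<le> 1 + norm (G x) powr p"
        proof (cases "norm (G x) \<le> 1")
          case False
          then have "norm (G x) powr 1 \<le> norm (G x) powr p" using p by (intro powr_mono) auto
          then show ?thesis using False by simp
        qed (auto intro: order_trans)
        then have "ennreal (norm (G x)) \<le> ennreal (1 + norm (G x) powr p)" by (rule ennreal_leI)
        then show ?thesis using True by simp
      qed (simp add: G_0)
    qed
    also have "\<dots> = emeasure lborel \<Omega> + (\<integral>\<^sup>+x. ennreal (norm (G x) powr p) \<partial>lborel)"
      by (subst nn_integral_add) auto
    also have "\<dots> < \<infinity>" using \<Omega>(2) fin unfolding eq by (auto simp: less_top[symmetric])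
    finally show "(\<integral>\<^sup>+x. ennreal (norm (G x)) \<partial>lborel) < \<infinity>" .
  qed simp
  have "continuous_on \<Omega> u"
    by (rule continuous_on_subset[OF _ closure_subset]) (use Cb in \<open>simp add: Cb_closure_def\<close>)
  then have "(\<lambda>y. indicator \<Omega> y *\<^sub>R u y) \<in> borel_measurable borel"
    using \<Omega> by (intro borel_measurable_continuous_on_indicator) auto
  then have u0 [measurable]: "(\<lambda>y. indicator \<Omega> y * u y) \<in> borel_measurable borel" by simp
  have G_bump: "integrable lborel (\<lambda>y. (G y \<bullet> \<theta>) * bump 1 \<epsilon> z y)" for \<theta> z \<epsilon>
  proof (rule Bochner_Integration.integrable_bound)
    show "integrable lborel (\<lambda>y. G y \<bullet> \<theta>)" using int_G by simp
    show "AE y in lborel. norm ((G y \<bullet> \<theta>) * bump 1 \<epsilon> z y) \<le> norm (G y \<bullet> \<theta>)"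
      using bump_le_1[of \<epsilon> z] bump_nonneg[of \<epsilon> z] by (auto simp: abs_mult intro!: AE_I2 mult_left_le)
  qed measurable
  have basis: "(\<integral>y. indicator \<Omega> y * u y * dbump \<epsilon> z y b \<partial>lborel) = - (\<integral>y. (G y \<bullet> b) * bump 1 \<epsilon> z y \<partial>lborel)"
    if \<epsilon>: "\<epsilon> > 0" "cball z \<epsilon> \<subseteq> \<Omega>" and b: "b \<in> Basis" for z \<epsilon> b
  proof -
    have "(LINT x:\<Omega>|lebesgue. u x * frechet_derivative (bump 1 \<epsilon> z) (at x) b) =
       - (LINT x:\<Omega>|lebesgue. (G0 x \<bullet> b) * bump 1 \<epsilon> z x)"
      using wg test_function_bump[OF \<epsilon>, of 1] b by (auto simp: weak_gradient_def)
    moreover have "(LINT x:\<Omega>|lebesgue. u x * frechet_derivative (bump 1 \<epsilon> z) (at x) b) =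
        (\<integral>y. indicator \<Omega> y * u y * dbump \<epsilon> z y b \<partial>lborel)"
      unfolding set_lebesgue_integral_def frechet_derivative_bump_1
      by (subst integral_completion[symmetric], measurable) (simp add: mult.assoc)
    moreover have "(LINT x:\<Omega>|lebesgue. (G0 x \<bullet> b) * bump 1 \<epsilon> z x) = (\<integral>y. (G y \<bullet> b) * bump 1 \<epsilon> z y \<partial>lebesgue)"
      unfolding set_lebesgue_integral_def
    proof (rule integral_cong_AE)
      have "(\<lambda>x. (G1 x \<bullet> b) * bump 1 \<epsilon> z x) \<in> borel_measurable lebesgue"
        using G1 by (intro borel_measurable_times borel_measurable_inner) (auto intro: measurable_completion)
      moreover have "(\<lambda>x. (G1 x \<bullet> b) * bump 1 \<epsilon> z x) = (\<lambda>x. indicator \<Omega> x *\<^sub>R ((G0 x \<bullet> b) * bump 1 \<epsilon> z x))"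
        by (auto simp: G1_def)
      ultimately show "(\<lambda>x. indicator \<Omega> x *\<^sub>R ((G0 x \<bullet> b) * bump 1 \<epsilon> z x)) \<in> borel_measurable lebesgue" by simp
      show "(\<lambda>y. (G y \<bullet> b) * bump 1 \<epsilon> z y) \<in> borel_measurable lebesgue" by (rule measurable_completion) measurable
      show "AE x in lebesgue. indicator \<Omega> x *\<^sub>R ((G0 x \<bullet> b) * bump 1 \<epsilon> z x) = (G x \<bullet> b) * bump 1 \<epsilon> z x"
        using AE_completion[OF GG1] by eventually_elim (auto simp: G1_def)
    qed
    moreover have "(\<integral>y. (G y \<bullet> b) * bump 1 \<epsilon> z y \<partial>lebesgue) = (\<integral>y. (G y \<bullet> b) * bump 1 \<epsilon> z y \<partial>lborel)"
      by (rule integral_completion) measurable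
    ultimately show ?thesis by simp
  qed
  have "weak_pair \<Omega> u G"
  proof
    show "open \<Omega>" "Cb_closure \<Omega> u" "integrable lborel G" using \<Omega> Cb int_G by auto
    show "G y = 0" if "y \<notin> \<Omega>" for y by (rule G_0[OF that])
    fix z \<epsilon> \<theta> assume \<epsilon>: "\<epsilon> > (0::real)" "cball z \<epsilon> \<subseteq> \<Omega>"
    have u_int: "integrable lborel (\<lambda>y. indicator \<Omega> y * u y * dbump \<epsilon> z y b)" for b
    proof -
      have "cball z \<epsilon> \<subseteq> closure \<Omega>" using \<epsilon> closure_subset by blast
      moreover have "continuous_on (closure \<Omega>) u" using Cb by (simp add: Cb_closure_def)
      ultimately have "compact (u ` cball z \<epsilon>)"
        by (intro compact_continuous_image) (auto intro: continuous_on_subset)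
      then obtain B where B: "\<And>y. y \<in> cball z \<epsilon> \<Longrightarrow> \<bar>u y\<bar> \<le> B"
        by (metis compact_imp_bounded bounded_iff imageI real_norm_def)
      obtain L where L: "L \<ge> 0" "\<And>z y \<theta> :: 'a. \<bar>dbump \<epsilon> z y \<theta>\<bar> \<le> L * norm \<theta>"
        using dbump_bounded[OF \<epsilon>(1)] by blast
      show ?thesis
      proof (rule Bochner_Integration.integrable_bound)
        show "integrable lborel (\<lambda>y. (B * (L * norm b)) * indicator (cball z \<epsilon>) y)"
          by (intro integrable_mult_right integrable_real_indicator emeasure_bounded_finite) auto
        have "norm (indicator \<Omega> y * u y * dbump \<epsilon> z y b) \<le> norm ((B * (L * norm b)) * indicator (cball z \<epsilon>) y)" for y
        proof (cases "y \<in> cball z \<epsilon>")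
          case True
          have "norm (indicator \<Omega> y * u y * dbump \<epsilon> z y b) \<le> \<bar>u y\<bar> * \<bar>dbump \<epsilon> z y b\<bar>"
            by (auto simp: abs_mult indicator_def)
          also have "\<dots> \<le> B * (L * norm b)"
            using B[OF True] L(2)[of z y b] by (intro mult_mono) auto
          finally show ?thesis using True by simp
        next
          case False
          then show ?thesis using \<epsilon> by (simp add: dbump_def bump_eq_0)
        qed
        then show "AE y in lborel. norm (indicator \<Omega> y * u y * dbump \<epsilon> z y b) \<le> norm ((B * (L * norm b)) * indicator (cball z \<epsilon>) y)"
          by (intro AE_I2)
      qed measurable
    qed
    have split_d: "dbump \<epsilon> z y \<theta> = (\<Sum>b\<in>Basis. (\<theta> \<bullet> b) * dbump \<epsilon> z y b)" for y
      by (simp add: dbump_def euclidean_inner[of "y - z" \<theta>] sum_distrib_left mult_ac)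
    have split_G: "G y \<bullet> \<theta> = (\<Sum>b\<in>Basis. (\<theta> \<bullet> b) * (G y \<bullet> b))" for y
      by (simp add: euclidean_inner[of "G y" \<theta>] mult.commute)
    have "(\<integral>y. indicator \<Omega> y * u y * dbump \<epsilon> z y \<theta> \<partial>lborel) =
        (\<integral>y. (\<Sum>b\<in>Basis. (\<theta> \<bullet> b) * (indicator \<Omega> y * u y * dbump \<epsilon> z y b)) \<partial>lborel)"
      by (subst split_d) (simp add: sum_distrib_left mult_ac)
    also have "\<dots> = (\<Sum>b\<in>Basis. (\<theta> \<bullet> b) * (\<integral>y. indicator \<Omega> y * u y * dbump \<epsilon> z y b \<partial>lborel))"
      using u_int by (subst Bochner_Integration.integral_sum) auto
    also have "\<dots> = - (\<Sum>b\<in>Basis. (\<theta> \<bullet> b) * (\<integral>y. (G y \<bullet> b) * bump 1 \<epsilon> z y \<partial>lborel))"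
      by (simp add: basis[OF \<epsilon>] sum_negf)
    also have "(\<Sum>b\<in>Basis. (\<theta> \<bullet> b) * (\<integral>y. (G y \<bullet> b) * bump 1 \<epsilon> z y \<partial>lborel)) =
        (\<integral>y. (\<Sum>b\<in>Basis. (\<theta> \<bullet> b) * ((G y \<bullet> b) * bump 1 \<epsilon> z y)) \<partial>lborel)"
      using G_bump by (subst Bochner_Integration.integral_sum) auto
    also have "\<dots> = (\<integral>y. (G y \<bullet> \<theta>) * bump 1 \<epsilon> z y \<partial>lborel)"
      by (subst split_G) (simp add: sum_distrib_right mult.assoc)
    finally show "(\<integral>y. indicator \<Omega> y * u y * dbump \<epsilon> z y \<theta> \<partial>lborel) = - (\<integral>y. (G y \<bullet> \<theta>) * bump 1 \<epsilon> z y \<partial>lborel)" .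
  qed
  then show ?thesis using eq by (rule that)
qed

text \<open>By \<open>x \<le> x powr p * l powr (1 - p) + l\<close> with the optimal \<open>l\<close>; this loses a factor 2 against Hoelder's inequality.\<close>

lemma nn_integral_Holder_set:
  fixes g :: "'a \<Rightarrow> real"
  assumes [measurable]: "g \<in> borel_measurable M" "A \<in> sets M" and g0: "\<And>x. g x \<ge> 0"
    and p: "1 < p" and B: "B > 0" and m: "m > 0"
    and I: "(\<integral>\<^sup>+x\<in>A. ennreal (g x powr p) \<partial>M) \<le> ennreal (B powr p)" and A: "emeasure M A \<le> ennreal m"
  shows "(\<integral>\<^sup>+x\<in>A. ennreal (g x) \<partial>M) \<le> ennreal (2 * B * m powr (1 - 1 / p))"
proof -
  \<comment> \<open>The truncation height at which the two terms of the pointwise bound have the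
    same integral bound, \<open>B * m powr (1 - 1 / p)\<close>.\<close>
  define l where "l = B * m powr (- 1 / p)"
  have l: "l > 0" using B m by (simp add: l_def)
  have pt: "x \<le> x powr p * l powr (1 - p) + l" if "x \<ge> 0" for x
  proof (cases "x \<le> l")
    case False
    then have x: "x > 0" using l by simp
    have "x powr (1 - p) \<le> l powr (1 - p)" using False l p by (intro powr_mono2') auto
    then have "x powr p * x powr (1 - p) \<le> x powr p * l powr (1 - p)" by (intro mult_left_mono) auto
    moreover have "x powr p * x powr (1 - p) = x" using x by (simp add: powr_add[symmetric])
    ultimately show ?thesis using l by simp
  qed (use that in \<open>simp add: add_increasing\<close>)
  have "(\<integral>\<^sup>+x\<in>A. ennreal (g x) \<partial>M) \<le> (\<integral>\<^sup>+x. ennreal (l powr (1 - p)) * (ennreal (g x powr p) * indicator A x) + ennreal l * indicator A x \<partial>M)"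
  proof (intro nn_integral_mono)
    fix x
    have "ennreal (g x) \<le> ennreal (g x powr p * l powr (1 - p) + l)" by (intro ennreal_leI pt g0)
    then show "ennreal (g x) * indicator A x \<le> ennreal (l powr (1 - p)) * (ennreal (g x powr p) * indicator A x) + ennreal l * indicator A x"
      using l by (auto simp: indicator_def ennreal_mult mult.commute)
  qed
  also have "\<dots> = ennreal (l powr (1 - p)) * (\<integral>\<^sup>+x\<in>A. ennreal (g x powr p) \<partial>M) + ennreal l * emeasure M A"
    by (subst nn_integral_add, measurable, subst nn_integral_cmult, measurable, subst nn_integral_cmult_indicator, measurable)
  also have "\<dots> \<le> ennreal (l powr (1 - p)) * ennreal (B powr p) + ennreal l * ennreal m"
    by (intro add_mono mult_left_mono I A) auto
  also have "\<dots> = ennreal (l powr (1 - p) * B powr p + l * m)"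
    using l m by (simp add: ennreal_mult[symmetric])
  also have "l powr (1 - p) * B powr p + l * m = 2 * B * m powr (1 - 1 / p)"
  proof -
    have "l powr (1 - p) * B powr p = (B powr (1 - p) * B powr p) * m powr (- 1 / p * (1 - p))"
      using B m by (simp add: l_def powr_mult powr_powr)
    also have "B powr (1 - p) * B powr p = B" using B by (simp add: powr_add[symmetric])
    also have "- 1 / p * (1 - p) = 1 - 1 / p" using p by (simp add: field_simps)
    finally have 1: "l powr (1 - p) * B powr p = B * m powr (1 - 1 / p)" .
    have "l * m = B * (m powr (- 1 / p) * m powr 1)" using m by (simp add: l_def)
    also have "\<dots> = B * m powr (1 - 1 / p)" by (subst powr_add[symmetric]) simp
    finally show ?thesis using 1 by simp
  qed
  finally show ?thesis .
qed

subsection \<open>Compactness in measure\<close>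

lemma borel_measurable_mollify [measurable]:
  fixes v :: "'a::euclidean_space \<Rightarrow> real"
  assumes [measurable]: "v \<in> borel_measurable borel"
  shows "mollify \<epsilon> v \<in> borel_measurable borel"
  unfolding mollify_def by measurable

text \<open>The bound of \<open>kernel_near\<close> at radius \<epsilon>, divided by the mass of the
  unit bump. The type argument only carries the dimension.\<close>

definition moll_error :: "'a::euclidean_space itself \<Rightarrow> real \<Rightarrow> real \<Rightarrow> real \<Rightarrow> real" where
  "moll_error _ C \<alpha> \<epsilon> = C * \<epsilon> powr (\<alpha> - real DIM('a) + 1) / (\<alpha> - real DIM('a) + 1) / (\<integral>y. bump 1 1 (0::'a) y \<partial>lborel)"

context weak_growth
begin

text \<open>\<open>N\<close> may be singular, so almost everywhere statements for Lebesgue measure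
  are of no use. Instead the mollification error at \<open>x\<close> is an average of increments
  along segments of length at most \<epsilon>, and integrating over \<open>x\<close> brings in only
  the near part of the kernel. The radius \<open>2 * \<epsilon>\<close> leaves room for such a
  segment and for a second kernel.\<close>

lemma mollify_error:
  assumes \<epsilon>: "\<epsilon> > 0" and K: "K \<in> sets borel" "\<And>x. x \<in> K \<Longrightarrow> cball x (2 * \<epsilon>) \<subseteq> \<Omega>"
    and B: "(\<integral>\<^sup>+y. ennreal (norm (G y)) \<partial>lborel) \<le> ennreal B" "B \<ge> 0"
  shows "(\<integral>\<^sup>+x\<in>K. ennreal \<bar>u x - mollify \<epsilon> u0 x\<bar> \<partial>N) \<le> ennreal (moll_error TYPE('a) C \<alpha> \<epsilon> * B)"
proof (rule ennreal_le_epsilon)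
  fix e :: real assume e: "e > 0"
  note [measurable] = K(1)
  define M0 where "M0 = (\<integral>y. bump 1 1 (0::'a) y \<partial>lborel)"
  have M0: "M0 > 0" unfolding M0_def by (rule integral_bump_pos) simp
  \<comment> \<open>Chosen so that the pointwise error \<open>2 * \<kappa>\<close>, integrated over
    \<open>K\<close>, is at most \<open>e\<close>.\<close>
  define \<kappa> where "\<kappa> = e / (2 * (measure N K + 1))"
  have \<kappa>: "\<kappa> > 0" using e by (simp add: \<kappa>_def add_nonneg_pos)
  obtain e2 where e2: "e2 > 0" "\<And>x y. x \<in> closure \<Omega> \<Longrightarrow> y \<in> closure \<Omega> \<Longrightarrow> dist x y < e2 \<Longrightarrow> \<bar>u x - u y\<bar> \<le> \<kappa>"
    using uniformly_continuous_u[OF \<kappa>] by blast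
  define \<sigma> where "\<sigma> = min \<epsilon> e2"
  have \<sigma>: "\<sigma> > 0" "\<sigma> \<le> \<epsilon>" "\<sigma> \<le> e2" using \<epsilon> e2 by (auto simp: \<sigma>_def)
  \<comment> \<open>A second, finer mollification stands in for \<open>u\<close> along the segments.
    Its scale depends on \<open>u\<close> through the modulus of continuity, but it does not enter
    the final bound, so the estimate is uniform along a sequence.\<close>
  define v where "v = mollify \<sigma> u0"
  have v_meas [measurable]: "v \<in> borel_measurable borel" by (simp add: v_def)
  define g where "g y = (\<integral>\<^sup>+x. ennreal (norm (G x) * mol \<sigma> y x) \<partial>lborel)" for y
  have g_meas [measurable]: "g \<in> borel_measurable borel" unfolding g_def by measurable
  have near: "cball y \<sigma> \<subseteq> \<Omega>" if "x \<in> K" "dist x y \<le> \<epsilon>" for x y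
  proof
    fix w assume "w \<in> cball y \<sigma>"
    then have "dist x w \<le> 2 * \<epsilon>" using that \<sigma> dist_triangle[of x w y] by auto
    then show "w \<in> \<Omega>" using K(2)[OF that(1)] by auto
  qed
  have close: "\<bar>v y - u y\<bar> \<le> \<kappa>" if "x \<in> K" "dist x y \<le> \<epsilon>" for x y
    unfolding v_def
  proof (rule mollify_close[OF \<sigma>(1) near[OF that]])
    fix w assume "w \<in> \<Omega>" "dist y w < \<sigma>"
    moreover have "y \<in> \<Omega>" using near[OF that] \<sigma> by auto
    ultimately show "\<bar>u y - u w\<bar> \<le> \<kappa>" using closure_subset[of \<Omega>] \<sigma> by (intro e2(2)) auto
  qed
  have point: "ennreal \<bar>u x - mollify \<epsilon> u0 x\<bar> \<le> ennreal (2 * \<kappa>) +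
      ennreal (1 / M0) * (\<integral>\<^sup>+\<theta>\<in>ball 0 1. (\<integral>\<^sup>+t\<in>{0<..\<epsilon>}. g (x + t *\<^sub>R \<theta>) \<partial>lborel) \<partial>lborel)" if x: "x \<in> K" for x
  proof -
    have i: "integrable lborel (\<lambda>y. u0 y * mol \<epsilon> x y)" "integrable lborel (\<lambda>y. u x * mol \<epsilon> x y)"
      using integrable_mult_mol[OF \<epsilon> integrable_u0] integrable_mol[OF \<epsilon>] by auto
    have "u x - mollify \<epsilon> u0 x = (\<integral>y. (u x - u0 y) * mol \<epsilon> x y \<partial>lborel)"
      using i integral_mol[OF \<epsilon>, of x] by (simp add: mollify_def left_diff_distrib)
    moreover have "integrable lborel (\<lambda>y. (u x - u0 y) * mol \<epsilon> x y)"
      using i by (simp add: left_diff_distrib)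
    ultimately have "ennreal \<bar>u x - mollify \<epsilon> u0 x\<bar> \<le> (\<integral>\<^sup>+y. ennreal (norm ((u x - u0 y) * mol \<epsilon> x y)) \<partial>lborel)"
      using integral_norm_bound_ennreal[of lborel "\<lambda>y. (u x - u0 y) * mol \<epsilon> x y"] by simp
    also have "\<dots> \<le> (\<integral>\<^sup>+y. ennreal (2 * \<kappa>) * ennreal (mol \<epsilon> x y) +
        ennreal (1 / M0) * (ennreal \<bar>v x - v y\<bar> * (if dist x y < \<epsilon> then ennreal (1 / \<epsilon> ^ DIM('a)) else 0)) \<partial>lborel)"
    proof (intro nn_integral_mono)
      fix y
      show "ennreal (norm ((u x - u0 y) * mol \<epsilon> x y)) \<le> ennreal (2 * \<kappa>) * ennreal (mol \<epsilon> x y) +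
        ennreal (1 / M0) * (ennreal \<bar>v x - v y\<bar> * (if dist x y < \<epsilon> then ennreal (1 / \<epsilon> ^ DIM('a)) else 0))"
      proof (cases "dist x y < \<epsilon>")
        case True
        have "y \<in> \<Omega>" using K(2)[OF x] True \<epsilon> by auto
        then have "\<bar>u x - u0 y\<bar> \<le> 2 * \<kappa> + \<bar>v x - v y\<bar>"
          using close[OF x, of x] close[OF x, of y] True \<epsilon> by (auto simp: u0_def)
        then have "norm ((u x - u0 y) * mol \<epsilon> x y) \<le> (2 * \<kappa> + \<bar>v x - v y\<bar>) * mol \<epsilon> x y"
          using mol_nonneg[OF \<epsilon>, of x y] by (simp add: abs_mult mult_right_mono)
        also have "\<dots> = 2 * \<kappa> * mol \<epsilon> x y + \<bar>v x - v y\<bar> * mol \<epsilon> x y" by (rule distrib_right)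
        also have "\<dots> \<le> 2 * \<kappa> * mol \<epsilon> x y + \<bar>v x - v y\<bar> * (1 / (\<epsilon> ^ DIM('a) * M0))"
          unfolding M0_def by (intro add_left_mono mult_left_mono mol_le[OF \<epsilon>]) auto
        also have "\<dots> = 2 * \<kappa> * mol \<epsilon> x y + 1 / M0 * (\<bar>v x - v y\<bar> * (1 / \<epsilon> ^ DIM('a)))" by (simp add: mult_ac)
        finally have "ennreal (norm ((u x - u0 y) * mol \<epsilon> x y)) \<le> ennreal (2 * \<kappa> * mol \<epsilon> x y + 1 / M0 * (\<bar>v x - v y\<bar> * (1 / \<epsilon> ^ DIM('a))))"
          by (rule ennreal_leI)
        also have "\<dots> = ennreal (2 * \<kappa> * mol \<epsilon> x y) + ennreal (1 / M0 * (\<bar>v x - v y\<bar> * (1 / \<epsilon> ^ DIM('a))))"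
          using \<kappa> M0 \<epsilon> mol_nonneg[OF \<epsilon>, of x y] by (intro ennreal_plus) auto
        also have "ennreal (2 * \<kappa> * mol \<epsilon> x y) = ennreal (2 * \<kappa>) * ennreal (mol \<epsilon> x y)"
          using \<kappa> mol_nonneg[OF \<epsilon>, of x y] by (intro ennreal_mult) auto
        also have "ennreal (1 / M0 * (\<bar>v x - v y\<bar> * (1 / \<epsilon> ^ DIM('a)))) = ennreal (1 / M0) * (ennreal \<bar>v x - v y\<bar> * ennreal (1 / \<epsilon> ^ DIM('a)))"
          using M0 \<epsilon> by (subst ennreal_mult, simp, simp, subst ennreal_mult) auto
        finally show ?thesis using True by simp
      qed (simp add: mol_eq_0[OF \<epsilon>])
    qed
    also have "\<dots> = ennreal (2 * \<kappa>) + ennreal (1 / M0) *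
        (\<integral>\<^sup>+y. ennreal \<bar>v x - v y\<bar> * (if dist x y < \<epsilon> then ennreal (1 / \<epsilon> ^ DIM('a)) else 0) \<partial>lborel)"
      by (subst nn_integral_add, measurable, subst nn_integral_cmult, measurable, subst nn_integral_cmult, measurable)
        (simp add: nn_integral_mol[OF \<epsilon>])
    also have "(\<integral>\<^sup>+y. ennreal \<bar>v x - v y\<bar> * (if dist x y < \<epsilon> then ennreal (1 / \<epsilon> ^ DIM('a)) else 0) \<partial>lborel) =
        (\<integral>\<^sup>+\<theta>\<in>ball 0 1. ennreal \<bar>v x - v (x + \<epsilon> *\<^sub>R \<theta>)\<bar> \<partial>lborel)"
      by (rule nn_integral_ball_affine[symmetric, OF _ \<epsilon>]) measurable
    also have "\<dots> \<le> (\<integral>\<^sup>+\<theta>\<in>ball 0 1. (\<integral>\<^sup>+t\<in>{0<..\<epsilon>}. g (x + t *\<^sub>R \<theta>) \<partial>lborel) \<partial>lborel)"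
    proof (intro nn_integral_mono)
      fix \<theta> :: 'a
      show "ennreal \<bar>v x - v (x + \<epsilon> *\<^sub>R \<theta>)\<bar> * indicator (ball 0 1) \<theta> \<le>
        (\<integral>\<^sup>+t\<in>{0<..\<epsilon>}. g (x + t *\<^sub>R \<theta>) \<partial>lborel) * indicator (ball 0 1) \<theta>"
      proof (cases "\<theta> \<in> ball 0 1")
        case True
        have "ennreal \<bar>v (x + \<epsilon> *\<^sub>R \<theta>) - v (x + 0 *\<^sub>R \<theta>)\<bar> \<le> (\<integral>\<^sup>+t\<in>{0..\<epsilon>}. g (x + t *\<^sub>R \<theta>) \<partial>lborel)"
          unfolding v_def g_def
        proof (rule mollify_line[OF \<sigma>(1)])
          fix t assume t: "0 \<le> t" "t \<le> \<epsilon>"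
          have "dist x (x + t *\<^sub>R \<theta>) = t * norm \<theta>" using t by (simp add: dist_norm)
          also have "\<dots> \<le> \<epsilon> * 1" using t True by (intro mult_mono) auto
          finally show "cball (x + t *\<^sub>R \<theta>) \<sigma> \<subseteq> \<Omega>" using near[OF x] by simp
        qed (use \<epsilon> True in auto)
        also have "\<dots> = (\<integral>\<^sup>+t\<in>{0<..\<epsilon>}. g (x + t *\<^sub>R \<theta>) \<partial>lborel)"
        proof (rule nn_integral_cong_AE)
          have "AE t in lborel. t \<noteq> (0::real)" by (rule AE_lborel_singleton)
          then show "AE t in lborel. g (x + t *\<^sub>R \<theta>) * indicator {0..\<epsilon>} t = g (x + t *\<^sub>R \<theta>) * indicator {0<..\<epsilon>} t"
            by eventually_elim (auto simp: indicator_def)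
        qed
        finally show ?thesis using True by (simp add: abs_minus_commute)
      qed simp
    qed
    finally show ?thesis by (simp add: add_left_mono mult_left_mono)
  qed
  define k where "k = C * \<epsilon> powr (\<alpha> - real DIM('a) + 1) / (\<alpha> - real DIM('a) + 1)"
  have k: "k \<ge> 0" using C \<alpha> by (simp add: k_def)
  have [measurable]: "ball (0::'a) 1 \<in> sets borel" by simp
  have "(\<integral>\<^sup>+x\<in>K. (\<integral>\<^sup>+\<theta>\<in>ball 0 1. (\<integral>\<^sup>+t\<in>{0<..\<epsilon>}. g (x + t *\<^sub>R \<theta>) \<partial>lborel) \<partial>lborel) \<partial>N) =
      (\<integral>\<^sup>+y. g y * (\<integral>\<^sup>+t\<in>{0<..\<epsilon>}. ennreal (1 / t ^ DIM('a)) * emeasure N (K \<inter> ball y t) \<partial>lborel) \<partial>lborel)"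
    by (rule ray_fubini) auto
  also have "\<dots> \<le> (\<integral>\<^sup>+y. g y * ennreal k \<partial>lborel)"
    unfolding k_def by (intro nn_integral_mono mult_left_mono kernel_near \<epsilon>) auto
  also have "\<dots> = (\<integral>\<^sup>+y. g y \<partial>lborel) * ennreal k" by (rule nn_integral_multc) measurable
  also have "\<dots> \<le> ennreal B * ennreal k"
    by (rule mult_right_mono) (use convolution_set_bound[OF \<sigma>(1), of G UNIV UNIV] B(1) in \<open>auto simp: g_def\<close>)
  finally have rays: "(\<integral>\<^sup>+x\<in>K. (\<integral>\<^sup>+\<theta>\<in>ball 0 1. (\<integral>\<^sup>+t\<in>{0<..\<epsilon>}. g (x + t *\<^sub>R \<theta>) \<partial>lborel) \<partial>lborel) \<partial>N) \<le> ennreal B * ennreal k" .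
  have "(\<integral>\<^sup>+x\<in>K. ennreal \<bar>u x - mollify \<epsilon> u0 x\<bar> \<partial>N) \<le>
      (\<integral>\<^sup>+x. ennreal (2 * \<kappa>) * indicator K x + ennreal (1 / M0) * ((\<integral>\<^sup>+\<theta>\<in>ball 0 1. (\<integral>\<^sup>+t\<in>{0<..\<epsilon>}. g (x + t *\<^sub>R \<theta>) \<partial>lborel) \<partial>lborel) * indicator K x) \<partial>N)"
    by (intro nn_integral_mono) (use point in \<open>auto simp: indicator_def\<close>)
  also have "\<dots> = ennreal (2 * \<kappa>) * emeasure N K + ennreal (1 / M0) *
      (\<integral>\<^sup>+x\<in>K. (\<integral>\<^sup>+\<theta>\<in>ball 0 1. (\<integral>\<^sup>+t\<in>{0<..\<epsilon>}. g (x + t *\<^sub>R \<theta>) \<partial>lborel) \<partial>lborel) \<partial>N)"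
    by (subst nn_integral_add, measurable, subst nn_integral_cmult, measurable, subst nn_integral_cmult_indicator, measurable)
  also have "\<dots> \<le> ennreal (2 * \<kappa>) * emeasure N K + ennreal (1 / M0) * (ennreal B * ennreal k)"
    by (intro add_left_mono mult_left_mono rays) auto
  also have "ennreal (2 * \<kappa>) * emeasure N K + ennreal (1 / M0) * (ennreal B * ennreal k) = ennreal (2 * \<kappa> * measure N K) + ennreal (moll_error TYPE('a) C \<alpha> \<epsilon> * B)"
  proof -
    have 1: "moll_error TYPE('a) C \<alpha> \<epsilon> * B = 1 / M0 * (B * k)" by (simp add: moll_error_def k_def M0_def mult_ac)
    have 2: "ennreal (2 * \<kappa>) * emeasure N K = ennreal (2 * \<kappa> * measure N K)"
      using \<kappa> by (simp add: emeasure_eq_measure ennreal_mult)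
    show ?thesis unfolding 1 2 using M0 B k by (subst (3) ennreal_mult, simp, simp, subst ennreal_mult) auto
  qed
  also have "\<dots> \<le> ennreal e + ennreal (moll_error TYPE('a) C \<alpha> \<epsilon> * B)"
  proof (intro add_right_mono ennreal_leI)
    have "2 * \<kappa> * measure N K \<le> 2 * \<kappa> * (measure N K + 1)" using \<kappa> by (intro mult_left_mono) auto
    also have "\<dots> = e"
    proof -
      have "measure N K + 1 \<noteq> 0" using measure_nonneg[of N K] by linarith
      then show ?thesis unfolding \<kappa>_def by (simp del: distrib_left_numeral)
    qed
    finally show "2 * \<kappa> * measure N K \<le> e" .
  qed
  finally show "(\<integral>\<^sup>+x\<in>K. ennreal \<bar>u x - mollify \<epsilon> u0 x\<bar> \<partial>N) \<le> ennreal (moll_error TYPE('a) C \<alpha> \<epsilon> * B) + ennreal e"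
    by (simp add: add.commute)
qed

lemma moll_error_tendsto: "(moll_error TYPE('a) C \<alpha> \<longlongrightarrow> 0) (at_right 0)"
proof -
  have "((\<lambda>\<epsilon>. \<epsilon> powr (\<alpha> - real DIM('a) + 1)) \<longlongrightarrow> 0) (at_right 0)"
    using \<alpha> by (intro tendsto_zero_powrI[where b = "\<alpha> - real DIM('a) + 1"] tendsto_intros)
      (auto simp: eventually_at_right_less intro: eventually_mono[OF eventually_at_right_less[of 0]])
  then have "((\<lambda>\<epsilon>. C * \<epsilon> powr (\<alpha> - real DIM('a) + 1) / (\<alpha> - real DIM('a) + 1) / (\<integral>y. bump 1 1 (0::'a) y \<partial>lborel)) \<longlongrightarrow>
     C * 0 / (\<alpha> - real DIM('a) + 1) / (\<integral>y. bump 1 1 (0::'a) y \<partial>lborel)) (at_right 0)"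
    using \<alpha> integral_bump_pos[of 1 "0::'a"] by (intro tendsto_intros) auto
  then show ?thesis by (simp add: moll_error_def[abs_def])
qed

end

lemma uniform_Cauchy_subsequence:
  fixes w :: "nat \<Rightarrow> 'a::euclidean_space \<Rightarrow> real"
  assumes K: "compact K" and L: "\<And>k x y. \<bar>w k x - w k y\<bar> \<le> L * dist x y" and B: "\<And>k x. \<bar>w k x\<bar> \<le> B"
  shows "\<exists>r. strict_mono (r :: nat \<Rightarrow> nat) \<and> (\<forall>e>0. \<exists>M. \<forall>k\<ge>M. \<forall>m\<ge>M. \<forall>x\<in>K. \<bar>w (r k) x - w (r m) x\<bar> < e)"
proof -
  obtain g and r :: "nat \<Rightarrow> nat" where r: "strict_mono r"
    and lim: "\<And>e. 0 < e \<Longrightarrow> \<exists>M. \<forall>n x. n \<ge> M \<and> x \<in> K \<longrightarrow> norm (w (r n) x - g x) < e"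
  proof (rule Arzela_Ascoli[OF K, of w B])
    show "norm (w n x) \<le> B" for n x using B by simp
    fix x and e :: real assume "0 < e"
    have "\<bar>w n x - w n y\<bar> < e" if "norm (x - y) < e / (\<bar>L\<bar> + 1)" for n y
    proof -
      have "\<bar>w n x - w n y\<bar> \<le> L * dist x y" by (rule L)
      also have "\<dots> \<le> (\<bar>L\<bar> + 1) * norm (x - y)" by (simp add: dist_norm mult_right_mono)
      also have "\<dots> < e" using that by (simp add: field_simps add_nonneg_pos)
      finally show ?thesis .
    qed
    then show "\<exists>d>0. \<forall>n y. y \<in> K \<and> norm (x - y) < d \<longrightarrow> norm (w n x - w n y) < e"
      using \<open>0 < e\<close> by (intro exI[of _ "e / (\<bar>L\<bar> + 1)"]) auto
  qed blast
  have "\<exists>M. \<forall>k\<ge>M. \<forall>m\<ge>M. \<forall>x\<in>K. \<bar>w (r k) x - w (r m) x\<bar> < e" if e: "e > 0" for e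
  proof -
    obtain M where M: "\<And>n x. n \<ge> M \<Longrightarrow> x \<in> K \<Longrightarrow> \<bar>w (r n) x - g x\<bar> < e / 2"
      using lim[OF half_gt_zero[OF e]] unfolding real_norm_def by blast
    have "\<bar>w (r k) x - w (r m) x\<bar> < e" if "k \<ge> M" "m \<ge> M" "x \<in> K" for k m x
      using M[OF that(1,3)] M[OF that(2,3)] by linarith
    then show ?thesis by blast
  qed
  with r show ?thesis by blast
qed

lemma compactness_in_measure:
  fixes u :: "nat \<Rightarrow> 'a::euclidean_space \<Rightarrow> real" and N :: "'a measure"
  assumes W: "\<And>k. weak_growth \<Omega> (u k) (G k) N C \<alpha>"
    and GB: "\<And>k. (\<integral>\<^sup>+y. ennreal (norm (G k y)) \<partial>lborel) \<le> ennreal B" and B: "B \<ge> 0"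
    and uB: "\<And>k. (\<integral>y. \<bar>weak_pair.u0 \<Omega> (u k) y\<bar> \<partial>lborel) \<le> B"
  shows "\<exists>s :: nat \<Rightarrow> nat. strict_mono s \<and> (\<forall>\<zeta>>0. \<forall>\<eta>>0. \<exists>M. \<forall>k\<ge>M. \<forall>m\<ge>M. measure N {x \<in> \<Omega>. \<zeta> < \<bar>u (s k) x - u (s m) x\<bar>} \<le> \<eta>)"
proof -
  interpret W: weak_growth \<Omega> "u k" "G k" N C \<alpha> for k by (rule W)
  define v where "v k = weak_pair.u0 \<Omega> (u k)" for k
  have v_meas [measurable]: "v k \<in> borel_measurable borel" for k unfolding v_def by (rule W.u0_measurable)
  obtain K where K: "\<And>n. compact (K n)" "\<And>n. K n \<subseteq> \<Omega>" "\<And>n. K n \<subseteq> interior (K (Suc n))" "\<Union>(range K) = \<Omega>"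
    using open_Union_compact_subsets[OF W.open_\<Omega>] by metis
  have K_borel [measurable]: "K n \<in> sets borel" for n using K(1) by (simp add: compact_imp_closed borel_closed)
  have \<Omega>_borel [measurable]: "\<Omega> \<in> sets borel" using W.open_\<Omega> by (simp add: borel_open)
  have K_mono: "incseq K"
    by (rule incseq_SucI) (use K(3) interior_subset in blast)
  \<comment> \<open>The L^1 error \<open>(1 / 4) ^ n\<close> is split evenly by Chebyshev: off a set
    of measure at most \<open>(1 / 2) ^ n\<close> the error is at most
    \<open>(1 / 2) ^ n\<close>.\<close>
  have "\<exists>\<epsilon>>0. (\<forall>x\<in>K n. cball x (2 * \<epsilon>) \<subseteq> \<Omega>) \<and> moll_error TYPE('a) C \<alpha> \<epsilon> * B \<le> (1 / 4) ^ n" for n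
  proof -
    obtain e where e: "e > 0" "\<And>x. x \<in> K n \<Longrightarrow> cball x e \<subseteq> \<Omega>"
      using compact_subset_open_imp_cball_epsilon_subset[OF K(1) W.open_\<Omega> K(2)] by (metis UN_subset_iff)
    have "((\<lambda>\<epsilon>. moll_error TYPE('a) C \<alpha> \<epsilon> * B) \<longlongrightarrow> 0 * B) (at_right 0)"
      by (intro tendsto_intros W.moll_error_tendsto)
    then have "\<forall>\<^sub>F \<epsilon> in at_right 0. moll_error TYPE('a) C \<alpha> \<epsilon> * B < (1 / 4) ^ n"
      by (intro order_tendstoD(2)) auto
    moreover have "\<forall>\<^sub>F \<epsilon> in at_right 0. \<epsilon> \<in> {0<..<e / 2}" using e by (intro eventually_at_right_real) auto
    ultimately have "\<forall>\<^sub>F \<epsilon> in at_right (0::real). moll_error TYPE('a) C \<alpha> \<epsilon> * B < (1 / 4) ^ n \<and> \<epsilon> \<in> {0<..<e / 2}"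
      by (rule eventually_conj)
    then obtain \<epsilon> where \<epsilon>: "moll_error TYPE('a) C \<alpha> \<epsilon> * B < (1 / 4) ^ n" "\<epsilon> \<in> {0<..<e / 2}"
      using eventually_happens'[OF trivial_limit_at_right_real] by blast
    have "cball x (2 * \<epsilon>) \<subseteq> \<Omega>" if "x \<in> K n" for x
      using e(2)[OF that] \<epsilon> by auto
    with \<epsilon> show ?thesis by (intro exI[of _ \<epsilon>]) auto
  qed
  then obtain \<epsilon> where \<epsilon>: "\<And>n. \<epsilon> n > (0::real)" "\<And>n x. x \<in> K n \<Longrightarrow> cball x (2 * \<epsilon> n) \<subseteq> \<Omega>"
    "\<And>n. moll_error TYPE('a) C \<alpha> (\<epsilon> n) * B \<le> (1 / 4) ^ n"
    by metis
  define w where "w n k = mollify (\<epsilon> n) (v k)" for n k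
  have w_meas [measurable]: "w n k \<in> borel_measurable borel" for n k unfolding w_def by measurable
  \<comment> \<open>The mollifications at scale \<epsilon> n are uniformly Cauchy on
    \<open>K n\<close> along \<open>s\<close>. This is inherited by subsequences, so one diagonal
    sequence can serve all \<open>n\<close>.\<close>
  define P where "P n s \<longleftrightarrow> (\<forall>e>0. \<exists>M. \<forall>k\<ge>M. \<forall>m\<ge>M. \<forall>x\<in>K n. \<bar>w n (s k) x - w n (s m) x\<bar> < e)" for n and s :: "nat \<Rightarrow> nat"
  have P_ex: "\<exists>r. strict_mono r \<and> P n (s \<circ> r)" if "strict_mono s" for n and s :: "nat \<Rightarrow> nat"
  proof -
    obtain L where L: "L \<ge> 0" "\<And>v x x'. integrable lborel v \<Longrightarrow>
      \<bar>mollify (\<epsilon> n) v x - mollify (\<epsilon> n) v (x'::'a)\<bar> \<le> L * (\<integral>y. \<bar>v y\<bar> \<partial>lborel) * dist x x'"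
      using mollify_lipschitz[OF \<epsilon>(1)] by blast
    have vi: "integrable lborel (v k)" for k unfolding v_def by (rule W.integrable_u0)
    have vB: "(\<integral>y. \<bar>v k y\<bar> \<partial>lborel) \<le> B" for k unfolding v_def by (rule uB)
    define c where "c = 1 / (\<epsilon> n ^ DIM('a) * (\<integral>y. bump 1 1 (0::'a) y \<partial>lborel))"
    have c: "c \<ge> 0" using \<epsilon>(1)[of n] integral_bump_pos[of 1 "0::'a"] by (simp add: c_def)
    have "\<exists>r. strict_mono (r :: nat \<Rightarrow> nat) \<and> (\<forall>e>0. \<exists>M. \<forall>k\<ge>M. \<forall>m\<ge>M. \<forall>x\<in>K n. \<bar>w n (s (r k)) x - w n (s (r m)) x\<bar> < e)"
    proof (rule uniform_Cauchy_subsequence[OF K(1)])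
      fix k and x y :: 'a
      have "\<bar>w n (s k) x - w n (s k) y\<bar> \<le> L * (\<integral>y. \<bar>v (s k) y\<bar> \<partial>lborel) * dist x y"
        unfolding w_def by (rule L(2)[OF vi])
      also have "\<dots> \<le> L * B * dist x y" by (intro mult_right_mono mult_left_mono vB L) auto
      finally show "\<bar>w n (s k) x - w n (s k) y\<bar> \<le> L * B * dist x y" .
      have "\<bar>w n (s k) x\<bar> \<le> c * (\<integral>y. \<bar>v (s k) y\<bar> \<partial>lborel)"
        unfolding w_def c_def by (rule mollify_bound[OF \<epsilon>(1) vi])
      also have "\<dots> \<le> c * B" by (intro mult_left_mono vB c)
      finally show "\<bar>w n (s k) x\<bar> \<le> c * B" .
    qed
    then show ?thesis by (simp add: P_def comp_def)
  qed
  interpret S: subseqs P by unfold_locales (rule P_ex)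
  define s where "s = S.diagseq"
  have s: "strict_mono s" unfolding s_def by (rule S.subseq_diagseq)
  have Ps: "P n s" for n
  proof -
    \<comment> \<open>The diagonal sequence is known to satisfy the property only after its first
      \<open>Suc n\<close> terms; a Cauchy property ignores finitely many terms, so shifting back is
      harmless.\<close>
    have "P n (S.diagseq \<circ> (+) (Suc n))"
    proof (rule S.diagseq_holds)
      fix r t and n :: nat assume r: "strict_mono (r :: nat \<Rightarrow> nat)" and t: "P n t"
      show "P n (t \<circ> r)"
        unfolding P_def
      proof (intro allI impI)
        fix e :: real assume "e > 0"
        then obtain M where "\<forall>k\<ge>M. \<forall>m\<ge>M. \<forall>x\<in>K n. \<bar>w n (t k) x - w n (t m) x\<bar> < e" using t by (auto simp: P_def)
        then show "\<exists>M. \<forall>k\<ge>M. \<forall>m\<ge>M. \<forall>x\<in>K n. \<bar>w n ((t \<circ> r) k) x - w n ((t \<circ> r) m) x\<bar> < e"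
          using order_trans[OF _ seq_suble[OF r]] by (auto intro!: exI[of _ M])
      qed
    qed
    then have shift: "\<exists>M. \<forall>k\<ge>M. \<forall>m\<ge>M. \<forall>x\<in>K n. \<bar>w n (s (Suc n + k)) x - w n (s (Suc n + m)) x\<bar> < e" if "e > 0" for e
      using that by (simp add: P_def s_def)
    show ?thesis
      unfolding P_def
    proof (intro allI impI)
      fix e :: real assume "e > 0"
      then obtain M where M: "\<And>k m x. k \<ge> M \<Longrightarrow> m \<ge> M \<Longrightarrow> x \<in> K n \<Longrightarrow> \<bar>w n (s (Suc n + k)) x - w n (s (Suc n + m)) x\<bar> < e"
        using shift by blast
      show "\<exists>M. \<forall>k\<ge>M. \<forall>m\<ge>M. \<forall>x\<in>K n. \<bar>w n (s k) x - w n (s m) x\<bar> < e"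
      proof (intro exI[of _ "M + Suc n"] allI impI ballI)
        fix k m x assume "M + Suc n \<le> k" "M + Suc n \<le> m" "x \<in> K n"
        then show "\<bar>w n (s k) x - w n (s m) x\<bar> < e"
          using M[of "k - Suc n" "m - Suc n" x] by simp
      qed
    qed
  qed
  have err: "measure N {x \<in> K n. (1 / 2) ^ n < \<bar>u k x - w n k x\<bar>} \<le> (1 / 2) ^ n" for n k
  proof -
    have eq: "u k x = v k x" if "x \<in> K n" for x using subsetD[OF K(2) that] by (simp add: v_def W.u0_def)
    have set_eq: "{x \<in> K n. (1 / 2) ^ n < \<bar>u k x - w n k x\<bar>} = {x \<in> K n. (1 / 2) ^ n < \<bar>v k x - w n k x\<bar>}" (is "_ = ?A")
      using eq by auto
    have "?A = K n \<inter> {x \<in> space borel. (1 / 2) ^ n < \<bar>v k x - w n k x\<bar>}" by auto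
    also have "\<dots> \<in> sets borel" by (intro sets.Int K_borel) measurable
    finally have A [measurable]: "?A \<in> sets borel" .
    have "ennreal ((1 / 2) ^ n) * emeasure N ?A = (\<integral>\<^sup>+x\<in>?A. ennreal ((1 / 2) ^ n) \<partial>N)"
      by (rule nn_integral_cmult_indicator[symmetric]) measurable
    also have "\<dots> \<le> (\<integral>\<^sup>+x\<in>K n. ennreal \<bar>u k x - mollify (\<epsilon> n) (weak_pair.u0 \<Omega> (u k)) x\<bar> \<partial>N)"
      using eq by (intro nn_integral_mono) (auto simp: indicator_def w_def v_def intro!: ennreal_leI)
    also have "\<dots> \<le> ennreal (moll_error TYPE('a) C \<alpha> (\<epsilon> n) * B)"
      by (rule W.mollify_error[OF \<epsilon>(1) K_borel \<epsilon>(2) GB B])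
    also have "\<dots> \<le> ennreal ((1 / 4) ^ n)" by (intro ennreal_leI \<epsilon>(3))
    finally have "ennreal ((1 / 2) ^ n * measure N ?A) \<le> ennreal ((1 / 4) ^ n)"
      by (simp add: W.emeasure_eq_measure ennreal_mult)
    then have "(1 / 2) ^ n * measure N ?A \<le> (1 / 4) ^ n" by (subst (asm) ennreal_le_iff) auto
    also have "(1 / 4 :: real) ^ n = (1 / 2) ^ n * (1 / 2) ^ n" by (simp add: power_mult_distrib[symmetric])
    finally show ?thesis unfolding set_eq by simp
  qed
  have exh: "(\<lambda>n. measure N (\<Omega> - K n)) \<longlonglongrightarrow> 0"
  proof -
    have "(\<lambda>n. measure N (\<Omega> - K n)) \<longlonglongrightarrow> measure N (\<Inter>n. \<Omega> - K n)"
      by (rule W.finite_Lim_measure_decseq) (use K_mono in \<open>auto simp: W.sets_N decseq_def incseq_def\<close>)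
    moreover have "(\<Inter>n. \<Omega> - K n) = {}" using K(4) by blast
    ultimately show ?thesis by (simp only: measure_empty)
  qed
  have "\<exists>M. \<forall>k\<ge>M. \<forall>m\<ge>M. measure N {x \<in> \<Omega>. \<zeta> < \<bar>u (s k) x - u (s m) x\<bar>} \<le> \<eta>" if \<zeta>: "\<zeta> > 0" and \<eta>: "\<eta> > 0" for \<zeta> \<eta>
  proof -
    have half: "(\<lambda>n. (1 / 2 :: real) ^ n) \<longlonglongrightarrow> 0" by (rule LIMSEQ_power_zero) simp
    \<comment> \<open>Three errors of size \<open>(1 / 2) ^ n\<close>: two mollification errors and
      the distance between the mollified functions.\<close>
    have "(\<lambda>n. 3 * (1 / 2 :: real) ^ n) \<longlonglongrightarrow> 3 * 0" by (intro tendsto_intros half)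
    then have "\<forall>\<^sub>F n in sequentially. 3 * (1 / 2 :: real) ^ n < \<zeta>" using \<zeta> by (intro order_tendstoD(2)) auto
    moreover have "(\<lambda>n. measure N (\<Omega> - K n) + 2 * (1 / 2 :: real) ^ n) \<longlonglongrightarrow> 0 + 2 * 0" by (intro tendsto_intros exh half)
    then have "\<forall>\<^sub>F n in sequentially. measure N (\<Omega> - K n) + 2 * (1 / 2 :: real) ^ n < \<eta>" using \<eta> by (intro order_tendstoD(2)) auto
    ultimately obtain n where n: "3 * (1 / 2 :: real) ^ n < \<zeta>" "measure N (\<Omega> - K n) + 2 * (1 / 2 :: real) ^ n < \<eta>"
      using eventually_happens'[OF _ eventually_conj] trivial_limit_sequentially by blast
    have "(1 / 2 :: real) ^ n > 0" by simp
    then obtain M where M: "\<And>k m x. k \<ge> M \<Longrightarrow> m \<ge> M \<Longrightarrow> x \<in> K n \<Longrightarrow> \<bar>w n (s k) x - w n (s m) x\<bar> < (1 / 2) ^ n"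
      using Ps[of n] unfolding P_def by meson
    have "measure N {x \<in> \<Omega>. \<zeta> < \<bar>u (s k) x - u (s m) x\<bar>} \<le> \<eta>" if km: "k \<ge> M" "m \<ge> M" for k m
    proof -
      define A where "A k = {x \<in> K n. (1 / 2) ^ n < \<bar>u k x - w n k x\<bar>}" for k
      have A: "A k \<in> sets N" for k
      proof -
        have "A k = {x \<in> K n. (1 / 2) ^ n < \<bar>v k x - w n k x\<bar>}"
          using subsetD[OF K(2)[of n]] by (auto simp: A_def v_def W.u0_def)
        also have "\<dots> = K n \<inter> {x \<in> space borel. (1 / 2) ^ n < \<bar>v k x - w n k x\<bar>}" by auto
        also have "\<dots> \<in> sets borel" by (intro sets.Int K_borel) measurable
        finally show ?thesis by (simp add: W.sets_N)
      qed
      have sub: "{x \<in> \<Omega>. \<zeta> < \<bar>u (s k) x - u (s m) x\<bar>} \<subseteq> (\<Omega> - K n) \<union> (A (s k) \<union> A (s m))"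
      proof
        fix x assume x: "x \<in> {x \<in> \<Omega>. \<zeta> < \<bar>u (s k) x - u (s m) x\<bar>}"
        show "x \<in> (\<Omega> - K n) \<union> (A (s k) \<union> A (s m))"
        proof (rule ccontr)
          assume neg: "x \<notin> (\<Omega> - K n) \<union> (A (s k) \<union> A (s m))"
          then have xK: "x \<in> K n" using x by blast
          then have "\<bar>u (s k) x - w n (s k) x\<bar> \<le> (1 / 2) ^ n" "\<bar>u (s m) x - w n (s m) x\<bar> \<le> (1 / 2) ^ n"
            using neg by (auto simp: A_def)
          then show False using M[OF km xK] x n(1) by auto
        qed
      qed
      have "measure N {x \<in> \<Omega>. \<zeta> < \<bar>u (s k) x - u (s m) x\<bar>} \<le> measure N ((\<Omega> - K n) \<union> (A (s k) \<union> A (s m)))"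
        by (rule W.finite_measure_mono[OF sub]) (use A in \<open>auto simp: W.sets_N\<close>)
      also have "\<dots> \<le> measure N (\<Omega> - K n) + measure N (A (s k) \<union> A (s m))"
        by (rule measure_Un_le) (use A in \<open>auto simp: W.sets_N\<close>)
      also have "measure N (A (s k) \<union> A (s m)) \<le> measure N (A (s k)) + measure N (A (s m))"
        by (rule measure_Un_le) (use A in auto)
      finally show ?thesis using err[of n "s k"] err[of n "s m"] n(2) unfolding A_def[symmetric] by linarith
    qed
    then show ?thesis by blast
  qed
  with s show ?thesis by blast
qed

subsection \<open>Distribution functions\<close>

text \<open>On the shell between \<open>2 ^ k\<close> and \<open>2 ^ Suc k\<close> the integrand is
  at most its value at the outer radius; values below 1 are covered by the first term.\<close>

lemma (in finite_measure) nn_integral_dyadic_le: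
  fixes f :: "'a \<Rightarrow> real" and \<Theta> :: "real \<Rightarrow> real"
  assumes [measurable]: "f \<in> borel_measurable M" and f: "\<And>x. f x \<ge> 0"
    and \<Theta>: "\<And>s t. 0 \<le> s \<Longrightarrow> s \<le> t \<Longrightarrow> \<Theta> s \<le> \<Theta> t" "\<Theta> 0 \<ge> 0"
    and T: "\<And>k. measure M {x \<in> space M. 2 ^ k \<le> f x} \<le> T k"
  shows "(\<integral>\<^sup>+x. ennreal (\<Theta> (f x)) \<partial>M) \<le> ennreal (\<Theta> 1 * measure M (space M)) + (\<Sum>k. ennreal (\<Theta> (2 ^ Suc k) * T k))"
proof -
  have \<Theta>0: "\<Theta> t \<ge> 0" if "t \<ge> 0" for t using \<Theta>(1)[of 0 t] \<Theta>(2) that by simp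
  have T0: "T k \<ge> 0" for k using T[of k] measure_nonneg order_trans by blast
  have "(\<integral>\<^sup>+x. ennreal (\<Theta> (f x)) \<partial>M) \<le>
      (\<integral>\<^sup>+x. ennreal (\<Theta> 1) + (\<Sum>k. ennreal (\<Theta> (2 ^ Suc k)) * indicator {x \<in> space M. 2 ^ k \<le> f x} x) \<partial>M)"
  proof (intro nn_integral_mono)
    fix x assume x: "x \<in> space M"
    show "ennreal (\<Theta> (f x)) \<le> ennreal (\<Theta> 1) + (\<Sum>k. ennreal (\<Theta> (2 ^ Suc k)) * indicator {x \<in> space M. 2 ^ k \<le> f x} x)"
    proof (cases "f x < 1")
      case True
      then have "ennreal (\<Theta> (f x)) \<le> ennreal (\<Theta> 1)" using f[of x] \<Theta>(1)[of "f x" 1] by (intro ennreal_leI) auto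
      then show ?thesis by (rule order_trans) simp
    next
      case False
      obtain m where m: "f x < 2 ^ m" using real_arch_pow[of 2 "f x"] by auto
      define k where "k = (LEAST m. f x < 2 ^ m)"
      have k: "f x < 2 ^ k" unfolding k_def by (rule LeastI[of _ m]) (rule m)
      have "k \<noteq> 0" using k False by (intro notI) simp
      then obtain j where j: "k = Suc j" by (cases k) auto
      have "2 ^ j \<le> f x" using not_less_Least[of j "\<lambda>m. f x < 2 ^ m"] j by (simp add: k_def)
      then have "ennreal (\<Theta> (f x)) \<le> ennreal (\<Theta> (2 ^ Suc j)) * indicator {x \<in> space M. 2 ^ j \<le> f x} x"
        using x k j f[of x] by (auto intro!: ennreal_leI \<Theta>(1))
      also have "\<dots> \<le> (\<Sum>k. ennreal (\<Theta> (2 ^ Suc k)) * indicator {x \<in> space M. 2 ^ k \<le> f x} x)"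
      proof -
        define g where "g k = ennreal (\<Theta> (2 ^ Suc k)) * indicator {x \<in> space M. 2 ^ k \<le> f x} x" for k
        have "sum g {j} \<le> suminf g" by (rule sum_le_suminf) auto
        then have "g j \<le> suminf g" by simp
        then show ?thesis unfolding g_def[abs_def] .
      qed
      finally show ?thesis by (rule order_trans) simp
    qed
  qed
  also have "\<dots> = ennreal (\<Theta> 1) * emeasure M (space M) + (\<Sum>k. ennreal (\<Theta> (2 ^ Suc k)) * emeasure M {x \<in> space M. 2 ^ k \<le> f x})"
    by (subst nn_integral_add, measurable, subst nn_integral_suminf, measurable) (simp add: nn_integral_cmult_indicator)
  also have "\<dots> \<le> ennreal (\<Theta> 1 * measure M (space M)) + (\<Sum>k. ennreal (\<Theta> (2 ^ Suc k) * T k))"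
  proof (intro add_mono suminf_le)
    show "ennreal (\<Theta> 1) * emeasure M (space M) \<le> ennreal (\<Theta> 1 * measure M (space M))"
      using \<Theta>0[of 1] by (simp add: emeasure_eq_measure ennreal_mult)
    fix k
    have "emeasure M {x \<in> space M. 2 ^ k \<le> f x} \<le> ennreal (T k)"
      unfolding emeasure_eq_measure by (intro ennreal_leI T)
    then show "ennreal (\<Theta> (2 ^ Suc k)) * emeasure M {x \<in> space M. 2 ^ k \<le> f x} \<le> ennreal (\<Theta> (2 ^ Suc k) * T k)"
      using \<Theta>0[of "2 ^ Suc k"] T0[of k] by (subst ennreal_mult) (auto intro: mult_left_mono)
  qed auto
  finally show ?thesis .
qed

text \<open>Lebesgue measure on \<Omega> satisfies the growth condition with exponent n, so the
  level set inequality can be applied to it before it is applied to the given measure.\<close>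

lemma ball_growth_lborel:
  fixes \<Omega> :: "'a::euclidean_space set"
  assumes [measurable]: "\<Omega> \<in> sets borel" and fin: "emeasure lborel \<Omega> < \<infinity>" and dim: "2 \<le> DIM('a)"
  shows "ball_growth (density lborel (indicator \<Omega>)) (unit_ball_vol (real DIM('a))) (real DIM('a))"
    and "\<And>A. A \<in> sets borel \<Longrightarrow> measure (density lborel (indicator \<Omega>)) A = measure lborel (A \<inter> \<Omega>)"
proof -
  have em: "emeasure (density lborel (indicator \<Omega>)) A = emeasure lborel (A \<inter> \<Omega>)" if [measurable]: "A \<in> sets borel" for A
  proof -
    have "emeasure (density lborel (indicator \<Omega>)) A = (\<integral>\<^sup>+x. indicator \<Omega> x * indicator A x \<partial>lborel)"
      by (rule emeasure_density) auto
    also have "\<dots> = (\<integral>\<^sup>+x. indicator (A \<inter> \<Omega>) x \<partial>lborel)"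
      by (rule nn_integral_cong) (auto simp: indicator_def)
    finally show ?thesis by simp
  qed
  then show "measure (density lborel (indicator \<Omega>)) A = measure lborel (A \<inter> \<Omega>)" if "A \<in> sets borel" for A
    using that by (simp add: measure_def)
  show "ball_growth (density lborel (indicator \<Omega>)) (unit_ball_vol (real DIM('a))) (real DIM('a))"
  proof (rule ball_growth.intro)
    show "finite_measure (density lborel (indicator \<Omega>))"
      using em[of UNIV] fin by (intro finite_measureI) simp
    fix y :: 'a and t :: real assume t: "t > 0"
    have "emeasure (density lborel (indicator \<Omega>)) (ball y t) \<le> emeasure lborel (ball y t)"
      by (subst em) (auto intro: emeasure_mono)
    also have "\<dots> = ennreal (unit_ball_vol (real DIM('a)) * t powr real DIM('a))"
    proof -
      have "emeasure lborel (ball y t) \<noteq> top" using emeasure_bounded_finite[of "ball y t"] by auto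
      then show ?thesis using t by (simp add: emeasure_eq_ennreal_measure content_ball powr_realpow)
    qed
    finally show "emeasure (density lborel (indicator \<Omega>)) (ball y t) \<le> ennreal (unit_ball_vol (real DIM('a)) * t powr real DIM('a))" .
  qed (use dim in auto)
qed

section \<open>One level step, and power decay for p < n\<close>

context weak_growth
begin

text \<open>Hoelder's inequality on the band. Only the energy inside the band enters; this
  localisation is what the case p = n lives on, while \<open>level_step\<close> uses the total
  energy.\<close>

lemma level_step_band:
  assumes p: "1 < p"
    and B: "B > 0" "(\<integral>\<^sup>+y\<in>{y \<in> \<Omega>. a < \<bar>u y\<bar> \<and> \<bar>u y\<bar> < b}. ennreal (norm (G y) powr p) \<partial>lborel) \<le> ennreal (B powr p)"
    and ab: "0 < a" "a < b" and m: "m > 0" "emeasure lborel {x \<in> \<Omega>. a \<le> \<bar>u x\<bar>} \<le> ennreal m"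
    and h: "hausdorff_outer (real DIM('a) - 1) {y \<in> frontier \<Omega>. a \<le> \<bar>u y\<bar>} \<le> ennreal h" "h \<ge> 0"
  shows "(b - a) * measure N {x \<in> \<Omega>. b \<le> \<bar>u x\<bar>} powr ((real DIM('a) - 1) / \<alpha>) \<le>
    level_const (real DIM('a)) C \<alpha> * (2 * B * m powr (1 - 1 / p) + (b - a) * h)"
proof (rule level_estimate[OF ab h])
  show "(\<integral>\<^sup>+y\<in>{y \<in> \<Omega>. a < \<bar>u y\<bar> \<and> \<bar>u y\<bar> < b}. ennreal (norm (G y)) \<partial>lborel) \<le> ennreal (2 * B * m powr (1 - 1 / p))"
  proof (rule nn_integral_Holder_set[OF _ _ _ p B(1) m(1) B(2)])
    have "emeasure lborel {y \<in> \<Omega>. a < \<bar>u y\<bar> \<and> \<bar>u y\<bar> < b} \<le> emeasure lborel {x \<in> \<Omega>. a \<le> \<bar>u x\<bar>}"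
      using superlevel_borel by (intro emeasure_mono) auto
    then show "emeasure lborel {y \<in> \<Omega>. a < \<bar>u y\<bar> \<and> \<bar>u y\<bar> < b} \<le> ennreal m" using m(2) by (rule order_trans)
  qed auto
qed (use B in auto)

lemma level_step:
  assumes p: "1 < p" and B: "B > 0" "(\<integral>\<^sup>+y. ennreal (norm (G y) powr p) \<partial>lborel) \<le> ennreal (B powr p)"
    and ab: "0 < a" "a < b" and m: "m > 0" "emeasure lborel {x \<in> \<Omega>. a \<le> \<bar>u x\<bar>} \<le> ennreal m"
    and h: "hausdorff_outer (real DIM('a) - 1) {y \<in> frontier \<Omega>. a \<le> \<bar>u y\<bar>} \<le> ennreal h" "h \<ge> 0"
  shows "(b - a) * measure N {x \<in> \<Omega>. b \<le> \<bar>u x\<bar>} powr ((real DIM('a) - 1) / \<alpha>) \<le>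
    level_const (real DIM('a)) C \<alpha> * (2 * B * m powr (1 - 1 / p) + (b - a) * h)"
proof (rule level_step_band[OF p B(1) _ ab m h])
  have "(\<integral>\<^sup>+y\<in>{y \<in> \<Omega>. a < \<bar>u y\<bar> \<and> \<bar>u y\<bar> < b}. ennreal (norm (G y) powr p) \<partial>lborel) \<le> (\<integral>\<^sup>+y. ennreal (norm (G y) powr p) \<partial>lborel)"
    by (intro nn_integral_mono) (auto simp: indicator_def)
  then show "(\<integral>\<^sup>+y\<in>{y \<in> \<Omega>. a < \<bar>u y\<bar> \<and> \<bar>u y\<bar> < b}. ennreal (norm (G y) powr p) \<partial>lborel) \<le> ennreal (B powr p)"
    using B(2) by (rule order_trans)
qed

end

text \<open>Insert a Lebesgue tail of order \<open>2 powr (- (k * s))\<close> into one level step.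
  The gradient term has the desired order iff s(1/p - 1/n) \<le> 1, the boundary term iff s(n - 1)/n
  \<le> r; these are the two upper bounds on \<open>s\<close>.\<close>

lemma dyadic_rhs_bound:
  fixes k :: nat
  assumes n: "2 \<le> n" and p: "1 < p" "p < n" and s: "0 < s" "s \<le> n * p / (n - p)" "s \<le> r * n / (n - 1)"
    and B: "B > 0" and H: "H > 0" and K: "K \<ge> 1"
  shows "2 * B * (K * 2 powr (- (real k * s))) powr (1 - 1 / p) + 2 ^ k * (H / 2 ^ k) powr r
    \<le> 2 ^ k * ((2 * B + H powr r) * K powr (1 - 1 / p) * 2 powr (- (real k * s) * ((n - 1) / n)))"
proof -
  define A where "A = (n - 1) / n"
  define q where "q = 1 - 1 / p"
  define E where "E = 2 powr (- (real k * s) * A)"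
  have "s * (1 / p - 1 / n) \<le> 1" using s(2) n p by (simp add: field_simps)
  then have "s * A \<le> 1 + s * q" using n p by (simp add: field_simps A_def q_def)
  then have "real k * (s * A) \<le> real k * (1 + s * q)" by (intro mult_left_mono) auto
  then have 1: "2 powr (- (real k * s) * q) \<le> 2 ^ k * E"
    unfolding E_def powr_realpow[of 2 k, simplified, symmetric] powr_add[symmetric] by (intro powr_mono) (auto simp: algebra_simps)
  have "s * A \<le> r" using s(3) n by (simp add: field_simps A_def)
  then have "real k * (s * A) \<le> real k * r" by (intro mult_left_mono) auto
  then have 2: "2 powr (- (real k * r)) \<le> E" unfolding E_def by (intro powr_mono) (auto simp: algebra_simps)
  have K1: "K powr q \<ge> 1" using K p by (intro ge_one_powr_ge_zero) (auto simp: q_def)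
  have "2 * B * (K * 2 powr (- (real k * s))) powr q = 2 * B * K powr q * 2 powr (- (real k * s) * q)"
    using K by (simp add: powr_mult powr_powr)
  also have "\<dots> \<le> 2 * B * K powr q * (2 ^ k * E)" using B K by (intro mult_left_mono 1) auto
  finally have a: "2 * B * (K * 2 powr (- (real k * s))) powr q \<le> 2 ^ k * (2 * B * K powr q * E)" by (simp add: mult_ac)
  have "(H / 2 ^ k) powr r = H powr r * 2 powr (- (real k * r))"
  proof -
    have "(H / 2 ^ k) powr r = H powr r / (2 powr real k) powr r" using H by (simp add: powr_divide powr_realpow)
    then show ?thesis by (simp only: powr_powr powr_minus divide_inverse)
  qed
  also have "\<dots> \<le> H powr r * E" by (intro mult_left_mono 2) auto
  also have "\<dots> \<le> H powr r * K powr q * E"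
    using K1 mult_left_mono[OF K1, of "H powr r * E"] by (simp add: E_def mult_ac)
  finally have b: "2 ^ k * (H / 2 ^ k) powr r \<le> 2 ^ k * (H powr r * K powr q * E)" by (intro mult_left_mono) auto
  show ?thesis using add_mono[OF a b] unfolding E_def A_def[symmetric] q_def[symmetric] by (simp add: algebra_simps)
qed

lemma powr_le_cancel:
  fixes x y e :: real assumes "x powr e \<le> y powr e" "0 < e" "0 \<le> x" "0 \<le> y" shows "x \<le> y"
  using assms powr_less_mono2[of e y x] by (meson not_le)

text \<open>Induction over dyadic levels with the same constant \<open>K\<close> at every level;
  \<open>K\<close> is fixed in advance and does not depend on \<open>u\<close>.\<close>

lemma lebesgue_power_tail:
  fixes \<Omega> :: "'a::euclidean_space set"
  defines "n \<equiv> real DIM('a)"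
  assumes \<Omega>: "\<Omega> \<in> sets borel" "emeasure lborel \<Omega> < \<infinity>" and dim: "2 \<le> DIM('a)"
    and p: "1 < p" "p < n" and s: "0 < s" "s \<le> n * p / (n - p)" "s \<le> r * n / (n - 1)" and B: "B > 0" and H: "H > 0"
  shows "\<exists>K\<ge>1. \<forall>u G. weak_pair \<Omega> u G \<longrightarrow> (\<integral>\<^sup>+y. ennreal (norm (G y) powr p) \<partial>lborel) \<le> ennreal (B powr p) \<longrightarrow>
    (\<forall>a>0. hausdorff_outer (n - 1) {y \<in> frontier \<Omega>. a \<le> \<bar>u y\<bar>} \<le> ennreal ((H / a) powr r)) \<longrightarrow>
    (\<forall>k. emeasure lborel {x \<in> \<Omega>. 2 ^ k \<le> \<bar>u x\<bar>} \<le> ennreal (K * 2 powr (- (real k * s))))"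
proof -
  have n: "n \<ge> 2" using dim by (simp add: n_def)
  define D where "D = level_const n (unit_ball_vol n) n"
  define e where "e = (n - 1) / n"
  have e: "e > 0" using n by (simp add: e_def)
  define Q where "Q = \<bar>D\<bar> * (2 * B + H powr r) * 2 powr (s * e)"
  have Q: "Q \<ge> 0" using B by (simp add: Q_def)
  define \<tau> where "\<tau> = 1 / p - 1 / n"
  have \<tau>: "\<tau> > 0" using p n by (simp add: \<tau>_def frac_less2)
  \<comment> \<open>The first entry starts the induction. The second closes it: a step returns
    \<open>Q * K powr (1 - 1 / p)\<close>, which must be at most \<open>K powr (1 - 1 / n)\<close>.
    That needs \<open>Q \<le> K powr \<tau>\<close>, possible because \<tau> > 0, that is, p <
    n.\<close>
  define K where "K = max (max 1 (measure lborel \<Omega>)) (Q powr (1 / \<tau>))"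
  have K: "K \<ge> 1" "measure lborel \<Omega> \<le> K" by (auto simp: K_def)
  have KQ: "Q \<le> K powr \<tau>"
  proof -
    have "Q = (Q powr (1 / \<tau>)) powr \<tau>" using Q \<tau> by (cases "Q = 0") (auto simp: powr_powr)
    also have "\<dots> \<le> K powr \<tau>" using \<tau> by (intro powr_mono2) (auto simp: K_def)
    finally show ?thesis .
  qed
  have "emeasure lborel {x \<in> \<Omega>. 2 ^ k \<le> \<bar>u x\<bar>} \<le> ennreal (K * 2 powr (- (real k * s)))"
    if W: "weak_pair \<Omega> u G" and G: "(\<integral>\<^sup>+y. ennreal (norm (G y) powr p) \<partial>lborel) \<le> ennreal (B powr p)"
      and h: "\<And>a. a > 0 \<Longrightarrow> hausdorff_outer (n - 1) {y \<in> frontier \<Omega>. a \<le> \<bar>u y\<bar>} \<le> ennreal ((H / a) powr r)" for u G k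
  proof -
    define N where "N = density lborel (indicator \<Omega> :: 'a \<Rightarrow> ennreal)"
    interpret W: weak_growth \<Omega> u G N "unit_ball_vol n" n
      unfolding N_def n_def weak_growth_def using W ball_growth_lborel(1)[OF \<Omega> dim] by blast
    have mN: "measure N {x \<in> \<Omega>. b \<le> \<bar>u x\<bar>} = measure lborel {x \<in> \<Omega>. b \<le> \<bar>u x\<bar>}" for b
    proof -
      have "{x \<in> \<Omega>. b \<le> \<bar>u x\<bar>} \<inter> \<Omega> = {x \<in> \<Omega>. b \<le> \<bar>u x\<bar>}" by auto
      then show ?thesis using ball_growth_lborel(2)[OF \<Omega> dim W.superlevel_borel[of b]] by (simp add: N_def)
    qed
    have fin: "emeasure lborel {x \<in> \<Omega>. b \<le> \<bar>u x\<bar>} = ennreal (measure lborel {x \<in> \<Omega>. b \<le> \<bar>u x\<bar>})" for b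
    proof (rule emeasure_eq_ennreal_measure)
      have "emeasure lborel {x \<in> \<Omega>. b \<le> \<bar>u x\<bar>} \<le> emeasure lborel \<Omega>" using \<Omega>(1) by (intro emeasure_mono) auto
      then show "emeasure lborel {x \<in> \<Omega>. b \<le> \<bar>u x\<bar>} \<noteq> top" using \<Omega>(2) by auto
    qed
    show ?thesis
    proof (induction k)
      case 0
      have "emeasure lborel {x \<in> \<Omega>. 2 ^ 0 \<le> \<bar>u x\<bar>} \<le> emeasure lborel \<Omega>" using \<Omega>(1) by (intro emeasure_mono) auto
      also have "\<dots> = ennreal (measure lborel \<Omega>)" using \<Omega>(2) by (intro emeasure_eq_ennreal_measure) auto
      also have "\<dots> \<le> ennreal (K * 2 powr (- (real 0 * s)))" using K by (intro ennreal_leI) auto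
      finally show ?case .
    next
      case (Suc k)
      define X where "X = measure lborel {x \<in> \<Omega>. 2 ^ Suc k \<le> \<bar>u x\<bar>}"
      have "(2 ^ Suc k - 2 ^ k) * X powr ((n - 1) / n) \<le> D * (2 * B * (K * 2 powr (- (real k * s))) powr (1 - 1 / p) + (2 ^ Suc k - 2 ^ k) * (H / 2 ^ k) powr r)"
        unfolding X_def mN[symmetric] D_def n_def
        by (rule W.level_step[unfolded n_def]) (use p B G Suc K h[of "2 ^ k"] in \<open>auto simp: n_def\<close>)
      also have "\<dots> = D * (2 * B * (K * 2 powr (- (real k * s))) powr (1 - 1 / p) + 2 ^ k * (H / 2 ^ k) powr r)" by simp
      also have "\<dots> \<le> \<bar>D\<bar> * (2 * B * (K * 2 powr (- (real k * s))) powr (1 - 1 / p) + 2 ^ k * (H / 2 ^ k) powr r)"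
        using B by (intro mult_right_mono) auto
      also have "\<dots> \<le> \<bar>D\<bar> * (2 ^ k * ((2 * B + H powr r) * K powr (1 - 1 / p) * 2 powr (- (real k * s) * ((n - 1) / n))))"
        by (intro mult_left_mono dyadic_rhs_bound n p s B H K) auto
      finally have "2 ^ k * X powr e \<le> 2 ^ k * (\<bar>D\<bar> * (2 * B + H powr r) * K powr (1 - 1 / p) * 2 powr (- (real k * s) * e))"
        by (simp add: e_def mult_ac)
      then have "X powr e \<le> \<bar>D\<bar> * (2 * B + H powr r) * K powr (1 - 1 / p) * 2 powr (- (real k * s) * e)" by simp
      also have "\<dots> = Q * (K powr (1 - 1 / p) * 2 powr (- (real (Suc k) * s) * e))"
      proof -
        have "2 powr (- (real k * s) * e) = 2 powr (s * e) * 2 powr (- (real (Suc k) * s) * e)"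
          by (subst powr_add[symmetric]) (simp add: algebra_simps)
        then show ?thesis by (simp add: Q_def mult_ac)
      qed
      also have "\<dots> \<le> K powr \<tau> * (K powr (1 - 1 / p) * 2 powr (- (real (Suc k) * s) * e))"
        by (intro mult_right_mono KQ) auto
      also have "\<dots> = (K powr \<tau> * K powr (1 - 1 / p)) * 2 powr (- (real (Suc k) * s) * e)" by simp
      also have "K powr \<tau> * K powr (1 - 1 / p) = K powr e"
        using n by (simp add: powr_add[symmetric] \<tau>_def e_def diff_divide_distrib)
      also have "K powr e * 2 powr (- (real (Suc k) * s) * e) = (K * 2 powr (- (real (Suc k) * s))) powr e"
        using K by (simp add: powr_mult powr_powr)
      finally have "X \<le> K * 2 powr (- (real (Suc k) * s))"
        using e K by (intro powr_le_cancel[of X e]) (auto simp: X_def)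
      then show ?case unfolding fin X_def by (rule ennreal_leI)
    qed
  qed
  then show ?thesis using K(1) by blast
qed

text \<open>One further level step, now measured by \<open>N\<close>: the left-hand power
  \<open>(n - 1) / \<alpha>\<close> replaces \<open>(n - 1) / n\<close>, which turns the decay
  exponent \<open>s\<close> into \<open>s * \<alpha> / n\<close>.\<close>

lemma (in weak_growth) power_tail:
  fixes p s r B H K :: real
  assumes p: "1 < p" "p < real DIM('a)" and s: "0 < s" "s \<le> real DIM('a) * p / (real DIM('a) - p)" "s \<le> r * real DIM('a) / (real DIM('a) - 1)"
    and B: "B > 0" and H: "H > 0" and K: "K \<ge> 1"
    and G: "(\<integral>\<^sup>+y. ennreal (norm (G y) powr p) \<partial>lborel) \<le> ennreal (B powr p)"
    and h: "\<And>a. a > 0 \<Longrightarrow> hausdorff_outer (real DIM('a) - 1) {y \<in> frontier \<Omega>. a \<le> \<bar>u y\<bar>} \<le> ennreal ((H / a) powr r)"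
    and tail: "\<And>k. emeasure lborel {x \<in> \<Omega>. 2 ^ k \<le> \<bar>u x\<bar>} \<le> ennreal (K * 2 powr (- (real k * s)))"
  shows "measure N {x \<in> \<Omega>. 2 ^ Suc k \<le> \<bar>u x\<bar>} \<le>
    (level_const (real DIM('a)) C \<alpha> * (2 * B + H powr r) * K) powr (\<alpha> / (real DIM('a) - 1)) * 2 powr (- (real k * (s * \<alpha> / real DIM('a))))"
proof -
  define n where "n = real DIM('a)"
  have n: "n \<ge> 2" using dim by (simp add: n_def)
  have \<alpha>0: "\<alpha> > 0" using \<alpha> n by (simp add: n_def)
  define D where "D = level_const n C \<alpha>"
  have D: "D > 0" using level_const_pos by (simp add: D_def n_def)
  define X where "X = measure N {x \<in> \<Omega>. 2 ^ Suc k \<le> \<bar>u x\<bar>}"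
  define e where "e = (n - 1) / \<alpha>"
  have e: "e > 0" using n \<alpha>0 by (simp add: e_def)
  have "(2 ^ Suc k - 2 ^ k) * X powr ((n - 1) / \<alpha>) \<le> D * (2 * B * (K * 2 powr (- (real k * s))) powr (1 - 1 / p) + (2 ^ Suc k - 2 ^ k) * (H / 2 ^ k) powr r)"
    unfolding X_def D_def n_def
    by (rule level_step) (use p B G tail K h[of "2 ^ k"] in auto)
  also have "\<dots> = D * (2 * B * (K * 2 powr (- (real k * s))) powr (1 - 1 / p) + 2 ^ k * (H / 2 ^ k) powr r)" by simp
  also have "\<dots> \<le> D * (2 ^ k * ((2 * B + H powr r) * K powr (1 - 1 / p) * 2 powr (- (real k * s) * ((n - 1) / n))))"
    using D p s by (intro mult_left_mono dyadic_rhs_bound n B H K) (auto simp: n_def)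
  finally have "2 ^ k * X powr e \<le> 2 ^ k * (D * (2 * B + H powr r) * K powr (1 - 1 / p) * 2 powr (- (real k * s) * ((n - 1) / n)))"
    by (simp add: e_def mult_ac)
  then have "X powr e \<le> D * (2 * B + H powr r) * K powr (1 - 1 / p) * 2 powr (- (real k * s) * ((n - 1) / n))" by simp
  also have "\<dots> \<le> D * (2 * B + H powr r) * K * 2 powr (- (real k * s) * ((n - 1) / n))"
  proof -
    have "K powr (1 - 1 / p) \<le> K powr 1" using K p by (intro powr_mono) auto
    then show ?thesis using D B K by (intro mult_right_mono mult_left_mono) auto
  qed
  also have "\<dots> = ((D * (2 * B + H powr r) * K) powr (\<alpha> / (n - 1)) * 2 powr (- (real k * (s * \<alpha> / n)))) powr e"
  proof -
    have pos: "D * (2 * B + H powr r) * K > 0" using D B K by (intro mult_pos_pos add_pos_nonneg) auto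
    have "\<alpha> / (n - 1) * e = 1" using n \<alpha>0 by (simp add: e_def)
    moreover have "- (real k * (s * \<alpha> / n)) * e = - (real k * s) * ((n - 1) / n)" using n \<alpha>0 by (simp add: e_def)
    ultimately show ?thesis using pos
      by (subst powr_mult) (simp_all only: powr_ge_zero powr_powr powr_one less_imp_le)
  qed
  finally have "X \<le> (D * (2 * B + H powr r) * K) powr (\<alpha> / (n - 1)) * 2 powr (- (real k * (s * \<alpha> / n)))"
    by (rule powr_le_cancel[OF _ e]) (auto simp: X_def)
  then show ?thesis by (simp add: X_def D_def n_def)
qed

section \<open>Exponential decay for p = n\<close>

lemma sum_band_indicator_le:
  fixes a :: "nat \<Rightarrow> real"
  assumes "\<And>k. a k \<le> a (Suc k)"
  shows "(\<Sum>k<N. indicator {t. a k < t \<and> t < a (Suc k)} t :: real) \<le> indicator {t. t < a N} t"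
proof (induction N)
  case (Suc N)
  have "(\<Sum>k<Suc N. indicator {t. a k < t \<and> t < a (Suc k)} t :: real) \<le>
      indicator {t. t < a N} t + indicator {t. a N < t \<and> t < a (Suc N)} t"
    using Suc by simp
  also have "\<dots> \<le> indicator {t. t < a (Suc N)} t" using assms[of N] by (auto simp: indicator_def)
  finally show ?case .
qed simp

text \<open>On \<open>[\<tau>/2, \<tau>]\<close> take \<open>N\<close> equidistant levels. Since the energies of the bands sum up to at most
  \<open>B powr n\<close>, at least half of the bands carry at most twice the average energy; crossing such
  a band shrinks \<open>\<bar>{\<bar>u\<bar> \<ge> t}\<bar> powr (1 - 1/n)\<close> by the factor \<open>1/e\<close>, up to the boundary term.\<close>

lemma lebesgue_iterated_tail:
  fixes \<Omega> :: "'a::euclidean_space set"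
  defines "n \<equiv> real DIM('a)"
  defines "D \<equiv> level_const n (unit_ball_vol n) n"
  assumes \<Omega>: "\<Omega> \<in> sets borel" "emeasure lborel \<Omega> < \<infinity>" and dim: "2 \<le> DIM('a)"
    and W: "weak_pair \<Omega> u G" and B: "B > 0" "(\<integral>\<^sup>+y. ennreal (norm (G y) powr n) \<partial>lborel) \<le> ennreal (B powr n)"
    and \<tau>: "\<tau> > 0" and N: "N \<ge> 1" and h: "h \<ge> 0" "hausdorff_outer (n - 1) {y \<in> frontier \<Omega>. \<tau> / 2 \<le> \<bar>u y\<bar>} \<le> ennreal h"
    and cond: "4 * exp 1 * D * (B * (2 / real N) powr (1 / n)) \<le> \<tau> / (2 * real N)"
    and xs: "xs \<ge> 1" "measure lborel \<Omega> \<le> xs"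
  shows "emeasure lborel {x \<in> \<Omega>. \<tau> \<le> \<bar>u x\<bar>} \<le> ennreal (max (exp (- (real N / 2)) * xs) (2 * exp 1 * D * h) powr (n / (n - 1)))"
proof -
  have n: "n \<ge> 2" using dim by (simp add: n_def)
  define NL where "NL = density lborel (indicator \<Omega> :: 'a \<Rightarrow> ennreal)"
  interpret W: weak_growth \<Omega> u G NL "unit_ball_vol n" n
    unfolding NL_def n_def weak_growth_def using W ball_growth_lborel(1)[OF \<Omega> dim] by blast
  have D: "D > 0" using W.level_const_pos by (simp add: D_def n_def)
  have mN: "measure NL {x \<in> \<Omega>. b \<le> \<bar>u x\<bar>} = measure lborel {x \<in> \<Omega>. b \<le> \<bar>u x\<bar>}" for b
  proof -
    have "{x \<in> \<Omega>. b \<le> \<bar>u x\<bar>} \<inter> \<Omega> = {x \<in> \<Omega>. b \<le> \<bar>u x\<bar>}" by auto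
    then show ?thesis using ball_growth_lborel(2)[OF \<Omega> dim W.superlevel_borel[of b]] by (simp add: NL_def)
  qed
  have le\<Omega>: "emeasure lborel {x \<in> \<Omega>. b \<le> \<bar>u x\<bar>} \<le> emeasure lborel \<Omega>" for b
    using \<Omega>(1) by (intro emeasure_mono) auto
  have fin: "emeasure lborel {x \<in> \<Omega>. b \<le> \<bar>u x\<bar>} = ennreal (measure lborel {x \<in> \<Omega>. b \<le> \<bar>u x\<bar>})" for b
    using le\<Omega>[of b] \<Omega>(2) by (intro emeasure_eq_ennreal_measure) auto
  define w where "w = \<tau> / (2 * real N)"
  have w: "w > 0" using \<tau> N by (simp add: w_def)
  define a where "a k = \<tau> / 2 + real k * w" for k
  have a_Suc: "a (Suc k) = a k + w" for k by (simp add: a_def algebra_simps)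
  have a0: "a k \<ge> \<tau> / 2" "a k > 0" for k using w \<tau> by (auto simp: a_def add_pos_nonneg)
  have aN: "a N = \<tau>" using N by (simp add: a_def w_def)
  define E where "E k = (\<integral>\<^sup>+y\<in>{y \<in> \<Omega>. a k < \<bar>u y\<bar> \<and> \<bar>u y\<bar> < a (Suc k)}. ennreal (norm (G y) powr n) \<partial>lborel)" for k
  have sumE: "(\<Sum>k<N. E k) \<le> ennreal (B powr n)"
  proof -
    have "(\<Sum>k<N. E k) = (\<integral>\<^sup>+y. (\<Sum>k<N. ennreal (norm (G y) powr n) * indicator {y \<in> \<Omega>. a k < \<bar>u y\<bar> \<and> \<bar>u y\<bar> < a (Suc k)} y) \<partial>lborel)"
      unfolding E_def by (rule nn_integral_sum[symmetric]) measurable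
    also have "\<dots> \<le> (\<integral>\<^sup>+y. ennreal (norm (G y) powr n) \<partial>lborel)"
    proof (intro nn_integral_mono)
      fix y
      have "(\<Sum>k<N. ennreal (norm (G y) powr n) * indicator {y \<in> \<Omega>. a k < \<bar>u y\<bar> \<and> \<bar>u y\<bar> < a (Suc k)} y) \<le>
          (\<Sum>k<N. ennreal (norm (G y) powr n * indicator {t. a k < t \<and> t < a (Suc k)} \<bar>u y\<bar>))"
        by (intro sum_mono) (auto simp: indicator_def)
      also have "\<dots> = ennreal (\<Sum>k<N. norm (G y) powr n * indicator {t. a k < t \<and> t < a (Suc k)} \<bar>u y\<bar>)"
        by (rule sum_ennreal) auto
      also have "\<dots> \<le> ennreal (norm (G y) powr n)"
      proof (rule ennreal_leI)
        have "(\<Sum>k<N. indicator {t. a k < t \<and> t < a (Suc k)} \<bar>u y\<bar> :: real) \<le> indicator {t. t < a N} \<bar>u y\<bar>"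
          by (rule sum_band_indicator_le) (use w a_Suc in auto)
        also have "\<dots> \<le> 1" by (simp add: indicator_def)
        finally have "norm (G y) powr n * (\<Sum>k<N. indicator {t. a k < t \<and> t < a (Suc k)} \<bar>u y\<bar>) \<le> norm (G y) powr n * 1"
          by (intro mult_left_mono) auto
        then show "(\<Sum>k<N. norm (G y) powr n * indicator {t. a k < t \<and> t < a (Suc k)} \<bar>u y\<bar>) \<le> norm (G y) powr n"
          by (simp add: sum_distrib_left)
      qed
      finally show "(\<Sum>k<N. ennreal (norm (G y) powr n) * indicator {y \<in> \<Omega>. a k < \<bar>u y\<bar> \<and> \<bar>u y\<bar> < a (Suc k)} y) \<le> ennreal (norm (G y) powr n)" .
    qed
    also note B(2)
    finally show ?thesis .
  qed
  \<comment> \<open>\<open>B' powr n\<close> is twice the average energy of a band, so more than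
    \<open>N / 2\<close> bands above it would exceed the total energy.\<close>
  define B' where "B' = B * (2 / real N) powr (1 / n)"
  have B': "B' > 0" using B N by (simp add: B'_def)
  have B'n: "B' powr n = 2 * B powr n / real N"
    using B N n by (simp add: B'_def powr_mult powr_powr)
  define good where "good k \<longleftrightarrow> E k \<le> ennreal (B' powr n)" for k
  have card_bad: "2 * card {k. k < N \<and> \<not> good k} \<le> N"
  proof -
    define S where "S = {k. k < N \<and> \<not> good k}"
    have S: "finite S" "S \<subseteq> {..<N}" by (auto simp: S_def)
    have "of_nat (card S) * ennreal (B' powr n) = (\<Sum>k\<in>S. ennreal (B' powr n))" by simp
    also have "\<dots> \<le> (\<Sum>k\<in>S. E k)" by (intro sum_mono) (auto simp: S_def good_def)
    also have "\<dots> \<le> (\<Sum>k<N. E k)" using S by (intro sum_mono2) auto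
    also note sumE
    finally have "ennreal (real (card S) * (B' powr n)) \<le> ennreal (B powr n)"
      by (simp add: ennreal_mult ennreal_of_nat_eq_real_of_nat)
    then have "real (card S) * (2 * B powr n / real N) \<le> B powr n" by (simp add: B'n)
    then have "(real (card S) * 2) * B powr n \<le> real N * B powr n" using N by (simp add: field_simps)
    then have "real (card S) * 2 \<le> real N" using B by (subst (asm) mult_le_cancel_right_pos) auto
    then show ?thesis unfolding S_def[symmetric] by linarith
  qed
  define g where "g k = card {j. j < k \<and> good j}" for k
  have g_Suc: "g (Suc k) = (if good k then Suc (g k) else g k)" for k
  proof -
    have "{j. j < Suc k \<and> good j} = (if good k then insert k {j. j < k \<and> good j} else {j. j < k \<and> good j})"
      by (auto simp: less_Suc_eq)
    then show ?thesis by (auto simp: g_def)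
  qed
  have gN: "real N / 2 \<le> real (g N)"
  proof -
    have "{..<N} = {j. j < N \<and> good j} \<union> {k. k < N \<and> \<not> good k}" by auto
    then have "N = card ({j. j < N \<and> good j} \<union> {k. k < N \<and> \<not> good k})" by (metis card_lessThan)
    also have "\<dots> = g N + card {k. k < N \<and> \<not> good k}" unfolding g_def by (rule card_Un_disjoint) auto
    finally show ?thesis using card_bad by linarith
  qed
  define Z where "Z = 2 * exp 1 * D * h"
  have Z: "Z \<ge> 0" using D h by (simp add: Z_def)
  \<comment> \<open>\<open>b k powr (n / (n - 1))\<close> is to bound the level set at
    \<open>a k\<close>. Without the floor \<open>Z\<close>, \<open>b\<close> is divided by e at each
    good band; at the floor the boundary term takes over. As \<open>xs \<ge> 1\<close>, the power
    n/(n - 1) does no harm at the start.\<close>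
  define b where "b k = max (exp (- real (g k)) * xs) Z" for k
  have b: "b k > 0" for k using xs by (auto simp: b_def less_max_iff_disj)
  define e where "e = (n - 1) / n"
  have e: "e > 0" "n / (n - 1) * e = 1" using n by (auto simp: e_def)
  have main: "emeasure lborel {x \<in> \<Omega>. a k \<le> \<bar>u x\<bar>} \<le> ennreal (b k powr (n / (n - 1)))" for k
  proof (induction k)
    case 0
    have "emeasure lborel {x \<in> \<Omega>. a 0 \<le> \<bar>u x\<bar>} \<le> ennreal (measure lborel \<Omega>)"
      using le\<Omega>[of "a 0"] \<Omega>(2) by (simp add: emeasure_eq_ennreal_measure)
    also have "\<dots> \<le> ennreal (b 0 powr (n / (n - 1)))"
    proof (rule ennreal_leI)
      have b0: "xs \<le> b 0" by (simp add: b_def g_def)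
      have "measure lborel \<Omega> \<le> b 0 powr 1" using xs b0 by simp
      also have "\<dots> \<le> b 0 powr (n / (n - 1))" using n xs b0 by (intro powr_mono) auto
      finally show "measure lborel \<Omega> \<le> b 0 powr (n / (n - 1))" .
    qed
    finally show ?case .
  next
    case (Suc k)
    show ?case
    proof (cases "good k")
      case False
      have "emeasure lborel {x \<in> \<Omega>. a (Suc k) \<le> \<bar>u x\<bar>} \<le> emeasure lborel {x \<in> \<Omega>. a k \<le> \<bar>u x\<bar>}"
        using w by (intro emeasure_mono) (auto simp: a_Suc)
      also note Suc
      also have "b k = b (Suc k)" using False by (simp add: b_def g_Suc)
      finally show ?thesis .
    next
      case True
      define X where "X = measure lborel {x \<in> \<Omega>. a (Suc k) \<le> \<bar>u x\<bar>}"
      have "(a (Suc k) - a k) * X powr ((n - 1) / n) \<le> D * (2 * B' * (b k powr (n / (n - 1))) powr (1 - 1 / n) + (a (Suc k) - a k) * h)"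
        unfolding X_def mN[symmetric] D_def n_def
      proof (rule W.level_step_band[unfolded n_def])
        have "hausdorff_outer (n - 1) {y \<in> frontier \<Omega>. a k \<le> \<bar>u y\<bar>} \<le> hausdorff_outer (n - 1) {y \<in> frontier \<Omega>. \<tau> / 2 \<le> \<bar>u y\<bar>}"
          using a0(1)[of k] by (intro hausdorff_outer_mono) auto
        then show "hausdorff_outer (real DIM('a) - 1) {y \<in> frontier \<Omega>. a k \<le> \<bar>u y\<bar>} \<le> ennreal h"
          using h(2) by (auto simp: n_def)
        show "(\<integral>\<^sup>+y\<in>{y \<in> \<Omega>. a k < \<bar>u y\<bar> \<and> \<bar>u y\<bar> < a (Suc k)}. ennreal (norm (G y) powr real DIM('a)) \<partial>lborel) \<le> ennreal (B' powr real DIM('a))"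
          using True by (simp add: good_def E_def n_def)
      qed (use B' a0[of k] w b[of k] h Suc dim in \<open>auto simp: a_Suc n_def\<close>)
      moreover have "(b k powr (n / (n - 1))) powr (1 - 1 / n) = b k"
      proof -
        have "n / (n - 1) * (1 - 1 / n) = 1" using n by (simp add: field_simps)
        then show ?thesis using b[of k] by (simp only: powr_powr) simp
      qed
      ultimately have "w * X powr e \<le> D * (2 * B' * b k + w * h)" by (simp add: a_Suc e_def)
      also have "\<dots> = (D * 2 * B') * b k + w * (D * h)" by (simp add: algebra_simps)
      \<comment> \<open>\<open>cond\<close> and the choice of \<open>Z\<close> make the gradient and
        the boundary term each at most half of \<open>w * b k / exp 1\<close>; this is the origin of
        the factors \<open>4 * exp 1\<close> and \<open>2 * exp 1\<close>.\<close>
      also have "\<dots> \<le> (w / (2 * exp 1)) * b k + w * (D * h)"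
      proof (intro add_right_mono mult_right_mono)
        have "4 * exp 1 * D * B' \<le> w" using cond by (simp add: B'_def w_def)
        then show "D * 2 * B' \<le> w / (2 * exp 1)" by (simp add: field_simps)
      qed (use b[of k] in simp)
      also have "\<dots> = w * (b k / (2 * exp 1) + Z / (2 * exp 1))" by (simp add: Z_def field_simps)
      finally have "X powr e \<le> b k / (2 * exp 1) + Z / (2 * exp 1)" using w by simp
      also have "\<dots> \<le> b k / exp 1"
      proof -
        have "Z \<le> b k" by (simp add: b_def)
        then show ?thesis by (simp add: field_simps)
      qed
      also have "\<dots> \<le> b (Suc k)"
      proof -
        have "b k / exp 1 = max (exp (- real (g k)) * xs / exp 1) (Z / exp 1)"
          by (simp add: b_def max_divide_distrib_right)
        also have "\<dots> \<le> max (exp (- real (g (Suc k))) * xs) Z"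
        proof (rule max.mono)
          show "exp (- real (g k)) * xs / exp 1 \<le> exp (- real (g (Suc k))) * xs"
          proof -
            have "- real (g (Suc k)) = - real (g k) - 1" using True by (simp add: g_Suc)
            then show ?thesis by (simp only: exp_diff) simp
          qed
          have "Z * 1 \<le> Z * exp 1" using Z by (intro mult_left_mono) auto
          then show "Z / exp 1 \<le> Z" by (simp add: field_simps)
        qed
        finally show ?thesis by (simp add: b_def)
      qed
      finally have "X powr e \<le> b (Suc k)" .
      also have "b (Suc k) = (b (Suc k) powr (n / (n - 1))) powr e" using b[of "Suc k"] e by (simp only: powr_powr) simp
      finally have "X \<le> b (Suc k) powr (n / (n - 1))"
        by (rule powr_le_cancel[OF _ e(1)]) (auto simp: X_def)
      then show ?thesis unfolding fin X_def by (rule ennreal_leI)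
    qed
  qed
  have "emeasure lborel {x \<in> \<Omega>. \<tau> \<le> \<bar>u x\<bar>} \<le> ennreal (b N powr (n / (n - 1)))" using main[of N] by (simp add: aN)
  also have "\<dots> \<le> ennreal (max (exp (- (real N / 2)) * xs) Z powr (n / (n - 1)))"
  proof (intro ennreal_leI powr_mono2)
    have "exp (- real (g N)) * xs \<le> exp (- (real N / 2)) * xs" using gN xs by (intro mult_right_mono) auto
    then show "b N \<le> max (exp (- (real N / 2)) * xs) Z" unfolding b_def by (intro max.mono) auto
  qed (use n b[of N] in auto)
  finally show ?thesis by (simp add: Z_def)
qed

text \<open>Use about \<tau> powr \<delta> bands. They are wide enough for \<open>cond\<close> if
  \<tau> powr (\<delta>(1 - 1/n)) is small against \<tau>, which is \<delta> < n/(n - 1); the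
  boundary term stays below the claimed decay if \<delta> < \<beta>. Both strict inequalities give
  the room to absorb constants for large \<tau>.\<close>

lemma lebesgue_exp_tail:
  fixes \<Omega> :: "'a::euclidean_space set"
  defines "n \<equiv> real DIM('a)"
  assumes \<Omega>: "\<Omega> \<in> sets borel" "emeasure lborel \<Omega> < \<infinity>" and dim: "2 \<le> DIM('a)"
    and B: "B > 0" and \<delta>: "0 < \<delta>" "\<delta> < n / (n - 1)" "\<delta> < \<beta>" and c: "c > 0"
  shows "\<exists>E>0. \<exists>t0>0. \<forall>u G. weak_pair \<Omega> u G \<longrightarrow> (\<integral>\<^sup>+y. ennreal (norm (G y) powr n) \<partial>lborel) \<le> ennreal (B powr n) \<longrightarrow>
    (\<forall>a\<ge>a0. hausdorff_outer (n - 1) {y \<in> frontier \<Omega>. a \<le> \<bar>u y\<bar>} \<le> ennreal (2 * exp (- ((c * a) powr \<beta>)))) \<longrightarrow>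
    (\<forall>\<tau>\<ge>t0. emeasure lborel {x \<in> \<Omega>. \<tau> \<le> \<bar>u x\<bar>} \<le> ennreal (E * exp (- (\<tau> powr \<delta> / 2))))"
proof -
  have n: "n \<ge> 2" using dim by (simp add: n_def)
  define D where "D = \<bar>level_const n (unit_ball_vol n) n\<bar>"
  define xs where "xs = max 1 (measure lborel \<Omega>)"
  have xs: "xs \<ge> 1" "measure lborel \<Omega> \<le> xs" by (auto simp: xs_def)
  define F where "F = xs + 4 * exp 1 * D"
  have F: "F > 0" using xs by (simp add: F_def D_def add_pos_nonneg)
  have \<delta>1: "\<delta> * (1 - 1 / n) < 1" using \<delta> n by (simp add: field_simps)
  \<comment> \<open>32 is 8 times 4: after clearing denominators \<open>cond\<close> has the factor
    8, and rounding the number of bands up costs the factor 4.\<close>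
  have "\<forall>\<^sub>F \<tau>::real in at_top. 32 * exp 1 * D * B * \<tau> powr (\<delta> * (1 - 1 / n)) \<le> \<tau>"
    using \<delta>1 by real_asymp
  moreover have "\<forall>\<^sub>F \<tau>::real in at_top. \<tau> powr \<delta> / 2 \<le> (c * (\<tau> / 2)) powr \<beta>"
    using \<delta> c by real_asymp
  moreover have "\<forall>\<^sub>F \<tau>::real in at_top. max 1 (2 * a0) \<le> \<tau>" by (rule eventually_ge_at_top)
  ultimately have "\<forall>\<^sub>F \<tau>::real in at_top. 32 * exp 1 * D * B * \<tau> powr (\<delta> * (1 - 1 / n)) \<le> \<tau> \<and>
      \<tau> powr \<delta> / 2 \<le> (c * (\<tau> / 2)) powr \<beta> \<and> max 1 (2 * a0) \<le> \<tau>"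
    by eventually_elim blast
  then obtain t1 where t1: "\<And>\<tau>. \<tau> \<ge> t1 \<Longrightarrow> 32 * exp 1 * D * B * \<tau> powr (\<delta> * (1 - 1 / n)) \<le> \<tau> \<and>
      \<tau> powr \<delta> / 2 \<le> (c * (\<tau> / 2)) powr \<beta> \<and> max 1 (2 * a0) \<le> \<tau>"
    by (auto simp: eventually_at_top_linorder)
  define t0 where "t0 = max 1 t1"
  have "emeasure lborel {x \<in> \<Omega>. \<tau> \<le> \<bar>u x\<bar>} \<le> ennreal (F powr (n / (n - 1)) * exp (- (\<tau> powr \<delta> / 2)))"
    if W: "weak_pair \<Omega> u G" and G: "(\<integral>\<^sup>+y. ennreal (norm (G y) powr n) \<partial>lborel) \<le> ennreal (B powr n)"
      and h: "\<And>a. a \<ge> a0 \<Longrightarrow> hausdorff_outer (n - 1) {y \<in> frontier \<Omega>. a \<le> \<bar>u y\<bar>} \<le> ennreal (2 * exp (- ((c * a) powr \<beta>)))"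
      and \<tau>: "\<tau> \<ge> t0" for u G \<tau>
  proof -
    interpret L: weak_growth \<Omega> u G "density lborel (indicator \<Omega> :: 'a \<Rightarrow> ennreal)" "unit_ball_vol n" n
      unfolding n_def weak_growth_def using W ball_growth_lborel(1)[OF \<Omega> dim] by blast
    have D: "level_const n (unit_ball_vol n) n = D" "D > 0"
      using L.level_const_pos by (auto simp: D_def n_def)
    have \<tau>1: "\<tau> \<ge> 1" and e1: "32 * exp 1 * D * B * \<tau> powr (\<delta> * (1 - 1 / n)) \<le> \<tau>"
      and e2: "\<tau> powr \<delta> / 2 \<le> (c * (\<tau> / 2)) powr \<beta>" and e3: "a0 \<le> \<tau> / 2"
      using t1[of \<tau>] \<tau> by (auto simp: t0_def)
    define N where "N = nat \<lceil>\<tau> powr \<delta>\<rceil>"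
    have \<tau>\<delta>: "\<tau> powr \<delta> \<ge> 1" using \<tau>1 \<delta> by (intro ge_one_powr_ge_zero) auto
    have N: "\<tau> powr \<delta> \<le> real N" "real N \<le> 2 * \<tau> powr \<delta>" "N \<ge> 1"
      using \<tau>\<delta> unfolding N_def by linarith+
    have cond: "4 * exp 1 * D * (B * (2 / real N) powr (1 / n)) \<le> \<tau> / (2 * real N)"
    proof -
      have "real N * (2 / real N) powr (1 / n) = 2 powr (1 / n) * real N powr (1 - 1 / n)"
        using N by (simp add: powr_divide powr_diff)
      also have "\<dots> \<le> 2 powr 1 * (2 * \<tau> powr \<delta>) powr (1 - 1 / n)"
        using N n by (intro mult_mono powr_mono powr_mono2) auto
      also have "(2 * \<tau> powr \<delta>) powr (1 - 1 / n) = 2 powr (1 - 1 / n) * \<tau> powr (\<delta> * (1 - 1 / n))"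
        by (simp add: powr_mult powr_powr)
      also have "2 powr 1 * \<dots> \<le> 2 powr 1 * (2 powr 1 * \<tau> powr (\<delta> * (1 - 1 / n)))"
        using n by (intro mult_left_mono mult_right_mono powr_mono) auto
      finally have "real N * (2 / real N) powr (1 / n) \<le> 4 * \<tau> powr (\<delta> * (1 - 1 / n))" by simp
      then have "8 * exp 1 * D * B * (real N * (2 / real N) powr (1 / n)) \<le> 8 * exp 1 * D * B * (4 * \<tau> powr (\<delta> * (1 - 1 / n)))"
        using D B by (intro mult_left_mono) auto
      also have "\<dots> \<le> \<tau>" using e1 by simp
      finally show ?thesis using N by (simp add: field_simps)
    qed
    have "emeasure lborel {x \<in> \<Omega>. \<tau> \<le> \<bar>u x\<bar>} \<le>
        ennreal (max (exp (- (real N / 2)) * xs) (2 * exp 1 * D * (2 * exp (- ((c * (\<tau> / 2)) powr \<beta>)))) powr (n / (n - 1)))"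
      unfolding D(1)[symmetric]
      by (rule lebesgue_iterated_tail[OF \<Omega> dim W B, folded n_def])
        (use G \<tau>1 N h[OF e3] cond xs in \<open>auto simp: D(1)\<close>)
    also have "\<dots> \<le> ennreal ((F * exp (- (\<tau> powr \<delta> / 2))) powr (n / (n - 1)))"
    proof (intro ennreal_leI powr_mono2)
      have "xs * exp (- (real N / 2)) \<le> F * exp (- (\<tau> powr \<delta> / 2))"
        using N xs D by (intro mult_mono) (auto simp: F_def)
      then have i1: "exp (- (real N / 2)) * xs \<le> F * exp (- (\<tau> powr \<delta> / 2))" by (simp only: mult.commute)
      have "2 * exp 1 * D * (2 * exp (- ((c * (\<tau> / 2)) powr \<beta>))) \<le> 4 * exp 1 * D * exp (- (\<tau> powr \<delta> / 2))"
        using e2 D by simp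
      also have "\<dots> \<le> F * exp (- (\<tau> powr \<delta> / 2))"
        using xs by (intro mult_right_mono) (auto simp: F_def)
      finally have i2: "2 * exp 1 * D * (2 * exp (- ((c * (\<tau> / 2)) powr \<beta>))) \<le> F * exp (- (\<tau> powr \<delta> / 2))" .
      show "max (exp (- (real N / 2)) * xs) (2 * exp 1 * D * (2 * exp (- ((c * (\<tau> / 2)) powr \<beta>)))) \<le> F * exp (- (\<tau> powr \<delta> / 2))"
        using i1 i2 by (rule max.boundedI)
      show "0 \<le> max (exp (- (real N / 2)) * xs) (2 * exp 1 * D * (2 * exp (- ((c * (\<tau> / 2)) powr \<beta>))))"
        using xs by (simp add: le_max_iff_disj)
    qed (use n in auto)
    also have "\<dots> \<le> ennreal (F powr (n / (n - 1)) * exp (- (\<tau> powr \<delta> / 2)))"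
    proof (rule ennreal_leI)
      have "exp (- (\<tau> powr \<delta> / 2)) powr (n / (n - 1)) \<le> exp (- (\<tau> powr \<delta> / 2)) powr 1"
        using n by (intro powr_mono') auto
      then show "(F * exp (- (\<tau> powr \<delta> / 2))) powr (n / (n - 1)) \<le> F powr (n / (n - 1)) * exp (- (\<tau> powr \<delta> / 2))"
        using F by (simp add: powr_mult mult_left_mono)
    qed
    finally show ?thesis .
  qed
  moreover have "F powr (n / (n - 1)) > 0" "t0 > 0" using F by (auto simp: t0_def)
  ultimately show ?thesis by blast
qed

text \<open>A single level step from \<open>\<tau> / 2\<close> to \<tau>, measured by
  \<open>N\<close>. Constants in the exponent are given away: 1 - 1/n \<ge> 1/2 reduces
  \<open>s\<close> to \<open>s / 2\<close>, and (n - 1)/\<alpha> < 1 lets the outer power be dropped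
  on the exponential.\<close>

lemma (in weak_growth) exp_tail:
  assumes B: "B > 0" and G: "(\<integral>\<^sup>+y. ennreal (norm (G y) powr real DIM('a)) \<partial>lborel) \<le> ennreal (B powr real DIM('a))"
    and \<tau>: "\<tau> \<ge> 2" and E: "E > 0"
    and m: "emeasure lborel {x \<in> \<Omega>. \<tau> / 2 \<le> \<bar>u x\<bar>} \<le> ennreal (E * exp (- s))"
    and h: "hausdorff_outer (real DIM('a) - 1) {y \<in> frontier \<Omega>. \<tau> / 2 \<le> \<bar>u y\<bar>} \<le> ennreal (2 * exp (- s))"
    and s: "s \<ge> 0"
  shows "measure N {x \<in> \<Omega>. \<tau> \<le> \<bar>u x\<bar>} \<le>
    (level_const (real DIM('a)) C \<alpha> * (2 * B * E powr (1 - 1 / real DIM('a)) + 2)) powr (\<alpha> / (real DIM('a) - 1)) * exp (- (s / 2))"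
proof -
  define n where "n = real DIM('a)"
  have n: "n \<ge> 2" using dim by (simp add: n_def)
  have \<alpha>n: "\<alpha> > n - 1" using \<alpha> by (simp add: n_def)
  define D where "D = level_const n C \<alpha>"
  have D: "D > 0" using level_const_pos by (simp add: D_def n_def)
  define e where "e = (n - 1) / \<alpha>"
  have e: "e > 0" "e < 1" "\<alpha> / (n - 1) * e = 1" using n \<alpha>n by (auto simp: e_def)
  define X where "X = measure N {x \<in> \<Omega>. \<tau> \<le> \<bar>u x\<bar>}"
  define Q where "Q = D * (2 * B * E powr (1 - 1 / n) + 2)"
  have Q: "Q > 0" using D B E unfolding Q_def by (intro mult_pos_pos add_nonneg_pos) auto
  have "(\<tau> - \<tau> / 2) * X powr ((n - 1) / \<alpha>) \<le> D * (2 * B * (E * exp (- s)) powr (1 - 1 / n) + (\<tau> - \<tau> / 2) * (2 * exp (- s)))"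
    unfolding X_def D_def n_def by (rule level_step) (use B G \<tau> m h E dim in auto)
  then have "(\<tau> / 2) * X powr e \<le> D * (2 * B * (E * exp (- s)) powr (1 - 1 / n) + (\<tau> / 2) * (2 * exp (- s)))"
    by (simp add: e_def)
  also have "\<dots> \<le> D * ((\<tau> / 2) * (2 * B * (E powr (1 - 1 / n) * exp (- (s / 2)))) + (\<tau> / 2) * (2 * exp (- (s / 2))))"
  proof (intro mult_left_mono add_mono)
    have "(E * exp (- s)) powr (1 - 1 / n) = E powr (1 - 1 / n) * exp (- s) powr (1 - 1 / n)" using E by (simp add: powr_mult)
    also have "exp (- s) powr (1 - 1 / n) \<le> exp (- s) powr (1 / 2)" using n s by (intro powr_mono') (auto simp: field_simps)
    also have "exp (- s) powr (1 / 2) = exp (- (s / 2))" by (simp add: powr_def)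
    finally have 1: "(E * exp (- s)) powr (1 - 1 / n) \<le> E powr (1 - 1 / n) * exp (- (s / 2))" by (simp add: mult_left_mono)
    have "2 * B * (E * exp (- s)) powr (1 - 1 / n) \<le> 1 * (2 * B * (E powr (1 - 1 / n) * exp (- (s / 2))))"
      using 1 B by simp
    also have "\<dots> \<le> \<tau> / 2 * (2 * B * (E powr (1 - 1 / n) * exp (- (s / 2))))"
      using \<tau> B by (intro mult_right_mono) auto
    finally show "2 * B * (E * exp (- s)) powr (1 - 1 / n) \<le> \<tau> / 2 * (2 * B * (E powr (1 - 1 / n) * exp (- (s / 2))))" .
  qed (use \<tau> s D in auto)
  also have "\<dots> = (\<tau> / 2) * (Q * exp (- (s / 2)))" by (simp add: Q_def algebra_simps)
  finally have "X powr e \<le> Q * exp (- (s / 2))" using \<tau> by (subst (asm) mult_le_cancel_left_pos) auto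
  also have "\<dots> \<le> (Q powr (\<alpha> / (n - 1)) * exp (- (s / 2))) powr e"
  proof -
    have "exp (- (s / 2)) powr 1 \<le> exp (- (s / 2)) powr e" using e s by (intro powr_mono') auto
    moreover have "(Q powr (\<alpha> / (n - 1))) powr e = Q" using Q e(3) by (simp only: powr_powr) simp
    ultimately show ?thesis using Q by (simp add: powr_mult mult_left_mono)
  qed
  finally have "X \<le> Q powr (\<alpha> / (n - 1)) * exp (- (s / 2))"
    by (rule powr_le_cancel[OF _ e(1)]) (auto simp: X_def)
  then show ?thesis by (simp add: X_def Q_def D_def n_def)
qed

text \<open>With x = 2^k the exponent is eventually at most -2 ln x, as \<gamma> < \<delta>; hence
  the terms are eventually at most 1/x.\<close>

lemma summable_exp_powr:
  assumes "0 < \<gamma>" "\<gamma> < \<delta>" "0 < c"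
  shows "summable (\<lambda>k. 2 ^ k * exp (L * (2 ^ k) powr \<gamma> - c * (2 ^ k) powr \<delta>) :: real)"
proof (rule summable_comparison_test_ev)
  have "\<forall>\<^sub>F x::real in at_top. 2 * ln x + L * x powr \<gamma> - c * x powr \<delta> \<le> 0"
    using assms by real_asymp
  moreover have "filterlim (\<lambda>k. 2 ^ k :: real) at_top sequentially" by real_asymp
  ultimately have "\<forall>\<^sub>F k in sequentially. 2 * ln (2 ^ k) + L * (2 ^ k) powr \<gamma> - c * (2 ^ k) powr \<delta> \<le> (0::real)"
    by (rule eventually_compose_filterlim)
  then show "\<forall>\<^sub>F k in sequentially. norm (2 ^ k * exp (L * (2 ^ k) powr \<gamma> - c * (2 ^ k) powr \<delta>) :: real) \<le> (1 / 2) ^ k"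
  proof eventually_elim
    case (elim k)
    have "exp (L * (2 ^ k) powr \<gamma> - c * (2 ^ k) powr \<delta>) \<le> exp (- 2 * ln (2 ^ k))" using elim by simp
    also have "- 2 * ln (2 ^ k :: real) = ln ((1 / 4) ^ k)"
    proof -
      have "(4 :: real) = 2 ^ 2" by simp
      then have "ln (4 :: real) = 2 * ln 2" by (simp only: ln_realpow)
      then show ?thesis by (simp add: ln_realpow ln_div)
    qed
    also have "exp \<dots> = (1 / 4 :: real) ^ k" by simp
    finally have "2 ^ k * exp (L * (2 ^ k) powr \<gamma> - c * (2 ^ k) powr \<delta>) \<le> 2 ^ k * (1 / 4) ^ k" by simp
    also have "\<dots> = (1 / 2 :: real) ^ k" by (simp add: power_mult_distrib[symmetric])
    finally show ?case by simp
  qed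
qed simp

subsection \<open>Uniform moments\<close>

text \<open>Stated for any measure of polynomial growth, because it is applied both to the given
  measure and, for L^1 bounds, to Lebesgue measure on \<Omega>.\<close>

lemma power_dyadic_tail:
  fixes \<Omega> :: "'a::euclidean_space set" and N :: "'a measure"
  defines "n \<equiv> real DIM('a)"
  assumes \<Omega>: "\<Omega> \<in> sets borel" "emeasure lborel \<Omega> < \<infinity>" and N: "ball_growth N C \<alpha>"
    and p: "1 < p" "p < n" and s: "0 < s" "s \<le> n * p / (n - p)" "s \<le> r * n / (n - 1)" and B: "B > 0" and H: "H > 0"
  shows "\<exists>Q\<ge>0. \<forall>u G. weak_pair \<Omega> u G \<longrightarrow> (\<integral>\<^sup>+y. ennreal (norm (G y) powr p) \<partial>lborel) \<le> ennreal (B powr p) \<longrightarrow>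
    (\<forall>a>0. hausdorff_outer (n - 1) {y \<in> frontier \<Omega>. a \<le> \<bar>u y\<bar>} \<le> ennreal ((H / a) powr r)) \<longrightarrow>
    (\<forall>k. measure N {x \<in> \<Omega>. 2 ^ k \<le> \<bar>u x\<bar>} \<le> Q * 2 powr (- (real k * (s * \<alpha> / n))))"
proof -
  interpret N: ball_growth N C \<alpha> by (rule N)
  obtain K where K: "K \<ge> 1" and tail: "\<And>u G k. weak_pair \<Omega> u G \<Longrightarrow> (\<integral>\<^sup>+y. ennreal (norm (G y) powr p) \<partial>lborel) \<le> ennreal (B powr p) \<Longrightarrow>
    (\<forall>a>0. hausdorff_outer (n - 1) {y \<in> frontier \<Omega>. a \<le> \<bar>u y\<bar>} \<le> ennreal ((H / a) powr r)) \<Longrightarrow>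
    emeasure lborel {x \<in> \<Omega>. 2 ^ k \<le> \<bar>u x\<bar>} \<le> ennreal (K * 2 powr (- (real k * s)))"
    using lebesgue_power_tail[OF \<Omega> N.dim p[unfolded n_def] s[unfolded n_def] B H] unfolding n_def by blast
  define Q1 where "Q1 = (level_const n C \<alpha> * (2 * B + H powr r) * K) powr (\<alpha> / (n - 1))"
  define Q where "Q = max (measure N UNIV) (Q1 * 2 powr (s * \<alpha> / n))"
  have "measure N {x \<in> \<Omega>. 2 ^ k \<le> \<bar>u x\<bar>} \<le> Q * 2 powr (- (real k * (s * \<alpha> / n)))"
    if W: "weak_pair \<Omega> u G" and G: "(\<integral>\<^sup>+y. ennreal (norm (G y) powr p) \<partial>lborel) \<le> ennreal (B powr p)"
      and h: "\<forall>a>0. hausdorff_outer (n - 1) {y \<in> frontier \<Omega>. a \<le> \<bar>u y\<bar>} \<le> ennreal ((H / a) powr r)" for u G k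
  proof -
    interpret W: weak_growth \<Omega> u G N C \<alpha> unfolding weak_growth_def using W N by blast
    show ?thesis
    proof (cases k)
      case 0
      have "measure N {x \<in> \<Omega>. 2 ^ k \<le> \<bar>u x\<bar>} \<le> measure N UNIV"
        by (intro N.finite_measure_mono) (auto simp: N.sets_N)
      then show ?thesis using 0 by (simp add: Q_def)
    next
      case (Suc j)
      have "measure N {x \<in> \<Omega>. 2 ^ Suc j \<le> \<bar>u x\<bar>} \<le> Q1 * 2 powr (- (real j * (s * \<alpha> / n)))"
        unfolding Q1_def n_def
        by (rule W.power_tail[OF p(1) p(2)[unfolded n_def] s(1) s(2,3)[unfolded n_def] B H K G _ tail[OF W G h]])
          (rule h[rule_format, unfolded n_def])
      also have "\<dots> = Q1 * 2 powr (s * \<alpha> / n) * 2 powr (- (real (Suc j) * (s * \<alpha> / n)))"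
      proof -
        have "2 powr x * 2 powr (- (real (Suc j) * x)) = 2 powr (- (real j * x))" for x
          by (subst powr_add[symmetric]) (simp add: algebra_simps)
        then show ?thesis by (simp only: mult.assoc)
      qed
      also have "\<dots> \<le> Q * 2 powr (- (real (Suc j) * (s * \<alpha> / n)))"
        by (intro mult_right_mono) (auto simp: Q_def)
      finally show ?thesis using Suc by simp
    qed
  qed
  moreover have "Q \<ge> 0" by (simp add: Q_def le_max_iff_disj)
  ultimately show ?thesis by blast
qed

lemma exp_dyadic_tail:
  fixes \<Omega> :: "'a::euclidean_space set" and N :: "'a measure"
  defines "n \<equiv> real DIM('a)"
  assumes \<Omega>: "\<Omega> \<in> sets borel" "emeasure lborel \<Omega> < \<infinity>" and N: "ball_growth N C \<alpha>"
    and B: "B > 0" and \<delta>: "0 < \<delta>" "\<delta> < n / (n - 1)" "\<delta> < \<beta>" and c: "c > 0"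
  shows "\<exists>Q\<ge>0. \<exists>c'>0. \<forall>u G. weak_pair \<Omega> u G \<longrightarrow> (\<integral>\<^sup>+y. ennreal (norm (G y) powr n) \<partial>lborel) \<le> ennreal (B powr n) \<longrightarrow>
    (\<forall>a\<ge>a0. hausdorff_outer (n - 1) {y \<in> frontier \<Omega>. a \<le> \<bar>u y\<bar>} \<le> ennreal (2 * exp (- ((c * a) powr \<beta>)))) \<longrightarrow>
    (\<forall>k. measure N {x \<in> \<Omega>. 2 ^ k \<le> \<bar>u x\<bar>} \<le> Q * exp (- (c' * (2 ^ k) powr \<delta>)))"
proof -
  interpret N: ball_growth N C \<alpha> by (rule N)
  obtain E t0 where E: "E > 0" "t0 > 0" and tail: "\<And>u G \<tau>. weak_pair \<Omega> u G \<Longrightarrow> (\<integral>\<^sup>+y. ennreal (norm (G y) powr n) \<partial>lborel) \<le> ennreal (B powr n) \<Longrightarrow>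
    (\<forall>a\<ge>a0. hausdorff_outer (n - 1) {y \<in> frontier \<Omega>. a \<le> \<bar>u y\<bar>} \<le> ennreal (2 * exp (- ((c * a) powr \<beta>)))) \<Longrightarrow> \<tau> \<ge> t0 \<Longrightarrow>
    emeasure lborel {x \<in> \<Omega>. \<tau> \<le> \<bar>u x\<bar>} \<le> ennreal (E * exp (- (\<tau> powr \<delta> / 2)))"
    using lebesgue_exp_tail[OF \<Omega> N.dim B \<delta>(1) \<delta>(2)[unfolded n_def] \<delta>(3) c, of a0] unfolding n_def by blast
  have "\<forall>\<^sub>F \<tau>::real in at_top. (\<tau> / 2) powr \<delta> / 2 \<le> (c * (\<tau> / 2)) powr \<beta>"
    using \<delta> c by real_asymp
  moreover have "\<forall>\<^sub>F \<tau>::real in at_top. max 2 (max (2 * a0) (2 * t0)) \<le> \<tau>" by (rule eventually_ge_at_top)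
  ultimately have "\<forall>\<^sub>F \<tau>::real in at_top. (\<tau> / 2) powr \<delta> / 2 \<le> (c * (\<tau> / 2)) powr \<beta> \<and> max 2 (max (2 * a0) (2 * t0)) \<le> \<tau>"
    by eventually_elim blast
  then obtain t1 where t1: "\<And>\<tau>. \<tau> \<ge> t1 \<Longrightarrow> (\<tau> / 2) powr \<delta> / 2 \<le> (c * (\<tau> / 2)) powr \<beta> \<and> max 2 (max (2 * a0) (2 * t0)) \<le> \<tau>"
    by (auto simp: eventually_at_top_linorder)
  \<comment> \<open>One factor 1/2 comes from the Lebesgue tail, one from \<open>exp_tail\<close>,
    and \<open>2 powr \<delta>\<close> from evaluating that tail at
    \<open>\<tau> / 2\<close>.\<close>
  define c' where "c' = 1 / (4 * 2 powr \<delta>)"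
  have c': "c' > 0" by (simp add: c'_def)
  define Q1 where "Q1 = (level_const n C \<alpha> * (2 * B * E powr (1 - 1 / n) + 2)) powr (\<alpha> / (n - 1))"
  \<comment> \<open>The second entry makes the bound hold trivially for levels below the threshold
    \<open>t1\<close>.\<close>
  define Q where "Q = max Q1 (measure N UNIV * exp (c' * \<bar>t1\<bar> powr \<delta>))"
  have "measure N {x \<in> \<Omega>. \<tau> \<le> \<bar>u x\<bar>} \<le> Q * exp (- (c' * \<tau> powr \<delta>))"
    if W: "weak_pair \<Omega> u G" and G: "(\<integral>\<^sup>+y. ennreal (norm (G y) powr n) \<partial>lborel) \<le> ennreal (B powr n)"
      and h: "\<forall>a\<ge>a0. hausdorff_outer (n - 1) {y \<in> frontier \<Omega>. a \<le> \<bar>u y\<bar>} \<le> ennreal (2 * exp (- ((c * a) powr \<beta>)))"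
      and \<tau>: "\<tau> > 0" for u G \<tau>
  proof -
    interpret W: weak_growth \<Omega> u G N C \<alpha> unfolding weak_growth_def using W N by blast
    show ?thesis
    proof (cases "\<tau> \<ge> t1")
      case True
      note t = t1[OF True]
      define s where "s = (\<tau> / 2) powr \<delta> / 2"
      have hs: "hausdorff_outer (n - 1) {y \<in> frontier \<Omega>. \<tau> / 2 \<le> \<bar>u y\<bar>} \<le> ennreal (2 * exp (- s))"
      proof -
        have "hausdorff_outer (n - 1) {y \<in> frontier \<Omega>. \<tau> / 2 \<le> \<bar>u y\<bar>} \<le> ennreal (2 * exp (- ((c * (\<tau> / 2)) powr \<beta>)))"
          by (rule h[rule_format]) (use t in simp)
        also have "\<dots> \<le> ennreal (2 * exp (- s))" using t by (intro ennreal_leI) (auto simp: s_def)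
        finally show ?thesis .
      qed
      have ms: "emeasure lborel {x \<in> \<Omega>. \<tau> / 2 \<le> \<bar>u x\<bar>} \<le> ennreal (E * exp (- s))"
        using tail[OF W G h, of "\<tau> / 2"] t by (simp add: s_def)
      have "measure N {x \<in> \<Omega>. \<tau> \<le> \<bar>u x\<bar>} \<le> Q1 * exp (- (s / 2))"
        unfolding Q1_def n_def
        by (rule W.exp_tail[OF B G[unfolded n_def] _ E(1) ms hs[unfolded n_def]]) (use t in \<open>auto simp: s_def\<close>)
      also have "s / 2 = c' * \<tau> powr \<delta>" using \<tau> by (simp add: s_def c'_def powr_divide)
      also have "Q1 * exp (- (c' * \<tau> powr \<delta>)) \<le> Q * exp (- (c' * \<tau> powr \<delta>))"
        by (intro mult_right_mono) (auto simp: Q_def)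
      finally show ?thesis .
    next
      case False
      have "measure N {x \<in> \<Omega>. \<tau> \<le> \<bar>u x\<bar>} \<le> measure N UNIV * 1"
        using N.finite_measure_mono[of "{x \<in> \<Omega>. \<tau> \<le> \<bar>u x\<bar>}" UNIV] by (auto simp: N.sets_N)
      also have "\<dots> \<le> measure N UNIV * (exp (c' * \<bar>t1\<bar> powr \<delta>) * exp (- (c' * \<tau> powr \<delta>)))"
      proof (intro mult_left_mono)
        have "\<tau> powr \<delta> \<le> \<bar>t1\<bar> powr \<delta>" using False \<tau> \<delta> by (intro powr_mono2) auto
        then have "0 \<le> c' * \<bar>t1\<bar> powr \<delta> - c' * \<tau> powr \<delta>" using c' by (simp add: mult_left_mono)
        then show "1 \<le> exp (c' * \<bar>t1\<bar> powr \<delta>) * exp (- (c' * \<tau> powr \<delta>))" by (simp add: exp_add[symmetric])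
      qed simp
      also have "\<dots> \<le> Q * exp (- (c' * \<tau> powr \<delta>))"
        by (subst mult.assoc[symmetric], intro mult_right_mono) (auto simp: Q_def)
      finally show ?thesis .
    qed
  qed
  moreover have "Q \<ge> 0" by (simp add: Q_def le_max_iff_disj)
  ultimately show ?thesis using c' zero_less_power[of "2::real"] by (intro exI[of _ Q] conjI exI[of _ c']) auto
qed

lemma (in weak_growth) moment_bound:
  assumes \<Theta>: "\<And>s t. 0 \<le> s \<Longrightarrow> s \<le> t \<Longrightarrow> \<Theta> s \<le> \<Theta> t" "\<Theta> 0 \<ge> (0::real)"
    and T: "\<And>k. measure N {x \<in> \<Omega>. 2 ^ k \<le> \<bar>u x\<bar>} \<le> T k" and summ: "summable (\<lambda>k. \<Theta> (2 ^ Suc k) * T k)"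
  shows "(\<integral>\<^sup>+x. ennreal (\<Theta> \<bar>u0 x\<bar>) \<partial>N) \<le> ennreal (\<Theta> 1 * measure N UNIV + (\<Sum>k. \<Theta> (2 ^ Suc k) * T k))"
proof -
  have sp: "space N = UNIV" using sets_eq_imp_space_eq[OF sets_N] by simp
  have \<Theta>0: "\<Theta> t \<ge> 0" if "t \<ge> 0" for t using \<Theta>(1)[of 0 t] \<Theta>(2) that by simp
  have T0: "T k \<ge> 0" for k using T[of k] measure_nonneg order_trans by blast
  have "(\<integral>\<^sup>+x. ennreal (\<Theta> \<bar>u0 x\<bar>) \<partial>N) \<le> ennreal (\<Theta> 1 * measure N (space N)) + (\<Sum>k. ennreal (\<Theta> (2 ^ Suc k) * T k))"
  proof (rule nn_integral_dyadic_le)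
    fix k
    have "{x \<in> space N. 2 ^ k \<le> \<bar>u0 x\<bar>} = {x \<in> \<Omega>. 2 ^ k \<le> \<bar>u x\<bar>}"
    proof -
      have "\<not> (2 :: real) ^ k \<le> 0" by (simp add: not_le)
      then show ?thesis by (auto simp del: power_le_zero_eq simp: u0_def sp indicator_def split: if_splits)
    qed
    then show "measure N {x \<in> space N. 2 ^ k \<le> \<bar>u0 x\<bar>} \<le> T k" using T by simp
  qed (use \<Theta> in auto)
  also have "(\<Sum>k. ennreal (\<Theta> (2 ^ Suc k) * T k)) = ennreal (\<Sum>k. \<Theta> (2 ^ Suc k) * T k)"
    using summ \<Theta>0 T0 by (intro suminf_ennreal2) auto
  also have "ennreal (\<Theta> 1 * measure N (space N)) + \<dots> = ennreal (\<Theta> 1 * measure N UNIV + (\<Sum>k. \<Theta> (2 ^ Suc k) * T k))"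
    using \<Theta>0 T0 summ by (subst ennreal_plus) (auto simp: sp intro!: suminf_nonneg)
  finally show ?thesis .
qed

lemma (in weak_pair) nn_integral_u0_density:
  "(\<integral>\<^sup>+x. ennreal \<bar>u0 x\<bar> \<partial>density lborel (indicator \<Omega>)) = ennreal (\<integral>x. \<bar>u0 x\<bar> \<partial>lborel)"
proof -
  have [measurable]: "\<Omega> \<in> sets borel" using open_\<Omega> by (simp add: borel_open)
  have "(\<integral>\<^sup>+x. ennreal \<bar>u0 x\<bar> \<partial>density lborel (indicator \<Omega>)) = (\<integral>\<^sup>+x. indicator \<Omega> x * ennreal \<bar>u0 x\<bar> \<partial>lborel)"
    by (rule nn_integral_density) auto
  also have "\<dots> = (\<integral>\<^sup>+x. ennreal \<bar>u0 x\<bar> \<partial>lborel)"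
    by (intro nn_integral_cong) (auto simp: u0_def indicator_def)
  also have "\<dots> = ennreal (\<integral>x. \<bar>u0 x\<bar> \<partial>lborel)"
    using integrable_u0 by (intro nn_integral_eq_integral) auto
  finally show ?thesis .
qed

text \<open>A Vitali argument by three ranges of \<open>g\<close>. Up to \<zeta> the integrand is
  small, up to \<open>T\<close> it is bounded on a set of small measure, and beyond \<open>T\<close>
  it is a small multiple of \<Theta>, whose integral is bounded.\<close>

lemma (in finite_measure) nn_integral_Cauchy_small:
  fixes g :: "nat \<Rightarrow> nat \<Rightarrow> 'a \<Rightarrow> real" and \<Psi> \<Theta> :: "real \<Rightarrow> real"
  assumes [measurable]: "\<And>k m. g k m \<in> borel_measurable M" and g0: "\<And>k m x. g k m x \<ge> 0"
    and conv: "\<And>\<zeta> \<eta>. \<zeta> > 0 \<Longrightarrow> \<eta> > 0 \<Longrightarrow> \<exists>K. \<forall>k\<ge>K. \<forall>m\<ge>K. measure M {x \<in> space M. \<zeta> < g k m x} \<le> \<eta>"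
    and \<Psi>: "\<And>s t. 0 \<le> s \<Longrightarrow> s \<le> t \<Longrightarrow> \<Psi> s \<le> \<Psi> t" "\<Psi> 0 \<ge> 0" "\<And>e. e > 0 \<Longrightarrow> \<exists>\<zeta>>0. \<Psi> \<zeta> \<le> e"
    and \<Theta>: "\<And>t. \<Theta> t \<ge> 0" and [measurable]: "\<Theta> \<in> borel_measurable borel"
    and dom: "\<And>\<eta>. \<eta> > 0 \<Longrightarrow> \<exists>T>0. \<forall>t\<ge>T. \<Psi> t \<le> \<eta> * \<Theta> t"
    and bound: "\<And>k m. (\<integral>\<^sup>+x. ennreal (\<Theta> (g k m x)) \<partial>M) \<le> ennreal B" and B: "B \<ge> 0" and e: "e > 0"
  shows "\<exists>K. \<forall>k\<ge>K. \<forall>m\<ge>K. (\<integral>\<^sup>+x. ennreal (\<Psi> (g k m x)) \<partial>M) \<le> ennreal e"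
proof -
  have \<Psi>0: "\<Psi> t \<ge> 0" if "t \<ge> 0" for t using \<Psi>(1)[of 0 t] \<Psi>(2) that by simp
  define V where "V = measure M (space M)"
  obtain \<zeta> where \<zeta>: "\<zeta> > 0" "\<Psi> \<zeta> \<le> e / (3 * (V + 1))"
    using \<Psi>(3)[of "e / (3 * (V + 1))"] e by (auto simp: V_def add_nonneg_pos)
  define \<eta> where "\<eta> = e / (3 * (B + 1))"
  have \<eta>: "\<eta> > 0" using e B by (simp add: \<eta>_def)
  obtain T where T: "T > 0" "\<And>t. t \<ge> T \<Longrightarrow> \<Psi> t \<le> \<eta> * \<Theta> t" using dom[OF \<eta>] by blast
  have PT: "\<Psi> T \<ge> 0" using \<Psi>0 T by simp
  obtain K where K: "\<And>k m. k \<ge> K \<Longrightarrow> m \<ge> K \<Longrightarrow> measure M {x \<in> space M. \<zeta> < g k m x} \<le> e / (3 * (\<Psi> T + 1))"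
    using conv[OF \<zeta>(1), of "e / (3 * (\<Psi> T + 1))"] e PT by auto
  have "(\<integral>\<^sup>+x. ennreal (\<Psi> (g k m x)) \<partial>M) \<le> ennreal e" if km: "k \<ge> K" "m \<ge> K" for k m
  proof -
    define A where "A = {x \<in> space M. \<zeta> < g k m x}"
    have [measurable]: "A \<in> sets M" unfolding A_def by measurable
    have "(\<integral>\<^sup>+x. ennreal (\<Psi> (g k m x)) \<partial>M) \<le>
        (\<integral>\<^sup>+x. ennreal (\<Psi> \<zeta>) + (ennreal (\<Psi> T) * indicator A x + ennreal \<eta> * ennreal (\<Theta> (g k m x))) \<partial>M)"
    proof (intro nn_integral_mono)
      fix x assume x: "x \<in> space M"
      consider "g k m x \<le> \<zeta>" | "\<zeta> < g k m x" "g k m x \<le> T" | "T \<le> g k m x" by linarith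
      then show "ennreal (\<Psi> (g k m x)) \<le> ennreal (\<Psi> \<zeta>) + (ennreal (\<Psi> T) * indicator A x + ennreal \<eta> * ennreal (\<Theta> (g k m x)))"
      proof cases
        case 1
        then have "ennreal (\<Psi> (g k m x)) \<le> ennreal (\<Psi> \<zeta>)" by (intro ennreal_leI \<Psi>(1) g0)
        then show ?thesis by (rule order_trans) simp
      next
        case 2
        then have "ennreal (\<Psi> (g k m x)) \<le> ennreal (\<Psi> T) * indicator A x" using x by (auto simp: A_def intro!: ennreal_leI \<Psi>(1) g0)
        then show ?thesis by (rule order_trans) (simp add: add_increasing)
      next
        case 3
        then have "ennreal (\<Psi> (g k m x)) \<le> ennreal (\<eta> * \<Theta> (g k m x))" by (intro ennreal_leI T(2))
        also have "\<dots> = ennreal \<eta> * ennreal (\<Theta> (g k m x))" using \<eta> \<Theta> by (intro ennreal_mult) auto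
        finally show ?thesis by (rule order_trans) (simp add: add_increasing)
      qed
    qed
    also have "\<dots> = ennreal (\<Psi> \<zeta>) * emeasure M (space M) + (ennreal (\<Psi> T) * emeasure M A + ennreal \<eta> * (\<integral>\<^sup>+x. ennreal (\<Theta> (g k m x)) \<partial>M))"
    proof -
      have m1: "(\<lambda>x. ennreal (\<Theta> (g k m x))) \<in> borel_measurable M" by measurable
      have m2: "(\<lambda>x. ennreal (\<Psi> T) * indicator A x) \<in> borel_measurable M" by measurable
      have m3: "(\<lambda>x. ennreal \<eta> * ennreal (\<Theta> (g k m x))) \<in> borel_measurable M" using m1 by measurable
      have "(\<integral>\<^sup>+x. ennreal (\<Psi> T) * indicator A x + ennreal \<eta> * ennreal (\<Theta> (g k m x)) \<partial>M) =
          ennreal (\<Psi> T) * emeasure M A + ennreal \<eta> * (\<integral>\<^sup>+x. ennreal (\<Theta> (g k m x)) \<partial>M)"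
        unfolding nn_integral_add[OF m2 m3] nn_integral_cmult[OF m1] by (simp add: nn_integral_cmult_indicator)
      then show ?thesis
        using m2 m3 by (subst nn_integral_add) (auto intro: borel_measurable_add)
    qed
    also have "\<dots> \<le> ennreal (\<Psi> \<zeta>) * ennreal V + (ennreal (\<Psi> T) * ennreal (measure M A) + ennreal \<eta> * ennreal B)"
      unfolding V_def by (intro add_mono mult_left_mono bound) (auto simp: emeasure_eq_measure)
    also have "\<dots> = ennreal (\<Psi> \<zeta> * V + (\<Psi> T * measure M A + \<eta> * B))"
      using \<Psi>0[of \<zeta>] \<zeta> PT \<eta> B by (simp add: ennreal_mult V_def)
    also have "\<dots> \<le> ennreal e"
    proof (rule ennreal_leI)
      have V0: "V \<ge> 0" by (simp add: V_def)
      have "\<Psi> \<zeta> * V \<le> e / (3 * (V + 1)) * (V + 1)" using \<zeta> V0 e by (intro mult_mono) auto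
      also have "\<dots> = e / 3" using V0 by (simp add: field_simps)
      finally have 1: "\<Psi> \<zeta> * V \<le> e / 3" .
      have "\<Psi> T * measure M A \<le> (\<Psi> T + 1) * (e / (3 * (\<Psi> T + 1)))"
        using K[OF km] PT e by (intro mult_mono) (auto simp: A_def)
      also have "\<dots> = e / 3" using PT by (simp add: field_simps)
      finally have 2: "\<Psi> T * measure M A \<le> e / 3" .
      have "\<eta> * B \<le> \<eta> * (B + 1)" using \<eta> by (intro mult_left_mono) auto
      also have "\<dots> = e / 3" using B by (simp add: \<eta>_def field_simps)
      finally show "\<Psi> \<zeta> * V + (\<Psi> T * measure M A + \<eta> * B) \<le> e" using 1 2 by simp
    qed
    finally show ?thesis .
  qed
  then show ?thesis by blast
qed

subsection \<open>Boundary values\<close>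

lemma ennreal_mult_le_imp:
  assumes "ennreal a * x \<le> ennreal b" "a > 0" "b \<ge> 0" shows "x \<le> ennreal (b / a)"
proof -
  have "x = ennreal (1 / a) * (ennreal a * x)"
    using assms by (simp add: mult.assoc[symmetric] ennreal_mult[symmetric])
  also have "\<dots> \<le> ennreal (1 / a) * ennreal b" by (intro mult_left_mono assms) simp
  also have "\<dots> = ennreal (b / a)" using assms by (simp add: ennreal_mult[symmetric])
  finally show ?thesis .
qed

lemma Cb_closure_frontier_level:
  fixes \<Omega> :: "'a::euclidean_space set"
  assumes "Cb_closure \<Omega> u"
  shows "{y \<in> frontier \<Omega>. a \<le> \<bar>u y\<bar>} \<in> sets borel" and "\<exists>B\<ge>0. \<forall>y\<in>frontier \<Omega>. \<bar>u y\<bar> \<le> B"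
proof -
  have cont: "continuous_on (closure \<Omega>) u" using assms by (simp add: Cb_closure_def)
  have sub: "frontier \<Omega> \<subseteq> closure \<Omega>" by (auto simp: frontier_def)
  have contF: "continuous_on (frontier \<Omega>) (\<lambda>y. \<bar>u y\<bar>)" by (intro continuous_on_rabs continuous_on_subset[OF cont sub])
  have "closed {y \<in> frontier \<Omega>. a \<le> \<bar>u y\<bar>}"
    using continuous_closed_preimage[OF contF frontier_closed, of "{a..}"] by (auto simp: vimage_def Int_def)
  then show "{y \<in> frontier \<Omega>. a \<le> \<bar>u y\<bar>} \<in> sets borel" by (rule borel_closed)
  define S where "S = closure {x \<in> closure \<Omega>. u x \<noteq> 0}"
  have "S \<subseteq> closure \<Omega>" unfolding S_def by (rule closure_minimal) auto
  moreover have "compact S" using assms by (simp add: S_def Cb_closure_def)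
  ultimately have "compact (u ` S)" using cont by (intro compact_continuous_image) (auto intro: continuous_on_subset)
  then obtain B where B: "\<And>x. x \<in> S \<Longrightarrow> \<bar>u x\<bar> \<le> B"
    by (metis compact_imp_bounded bounded_iff imageI real_norm_def)
  have "\<bar>u y\<bar> \<le> max B 0" if "y \<in> frontier \<Omega>" for y
  proof (cases "u y = 0")
    case False
    then have "y \<in> {x \<in> closure \<Omega>. u x \<noteq> 0}" using that sub by auto
    then have "y \<in> S" unfolding S_def by (rule subsetD[OF closure_subset])
    then have "\<bar>u y\<bar> \<le> B" by (rule B)
    then show ?thesis by simp
  qed simp
  then show "\<exists>B\<ge>0. \<forall>y\<in>frontier \<Omega>. \<bar>u y\<bar> \<le> B" by (intro exI[of _ "max B 0"]) auto
qed

text \<open>Chebyshev's inequality on the boundary.\<close>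

lemma frontier_power_tail:
  fixes \<Omega> :: "'a::euclidean_space set"
  assumes Cb: "Cb_closure \<Omega> u" and fin: "hausdorff_outer t (frontier \<Omega>) < \<infinity>" and r: "r > 0"
    and H: "Lp_norm (hausdorff_on t (frontier \<Omega>)) r u \<le> H" "H > 0" and a: "a > 0"
  shows "hausdorff_outer t {y \<in> frontier \<Omega>. a \<le> \<bar>u y\<bar>} \<le> ennreal ((H / a) powr r)"
proof -
  define P where "P = {y \<in> frontier \<Omega>. a \<le> \<bar>u y\<bar>}"
  define M where "M = hausdorff_on t (frontier \<Omega>)"
  have S: "frontier \<Omega> \<in> sets borel" by (simp add: borel_closed)
  have P: "P \<in> sets borel" "P \<subseteq> frontier \<Omega>" using Cb_closure_frontier_level[OF Cb] by (auto simp: P_def)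
  have PM: "P \<in> sets M" unfolding M_def sets_hausdorff_on[OF S] using P by (auto simp: sets_restrict_space)
  have sp: "space M = frontier \<Omega>" by (simp add: M_def space_hausdorff_on[OF S])
  have eP: "emeasure M P = hausdorff_outer t P" unfolding M_def by (rule emeasure_hausdorff_on[OF S P])
  obtain B where B: "B \<ge> 0" "\<And>y. y \<in> frontier \<Omega> \<Longrightarrow> \<bar>u y\<bar> \<le> B" using Cb_closure_frontier_level(2)[OF Cb] by blast
  define J where "J = (\<integral>\<^sup>+x. ennreal (\<bar>u x\<bar> powr r) \<partial>M)"
  \<comment> \<open>\<open>Lp_norm\<close> uses \<open>enn2real\<close>, which sends infinity to 0,
    so its bound says nothing until the integral is known to be finite. Here \<open>u\<close> is
    bounded and the boundary has finite measure.\<close>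
  have "J \<le> (\<integral>\<^sup>+x. ennreal (B powr r) \<partial>M)"
    unfolding J_def using B r by (intro nn_integral_mono ennreal_leI powr_mono2) (auto simp: sp)
  also have "\<dots> = ennreal (B powr r) * hausdorff_outer t (frontier \<Omega>)"
    using emeasure_hausdorff_on[OF S S, of t] by (simp add: sp) (simp add: M_def)
  also have "\<dots> < \<infinity>" using fin by (simp add: ennreal_mult_less_top)
  finally have J: "J = ennreal (enn2real J)" by simp
  have "enn2real J = (enn2real J powr (1 / r)) powr r" using r by (simp add: powr_powr)
  also have "\<dots> \<le> H powr r" using H r by (intro powr_mono2) (auto simp: Lp_norm_def J_def M_def)
  finally have JH: "J \<le> ennreal (H powr r)" using J by (metis ennreal_leI)
  have "ennreal (a powr r) * emeasure M P = (\<integral>\<^sup>+x. ennreal (a powr r) * indicator P x \<partial>M)"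
    by (rule nn_integral_cmult_indicator[symmetric, OF PM])
  also have "\<dots> \<le> J"
    unfolding J_def using a r by (intro nn_integral_mono) (auto simp: P_def indicator_def intro!: ennreal_leI powr_mono2)
  finally have "ennreal (a powr r) * emeasure M P \<le> ennreal (H powr r)" using JH by (rule order_trans)
  then have "emeasure M P \<le> ennreal (H powr r / a powr r)" using a by (intro ennreal_mult_le_imp) auto
  moreover have "H powr r / a powr r = (H / a) powr r" using a H by (simp add: powr_divide)
  ultimately show ?thesis unfolding P_def[symmetric] eP[symmetric] by simp
qed

lemma young_function_le:
  assumes "young_function A" "0 \<le> s" "s \<le> t" "0 < t" shows "A s \<le> s / t * A t"
proof -
  have "convex_on {0..} A" "A 0 = 0" using assms by (auto simp: young_function_def)
  then have "A ((1 - s / t) *\<^sub>R 0 + (s / t) *\<^sub>R t) \<le> (1 - s / t) * A 0 + (s / t) * A t"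
    using assms by (intro convex_onD) auto
  then show ?thesis using assms \<open>A 0 = 0\<close> by simp
qed

lemma young_function_mono:
  assumes "young_function A" "0 \<le> s" "s \<le> t" shows "A s \<le> A t"
proof (cases "t = 0")
  case False
  then have "A s \<le> s / t * A t" using assms by (intro young_function_le) auto
  also have "\<dots> \<le> 1 * A t" using assms False by (intro mult_right_mono) (auto simp: young_function_def)
  finally show ?thesis by simp
qed (use assms in simp)

text \<open>Chebyshev for the Young function. The threshold and the rate depend on \<open>A\<close>
  and \<open>B\<close> only, so they serve a whole sequence.\<close>

lemma frontier_exp_tail:
  assumes A: "exp_young \<beta> A" and \<beta>: "\<beta> > 0"
  shows "\<exists>a0. \<exists>c>0. \<forall>\<Omega> (u :: 'a::euclidean_space \<Rightarrow> real). Cb_closure \<Omega> u \<longrightarrow>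
    luxemburg_norm A (hausdorff_on t (frontier \<Omega>)) u \<le> ennreal B \<longrightarrow>
    (\<forall>a\<ge>a0. hausdorff_outer t {y \<in> frontier \<Omega>. a \<le> \<bar>u y\<bar>} \<le> ennreal (2 * exp (- ((c * a) powr \<beta>))))"
proof -
  have Y: "young_function A" using A by (simp add: exp_young_def)
  obtain c1 t0 where c1: "c1 > 0" "t0 \<ge> 0" and low: "\<And>t. t \<ge> t0 \<Longrightarrow> exp ((c1 * t) powr \<beta>) - 1 \<le> A t"
    using A by (auto simp: exp_young_def equiv_near_infinity_def)
  \<comment> \<open>Strictly above \<open>B\<close>, so the infimum in the Luxemburg norm is beaten
    by some admissible \<open>l < L\<close>, and positive even if \<open>B\<close> is
    negative.\<close>
  define L where "L = max B 0 + 1"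
  have L: "L > 0" by (simp add: L_def)
  define c where "c = c1 / L"
  have c: "c > 0" using c1 L by (simp add: c_def)
  \<comment> \<open>\<open>L * t0\<close> reaches the range where \<open>A\<close> is comparable to
    the exponential; \<open>1 / c\<close> makes the exponent \<open>y\<close> at least 1, so that
    \<open>exp y - 1 \<ge> exp y / 2\<close>.\<close>
  define a0 where "a0 = max (L * t0) (1 / c)"
  have "hausdorff_outer t {y \<in> frontier \<Omega>. a \<le> \<bar>u y\<bar>} \<le> ennreal (2 * exp (- ((c * a) powr \<beta>)))"
    if Cb: "Cb_closure \<Omega> u" and lux: "luxemburg_norm A (hausdorff_on t (frontier \<Omega>)) u \<le> ennreal B" and a: "a \<ge> a0"
    for \<Omega> and u :: "'a \<Rightarrow> real" and a
  proof -
    define P where "P = {y \<in> frontier \<Omega>. a \<le> \<bar>u y\<bar>}"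
    define M where "M = hausdorff_on t (frontier \<Omega>)"
    have S: "frontier \<Omega> \<in> sets borel" by (simp add: borel_closed)
    have P: "P \<in> sets borel" "P \<subseteq> frontier \<Omega>" using Cb_closure_frontier_level[OF Cb] by (auto simp: P_def)
    have PM: "P \<in> sets M" unfolding M_def sets_hausdorff_on[OF S] using P by (auto simp: sets_restrict_space)
    have eP: "emeasure M P = hausdorff_outer t P" unfolding M_def by (rule emeasure_hausdorff_on[OF S P])
    have "ennreal B < ennreal L" by (simp add: L_def ennreal_less_iff max_def ennreal_neg)
    with lux have "luxemburg_norm A M u < ennreal L" by (simp add: M_def)
    then obtain l where l: "l > 0" "ennreal l < ennreal L" and int: "(\<integral>\<^sup>+x. ennreal (A (\<bar>u x\<bar> / l)) \<partial>M) \<le> 1"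
      unfolding luxemburg_norm_def Inf_less_iff by auto
    have lL: "l \<le> L" using l by (simp add: ennreal_less_iff)
    have a1: "a / L \<ge> t0" "c * a \<ge> 1" "a > 0"
    proof -
      show "a / L \<ge> t0" using a L by (simp add: a0_def field_simps)
      have "1 / c \<le> a" using a by (simp add: a0_def)
      then show "c * a \<ge> 1" using c by (simp add: field_simps)
      have "0 < 1 / c" using c by simp
      then show "a > 0" using \<open>1 / c \<le> a\<close> by linarith
    qed
    define y where "y = (c * a) powr \<beta>"
    have y: "y \<ge> 1" unfolding y_def using a1 \<beta> by (intro ge_one_powr_ge_zero) auto
    have "exp y \<ge> 2" using y exp_ge_add_one_self[of y] by linarith
    then have "exp y / 2 \<le> exp y - 1" by simp
    also have "\<dots> \<le> A (a / L)" using low[OF a1(1)] by (simp add: y_def c_def)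
    finally have Aa: "exp y / 2 \<le> A (a / L)" .
    have "ennreal (exp y / 2) * emeasure M P = (\<integral>\<^sup>+x. ennreal (exp y / 2) * indicator P x \<partial>M)"
      by (rule nn_integral_cmult_indicator[symmetric, OF PM])
    also have "\<dots> \<le> (\<integral>\<^sup>+x. ennreal (A (\<bar>u x\<bar> / l)) \<partial>M)"
    proof (intro nn_integral_mono)
      fix x
      show "ennreal (exp y / 2) * indicator P x \<le> ennreal (A (\<bar>u x\<bar> / l))"
      proof (cases "x \<in> P")
        case True
        then have "a / L \<le> \<bar>u x\<bar> / l" using lL l a1 by (intro frac_le) (auto simp: P_def)
        then have "A (a / L) \<le> A (\<bar>u x\<bar> / l)" using a1 L by (intro young_function_mono[OF Y]) auto
        then show ?thesis using Aa True by (simp add: ennreal_leI)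
      qed simp
    qed
    also have "\<dots> \<le> ennreal 1" using int by simp
    finally have "emeasure M P \<le> ennreal (1 / (exp y / 2))" by (rule ennreal_mult_le_imp) auto
    also have "1 / (exp y / 2) = 2 * exp (- y)" by (simp add: exp_minus field_simps)
    finally show ?thesis unfolding P_def[symmetric] eP[symmetric] y_def .
  qed
  with c show ?thesis by blast
qed

subsection \<open>Compact embeddings\<close>

lemma V1Lp_norm_bound:
  fixes \<Omega> :: "'a::euclidean_space set"
  assumes \<Omega>: "open \<Omega>" and V: "V1Lp \<Omega> p u G" and p: "p > 0"
    and B: "Lp_norm (restrict_space lebesgue \<Omega>) p (\<lambda>x. norm (G x)) \<le> B"
  shows "(\<integral>\<^sup>+x\<in>\<Omega>. ennreal (norm (G x) powr p) \<partial>lebesgue) \<le> ennreal (B powr p)"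
proof -
  define J where "J = (\<integral>\<^sup>+x\<in>\<Omega>. ennreal (norm (G x) powr p) \<partial>lebesgue)"
  have "J < \<infinity>" using V by (simp add: V1Lp_def J_def)
  then have J: "J = ennreal (enn2real J)" by simp
  have "(\<integral>\<^sup>+x. ennreal (\<bar>norm (G x)\<bar> powr p) \<partial>restrict_space lebesgue \<Omega>) = J"
    unfolding J_def using \<Omega> by (subst nn_integral_restrict_space) (auto intro: borel_open)
  then have "enn2real J powr (1 / p) \<le> B" using B by (simp add: Lp_norm_def)
  then have "(enn2real J powr (1 / p)) powr p \<le> B powr p" using p by (intro powr_mono2) auto
  then have "enn2real J \<le> B powr p" using p by (simp add: powr_powr)
  then show ?thesis unfolding J_def[symmetric] using J by (metis ennreal_leI)
qed

lemma (in weak_pair) nn_integral_G_le: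
  assumes fin: "emeasure lborel \<Omega> < \<infinity>" and p: "1 < p" and B: "B > 0"
    and G: "(\<integral>\<^sup>+y. ennreal (norm (G y) powr p) \<partial>lborel) \<le> ennreal (B powr p)"
  shows "(\<integral>\<^sup>+y. ennreal (norm (G y)) \<partial>lborel) \<le> ennreal (2 * B * (measure lborel \<Omega> + 1) powr (1 - 1 / p))"
proof -
  have [measurable]: "\<Omega> \<in> sets borel" using open_\<Omega> by (simp add: borel_open)
  have "(\<integral>\<^sup>+y. ennreal (norm (G y)) \<partial>lborel) = (\<integral>\<^sup>+y\<in>\<Omega>. ennreal (norm (G y)) \<partial>lborel)"
    using G_0 by (intro nn_integral_cong) (auto simp: indicator_def)
  also have "\<dots> \<le> ennreal (2 * B * (measure lborel \<Omega> + 1) powr (1 - 1 / p))"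
  proof (rule nn_integral_Holder_set[OF _ _ _ p B])
    have "(\<integral>\<^sup>+y\<in>\<Omega>. ennreal (norm (G y) powr p) \<partial>lborel) \<le> (\<integral>\<^sup>+y. ennreal (norm (G y) powr p) \<partial>lborel)"
      by (intro nn_integral_mono) (auto simp: indicator_def)
    then show "(\<integral>\<^sup>+y\<in>\<Omega>. ennreal (norm (G y) powr p) \<partial>lborel) \<le> ennreal (B powr p)" using G by (rule order_trans)
    show "measure lborel \<Omega> + 1 > 0" by (simp add: add_nonneg_pos)
    have "emeasure lborel \<Omega> = ennreal (measure lborel \<Omega>)" using fin by (intro emeasure_eq_ennreal_measure) auto
    also have "\<dots> \<le> ennreal (measure lborel \<Omega> + 1)" by (intro ennreal_leI) auto
    finally show "emeasure lborel \<Omega> \<le> ennreal (measure lborel \<Omega> + 1)" .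
  qed auto
  finally show ?thesis .
qed

text \<open>\<Psi> measures convergence and \<Theta> is the moment known to be bounded: \<Psi> is
  small near 0 and negligible against \<Theta> at infinity. These are the assumptions of
  \<open>nn_integral_Cauchy_small\<close>.\<close>

definition dominated :: "(real \<Rightarrow> real) \<Rightarrow> (real \<Rightarrow> real) \<Rightarrow> bool" where
  "dominated \<Psi> \<Theta> \<longleftrightarrow> (\<forall>s t. 0 \<le> s \<longrightarrow> s \<le> t \<longrightarrow> \<Psi> s \<le> \<Psi> t) \<and> 0 \<le> \<Psi> 0 \<and> (\<forall>e>0. \<exists>\<zeta>>0. \<Psi> \<zeta> \<le> e) \<and>
     (\<forall>t. 0 \<le> \<Theta> t) \<and> \<Theta> \<in> borel_measurable borel \<and> (\<forall>\<eta>>0. \<exists>T>0. \<forall>t\<ge>T. \<Psi> t \<le> \<eta> * \<Theta> t)"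

text \<open>The subsequence is chosen before \<Psi> and \<Theta>. In the exponential case one
  subsequence must serve every Young function of the class and every scaling
  \<open>l\<close>.\<close>

lemma Cauchy_integral_subsequence:
  fixes \<Omega> :: "'a::euclidean_space set" and u :: "nat \<Rightarrow> 'a::euclidean_space \<Rightarrow> real" and N :: "'a measure"
  assumes W: "\<And>k. weak_growth \<Omega> (u k) (G k) N C \<alpha>"
    and GB: "\<And>k. (\<integral>\<^sup>+y. ennreal (norm (G k y)) \<partial>lborel) \<le> ennreal B"
    and uB: "\<And>k. (\<integral>\<^sup>+x. ennreal \<bar>indicator \<Omega> x * u k x\<bar> \<partial>density lborel (indicator \<Omega>)) \<le> ennreal B" and B: "B \<ge> 0"
  shows "\<exists>s :: nat \<Rightarrow> nat. strict_mono s \<and> (\<forall>\<Psi> \<Theta> D e. dominated \<Psi> \<Theta> \<longrightarrow>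
    (\<forall>k m. (\<integral>\<^sup>+x. ennreal (\<Theta> \<bar>indicator \<Omega> x * u k x - indicator \<Omega> x * u m x\<bar>) \<partial>N) \<le> ennreal D) \<longrightarrow> 0 \<le> D \<longrightarrow> 0 < e \<longrightarrow>
    (\<exists>K. \<forall>k\<ge>K. \<forall>m\<ge>K. (\<integral>\<^sup>+x. ennreal (\<Psi> \<bar>indicator \<Omega> x * u (s k) x - indicator \<Omega> x * u (s m) x\<bar>) \<partial>N) \<le> ennreal e))"
proof -
  interpret W: weak_growth \<Omega> "u k" "G k" N C \<alpha> for k by (rule W)
  define v where "v = (\<lambda>k x. indicator \<Omega> x * u k x)"
  have v: "v k = weak_pair.u0 \<Omega> (u k)" for k by (simp add: v_def W.u0_def[abs_def])
  have v_meas [measurable]: "v k \<in> borel_measurable borel" for k unfolding v by (rule W.u0_measurable)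
  have sp: "space N = UNIV" using sets_eq_imp_space_eq[OF W.sets_N] by simp
  have L1: "(\<integral>y. \<bar>weak_pair.u0 \<Omega> (u k) y\<bar> \<partial>lborel) \<le> B" for k
  proof -
    have "ennreal (\<integral>y. \<bar>weak_pair.u0 \<Omega> (u k) y\<bar> \<partial>lborel) \<le> ennreal B"
      using uB[of k] W.nn_integral_u0_density[of k] by (simp add: W.u0_def)
    then show ?thesis using B by (simp add: ennreal_le_iff)
  qed
  from compactness_in_measure[OF W GB B L1]
  obtain s :: "nat \<Rightarrow> nat" where s': "strict_mono s \<and> (\<forall>\<zeta>>0. \<forall>\<eta>>0.
      \<exists>M. \<forall>k\<ge>M. \<forall>m\<ge>M. measure N {x \<in> \<Omega>. \<zeta> < \<bar>u (s k) x - u (s m) x\<bar>} \<le> \<eta>)" ..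
  then have s: "strict_mono s" ..
  have conv: "\<exists>M. \<forall>k\<ge>M. \<forall>m\<ge>M. measure N {x \<in> \<Omega>. \<zeta> < \<bar>u (s k) x - u (s m) x\<bar>} \<le> \<eta>"
    if "\<zeta> > 0" "\<eta> > 0" for \<zeta> \<eta>
    using conjunct2[OF s', rule_format, OF that] .
  have conv': "\<exists>M. \<forall>k\<ge>M. \<forall>m\<ge>M. measure N {x \<in> space N. \<zeta> < \<bar>v (s k) x - v (s m) x\<bar>} \<le> \<eta>" if z: "\<zeta> > 0" "\<eta> > 0" for \<zeta> \<eta>
  proof -
    have "{x \<in> space N. \<zeta> < \<bar>v (s k) x - v (s m) x\<bar>} = {x \<in> \<Omega>. \<zeta> < \<bar>u (s k) x - u (s m) x\<bar>}" for k m
      using z by (auto simp: v_def sp indicator_def split: if_splits)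
    then show ?thesis using conv[OF z] by simp
  qed
  show ?thesis
  proof (intro exI[of _ s] conjI s allI impI)
    fix \<Psi> \<Theta> :: "real \<Rightarrow> real" and D e :: real
    assume dom: "dominated \<Psi> \<Theta>"
      and D: "\<forall>k m. (\<integral>\<^sup>+x. ennreal (\<Theta> \<bar>indicator \<Omega> x * u k x - indicator \<Omega> x * u m x\<bar>) \<partial>N) \<le> ennreal D" "0 \<le> D" "0 < e"
    note A = dom[unfolded dominated_def]
    have "\<exists>K. \<forall>k\<ge>K. \<forall>m\<ge>K. (\<integral>\<^sup>+x. ennreal (\<Psi> \<bar>v (s k) x - v (s m) x\<bar>) \<partial>N) \<le> ennreal e"
    proof (rule W.nn_integral_Cauchy_small[where g = "\<lambda>k m x. \<bar>v (s k) x - v (s m) x\<bar>" and \<Psi> = \<Psi> and \<Theta> = \<Theta> and B = D])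
      show "(\<lambda>x. \<bar>v (s k) x - v (s m) x\<bar>) \<in> borel_measurable N" for k m by measurable
      show "\<exists>M. \<forall>k\<ge>M. \<forall>m\<ge>M. measure N {x \<in> space N. \<zeta> < \<bar>v (s k) x - v (s m) x\<bar>} \<le> \<eta>" if "\<zeta> > 0" "\<eta> > 0" for \<zeta> \<eta>
        by (rule conv'[OF that])
      show "(\<integral>\<^sup>+x. ennreal (\<Theta> \<bar>v (s k) x - v (s m) x\<bar>) \<partial>N) \<le> ennreal D" for k m
        unfolding v_def using D(1) by blast
    qed (use A D(2,3) in auto)
    then show "\<exists>K. \<forall>k\<ge>K. \<forall>m\<ge>K. (\<integral>\<^sup>+x. ennreal (\<Psi> \<bar>indicator \<Omega> x * u (s k) x - indicator \<Omega> x * u (s m) x\<bar>) \<partial>N) \<le> ennreal e"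
      unfolding v_def .
  qed
qed

lemma summable_power_tail:
  assumes "\<sigma> < w" shows "summable (\<lambda>k. (2 ^ Suc k) powr \<sigma> * (Q * 2 powr (- (real k * w))) :: real)"
proof -
  have "(2 ^ Suc k) powr \<sigma> * (Q * 2 powr (- (real k * w))) = Q * 2 powr \<sigma> * (2 powr (\<sigma> - w)) ^ k" for k
  proof -
    have "(2 ^ Suc k :: real) powr \<sigma> = 2 powr (real (Suc k) * \<sigma>)" by (simp only: powr_realpow[symmetric] zero_less_numeral powr_powr)
    moreover have "(2 powr (\<sigma> - w)) ^ k = 2 powr (real k * (\<sigma> - w))" by (simp add: powr_realpow[symmetric] powr_powr mult.commute)
    moreover have "2 powr (real (Suc k) * \<sigma>) * 2 powr (- (real k * w)) = 2 powr \<sigma> * 2 powr (real k * (\<sigma> - w))"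
      by (simp add: powr_add[symmetric] algebra_simps)
    ultimately show ?thesis by (simp add: mult_ac)
  qed
  then have eq: "(\<lambda>k. (2 ^ Suc k) powr \<sigma> * (Q * 2 powr (- (real k * w)))) = (\<lambda>k. Q * 2 powr \<sigma> * (2 powr (\<sigma> - w)) ^ k)"
    by (rule ext)
  have "2 powr (\<sigma> - w) < 1" using assms by (simp add: powr_less_one)
  then show ?thesis unfolding eq by (intro summable_mult summable_geometric) simp
qed

lemma compact_embedding_power:
  fixes \<Omega> :: "'a::euclidean_space set" and u :: "nat \<Rightarrow> 'a \<Rightarrow> real" and N :: "'a measure"
  defines "n \<equiv> real DIM('a)"
  assumes \<Omega>: "open \<Omega>" "emeasure lebesgue \<Omega> < \<infinity>" and fin: "hausdorff_outer (n - 1) (frontier \<Omega>) < \<infinity>"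
    and N: "ball_growth N C \<alpha>"
    and p: "1 < p" "p < n" and r: "1 < r" and q: "1 \<le> q" "q < min (p * \<alpha> / (n - p)) (r * \<alpha> / (n - 1))"
    and Cb: "\<And>k. Cb_closure \<Omega> (u k)" and V: "\<And>k. V1Lp \<Omega> p (u k) (G0 k)"
    and GB: "\<And>k. Lp_norm (restrict_space lebesgue \<Omega>) p (\<lambda>x. norm (G0 k x)) \<le> B" and B: "B > 0"
    and uH: "\<And>k. Lp_norm (hausdorff_on (n - 1) (frontier \<Omega>)) r (u k) \<le> H" and H: "H > 0"
  shows "\<exists>s :: nat \<Rightarrow> nat. strict_mono s \<and> (\<forall>e>0. \<exists>K. \<forall>k\<ge>K. \<forall>m\<ge>K.
    (\<integral>\<^sup>+x. ennreal (\<bar>indicator \<Omega> x * u (s k) x - indicator \<Omega> x * u (s m) x\<bar> powr q) \<partial>N) \<le> ennreal e)"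
proof -
  interpret N: ball_growth N C \<alpha> by (rule N)
  have n: "n \<ge> 2" using N.dim by (simp add: n_def)
  have \<Omega>b: "\<Omega> \<in> sets borel" "emeasure lborel \<Omega> < \<infinity>" using \<Omega> by (auto simp: borel_open)
  have "\<forall>k. \<exists>G. weak_pair \<Omega> (u k) G \<and> (\<integral>\<^sup>+y. ennreal (norm (G y) powr p) \<partial>lborel) = (\<integral>\<^sup>+x\<in>\<Omega>. ennreal (norm (G0 k x) powr p) \<partial>lebesgue)"
  proof
    fix k
    have "1 \<le> p" using p by simp
    from V1Lp_weak_pair[OF \<Omega> Cb[of k] V[of k] this]
    show "\<exists>G. weak_pair \<Omega> (u k) G \<and> (\<integral>\<^sup>+y. ennreal (norm (G y) powr p) \<partial>lborel) = (\<integral>\<^sup>+x\<in>\<Omega>. ennreal (norm (G0 k x) powr p) \<partial>lebesgue)"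
      by blast
  qed
  from choice[OF this] obtain G where G: "\<forall>k. weak_pair \<Omega> (u k) (G k) \<and>
    (\<integral>\<^sup>+y. ennreal (norm (G k y) powr p) \<partial>lborel) = (\<integral>\<^sup>+x\<in>\<Omega>. ennreal (norm (G0 k x) powr p) \<partial>lebesgue)" ..
  have WP: "weak_pair \<Omega> (u k) (G k)"
    and Gp': "(\<integral>\<^sup>+y. ennreal (norm (G k y) powr p) \<partial>lborel) = (\<integral>\<^sup>+x\<in>\<Omega>. ennreal (norm (G0 k x) powr p) \<partial>lebesgue)" for k
    using G by simp_all
  have Gp: "(\<integral>\<^sup>+y. ennreal (norm (G k y) powr p) \<partial>lborel) \<le> ennreal (B powr p)" for k
    unfolding Gp' using p by (intro V1Lp_norm_bound[OF \<Omega>(1) V _ GB]) auto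
  have h: "\<forall>a>0. hausdorff_outer (n - 1) {y \<in> frontier \<Omega>. a \<le> \<bar>u k y\<bar>} \<le> ennreal ((H / a) powr r)" for k
    using r by (intro allI impI frontier_power_tail[OF Cb fin _ uH H]) auto
  \<comment> \<open>The best exponent allowed by the gradient and by the boundary data for Lebesgue
    measure; multiplied by \<open>\<alpha> / n\<close> it is the critical exponent for
    \<open>N\<close>. That it exceeds 1 gives the L^1 bound below.\<close>
  define s where "s = min (n * p / (n - p)) (r * n / (n - 1))"
  have s: "s > 1" "s \<le> n * p / (n - p)" "s \<le> r * n / (n - 1)"
  proof -
    have "n < n * p" using n p mult_strict_left_mono[of 1 p n] by simp
    then have "n - p < n * p" using p by linarith
    then have "1 < n * p / (n - p)" using p by (simp add: less_divide_eq)
    moreover have "n \<le> r * n" using r n mult_right_mono[of 1 r n] by simp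
    then have "n - 1 < r * n" by linarith
    then have "1 < r * n / (n - 1)" using n by (simp add: less_divide_eq)
    ultimately show "s > 1" by (simp add: s_def)
  qed (auto simp: s_def)
  have \<alpha>0: "\<alpha> > 0" using N.\<alpha> n by (simp add: n_def)
  have qs: "q < s * \<alpha> / n"
  proof -
    have e: "p * \<alpha> / (n - p) = n * p / (n - p) * (\<alpha> / n)" "r * \<alpha> / (n - 1) = r * n / (n - 1) * (\<alpha> / n)"
      using n by auto
    have "s * (\<alpha> / n) = min (p * \<alpha> / (n - p)) (r * \<alpha> / (n - 1))"
      unfolding e s_def using n \<alpha>0 by (intro min_mult_distrib_right[THEN trans]) auto
    then show ?thesis using q by simp
  qed
  have s0: "s > 0" using s by simp
  obtain Q where Q: "Q \<ge> 0" and tail': "\<forall>u G. weak_pair \<Omega> u G \<longrightarrow> (\<integral>\<^sup>+y. ennreal (norm (G y) powr p) \<partial>lborel) \<le> ennreal (B powr p) \<longrightarrow>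
    (\<forall>a>0. hausdorff_outer (n - 1) {y \<in> frontier \<Omega>. a \<le> \<bar>u y\<bar>} \<le> ennreal ((H / a) powr r)) \<longrightarrow>
    (\<forall>k. measure N {x \<in> \<Omega>. 2 ^ k \<le> \<bar>u x\<bar>} \<le> Q * 2 powr (- (real k * (s * \<alpha> / n))))"
    using power_dyadic_tail[OF \<Omega>b N p[unfolded n_def] s0 s(2,3)[unfolded n_def] B H, folded n_def] by (elim exE conjE)
  have tail: "measure N {x \<in> \<Omega>. 2 ^ j \<le> \<bar>u k x\<bar>} \<le> Q * 2 powr (- (real j * (s * \<alpha> / n)))" for k j
    using tail'[THEN spec, THEN spec, THEN mp, OF WP, THEN mp, OF Gp, THEN mp, OF h] by (rule spec)
  \<comment> \<open>The mollifications must be bounded uniformly in \<open>k\<close>, which takes a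
    Lebesgue L^1 bound on \<open>u k\<close>; the same tail lemma yields it with Lebesgue measure on
    \<Omega> in place of \<open>N\<close>.\<close>
  define NL where "NL = density lborel (indicator \<Omega> :: 'a \<Rightarrow> ennreal)"
  have NL: "ball_growth NL (unit_ball_vol n) n"
    unfolding NL_def n_def by (rule ball_growth_lborel(1)[OF \<Omega>b N.dim])
  obtain QL where QL: "QL \<ge> 0" and tailL': "\<forall>u G. weak_pair \<Omega> u G \<longrightarrow> (\<integral>\<^sup>+y. ennreal (norm (G y) powr p) \<partial>lborel) \<le> ennreal (B powr p) \<longrightarrow>
    (\<forall>a>0. hausdorff_outer (n - 1) {y \<in> frontier \<Omega>. a \<le> \<bar>u y\<bar>} \<le> ennreal ((H / a) powr r)) \<longrightarrow>
    (\<forall>k. measure NL {x \<in> \<Omega>. 2 ^ k \<le> \<bar>u x\<bar>} \<le> QL * 2 powr (- (real k * (s * n / n))))"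
    using power_dyadic_tail[OF \<Omega>b NL p[unfolded n_def] s0 s(2,3)[unfolded n_def] B H, folded n_def] by (elim exE conjE)
  have tailL: "measure NL {x \<in> \<Omega>. 2 ^ j \<le> \<bar>u k x\<bar>} \<le> QL * 2 powr (- (real j * (s * n / n)))" for k j
    using tailL'[THEN spec, THEN spec, THEN mp, OF WP, THEN mp, OF Gp, THEN mp, OF h] by (rule spec)
  interpret W: weak_growth \<Omega> "u k" "G k" N C \<alpha> for k unfolding weak_growth_def using WP N by blast
  interpret L: weak_growth \<Omega> "u k" "G k" NL "unit_ball_vol n" n for k unfolding weak_growth_def using WP NL by blast
  have v: "weak_pair.u0 \<Omega> (u k) = (\<lambda>x. indicator \<Omega> x * u k x)" for k by (simp add: W.u0_def[abs_def])
  define B1 where "B1 = 2 * B * (measure lborel \<Omega> + 1) powr (1 - 1 / p)"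
  define B2 where "B2 = 1 powr 1 * measure NL UNIV + (\<Sum>k. (2 ^ Suc k) powr 1 * (QL * 2 powr (- (real k * (s * n / n)))))"
  have B2: "(\<integral>\<^sup>+x. ennreal \<bar>indicator \<Omega> x * u k x\<bar> \<partial>NL) \<le> ennreal B2" for k
  proof -
    have "(\<integral>\<^sup>+x. ennreal (\<bar>weak_pair.u0 \<Omega> (u k) x\<bar> powr 1) \<partial>NL) \<le> ennreal B2"
      unfolding B2_def using s n by (intro L.moment_bound tailL summable_power_tail powr_mono2) auto
    then show ?thesis unfolding v by simp
  qed
  \<comment> \<open>The strict inequality for \<open>q\<close> leaves room for a higher moment of
    order \<sigma> that is still bounded.\<close>
  obtain \<sigma> where \<sigma>': "q < \<sigma>" "\<sigma> < s * \<alpha> / n" using dense[OF qs] by blast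
  have \<sigma>: "q < \<sigma>" "\<sigma> < s * \<alpha> / n" "\<sigma> > 0" using \<sigma>' less_le_trans[OF zero_less_one q(1)] by (blast intro: less_trans)+
  define D where "D = 1 powr \<sigma> * measure N UNIV + (\<Sum>k. (2 ^ Suc k) powr \<sigma> * (Q * 2 powr (- (real k * (s * \<alpha> / n)))))"
  have D: "(\<integral>\<^sup>+x. ennreal (\<bar>weak_pair.u0 \<Omega> (u k) x\<bar> powr \<sigma>) \<partial>N) \<le> ennreal D" for k
    unfolding D_def using \<sigma> by (intro W.moment_bound tail summable_power_tail powr_mono2) auto
  have D0: "D \<ge> 0" unfolding D_def using \<sigma> Q by (intro add_nonneg_nonneg suminf_nonneg summable_power_tail) auto
  have diff: "(\<integral>\<^sup>+x. ennreal (\<bar>indicator \<Omega> x * u k x - indicator \<Omega> x * u m x\<bar> powr \<sigma>) \<partial>N) \<le> ennreal (2 powr \<sigma> * (D + D))" for k m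
  proof -
    let ?v = "\<lambda>k. weak_pair.u0 \<Omega> (u k)"
    have "(\<integral>\<^sup>+x. ennreal (\<bar>?v k x - ?v m x\<bar> powr \<sigma>) \<partial>N) \<le> (\<integral>\<^sup>+x. ennreal (2 powr \<sigma>) * (ennreal (\<bar>?v k x\<bar> powr \<sigma>) + ennreal (\<bar>?v m x\<bar> powr \<sigma>)) \<partial>N)"
    proof (intro nn_integral_mono)
      fix x
      have "\<bar>?v k x - ?v m x\<bar> powr \<sigma> \<le> (\<bar>?v k x\<bar> + \<bar>?v m x\<bar>) powr \<sigma>" using \<sigma> by (intro powr_mono2) auto
      also have "\<dots> \<le> 2 powr \<sigma> * (\<bar>?v k x\<bar> powr \<sigma> + \<bar>?v m x\<bar> powr \<sigma>)" using \<sigma> by (intro powr_add_le) auto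
      finally have "ennreal (\<bar>?v k x - ?v m x\<bar> powr \<sigma>) \<le> ennreal (2 powr \<sigma> * (\<bar>?v k x\<bar> powr \<sigma> + \<bar>?v m x\<bar> powr \<sigma>))" by (rule ennreal_leI)
      then show "ennreal (\<bar>?v k x - ?v m x\<bar> powr \<sigma>) \<le> ennreal (2 powr \<sigma>) * (ennreal (\<bar>?v k x\<bar> powr \<sigma>) + ennreal (\<bar>?v m x\<bar> powr \<sigma>))"
        by (simp add: ennreal_mult)
    qed
    also have "\<dots> = ennreal (2 powr \<sigma>) * ((\<integral>\<^sup>+x. ennreal (\<bar>?v k x\<bar> powr \<sigma>) \<partial>N) + (\<integral>\<^sup>+x. ennreal (\<bar>?v m x\<bar> powr \<sigma>) \<partial>N))"
      by (subst nn_integral_cmult, measurable, subst nn_integral_add) auto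
    also have "\<dots> \<le> ennreal (2 powr \<sigma>) * (ennreal D + ennreal D)" by (intro mult_left_mono add_mono D) auto
    also have "\<dots> = ennreal (2 powr \<sigma> * (D + D))" using D0
      by (simp only: ennreal_mult powr_ge_zero add_nonneg_nonneg ennreal_plus)
    finally show ?thesis unfolding v .
  qed
  define BB where "BB = max (max B1 B2) 0"
  have GBB: "(\<integral>\<^sup>+y. ennreal (norm (G k y)) \<partial>lborel) \<le> ennreal BB" for k
      by (rule order_trans[OF W.nn_integral_G_le[OF \<Omega>b(2) p(1) B Gp]]) (auto simp: BB_def B1_def intro!: ennreal_leI)
  have uBB: "(\<integral>\<^sup>+x. ennreal \<bar>indicator \<Omega> x * u k x\<bar> \<partial>density lborel (indicator \<Omega>)) \<le> ennreal BB" for k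
      by (rule order_trans[OF B2[unfolded NL_def]]) (auto simp: BB_def intro!: ennreal_leI)
  have BB: "BB \<ge> 0" by (simp add: BB_def)
  from Cauchy_integral_subsequence[where u = u and G = G, OF W.weak_growth_axioms GBB uBB BB]
  obtain t :: "nat \<Rightarrow> nat" where t': "strict_mono t \<and> (\<forall>\<Psi> \<Theta> D e. dominated \<Psi> \<Theta> \<longrightarrow>
    (\<forall>k m. (\<integral>\<^sup>+x. ennreal (\<Theta> \<bar>indicator \<Omega> x * u k x - indicator \<Omega> x * u m x\<bar>) \<partial>N) \<le> ennreal D) \<longrightarrow> 0 \<le> D \<longrightarrow> 0 < e \<longrightarrow>
    (\<exists>K. \<forall>k\<ge>K. \<forall>m\<ge>K. (\<integral>\<^sup>+x. ennreal (\<Psi> \<bar>indicator \<Omega> x * u (t k) x - indicator \<Omega> x * u (t m) x\<bar>) \<partial>N) \<le> ennreal e))" ..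
  then have t: "strict_mono t" ..
  note main = conjunct2[OF t', THEN spec, THEN spec, THEN spec, THEN spec, THEN mp, THEN mp, THEN mp, THEN mp]
  have dom: "dominated (\<lambda>t. t powr q) (\<lambda>t. t powr \<sigma>)"
    unfolding dominated_def
  proof (intro conjI allI impI)
    fix e :: real assume e: "e > 0"
    have "(e powr (1 / q)) powr q \<le> e" using e q by (simp add: powr_powr)
    then show "\<exists>\<zeta>>0. \<zeta> powr q \<le> e" using e by (intro exI[of _ "e powr (1 / q)"]) auto
  next
    fix \<eta> :: real assume \<eta>: "\<eta> > 0"
    define T where "T = (1 / \<eta>) powr (1 / (\<sigma> - q))"
    have T: "T > 0" using \<eta> by (simp add: T_def)
    have "t powr q \<le> \<eta> * t powr \<sigma>" if "t \<ge> T" for t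
    proof -
      have "1 / \<eta> = T powr (\<sigma> - q)" using \<eta> \<sigma> by (simp add: T_def powr_powr)
      also have "\<dots> \<le> t powr (\<sigma> - q)" using that T \<sigma> by (intro powr_mono2) auto
      finally have "1 \<le> \<eta> * t powr (\<sigma> - q)" using \<eta> by (simp add: field_simps)
      then have "t powr q * 1 \<le> t powr q * (\<eta> * t powr (\<sigma> - q))" by (intro mult_left_mono) auto
      also have "\<dots> = \<eta> * (t powr q * t powr (\<sigma> - q))" by simp
      also have "t powr q * t powr (\<sigma> - q) = t powr \<sigma>" by (simp add: powr_add[symmetric])
      finally show ?thesis by simp
    qed
    with T show "\<exists>T>0. \<forall>t\<ge>T. t powr q \<le> \<eta> * t powr \<sigma>" by blast
  qed (use q in \<open>auto intro!: powr_mono2\<close>)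
  have diff': "\<forall>k m. (\<integral>\<^sup>+x. ennreal (\<bar>indicator \<Omega> x * u k x - indicator \<Omega> x * u m x\<bar> powr \<sigma>) \<partial>N) \<le> ennreal (2 powr \<sigma> * (D + D))"
    using diff by (intro allI)
  have "0 \<le> 2 powr \<sigma> * (D + D)" using D0 by simp
  note main = main[OF dom diff' this]
  show ?thesis
    by (intro exI[of _ t] conjI t allI impI main)
qed

lemma summable_exp_tail:
  fixes \<Lambda> c Q :: real
  assumes "0 < \<gamma>" "\<gamma> < \<delta>" "0 < c" "0 \<le> Q"
  shows "summable (\<lambda>k. exp (\<Lambda> * (2 ^ Suc k) powr \<gamma>) * (Q * exp (- (c * (2 ^ k) powr \<delta>))))"
    and "summable (\<lambda>k. 2 ^ Suc k * (Q * exp (- (c * (2 ^ k) powr \<delta>))))"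
proof -
  have S: "summable (\<lambda>k. Q * (2 ^ k * exp (\<Lambda> * 2 powr \<gamma> * (2 ^ k) powr \<gamma> - c * (2 ^ k) powr \<delta>)))"
    by (intro summable_mult summable_exp_powr assms)
  show "summable (\<lambda>k. exp (\<Lambda> * (2 ^ Suc k) powr \<gamma>) * (Q * exp (- (c * (2 ^ k) powr \<delta>))))"
  proof (rule summable_comparison_test'[OF S])
    fix k :: nat
    have "exp (\<Lambda> * (2 ^ Suc k) powr \<gamma>) * (Q * exp (- (c * (2 ^ k) powr \<delta>))) = Q * (1 * exp (\<Lambda> * 2 powr \<gamma> * (2 ^ k) powr \<gamma> - c * (2 ^ k) powr \<delta>))"
      by (simp add: powr_mult exp_diff exp_minus field_simps)
    also have "\<dots> \<le> Q * (2 ^ k * exp (\<Lambda> * 2 powr \<gamma> * (2 ^ k) powr \<gamma> - c * (2 ^ k) powr \<delta>))"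
      using assms by (intro mult_left_mono mult_right_mono) auto
    finally show "norm (exp (\<Lambda> * (2 ^ Suc k) powr \<gamma>) * (Q * exp (- (c * (2 ^ k) powr \<delta>)))) \<le> Q * (2 ^ k * exp (\<Lambda> * 2 powr \<gamma> * (2 ^ k) powr \<gamma> - c * (2 ^ k) powr \<delta>))"
      using assms by (simp add: abs_mult)
  qed
  have "summable (\<lambda>k. 2 * Q * (2 ^ k * exp (0 * (2 ^ k) powr \<gamma> - c * (2 ^ k) powr \<delta>)))"
    by (intro summable_mult summable_exp_powr assms)
  then show "summable (\<lambda>k. 2 ^ Suc k * (Q * exp (- (c * (2 ^ k) powr \<delta>))))"
    by (simp add: mult_ac)
qed

lemma exp_young_dominated:
  assumes A: "exp_young \<gamma> A" and \<gamma>: "\<gamma> > 0" and l: "l > 0"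
  shows "\<exists>\<Lambda>\<ge>0. \<forall>\<eta>>0. \<exists>T>0. \<forall>t\<ge>T. A (t / l) \<le> \<eta> * exp (\<Lambda> * t powr \<gamma>)"
proof -
  obtain c2 t0 where c2: "c2 > 0" "t0 \<ge> 0" and up: "\<And>t. t \<ge> t0 \<Longrightarrow> A t \<le> exp ((c2 * t) powr \<gamma>) - 1"
    using A by (auto simp: exp_young_def equiv_near_infinity_def)
  \<comment> \<open>The first summand is the rate of \<open>A\<close> after scaling by
    \<open>l\<close>; the extra 1 provides a factor \<open>exp (t powr \<gamma>)\<close> that beats
    \<open>1 / \<eta>\<close> for large \<open>t\<close>.\<close>
  define \<Lambda> where "\<Lambda> = (c2 / l) powr \<gamma> + 1"
  have "\<exists>T>0. \<forall>t\<ge>T. A (t / l) \<le> \<eta> * exp (\<Lambda> * t powr \<gamma>)" if \<eta>: "\<eta> > 0" for \<eta>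
  proof -
    define T where "T = max (l * t0) ((max 1 (ln (1 / \<eta>))) powr (1 / \<gamma>))"
    have T1: "T \<ge> (max 1 (ln (1 / \<eta>))) powr (1 / \<gamma>)" by (simp add: T_def)
    have "(max 1 (ln (1 / \<eta>))) powr (1 / \<gamma>) > 0" by simp
    then have T: "T > 0" using T1 by linarith
    have "A (t / l) \<le> \<eta> * exp (\<Lambda> * t powr \<gamma>)" if t: "t \<ge> T" for t
    proof -
      have "ln (1 / \<eta>) \<le> ((max 1 (ln (1 / \<eta>))) powr (1 / \<gamma>)) powr \<gamma>" using \<gamma> by (simp add: powr_powr)
      also have "\<dots> \<le> t powr \<gamma>" using t T1 \<gamma> by (intro powr_mono2) auto
      finally have "exp (ln (1 / \<eta>)) \<le> exp (t powr \<gamma>)" by simp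
      then have 1: "1 \<le> \<eta> * exp (t powr \<gamma>)" using \<eta> by (simp add: field_simps)
      have "t / l \<ge> t0" using t l by (simp add: T_def field_simps)
      then have "A (t / l) \<le> exp ((c2 * (t / l)) powr \<gamma>)" using up[of "t / l"] by simp
      also have "c2 * (t / l) = (c2 / l) * t" by simp
      also have "((c2 / l) * t) powr \<gamma> = (c2 / l) powr \<gamma> * t powr \<gamma>" by (rule powr_mult)
      also have "exp \<dots> \<le> \<eta> * exp (t powr \<gamma>) * exp ((c2 / l) powr \<gamma> * t powr \<gamma>)"
        using mult_right_mono[OF 1, of "exp ((c2 / l) powr \<gamma> * t powr \<gamma>)"] by simp
      also have "\<dots> = \<eta> * exp (\<Lambda> * t powr \<gamma>)" by (simp add: \<Lambda>_def exp_add[symmetric] algebra_simps)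
      finally show ?thesis .
    qed
    with T show ?thesis by blast
  qed
  moreover have "\<Lambda> \<ge> 0" by (simp add: \<Lambda>_def)
  ultimately show ?thesis by blast
qed

lemma compact_embedding_exp:
  fixes \<Omega> :: "'a::euclidean_space set" and u :: "nat \<Rightarrow> 'a \<Rightarrow> real" and N :: "'a measure"
  defines "n \<equiv> real DIM('a)"
  assumes \<Omega>: "open \<Omega>" "emeasure lebesgue \<Omega> < \<infinity>"
    and N: "ball_growth N C \<alpha>"
    and \<gamma>: "0 < \<gamma>" "\<gamma> < min (n / (n - 1)) \<beta>"
    and Cb: "\<And>k. Cb_closure \<Omega> (u k)" and V: "\<And>k. V1Lp \<Omega> n (u k) (G0 k)"
    and GB: "\<And>k. Lp_norm (restrict_space lebesgue \<Omega>) n (\<lambda>x. norm (G0 k x)) \<le> B" and B: "B > 0"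
    and A: "exp_young \<beta> A" and uH: "\<And>k. luxemburg_norm A (hausdorff_on (n - 1) (frontier \<Omega>)) (u k) \<le> ennreal H"
  shows "\<exists>s :: nat \<Rightarrow> nat. strict_mono s \<and> (\<forall>A l. exp_young \<gamma> A \<longrightarrow> 0 < l \<longrightarrow> (\<exists>K. \<forall>k\<ge>K. \<forall>m\<ge>K.
    (\<integral>\<^sup>+x. ennreal (A (\<bar>indicator \<Omega> x * u (s k) x - indicator \<Omega> x * u (s m) x\<bar> / l)) \<partial>N) \<le> 1))"
proof -
  interpret N: ball_growth N C \<alpha> by (rule N)
  have n: "n \<ge> 2" using N.dim by (simp add: n_def)
  have \<Omega>b: "\<Omega> \<in> sets borel" "emeasure lborel \<Omega> < \<infinity>" using \<Omega> by (auto simp: borel_open)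
  have "\<forall>k. \<exists>G. weak_pair \<Omega> (u k) G \<and> (\<integral>\<^sup>+y. ennreal (norm (G y) powr n) \<partial>lborel) = (\<integral>\<^sup>+x\<in>\<Omega>. ennreal (norm (G0 k x) powr n) \<partial>lebesgue)"
  proof
    fix k
    have "1 \<le> n" using n by simp
    from V1Lp_weak_pair[OF \<Omega> Cb[of k] V[of k] this]
    show "\<exists>G. weak_pair \<Omega> (u k) G \<and> (\<integral>\<^sup>+y. ennreal (norm (G y) powr n) \<partial>lborel) = (\<integral>\<^sup>+x\<in>\<Omega>. ennreal (norm (G0 k x) powr n) \<partial>lebesgue)"
      by blast
  qed
  from choice[OF this] obtain G where G: "\<forall>k. weak_pair \<Omega> (u k) (G k) \<and>
    (\<integral>\<^sup>+y. ennreal (norm (G k y) powr n) \<partial>lborel) = (\<integral>\<^sup>+x\<in>\<Omega>. ennreal (norm (G0 k x) powr n) \<partial>lebesgue)" ..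
  have WP: "weak_pair \<Omega> (u k) (G k)"
    and Gp': "(\<integral>\<^sup>+y. ennreal (norm (G k y) powr n) \<partial>lborel) = (\<integral>\<^sup>+x\<in>\<Omega>. ennreal (norm (G0 k x) powr n) \<partial>lebesgue)" for k
    using G by simp_all
  have Gp: "(\<integral>\<^sup>+y. ennreal (norm (G k y) powr n) \<partial>lborel) \<le> ennreal (B powr n)" for k
    unfolding Gp' using n by (intro V1Lp_norm_bound[OF \<Omega>(1) V _ GB]) auto
  define b where "b = min (n / (n - 1)) \<beta>"
  \<comment> \<open>The tails decay like exp(-c' t^\<delta>) with \<delta> strictly above \<gamma>,
    so exponential moments of order \<gamma> are finite for every rate \<Lambda>.\<close>
  define \<delta> where "\<delta> = (\<gamma> + b) / 2"
  have b: "\<gamma> < b" "b \<le> n / (n - 1)" "b \<le> \<beta>" using \<gamma> unfolding b_def by (blast intro: min.cobounded1 min.cobounded2)+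
  have \<gamma>\<delta>: "\<gamma> < \<delta>" "\<delta> < b" using b(1) by (auto simp: \<delta>_def)
  have \<delta>: "0 < \<delta>" "\<delta> < n / (n - 1)" "\<delta> < \<beta>" "\<gamma> < \<delta>"
    using \<gamma>\<delta> \<gamma>(1) b(2,3) by (blast intro: less_trans less_le_trans)+
  have \<beta>: "\<beta> > 0" using \<delta> by simp
  obtain a0 c where c: "c > 0" and h0: "\<forall>\<Omega> (u :: 'a \<Rightarrow> real). Cb_closure \<Omega> u \<longrightarrow>
    luxemburg_norm A (hausdorff_on (n - 1) (frontier \<Omega>)) u \<le> ennreal H \<longrightarrow>
    (\<forall>a\<ge>a0. hausdorff_outer (n - 1) {y \<in> frontier \<Omega>. a \<le> \<bar>u y\<bar>} \<le> ennreal (2 * exp (- ((c * a) powr \<beta>))))"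
    using frontier_exp_tail[OF A \<beta>, of "n - 1" H] by (elim exE conjE)
  note h = h0[THEN spec, THEN spec, THEN mp, OF Cb, THEN mp, OF uH]
  obtain Q c' where Q: "Q \<ge> 0" "c' > 0" and tail': "\<forall>u G. weak_pair \<Omega> u G \<longrightarrow> (\<integral>\<^sup>+y. ennreal (norm (G y) powr n) \<partial>lborel) \<le> ennreal (B powr n) \<longrightarrow>
    (\<forall>a\<ge>a0. hausdorff_outer (n - 1) {y \<in> frontier \<Omega>. a \<le> \<bar>u y\<bar>} \<le> ennreal (2 * exp (- ((c * a) powr \<beta>)))) \<longrightarrow>
    (\<forall>k. measure N {x \<in> \<Omega>. 2 ^ k \<le> \<bar>u x\<bar>} \<le> Q * exp (- (c' * (2 ^ k) powr \<delta>)))"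
    using exp_dyadic_tail[OF \<Omega>b N B \<delta>(1) \<delta>(2)[unfolded n_def] \<delta>(3) c, of a0, folded n_def] by (elim exE conjE)
  have tail: "measure N {x \<in> \<Omega>. 2 ^ j \<le> \<bar>u k x\<bar>} \<le> Q * exp (- (c' * (2 ^ j) powr \<delta>))" for k j
    using tail'[THEN spec, THEN spec, THEN mp, OF WP, THEN mp, OF Gp, THEN mp, OF h] by (rule spec)
  define NL where "NL = density lborel (indicator \<Omega> :: 'a \<Rightarrow> ennreal)"
  have NL: "ball_growth NL (unit_ball_vol n) n"
    unfolding NL_def n_def by (rule ball_growth_lborel(1)[OF \<Omega>b N.dim])
  obtain QL cL where QL: "QL \<ge> 0" "cL > 0" and tailL': "\<forall>u G. weak_pair \<Omega> u G \<longrightarrow> (\<integral>\<^sup>+y. ennreal (norm (G y) powr n) \<partial>lborel) \<le> ennreal (B powr n) \<longrightarrow>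
    (\<forall>a\<ge>a0. hausdorff_outer (n - 1) {y \<in> frontier \<Omega>. a \<le> \<bar>u y\<bar>} \<le> ennreal (2 * exp (- ((c * a) powr \<beta>)))) \<longrightarrow>
    (\<forall>k. measure NL {x \<in> \<Omega>. 2 ^ k \<le> \<bar>u x\<bar>} \<le> QL * exp (- (cL * (2 ^ k) powr \<delta>)))"
    using exp_dyadic_tail[OF \<Omega>b NL B \<delta>(1) \<delta>(2)[unfolded n_def] \<delta>(3) c, of a0, folded n_def] by (elim exE conjE)
  have tailL: "measure NL {x \<in> \<Omega>. 2 ^ j \<le> \<bar>u k x\<bar>} \<le> QL * exp (- (cL * (2 ^ j) powr \<delta>))" for k j
    using tailL'[THEN spec, THEN spec, THEN mp, OF WP, THEN mp, OF Gp, THEN mp, OF h] by (rule spec)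
  interpret W: weak_growth \<Omega> "u k" "G k" N C \<alpha> for k unfolding weak_growth_def using WP N by blast
  interpret L: weak_growth \<Omega> "u k" "G k" NL "unit_ball_vol n" n for k unfolding weak_growth_def using WP NL by blast
  have v: "weak_pair.u0 \<Omega> (u k) = (\<lambda>x. indicator \<Omega> x * u k x)" for k by (simp add: W.u0_def[abs_def])
  define B1 where "B1 = 2 * B * (measure lborel \<Omega> + 1) powr (1 - 1 / n)"
  define B2 where "B2 = 1 * measure NL UNIV + (\<Sum>k. 2 ^ Suc k * (QL * exp (- (cL * (2 ^ k) powr \<delta>))))"
  have B2: "(\<integral>\<^sup>+x. ennreal \<bar>indicator \<Omega> x * u k x\<bar> \<partial>NL) \<le> ennreal B2" for k
  proof -
    have "(\<integral>\<^sup>+x. ennreal \<bar>weak_pair.u0 \<Omega> (u k) x\<bar> \<partial>NL) \<le> ennreal B2"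
      unfolding B2_def
      by (rule L.moment_bound[where \<Theta> = "\<lambda>t. t", OF _ _ tailL summable_exp_tail(2)[OF \<gamma>(1) \<delta>(4) QL(2,1)]]) auto
    then show ?thesis unfolding v .
  qed
  \<comment> \<open>The factor \<open>2 powr \<gamma>\<close> anticipates differences:
    \<open>\<bar>v - w\<bar> powr \<gamma>\<close> is at most \<open>2 powr \<gamma>\<close> times
    the larger of the two powers.\<close>
  define DD where "DD \<Lambda> = exp (\<Lambda> * 2 powr \<gamma> * 1 powr \<gamma>) * measure N UNIV + (\<Sum>k. exp (\<Lambda> * 2 powr \<gamma> * (2 ^ Suc k) powr \<gamma>) * (Q * exp (- (c' * (2 ^ k) powr \<delta>))))" for \<Lambda>
  have DD: "(\<integral>\<^sup>+x. ennreal (exp (\<Lambda> * 2 powr \<gamma> * \<bar>weak_pair.u0 \<Omega> (u k) x\<bar> powr \<gamma>)) \<partial>N) \<le> ennreal (DD \<Lambda>)" if "\<Lambda> \<ge> 0" for k \<Lambda>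
    unfolding DD_def
    by (rule W.moment_bound[where \<Theta> = "\<lambda>t. exp (\<Lambda> * 2 powr \<gamma> * t powr \<gamma>)", OF _ _ tail summable_exp_tail(1)[OF \<gamma>(1) \<delta>(4) Q(2,1)]])
      (use that \<gamma> in \<open>auto intro!: mult_left_mono powr_mono2\<close>)
  have DD0: "DD \<Lambda> \<ge> 0" for \<Lambda>
    unfolding DD_def using Q by (intro add_nonneg_nonneg suminf_nonneg summable_exp_tail[OF \<gamma>(1) \<delta>(4) Q(2,1)]) auto
  have diff: "(\<integral>\<^sup>+x. ennreal (exp (\<Lambda> * \<bar>indicator \<Omega> x * u k x - indicator \<Omega> x * u m x\<bar> powr \<gamma>)) \<partial>N) \<le> ennreal (DD \<Lambda> + DD \<Lambda>)" if \<Lambda>: "\<Lambda> \<ge> 0" for k m \<Lambda>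
  proof -
    let ?v = "\<lambda>k. weak_pair.u0 \<Omega> (u k)"
    let ?e = "\<lambda>t. exp (\<Lambda> * 2 powr \<gamma> * t powr \<gamma>)"
    have "(\<integral>\<^sup>+x. ennreal (exp (\<Lambda> * \<bar>?v k x - ?v m x\<bar> powr \<gamma>)) \<partial>N) \<le> (\<integral>\<^sup>+x. ennreal (?e \<bar>?v k x\<bar>) + ennreal (?e \<bar>?v m x\<bar>) \<partial>N)"
    proof (intro nn_integral_mono)
      fix x
      define y where "y = max \<bar>?v k x\<bar> \<bar>?v m x\<bar>"
      have "\<bar>?v k x - ?v m x\<bar> powr \<gamma> \<le> (2 * y) powr \<gamma>" using \<gamma> by (intro powr_mono2) (auto simp: y_def)
      then have "\<Lambda> * \<bar>?v k x - ?v m x\<bar> powr \<gamma> \<le> \<Lambda> * (2 * y) powr \<gamma>" using \<Lambda> by (rule mult_left_mono)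
      also have "\<dots> = \<Lambda> * 2 powr \<gamma> * y powr \<gamma>" by (simp add: powr_mult y_def)
      finally have "exp (\<Lambda> * \<bar>?v k x - ?v m x\<bar> powr \<gamma>) \<le> ?e y" by simp
      also have "?e y \<le> ?e \<bar>?v k x\<bar> + ?e \<bar>?v m x\<bar>" by (simp add: y_def max_def)
      finally have "ennreal (exp (\<Lambda> * \<bar>?v k x - ?v m x\<bar> powr \<gamma>)) \<le> ennreal (?e \<bar>?v k x\<bar> + ?e \<bar>?v m x\<bar>)" by (rule ennreal_leI)
      then show "ennreal (exp (\<Lambda> * \<bar>?v k x - ?v m x\<bar> powr \<gamma>)) \<le> ennreal (?e \<bar>?v k x\<bar>) + ennreal (?e \<bar>?v m x\<bar>)"
        by (subst (asm) ennreal_plus) auto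
    qed
    also have "\<dots> = (\<integral>\<^sup>+x. ennreal (?e \<bar>?v k x\<bar>) \<partial>N) + (\<integral>\<^sup>+x. ennreal (?e \<bar>?v m x\<bar>) \<partial>N)"
      by (rule nn_integral_add) measurable
    also have "\<dots> \<le> ennreal (DD \<Lambda>) + ennreal (DD \<Lambda>)" by (intro add_mono DD \<Lambda>)
    also have "\<dots> = ennreal (DD \<Lambda> + DD \<Lambda>)" using DD0 by (intro ennreal_plus[symmetric])
    finally show ?thesis unfolding v .
  qed
  define BB where "BB = max (max B1 B2) 0"
  have n1: "1 < n" using n by simp
  have GBB: "(\<integral>\<^sup>+y. ennreal (norm (G k y)) \<partial>lborel) \<le> ennreal BB" for k
      by (rule order_trans[OF W.nn_integral_G_le[OF \<Omega>b(2) n1 B Gp]]) (auto simp: BB_def B1_def intro!: ennreal_leI)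
  have uBB: "(\<integral>\<^sup>+x. ennreal \<bar>indicator \<Omega> x * u k x\<bar> \<partial>density lborel (indicator \<Omega>)) \<le> ennreal BB" for k
      by (rule order_trans[OF B2[unfolded NL_def]]) (auto simp: BB_def intro!: ennreal_leI)
  have BB: "BB \<ge> 0" by (simp add: BB_def)
  from Cauchy_integral_subsequence[where u = u and G = G, OF W.weak_growth_axioms GBB uBB BB]
  obtain t :: "nat \<Rightarrow> nat" where t': "strict_mono t \<and> (\<forall>\<Psi> \<Theta> D e. dominated \<Psi> \<Theta> \<longrightarrow>
    (\<forall>k m. (\<integral>\<^sup>+x. ennreal (\<Theta> \<bar>indicator \<Omega> x * u k x - indicator \<Omega> x * u m x\<bar>) \<partial>N) \<le> ennreal D) \<longrightarrow> 0 \<le> D \<longrightarrow> 0 < e \<longrightarrow>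
    (\<exists>K. \<forall>k\<ge>K. \<forall>m\<ge>K. (\<integral>\<^sup>+x. ennreal (\<Psi> \<bar>indicator \<Omega> x * u (t k) x - indicator \<Omega> x * u (t m) x\<bar>) \<partial>N) \<le> ennreal e))" ..
  then have t: "strict_mono t" ..
  note main = conjunct2[OF t', THEN spec, THEN spec, THEN spec, THEN spec, THEN mp, THEN mp, THEN mp, THEN mp]
  have "\<exists>K. \<forall>k\<ge>K. \<forall>m\<ge>K. (\<integral>\<^sup>+x. ennreal (A' (\<bar>indicator \<Omega> x * u (t k) x - indicator \<Omega> x * u (t m) x\<bar> / l)) \<partial>N) \<le> 1"
    if A': "exp_young \<gamma> A'" and l: "l > 0" for A' l
  proof -
    have Y: "young_function A'" using A' by (simp add: exp_young_def)
    obtain \<Lambda> where \<Lambda>: "\<Lambda> \<ge> 0" "\<forall>\<eta>>0. \<exists>T>0. \<forall>t\<ge>T. A' (t / l) \<le> \<eta> * exp (\<Lambda> * t powr \<gamma>)"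
      using exp_young_dominated[OF A' \<gamma>(1) l] by blast
    have dom: "dominated (\<lambda>t. A' (t / l)) (\<lambda>t. exp (\<Lambda> * t powr \<gamma>))"
      unfolding dominated_def
    proof (intro conjI allI impI)
      fix s t :: real assume "0 \<le> s" "s \<le> t"
      then show "A' (s / l) \<le> A' (t / l)"
        using l by (auto intro!: young_function_mono[OF Y] divide_right_mono)
    next
      show "0 \<le> A' (0 / l)" using Y by (simp add: young_function_def)
    next
      fix e :: real assume e: "e > 0"
      define z where "z = min 1 (e / (A' 1 + 1))"
      have A1: "A' 1 \<ge> 0" using Y by (simp add: young_function_def)
      have z: "0 < z" "z \<le> 1" "z \<le> e / (A' 1 + 1)" using e A1 by (auto simp: z_def add_nonneg_pos)
      have "A' z \<le> z / 1 * A' 1" using z by (intro young_function_le[OF Y]) auto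
      also have "\<dots> \<le> e / (A' 1 + 1) * (A' 1 + 1)" using z A1 e by (intro mult_mono) auto
      also have "\<dots> = e" using A1 by simp
      finally show "\<exists>\<zeta>>0. A' (\<zeta> / l) \<le> e" using l z by (intro exI[of _ "z * l"]) auto
    next
      fix \<eta> :: real assume "\<eta> > 0"
      then show "\<exists>T>0. \<forall>t\<ge>T. A' (t / l) \<le> \<eta> * exp (\<Lambda> * t powr \<gamma>)" using \<Lambda>(2) by blast
    qed auto
    have diff': "\<forall>k m. (\<integral>\<^sup>+x. ennreal (exp (\<Lambda> * \<bar>indicator \<Omega> x * u k x - indicator \<Omega> x * u m x\<bar> powr \<gamma>)) \<partial>N) \<le> ennreal (DD \<Lambda> + DD \<Lambda>)"
      using diff[OF \<Lambda>(1)] by (intro allI)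
    have "0 \<le> DD \<Lambda> + DD \<Lambda>" using DD0[of \<Lambda>] by simp
    from main[OF dom diff' this zero_less_one] show ?thesis by simp
  qed
  then show ?thesis by (intro exI[of _ t] conjI t allI impI)
qed

text \<open>Growth is assumed only for centres in \<Omega>. A ball that meets \<Omega> at
  \<open>x\<close> lies in the ball of twice the radius around \<open>x\<close>, whence the factor
  \<open>2 powr \<alpha>\<close>.\<close>

lemma ball_growth_distr:
  fixes \<Omega> :: "'a::euclidean_space set" and M :: "'a measure"
  assumes dim: "2 \<le> DIM('a)" and M_space: "space M = \<Omega>" and id: "(\<lambda>x. x) \<in> measurable M borel"
    and M_fin: "emeasure M \<Omega> < \<infinity>" and \<alpha>: "real DIM('a) - 1 < \<alpha>" and C: "C > 0"
    and growth: "\<forall>x\<in>\<Omega>. \<forall>r>0. emeasure M (ball x r \<inter> \<Omega>) \<le> ennreal (C * r powr \<alpha>)"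
  shows "ball_growth (distr M borel (\<lambda>x. x)) (C * 2 powr \<alpha>) \<alpha>"
proof (rule ball_growth.intro)
  have em: "emeasure (distr M borel (\<lambda>x. x)) A = emeasure M (A \<inter> \<Omega>)" if "A \<in> sets borel" for A
    using emeasure_distr[OF id that] by (simp add: M_space)
  show "finite_measure (distr M borel (\<lambda>x. x))"
    using em[of UNIV] M_fin by (intro finite_measureI) simp
  fix y :: 'a and t :: real assume t: "t > 0"
  show "emeasure (distr M borel (\<lambda>x. x)) (ball y t) \<le> ennreal (C * 2 powr \<alpha> * t powr \<alpha>)"
  proof (cases "ball y t \<inter> \<Omega> = {}")
    case True
    then show ?thesis by (simp add: em)
  next
    case False
    then obtain x where x: "x \<in> \<Omega>" "dist y x < t" by auto
    have "ball y t \<subseteq> ball x (2 * t)"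
    proof
      fix w assume "w \<in> ball y t"
      then show "w \<in> ball x (2 * t)" using x dist_triangle[of x w y] by (simp add: dist_commute)
    qed
    moreover have "ball x (2 * t) \<inter> \<Omega> \<in> sets M"
      using measurable_sets[OF id, of "ball x (2 * t)"] by (simp add: M_space)
    ultimately have "emeasure M (ball y t \<inter> \<Omega>) \<le> emeasure M (ball x (2 * t) \<inter> \<Omega>)"
      by (intro emeasure_mono) auto
    also have "\<dots> \<le> ennreal (C * (2 * t) powr \<alpha>)" using growth x t by auto
    also have "C * (2 * t) powr \<alpha> = C * 2 powr \<alpha> * t powr \<alpha>" using t by (simp add: powr_mult)
    finally show ?thesis by (simp add: em)
  qed
qed (use assms in auto)

text \<open>Compactness can only give a Cauchy subsequence: alternating between two fixed functions
  is bounded but not Cauchy unless they coincide in the target space. In the exponential case one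
  admissible Young function bounds the boundary values, and a single subsequence serves all target
  Young functions.\<close>

theorem theorem3p2:
  fixes \<Omega> :: "'a::euclidean_space set" and M :: "'a measure" and C\<^sub>\<mu> \<alpha> :: real
  defines "n \<equiv> real DIM('a)"
  assumes dim: "DIM('a) \<ge> 2"
    and open_\<Omega>: "open \<Omega>"
    and leb_fin: "emeasure lebesgue \<Omega> < \<infinity>"
    and bdry_fin: "hausdorff_outer (n - 1) (frontier \<Omega>) < \<infinity>"
    and M_space: "space M = \<Omega>"
    and M_sets: "sets M = sets (restrict_space borel \<Omega>)"
    and M_fin: "emeasure M \<Omega> < \<infinity>"
    and \<alpha>: "n - 1 < \<alpha>" "\<alpha> \<le> n"
    and C\<^sub>\<mu>: "C\<^sub>\<mu> > 0"
    and M_growth: "\<forall>x\<in>\<Omega>. \<forall>r>0. emeasure M (ball x r \<inter> \<Omega>) \<le> ennreal (C\<^sub>\<mu> * r powr \<alpha>)"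
  shows
   "(\<forall>p r q (u :: nat \<Rightarrow> 'a \<Rightarrow> real).
      1 < p \<and> p < n \<and> 1 < r \<and> 1 \<le> q \<and> q < min (p * \<alpha> / (n - p)) (r * \<alpha> / (n - 1)) \<and>
      (\<forall>k. Cb_closure \<Omega> (u k)) \<and>
      (\<exists>B. \<forall>k. \<exists>G. V1Lp \<Omega> p (u k) G \<and>
          (let qh = min (p * \<alpha> / (n - p)) (r * \<alpha> / (n - 1)) in
            max (measure M \<Omega> powr (n / \<alpha>)) (measure lebesgue \<Omega>)
                powr (\<alpha> / (qh * n) - (n - p) / (p * n))
              * Lp_norm (restrict_space lebesgue \<Omega>) p (\<lambda>x. norm (G x))
            + max (measure M \<Omega> powr ((n - 1) / \<alpha>)) (measure (hausdorff_on (n - 1) (frontier \<Omega>)) (frontier \<Omega>))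
                powr (\<alpha> / (qh * (n - 1)) - 1 / r)
              * Lp_norm (hausdorff_on (n - 1) (frontier \<Omega>)) r (u k)) \<le> B)
      \<longrightarrow> (\<exists>s :: nat \<Rightarrow> nat. strict_mono s \<and>
            (\<forall>\<epsilon>>0. \<exists>N. \<forall>k\<ge>N. \<forall>m\<ge>N.
               (\<integral>\<^sup>+x. ennreal (\<bar>u (s k) x - u (s m) x\<bar> powr q) \<partial>M) < ennreal \<epsilon>)))
    \<and>
    (\<forall>\<beta> \<gamma> (u :: nat \<Rightarrow> 'a \<Rightarrow> real).
      0 < \<beta> \<and> 0 < \<gamma> \<and> \<gamma> < min (n / (n - 1)) \<beta> \<and>
      (\<forall>k. Cb_closure \<Omega> (u k)) \<and>
      (\<exists>A B. exp_young \<beta> A \<and> (\<forall>k. \<exists>G. V1Lp \<Omega> n (u k) G \<and>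
          ennreal (Lp_norm (restrict_space lebesgue \<Omega>) n (\<lambda>x. norm (G x)))
            + luxemburg_norm A (hausdorff_on (n - 1) (frontier \<Omega>)) (u k) \<le> ennreal B))
      \<longrightarrow> (\<exists>s :: nat \<Rightarrow> nat. strict_mono s \<and>
            (\<forall>A. exp_young \<gamma> A \<longrightarrow>
              (\<forall>\<epsilon>>0. \<exists>N. \<forall>k\<ge>N. \<forall>m\<ge>N.
                 luxemburg_norm A M (\<lambda>x. u (s k) x - u (s m) x) < ennreal \<epsilon>))))"
proof -
  have id [measurable]: "(\<lambda>x. x) \<in> measurable M borel"
  proof -
    have "(\<lambda>x. x) \<in> measurable (restrict_space borel \<Omega>) (borel :: 'a measure)" by (rule measurable_restrict_space1) simp
    then show ?thesis using measurable_cong_sets[OF M_sets refl] by blast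
  qed
  define N where "N = distr M borel (\<lambda>x. x)"
  have N: "ball_growth N (C\<^sub>\<mu> * 2 powr \<alpha>) \<alpha>"
    unfolding N_def by (rule ball_growth_distr[OF dim M_space id M_fin _ C\<^sub>\<mu> M_growth]) (use \<alpha> in \<open>simp add: n_def\<close>)
  have n: "n \<ge> 2" using dim by (simp add: n_def)
  have \<alpha>0: "\<alpha> > 0" using \<alpha> n by simp
  have u0_meas: "(\<lambda>x. indicator \<Omega> x * u x) \<in> borel_measurable borel" if "Cb_closure \<Omega> u" for u
  proof -
    have "continuous_on \<Omega> u"
      by (rule continuous_on_subset[OF _ closure_subset]) (use that in \<open>simp add: Cb_closure_def\<close>)
    then have "(\<lambda>y. indicator \<Omega> y *\<^sub>R u y) \<in> borel_measurable borel"
      using open_\<Omega> by (intro borel_measurable_continuous_on_indicator) auto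
    then show ?thesis by simp
  qed
  have to_N: "(\<integral>\<^sup>+x. F (u x - v x) \<partial>M) = (\<integral>\<^sup>+x. F (indicator \<Omega> x * u x - indicator \<Omega> x * v x) \<partial>N)"
    if Cb: "Cb_closure \<Omega> u" "Cb_closure \<Omega> v" and F: "F \<in> borel_measurable borel" for u v and F :: "real \<Rightarrow> ennreal"
  proof -
    have meas: "(\<lambda>x. F (indicator \<Omega> x * u x - indicator \<Omega> x * v x)) \<in> borel_measurable borel"
      by (rule measurable_compose[OF borel_measurable_diff[OF u0_meas[OF Cb(1)] u0_meas[OF Cb(2)]] F])
    have "(\<integral>\<^sup>+x. F (indicator \<Omega> x * u x - indicator \<Omega> x * v x) \<partial>N) = (\<integral>\<^sup>+x. F (indicator \<Omega> x * u x - indicator \<Omega> x * v x) \<partial>M)"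
      unfolding N_def by (rule nn_integral_distr[OF id]) (use meas in simp)
    also have "\<dots> = (\<integral>\<^sup>+x. F (u x - v x) \<partial>M)" by (intro nn_integral_cong) (simp add: M_space)
    finally show ?thesis by simp
  qed
  show ?thesis
  proof (intro conjI allI impI; elim conjE exE)
    fix p r q B :: real and u :: "nat \<Rightarrow> 'a \<Rightarrow> real"
    assume p: "1 < p" "p < n" and r: "1 < r" and q: "1 \<le> q" "q < min (p * \<alpha> / (n - p)) (r * \<alpha> / (n - 1))"
      and Cb: "\<forall>k. Cb_closure \<Omega> (u k)"
      and bd: "\<forall>k. \<exists>G. V1Lp \<Omega> p (u k) G \<and>
          (let qh = min (p * \<alpha> / (n - p)) (r * \<alpha> / (n - 1)) in
            max (measure M \<Omega> powr (n / \<alpha>)) (measure lebesgue \<Omega>)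
                powr (\<alpha> / (qh * n) - (n - p) / (p * n))
              * Lp_norm (restrict_space lebesgue \<Omega>) p (\<lambda>x. norm (G x))
            + max (measure M \<Omega> powr ((n - 1) / \<alpha>)) (measure (hausdorff_on (n - 1) (frontier \<Omega>)) (frontier \<Omega>))
                powr (\<alpha> / (qh * (n - 1)) - 1 / r)
              * Lp_norm (hausdorff_on (n - 1) (frontier \<Omega>)) r (u k)) \<le> B"
    show "\<exists>s :: nat \<Rightarrow> nat. strict_mono s \<and>
            (\<forall>\<epsilon>>0. \<exists>N. \<forall>k\<ge>N. \<forall>m\<ge>N.
               (\<integral>\<^sup>+x. ennreal (\<bar>u (s k) x - u (s m) x\<bar> powr q) \<partial>M) < ennreal \<epsilon>)"
    \<comment> \<open>Positive mass makes both weights in the norm positive, so that they can be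
      divided out; if the mass is 0, all integrals vanish and any subsequence will do.\<close>
    proof (cases "measure M \<Omega> = 0")
      case True
      then have "emeasure M (space M) = 0"
        using M_fin by (auto simp: measure_def M_space enn2real_eq_0_iff)
      then have null: "AE x in M. f x = (0::ennreal)" for f
        by (intro AE_I'[of "space M"]) (auto simp: null_sets_def)
      have "(\<integral>\<^sup>+x. f x \<partial>M) = 0" for f
        using nn_integral_cong_AE[OF null[of f]] by simp
      then show ?thesis by (intro exI[of _ "\<lambda>k. k"]) (auto simp: strict_mono_def)
    next
      case False
      then have m: "measure M \<Omega> > 0" using measure_nonneg[of M \<Omega>] by linarith
      \<comment> \<open>The weights do not depend on \<open>k\<close>, so a bound on the weighted
        sum bounds each of the two norms.\<close>
      define c1 where "c1 = max (measure M \<Omega> powr (n / \<alpha>)) (measure lebesgue \<Omega>)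
                powr (\<alpha> / (min (p * \<alpha> / (n - p)) (r * \<alpha> / (n - 1)) * n) - (n - p) / (p * n))"
      define c2 where "c2 = max (measure M \<Omega> powr ((n - 1) / \<alpha>)) (measure (hausdorff_on (n - 1) (frontier \<Omega>)) (frontier \<Omega>))
                powr (\<alpha> / (min (p * \<alpha> / (n - p)) (r * \<alpha> / (n - 1)) * (n - 1)) - 1 / r)"
      have c: "c1 > 0" "c2 > 0" using m unfolding c1_def c2_def by (auto simp: less_max_iff_disj intro!: powr_gt_zero[THEN iffD2] less_imp_neq[THEN not_sym])
      from choice[OF bd] obtain G where G: "\<forall>k. V1Lp \<Omega> p (u k) (G k) \<and>
          c1 * Lp_norm (restrict_space lebesgue \<Omega>) p (\<lambda>x. norm (G k x)) + c2 * Lp_norm (hausdorff_on (n - 1) (frontier \<Omega>)) r (u k) \<le> B"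
        unfolding Let_def c1_def c2_def ..
      have V: "V1Lp \<Omega> p (u k) (G k)" for k using G by blast
      have Lp0: "Lp_norm M' s f \<ge> 0" for M' :: "'a measure" and s f by (simp add: Lp_norm_def)
      have GB: "Lp_norm (restrict_space lebesgue \<Omega>) p (\<lambda>x. norm (G k x)) \<le> max 1 (B / c1)"
        and uB: "Lp_norm (hausdorff_on (n - 1) (frontier \<Omega>)) r (u k) \<le> max 1 (B / c2)" for k
      proof -
        have b: "c1 * Lp_norm (restrict_space lebesgue \<Omega>) p (\<lambda>x. norm (G k x)) + c2 * Lp_norm (hausdorff_on (n - 1) (frontier \<Omega>)) r (u k) \<le> B"
          using G by blast
        have nonneg: "0 \<le> c1 * Lp_norm (restrict_space lebesgue \<Omega>) p (\<lambda>x. norm (G k x))" "0 \<le> c2 * Lp_norm (hausdorff_on (n - 1) (frontier \<Omega>)) r (u k)"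
          using c Lp0 by (intro mult_nonneg_nonneg; simp)+
        have "Lp_norm (restrict_space lebesgue \<Omega>) p (\<lambda>x. norm (G k x)) \<le> B / c1"
          using b nonneg(2) c by (simp add: pos_le_divide_eq mult.commute)
        then show "Lp_norm (restrict_space lebesgue \<Omega>) p (\<lambda>x. norm (G k x)) \<le> max 1 (B / c1)" by simp
        have "Lp_norm (hausdorff_on (n - 1) (frontier \<Omega>)) r (u k) \<le> B / c2"
          using b nonneg(1) c by (simp add: pos_le_divide_eq mult.commute)
        then show "Lp_norm (hausdorff_on (n - 1) (frontier \<Omega>)) r (u k) \<le> max 1 (B / c2)" by simp
      qed
      have pos: "max 1 (B / c1) > 0" "max 1 (B / c2) > 0" by (simp_all add: less_max_iff_disj)
      obtain s :: "nat \<Rightarrow> nat" where s: "strict_mono s" and conv: "\<forall>e>0. \<exists>K. \<forall>k\<ge>K. \<forall>m\<ge>K.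
          (\<integral>\<^sup>+x. ennreal (\<bar>indicator \<Omega> x * u (s k) x - indicator \<Omega> x * u (s m) x\<bar> powr q) \<partial>N) \<le> ennreal e"
        using compact_embedding_power[where u = u, OF open_\<Omega> leb_fin bdry_fin[unfolded n_def] N p[unfolded n_def] r q[unfolded n_def]
            Cb[THEN spec] V GB pos(1) uB[unfolded n_def] pos(2)] by blast
      show ?thesis
      proof (intro exI[of _ s] conjI s allI impI)
        fix \<epsilon> :: real assume \<epsilon>: "\<epsilon> > 0"
        obtain K where K: "\<forall>k\<ge>K. \<forall>m\<ge>K. (\<integral>\<^sup>+x. ennreal (\<bar>indicator \<Omega> x * u (s k) x - indicator \<Omega> x * u (s m) x\<bar> powr q) \<partial>N) \<le> ennreal (\<epsilon> / 2)"
          using conv \<epsilon> half_gt_zero by blast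
        have "(\<integral>\<^sup>+x. ennreal (\<bar>u (s k) x - u (s m) x\<bar> powr q) \<partial>M) < ennreal \<epsilon>" if "k \<ge> K" "m \<ge> K" for k m
        proof -
          have "(\<integral>\<^sup>+x. ennreal (\<bar>u (s k) x - u (s m) x\<bar> powr q) \<partial>M) =
              (\<integral>\<^sup>+x. ennreal (\<bar>indicator \<Omega> x * u (s k) x - indicator \<Omega> x * u (s m) x\<bar> powr q) \<partial>N)"
            using Cb by (intro to_N[where F = "\<lambda>t. ennreal (\<bar>t\<bar> powr q)"]) auto
          also have "\<dots> \<le> ennreal (\<epsilon> / 2)" using K that by blast
          also have "\<dots> < ennreal \<epsilon>" using \<epsilon> by (intro ennreal_lessI) auto
          finally show ?thesis .
        qed
        then show "\<exists>K. \<forall>k\<ge>K. \<forall>m\<ge>K. (\<integral>\<^sup>+x. ennreal (\<bar>u (s k) x - u (s m) x\<bar> powr q) \<partial>M) < ennreal \<epsilon>" by blast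
      qed
    qed
  next
    fix \<beta> \<gamma> B :: real and A and u :: "nat \<Rightarrow> 'a \<Rightarrow> real"
    assume \<beta>: "0 < \<beta>" and \<gamma>: "0 < \<gamma>" "\<gamma> < min (n / (n - 1)) \<beta>"
      and Cb: "\<forall>k. Cb_closure \<Omega> (u k)" and A: "exp_young \<beta> A"
      and bd: "\<forall>k. \<exists>G. V1Lp \<Omega> n (u k) G \<and>
          ennreal (Lp_norm (restrict_space lebesgue \<Omega>) n (\<lambda>x. norm (G x)))
            + luxemburg_norm A (hausdorff_on (n - 1) (frontier \<Omega>)) (u k) \<le> ennreal B"
    from choice[OF bd] obtain G where G: "\<forall>k. V1Lp \<Omega> n (u k) (G k) \<and>
        ennreal (Lp_norm (restrict_space lebesgue \<Omega>) n (\<lambda>x. norm (G k x)))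
            + luxemburg_norm A (hausdorff_on (n - 1) (frontier \<Omega>)) (u k) \<le> ennreal B" ..
    have V: "V1Lp \<Omega> n (u k) (G k)" for k using G by blast
    have GB: "Lp_norm (restrict_space lebesgue \<Omega>) n (\<lambda>x. norm (G k x)) \<le> max 1 B" for k
    proof -
      have "ennreal (Lp_norm (restrict_space lebesgue \<Omega>) n (\<lambda>x. norm (G k x)))
          \<le> ennreal (Lp_norm (restrict_space lebesgue \<Omega>) n (\<lambda>x. norm (G k x))) + luxemburg_norm A (hausdorff_on (n - 1) (frontier \<Omega>)) (u k)"
        by (rule add_increasing2) simp_all
      also have "\<dots> \<le> ennreal B" using G by blast
      \<comment> \<open>\<open>ennreal\<close> truncates a negative \<open>B\<close> to 0, and the
        embedding lemma needs a positive bound.\<close>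
      also have "\<dots> \<le> ennreal (max 1 B)" by (intro ennreal_leI) simp
      finally have "ennreal (Lp_norm (restrict_space lebesgue \<Omega>) n (\<lambda>x. norm (G k x))) \<le> ennreal (max 1 B)" .
      then show ?thesis by (subst (asm) ennreal_le_iff) (auto simp: le_max_iff_disj)
    qed
    have uB: "luxemburg_norm A (hausdorff_on (n - 1) (frontier \<Omega>)) (u k) \<le> ennreal B" for k
    proof -
      have "luxemburg_norm A (hausdorff_on (n - 1) (frontier \<Omega>)) (u k)
          \<le> ennreal (Lp_norm (restrict_space lebesgue \<Omega>) n (\<lambda>x. norm (G k x))) + luxemburg_norm A (hausdorff_on (n - 1) (frontier \<Omega>)) (u k)"
        by (rule add_increasing) simp_all
      also have "\<dots> \<le> ennreal B" using G by blast
      finally show ?thesis .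
    qed
    have pos: "max 1 B > 0" by (simp add: less_max_iff_disj)
    obtain s :: "nat \<Rightarrow> nat" where s: "strict_mono s" and conv: "\<forall>A l. exp_young \<gamma> A \<longrightarrow> 0 < l \<longrightarrow> (\<exists>K. \<forall>k\<ge>K. \<forall>m\<ge>K.
        (\<integral>\<^sup>+x. ennreal (A (\<bar>indicator \<Omega> x * u (s k) x - indicator \<Omega> x * u (s m) x\<bar> / l)) \<partial>N) \<le> 1)"
      using compact_embedding_exp[where u = u, OF open_\<Omega> leb_fin N \<gamma>(1) \<gamma>(2)[unfolded n_def] Cb[THEN spec] V[unfolded n_def] GB[unfolded n_def] pos A uB[unfolded n_def]]
      by blast
    show "\<exists>s :: nat \<Rightarrow> nat. strict_mono s \<and>
            (\<forall>A. exp_young \<gamma> A \<longrightarrow>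
              (\<forall>\<epsilon>>0. \<exists>N. \<forall>k\<ge>N. \<forall>m\<ge>N.
                 luxemburg_norm A M (\<lambda>x. u (s k) x - u (s m) x) < ennreal \<epsilon>))"
    proof (intro exI[of _ s] conjI s allI impI)
      fix A' and \<epsilon> :: real assume A': "exp_young \<gamma> A'" and \<epsilon>: "\<epsilon> > 0"
      obtain K where K: "\<forall>k\<ge>K. \<forall>m\<ge>K. (\<integral>\<^sup>+x. ennreal (A' (\<bar>indicator \<Omega> x * u (s k) x - indicator \<Omega> x * u (s m) x\<bar> / (\<epsilon> / 2))) \<partial>N) \<le> 1"
        using conv A' \<epsilon> half_gt_zero by blast
      have "luxemburg_norm A' M (\<lambda>x. u (s k) x - u (s m) x) < ennreal \<epsilon>" if "k \<ge> K" "m \<ge> K" for k m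
      proof -
        have "(\<integral>\<^sup>+x. ennreal (A' (\<bar>u (s k) x - u (s m) x\<bar> / (\<epsilon> / 2))) \<partial>M) =
            (\<integral>\<^sup>+x. ennreal (A' (\<bar>indicator \<Omega> x * u (s k) x - indicator \<Omega> x * u (s m) x\<bar> / (\<epsilon> / 2))) \<partial>N)"
        proof (rule to_N[where F = "\<lambda>t. ennreal (A' (\<bar>t\<bar> / (\<epsilon> / 2)))"])
          have Y: "young_function A'" using A' by (simp add: exp_young_def)
          \<comment> \<open>A Young function is monotone on the nonnegative half-line only and
            arbitrary below it, so measurability is obtained after clipping the argument at
            0.\<close>
          have "mono (\<lambda>t. A' (max 0 t))" by (auto simp: mono_def intro!: young_function_mono[OF Y])
          then have [measurable]: "(\<lambda>t. A' (max 0 t)) \<in> borel_measurable borel" by (rule borel_measurable_mono)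
          have "(\<lambda>t. ennreal (A' (max 0 (\<bar>t\<bar> / (\<epsilon> / 2))))) \<in> borel_measurable borel" by measurable
          moreover have "max 0 (\<bar>t\<bar> / (\<epsilon> / 2)) = \<bar>t\<bar> / (\<epsilon> / 2)" for t using \<epsilon> by simp
          ultimately show "(\<lambda>t. ennreal (A' (\<bar>t\<bar> / (\<epsilon> / 2)))) \<in> borel_measurable borel" by (simp only:)
        qed (use Cb in auto)
        also have "\<dots> \<le> 1" using K that by blast
        finally have "luxemburg_norm A' M (\<lambda>x. u (s k) x - u (s m) x) \<le> ennreal (\<epsilon> / 2)"
          unfolding luxemburg_norm_def using \<epsilon> by (intro Inf_lower) auto
        also have "\<dots> < ennreal \<epsilon>" using \<epsilon> by (intro ennreal_lessI) auto
        finally show ?thesis .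
      qed
      then show "\<exists>K. \<forall>k\<ge>K. \<forall>m\<ge>K. luxemburg_norm A' M (\<lambda>x. u (s k) x - u (s m) x) < ennreal \<epsilon>" by blast
    qed
  qed
qed

end
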